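(* Let $\Omega\subset\mathbb{R}^n$ be a bounded domain with $\partial\Omega\in C^2$, let $\omega$ be a non-empty open subset of $\Omega$, and let $A$, $a_0$ be as in the context. Then there is a constant $C$, depending only on $\Omega,\omega,A,a_0$ (not on $k$, $u$, $f$), such that $$\|u\|_{(0)}(\Omega)\leq Ck^{-1}\big(\|f\|_{(0)}(\Omega)+\|u\|_{(1)}(\omega)+\|u\|_{(1)}(\Omega)\big)$$ for all $k\ge1$ and all $u\in H^{(2)}(\Omega)$ solving $(A-ia_0k+k^2)u=f$ in $\Omega$. Moreover, if $\Omega$ is $C^2$-diffeomorphic to the unit ball and $\bar\omega$ contains a non-empty subset of $\partial\Omega$ that is open in $\partial\Omega$, then there are a monotone (increasing in $k$) family of closed subspaces $H^{(1)}(\Omega;k)$ of $H^{(1)}(\Omega)$ with $\overline{\bigcup_k H^{(1)}(\Omega;k)}=H^{(1)}(\Omega)$, semi-norms $|||\cdot|||_{(1;k)}(\Omega)$ on $H^{(1)}(\Omega)$ such that $|||\cdot|||_{(1;k)}(\Omega)$ is zero on $H^{(1)}(\Omega;k)$ and is decreasing with respect to $k$, and a constant $C$ (independent of $k$, $u$, $f$) such that $$\|u\|_{(0)}(\Omega)\leq Ck^{-1}\big(\|f\|_{(0)}(\Omega)+\|u\|_{(1)}(\omega)+|||u|||_{(1;k)}(\Omega)\big)$$ for all $k\ge1$ and all $u\in H^{(2)}(\Omega)$ solving $(A-ia_0k+k^2)u=f$ in $\Omega$.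
   Context: $A$ is the operator $Au=\sum_{j,m=1}^n a_{jm}\partial_j\partial_m u+\sum_{j=1}^n a_j\partial_j u+au$ on $\Omega$, with real symmetric $(a_{jm})$ satisfying the uniform ellipticity condition $\varepsilon_0|\xi|^2\le\sum_{j,l=1}^n a_{jl}(x)\xi_j\xi_l\le E_0^2|\xi|^2$ for some positive numbers $\varepsilon_0,E_0$ and all $x\in\Omega$, $\xi\in\mathbb{R}^n$. It is assumed that $a_{jm},\partial_p a_{jm},a_j,a\in L^\infty(\Omega)$, and $a_0\in L^\infty(\Omega)$. The functions $u$ may be complex-valued. $H^{(l)}(\Omega)$ is the $L^2$-based Sobolev space of order $l$ with standard norm $\|\cdot\|_{(l)}(\Omega)$ (so $\|\cdot\|_{(0)}$ is the $L^2$ norm), and similarly on $\omega$. The number $k$ is the wave number. "Increasing in $k$" means $H^{(1)}(\Omega;k_1)\subset H^{(1)}(\Omega;k_2)$ for $k_1\le k_2$; "decreasing with respect to $k$" means $|||u|||_{(1;k_2)}(\Omega)\le|||u|||_{(1;k_1)}(\Omega)$ for $k_1\le k_2$. The closure of the union is taken in $H^{(1)}(\Omega)$. *)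

theory Defs
  imports "HOL-Analysis.Analysis"
begin

definition partial_deriv ::
    "'n::finite \<Rightarrow> (real^'n \<Rightarrow> 'b::real_normed_vector) \<Rightarrow> real^'n \<Rightarrow> 'b" where
  "partial_deriv i f x = frechet_derivative f (at x) (axis i 1)"

text \<open>Meant for open \<open>S\<close> only: the derivatives are full (not one-sided) derivatives.\<close>

primrec Ck_on ::
    "nat \<Rightarrow> (real^'n \<Rightarrow> 'b::real_normed_vector) \<Rightarrow> (real^'n::finite) set \<Rightarrow> bool" where
  "Ck_on 0 f S \<longleftrightarrow> continuous_on S f"
| "Ck_on (Suc l) f S \<longleftrightarrow>
     f differentiable_on S \<and> (\<forall>i. Ck_on l (partial_deriv i f) S)"

text \<open>The boundary is locally the graph of a \<open>C\<^sup>2\<close> function over a coordinate hyperplane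
  \<open>x\<^sub>j = 0\<close>, with \<open>\<Omega>\<close> locally on exactly one side of it (\<open>\<sigma>\<close> selects the side).  A function of the
  remaining \<open>n - 1\<close> coordinates is encoded as a function on the whole space which does
  not depend on the \<open>j\<close>-th coordinate.\<close>

definition C2_boundary :: "(real^'n::finite) set \<Rightarrow> bool" where
  "C2_boundary \<Omega> \<longleftrightarrow>
     (\<forall>x0 \<in> frontier \<Omega>. \<exists>r>0. \<exists>j. \<exists>\<sigma>\<in>{1, -1}. \<exists>\<gamma> :: real^'n \<Rightarrow> real.
        Ck_on 2 \<gamma> UNIV \<and>
        (\<forall>x y. (\<forall>i. i \<noteq> j \<longrightarrow> x $ i = y $ i) \<longrightarrow> \<gamma> x = \<gamma> y) \<and>
        \<Omega> \<inter> ball x0 r = {x \<in> ball x0 r. \<sigma> * x $ j > \<gamma> x})"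

definition C2_diffeomorphic :: "(real^'n::finite) set \<Rightarrow> (real^'n) set \<Rightarrow> bool" where
  "C2_diffeomorphic S T \<longleftrightarrow>
     (\<exists>F G. homeomorphism S T F G \<and> Ck_on 2 F S \<and> Ck_on 2 G T)"

definition test_function :: "(real^'n::finite) set \<Rightarrow> (real^'n \<Rightarrow> real) \<Rightarrow> bool" where
  "test_function \<Omega> \<phi> \<longleftrightarrow>
     (\<forall>l. Ck_on l \<phi> UNIV) \<and>
     compact (closure {x. \<phi> x \<noteq> 0}) \<and> closure {x. \<phi> x \<noteq> 0} \<subseteq> \<Omega>"

definition locally_integrable_on ::
    "(real^'n::finite \<Rightarrow> 'b::{banach, second_countable_topology}) \<Rightarrow> (real^'n) set \<Rightarrow> bool" where
  "locally_integrable_on f \<Omega> \<longleftrightarrow> (\<forall>K. compact K \<and> K \<subseteq> \<Omega> \<longrightarrow> integrable (lebesgue_on K) f)"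

definition has_weak_partial ::
    "(real^'n::finite) set \<Rightarrow> 'n \<Rightarrow> (real^'n \<Rightarrow> 'b::{banach, second_countable_topology})
       \<Rightarrow> (real^'n \<Rightarrow> 'b) \<Rightarrow> bool" where
  "has_weak_partial \<Omega> i u g \<longleftrightarrow>
     locally_integrable_on u \<Omega> \<and> locally_integrable_on g \<Omega> \<and>
     (\<forall>\<phi>. test_function \<Omega> \<phi> \<longrightarrow>
        integral\<^sup>L (lebesgue_on \<Omega>) (\<lambda>x. partial_deriv i \<phi> x *\<^sub>R u x)
        = - integral\<^sup>L (lebesgue_on \<Omega>) (\<lambda>x. \<phi> x *\<^sub>R g x))"

text \<open>An arbitrary representative; weak derivatives on an open set are unique almost everywhere.\<close>

definition weak_partial ::
    "(real^'n::finite) set \<Rightarrow> 'n \<Rightarrow> (real^'n \<Rightarrow> 'b::{banach, second_countable_topology})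
       \<Rightarrow> real^'n \<Rightarrow> 'b" where
  "weak_partial \<Omega> i u = (SOME g. has_weak_partial \<Omega> i u g)"

text \<open>Function spaces are sets of representatives: functions which agree almost everywhere
  on \<open>\<Omega>\<close> are to be identified, and values outside \<open>\<Omega>\<close> are irrelevant.\<close>

definition Linfty :: "(real^'n::finite) set \<Rightarrow> (real^'n \<Rightarrow> 'b::real_normed_vector) set" where
  "Linfty \<Omega> = {f \<in> borel_measurable (lebesgue_on \<Omega>).
                 \<exists>M. AE x in lebesgue_on \<Omega>. norm (f x) \<le> M}"

definition L2 :: "(real^'n::finite) set \<Rightarrow> (real^'n \<Rightarrow> complex) set" where
  "L2 \<Omega> = {f \<in> borel_measurable (lebesgue_on \<Omega>).
             integrable (lebesgue_on \<Omega>) (\<lambda>x. (cmod (f x))\<^sup>2)}"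

definition L2_norm :: "(real^'n::finite) set \<Rightarrow> (real^'n \<Rightarrow> complex) \<Rightarrow> real" where
  "L2_norm \<Omega> f = sqrt (integral\<^sup>L (lebesgue_on \<Omega>) (\<lambda>x. (cmod (f x))\<^sup>2))"

primrec sobolev :: "nat \<Rightarrow> (real^'n::finite) set \<Rightarrow> (real^'n \<Rightarrow> complex) set" where
  "sobolev 0 \<Omega> = L2 \<Omega>"
| "sobolev (Suc l) \<Omega> = {u \<in> L2 \<Omega>. \<forall>i. \<exists>g \<in> sobolev l \<Omega>. has_weak_partial \<Omega> i u g}"

text \<open>For orders 0 and 1 this is literally the root of the sum over all multi-indices of the squared
  \<open>L\<^sup>2\<close> norms of the weak derivatives; from order 2 on each mixed derivative is counted once
  for every order of differentiation, which gives an equivalent norm.\<close>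

primrec sobolev_norm :: "nat \<Rightarrow> (real^'n::finite) set \<Rightarrow> (real^'n \<Rightarrow> complex) \<Rightarrow> real" where
  "sobolev_norm 0 \<Omega> u = L2_norm \<Omega> u"
| "sobolev_norm (Suc l) \<Omega> u =
     sqrt ((L2_norm \<Omega> u)\<^sup>2 + (\<Sum>i\<in>UNIV. (sobolev_norm l \<Omega> (weak_partial \<Omega> i u))\<^sup>2))"

definition sobolev_closure ::
    "nat \<Rightarrow> (real^'n::finite) set \<Rightarrow> (real^'n \<Rightarrow> complex) set \<Rightarrow> (real^'n \<Rightarrow> complex) set" where
  "sobolev_closure l \<Omega> V =
     {u \<in> sobolev l \<Omega>. \<forall>e>0. \<exists>v\<in>V. sobolev_norm l \<Omega> (\<lambda>x. u x - v x) < e}"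

text \<open>The last conjunct also makes \<open>V\<close> invariant under changes on null sets.\<close>

definition closed_sobolev_subspace ::
    "nat \<Rightarrow> (real^'n::finite) set \<Rightarrow> (real^'n \<Rightarrow> complex) set \<Rightarrow> bool" where
  "closed_sobolev_subspace l \<Omega> V \<longleftrightarrow>
     V \<subseteq> sobolev l \<Omega> \<and> (\<lambda>x. 0) \<in> V \<and>
     (\<forall>u\<in>V. \<forall>v\<in>V. (\<lambda>x. u x + v x) \<in> V) \<and>
     (\<forall>c. \<forall>u\<in>V. (\<lambda>x. c * u x) \<in> V) \<and>
     sobolev_closure l \<Omega> V = V"

text \<open>The last conjunct says that \<open>p\<close> is well defined on almost-everywhere classes.\<close>

definition sobolev_seminorm ::
    "nat \<Rightarrow> (real^'n::finite) set \<Rightarrow> ((real^'n \<Rightarrow> complex) \<Rightarrow> real) \<Rightarrow> bool" where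
  "sobolev_seminorm l \<Omega> p \<longleftrightarrow>
     (\<forall>u \<in> sobolev l \<Omega>. 0 \<le> p u) \<and>
     (\<forall>u \<in> sobolev l \<Omega>. \<forall>v \<in> sobolev l \<Omega>. p (\<lambda>x. u x + v x) \<le> p u + p v) \<and>
     (\<forall>c. \<forall>u \<in> sobolev l \<Omega>. p (\<lambda>x. c * u x) = cmod c * p u) \<and>
     (\<forall>u \<in> sobolev l \<Omega>. \<forall>v \<in> sobolev l \<Omega>.
        (AE x in lebesgue_on \<Omega>. u x = v x) \<longrightarrow> p u = p v)"

definition elliptic_op ::
    "(real^'n::finite) set \<Rightarrow> ('n \<Rightarrow> 'n \<Rightarrow> real^'n \<Rightarrow> real) \<Rightarrow> ('n \<Rightarrow> real^'n \<Rightarrow> complex)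
       \<Rightarrow> (real^'n \<Rightarrow> complex) \<Rightarrow> (real^'n \<Rightarrow> complex) \<Rightarrow> real^'n \<Rightarrow> complex" where
  "elliptic_op \<Omega> a2 a1 a u x =
     (\<Sum>j\<in>UNIV. \<Sum>m\<in>UNIV.
        complex_of_real (a2 j m x) * weak_partial \<Omega> j (weak_partial \<Omega> m u) x)
     + (\<Sum>j\<in>UNIV. a1 j x * weak_partial \<Omega> j u x)
     + a x * u x"

text \<open>\<open>u \<in> H\<^sup>2(\<Omega>)\<close> is a strong solution of \<open>(A - i a\<^sub>0 k + k\<^sup>2) u = f\<close> in \<open>\<Omega>\<close>.\<close>

definition solves_helmholtz ::
    "(real^'n::finite) set \<Rightarrow> ('n \<Rightarrow> 'n \<Rightarrow> real^'n \<Rightarrow> real) \<Rightarrow> ('n \<Rightarrow> real^'n \<Rightarrow> complex)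
       \<Rightarrow> (real^'n \<Rightarrow> complex) \<Rightarrow> (real^'n \<Rightarrow> complex) \<Rightarrow> real
       \<Rightarrow> (real^'n \<Rightarrow> complex) \<Rightarrow> (real^'n \<Rightarrow> complex) \<Rightarrow> bool" where
  "solves_helmholtz \<Omega> a2 a1 a a0 k u f \<longleftrightarrow>
     u \<in> sobolev 2 \<Omega> \<and> f \<in> L2 \<Omega> \<and>
     (AE x in lebesgue_on \<Omega>.
        elliptic_op \<Omega> a2 a1 a u x - \<i> * a0 x * of_real k * u x + (of_real k)\<^sup>2 * u x = f x)"

end

theory Submission
  imports Defs "HOL-Computational_Algebra.Polynomial"
begin

text \<open>Write \<open>X\<close>, \<open>Y\<close> for the norms of \<open>u\<close> in \<open>L\<^sup>2(\<Omega>)\<close> and \<open>H\<^sup>1(\<Omega>)\<close> and \<open>F\<close> for the \<open>L\<^sup>2\<close> norm of \<open>f\<close>.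
  Testing the equation with \<open>\<phi> \<sqdot> cnj u\<close>, for a cutoff \<open>\<phi>\<close> vanishing at the boundary and having gradient
  \<open>O(k)\<close>, gives \<open>k\<^sup>2 \<integral> \<phi> |u|\<^sup>2 \<le> C (k X (F + Y) + Y\<^sup>2)\<close>. Near the boundary \<open>\<phi>\<close> is a cutoff times
  \<open>1 - exp (- k \<eta>)\<close>, where \<open>\<eta>\<close> is the height above the boundary; the missing boundary layer
  \<open>exp (- k \<eta>)\<close> is, up to a factor \<open>k\<close>, a transversal derivative of \<open>\<phi>\<close>, so that an integration by parts
  bounds it by \<open>X Y / k\<close>. Summing over a finite cover gives \<open>(k X)\<^sup>2 \<le> C (k X (F + Y) + Y\<^sup>2)\<close>,
  that is, \<open>k X \<le> C (F + Y)\<close>.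

  For the second part, the Riesz representers in \<open>H\<^sup>1\<close> of the \<open>L\<^sup>2\<close> products with indicators of boxes
  span a dense subspace of \<open>H\<^sup>1\<close>, and the orthogonal projection onto the span of the first \<open>N\<close> of them is bounded
  from \<open>L\<^sup>2\<close> to \<open>H\<^sup>1\<close>. If \<open>N\<close> grows slowly enough with \<open>k\<close>, this bound is at most \<open>c k\<close>, and the
  \<open>H\<^sup>1\<close> norm of the remaining component is the desired semi-norm; for small \<open>c\<close> the term \<open>c k X\<close> is
  absorbed.\<close>

section \<open>Semi-inner products\<close>

text \<open>Integration by parts is carried out only against functions with compact support in
  \<Omega>, so no boundary integral ever appears; the price is that such tests do not see the mass
  close to the boundary. A strip of thickness 1/k is the right scale: a cutoff there has a gradient
  of order k, which meets \<open>u\<close> times a first derivative and yields \<open>k X Y\<close>,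
  a term that a quadratic inequality for \<open>k X\<close> tolerates. These cutoffs are only C1, so
  weak derivatives must be tested beyond smooth functions, and the products of H1 functions that
  occur call for a Leibniz rule; mollification serves both purposes. Since spaces consist of
  functions and not of classes, inner products are only semi-definite and identities between weak
  derivatives hold almost everywhere.

  In the second part the family is built from representers of L2 products because the H1
  coefficients of \<open>u\<close> are then L2 products themselves. Hence a finite projection is
  bounded in H1 by the L2 norm of \<open>u\<close> alone, which may fail for other orthonormal
  families of H1.\<close>

locale semi_inner_product =
  fixes H :: "('x \<Rightarrow> complex) set" and ip :: "('x \<Rightarrow> complex) \<Rightarrow> ('x \<Rightarrow> complex) \<Rightarrow> complex"
  assumes zero_mem [simp]: "(\<lambda>x. 0) \<in> H"
    and add_mem [simp]: "u \<in> H \<Longrightarrow> v \<in> H \<Longrightarrow> (\<lambda>x. u x + v x) \<in> H"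
    and scale_mem [simp]: "u \<in> H \<Longrightarrow> (\<lambda>x. c * u x) \<in> H"
    and ip_add: "u \<in> H \<Longrightarrow> v \<in> H \<Longrightarrow> w \<in> H \<Longrightarrow> ip (\<lambda>x. u x + v x) w = ip u w + ip v w"
    and ip_scale: "u \<in> H \<Longrightarrow> w \<in> H \<Longrightarrow> ip (\<lambda>x. c * u x) w = c * ip u w"
    and ip_herm: "u \<in> H \<Longrightarrow> v \<in> H \<Longrightarrow> ip v u = cnj (ip u v)"
    and ip_nonneg: "u \<in> H \<Longrightarrow> 0 \<le> Re (ip u u)"
begin

definition nrm :: "('x \<Rightarrow> complex) \<Rightarrow> real" where
  "nrm u = sqrt (Re (ip u u))"

lemma diff_mem [simp]: "u \<in> H \<Longrightarrow> v \<in> H \<Longrightarrow> (\<lambda>x. u x - v x) \<in> H"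
  using add_mem[of u "\<lambda>x. (-1) * v x"] scale_mem[of v "-1"] by simp

lemma sum_mem [simp]: "finite A \<Longrightarrow> (\<And>i. i \<in> A \<Longrightarrow> f i \<in> H) \<Longrightarrow> (\<lambda>x. \<Sum>i\<in>A. f i x) \<in> H"
  by (induction A rule: finite_induct) auto

lemma ip_diff: "u \<in> H \<Longrightarrow> v \<in> H \<Longrightarrow> w \<in> H \<Longrightarrow> ip (\<lambda>x. u x - v x) w = ip u w - ip v w"
  using ip_add[of u "\<lambda>x. (-1) * v x" w] ip_scale[of v w "-1"] scale_mem[of v "-1"] by simp

lemma ip_zero: "w \<in> H \<Longrightarrow> ip (\<lambda>x. 0) w = 0"
  using ip_scale[of "\<lambda>x. 0" w 0] by simp

lemma ip_sum: "finite A \<Longrightarrow> (\<And>i. i \<in> A \<Longrightarrow> f i \<in> H) \<Longrightarrow> w \<in> H \<Longrightarrow>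
    ip (\<lambda>x. \<Sum>i\<in>A. f i x) w = (\<Sum>i\<in>A. ip (f i) w)"
  by (induction A rule: finite_induct) (auto simp: ip_zero ip_add)

lemma ip_add_right: "u \<in> H \<Longrightarrow> v \<in> H \<Longrightarrow> w \<in> H \<Longrightarrow> ip w (\<lambda>x. u x + v x) = ip w u + ip w v"
  by (subst (1 2 3) ip_herm) (auto simp: ip_add)

lemma ip_diff_right: "u \<in> H \<Longrightarrow> v \<in> H \<Longrightarrow> w \<in> H \<Longrightarrow> ip w (\<lambda>x. u x - v x) = ip w u - ip w v"
  by (subst (1 2 3) ip_herm) (auto simp: ip_diff)

lemma ip_scale_right: "u \<in> H \<Longrightarrow> w \<in> H \<Longrightarrow> ip w (\<lambda>x. c * u x) = cnj c * ip w u"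
  by (subst (1 2) ip_herm) (auto simp: ip_scale)

lemma ip_zero_right: "w \<in> H \<Longrightarrow> ip w (\<lambda>x. 0) = 0"
  by (subst ip_herm) (auto simp: ip_zero)

lemma ip_sum_right: "finite A \<Longrightarrow> (\<And>i. i \<in> A \<Longrightarrow> f i \<in> H) \<Longrightarrow> w \<in> H \<Longrightarrow>
    ip w (\<lambda>x. \<Sum>i\<in>A. f i x) = (\<Sum>i\<in>A. ip w (f i))"
  by (induction A rule: finite_induct) (auto simp: ip_zero_right ip_add_right)

lemmas ip_simps = ip_add ip_diff ip_scale ip_add_right ip_diff_right ip_scale_right

lemma nrm_nonneg [simp]: "u \<in> H \<Longrightarrow> 0 \<le> nrm u"
  by (simp add: nrm_def ip_nonneg)

lemma nrm_sq: "u \<in> H \<Longrightarrow> (nrm u)\<^sup>2 = Re (ip u u)"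
  by (simp add: nrm_def ip_nonneg)

lemma ip_self: "u \<in> H \<Longrightarrow> ip u u = complex_of_real ((nrm u)\<^sup>2)"
proof -
  assume "u \<in> H"
  then have "Im (ip u u) = - Im (ip u u)"
    using ip_herm[of u u] by (metis cnj.simps(2))
  then show ?thesis using nrm_sq[OF \<open>u \<in> H\<close>] by (simp add: complex_eq_iff)
qed

lemma nrm_zero [simp]: "nrm (\<lambda>x. 0) = 0"
  by (simp add: nrm_def ip_zero)

lemma nrm_scale: assumes "u \<in> H" shows "nrm (\<lambda>x. c * u x) = cmod c * nrm u"
proof -
  have "(nrm (\<lambda>x. c * u x))\<^sup>2 = (cmod c * nrm u)\<^sup>2"
  proof -
    have "c * (cnj c * ip u u) = complex_of_real ((cmod c)\<^sup>2 * (nrm u)\<^sup>2)"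
      using ip_self[OF assms] complex_norm_square[of c] by (simp add: mult.assoc[symmetric])
    then show ?thesis using assms
      by (simp add: nrm_sq[OF scale_mem] ip_simps power_mult_distrib del: of_real_mult of_real_power)
  qed
  then show ?thesis using assms by (simp add: power2_eq_iff_nonneg)
qed

lemma nrm_diff_commute: "u \<in> H \<Longrightarrow> v \<in> H \<Longrightarrow> nrm (\<lambda>x. u x - v x) = nrm (\<lambda>x. v x - u x)"
  using nrm_scale[of "\<lambda>x. u x - v x" "-1"] by simp

lemma nrm_sq_add: "u \<in> H \<Longrightarrow> v \<in> H \<Longrightarrow>
    (nrm (\<lambda>x. u x + v x))\<^sup>2 = (nrm u)\<^sup>2 + 2 * Re (ip u v) + (nrm v)\<^sup>2"
  using ip_herm[of u v] by (simp add: nrm_sq ip_simps)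

text \<open>Expand the square of the norm of \<open>u\<close> minus t times \<open>ip u v\<close>
  times \<open>v\<close>, for real t. As the form is only semi-definite, \<open>nrm v = 0\<close> is
  a case of its own: the expansion is then linear in t, and a large t forces
  \<open>ip u v = 0\<close>. Otherwise \<open>1 / (nrm v)\<^sup>2\<close> is the best t.\<close>

lemma cauchy_schwarz:
  assumes "u \<in> H" "v \<in> H"
  shows "cmod (ip u v) \<le> nrm u * nrm v"
proof -
  have *: "2 * t * (cmod (ip u v))\<^sup>2 \<le> (nrm u)\<^sup>2 + t\<^sup>2 * (cmod (ip u v))\<^sup>2 * (nrm v)\<^sup>2" for t :: real
  proof -
    let ?z = "ip u v"
    let ?c = "- complex_of_real t * ?z"
    have "0 \<le> (nrm (\<lambda>x. u x + ?c * v x))\<^sup>2" by simp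
    also have "\<dots> = (nrm u)\<^sup>2 + 2 * Re (ip u (\<lambda>x. ?c * v x)) + (nrm (\<lambda>x. ?c * v x))\<^sup>2"
      using assms(1) scale_mem[OF assms(2), of ?c] by (rule nrm_sq_add)
    also have "ip u (\<lambda>x. ?c * v x) = - complex_of_real t * (cnj ?z * ?z)"
      using assms by (subst ip_scale_right) (auto simp: algebra_simps)
    also have "cnj ?z * ?z = complex_of_real ((cmod ?z)\<^sup>2)"
      by (metis complex_norm_square mult.commute)
    also have "nrm (\<lambda>x. ?c * v x) = \<bar>t\<bar> * cmod ?z * nrm v"
      using assms by (subst nrm_scale) (auto simp: norm_mult)
    finally show ?thesis by (simp add: power_mult_distrib)
  qed
  let ?A = "cmod (ip u v)"
  have "?A\<^sup>2 \<le> (nrm u * nrm v)\<^sup>2"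
  proof (cases "nrm v = 0")
    case True
    have "?A = 0"
    proof (rule ccontr)
      assume "?A \<noteq> 0"
      moreover from *[of "((nrm u)\<^sup>2 + 1) / ?A\<^sup>2"] True
      have "2 * (((nrm u)\<^sup>2 + 1) / ?A\<^sup>2) * ?A\<^sup>2 \<le> (nrm u)\<^sup>2" by simp
      ultimately have "2 * ((nrm u)\<^sup>2 + 1) \<le> (nrm u)\<^sup>2" by simp
      then have "(nrm u)\<^sup>2 + 2 \<le> 0" by (simp add: algebra_simps)
      then show False using zero_le_power2[of "nrm u"] by linarith
    qed
    then show ?thesis by simp
  next
    case False
    from *[of "1 / (nrm v)\<^sup>2"] False have "?A\<^sup>2 / (nrm v)\<^sup>2 \<le> (nrm u)\<^sup>2"
      by (simp add: power2_eq_square)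
    then show ?thesis using False by (simp add: field_simps power_mult_distrib)
  qed
  then show ?thesis using assms by (meson mult_nonneg_nonneg nrm_nonneg power2_le_imp_le)
qed

lemma nrm_triangle: "u \<in> H \<Longrightarrow> v \<in> H \<Longrightarrow> nrm (\<lambda>x. u x + v x) \<le> nrm u + nrm v"
proof -
  assume *: "u \<in> H" "v \<in> H"
  have "(nrm (\<lambda>x. u x + v x))\<^sup>2 \<le> (nrm u + nrm v)\<^sup>2"
    using nrm_sq_add[OF *] cauchy_schwarz[OF *] complex_Re_le_cmod[of "ip u v"]
    by (simp add: power2_sum)
  then show ?thesis using * by (meson add_nonneg_nonneg nrm_nonneg power2_le_imp_le)
qed

lemma nrm_triangle_diff: "u \<in> H \<Longrightarrow> v \<in> H \<Longrightarrow> nrm u \<le> nrm (\<lambda>x. u x - v x) + nrm v"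
  using nrm_triangle[of "\<lambda>x. u x - v x" v] by simp

lemma nrm_sum_le: "finite A \<Longrightarrow> (\<And>i. i \<in> A \<Longrightarrow> f i \<in> H) \<Longrightarrow>
    nrm (\<lambda>x. \<Sum>i\<in>A. f i x) \<le> (\<Sum>i\<in>A. nrm (f i))"
proof (induction A rule: finite_induct)
  case (insert a A)
  then show ?case
    using nrm_triangle[of "f a" "\<lambda>x. \<Sum>i\<in>A. f i x"] by fastforce
qed auto

lemma ip_null: "u \<in> H \<Longrightarrow> v \<in> H \<Longrightarrow> nrm v = 0 \<Longrightarrow> ip u v = 0"
  using cauchy_schwarz[of u v] by simp

section \<open>Gram-Schmidt orthogonalisation and projections\<close>

text \<open>Each term has norm 1 or 0; the degenerate ones are kept to avoid reindexing.\<close>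

fun gram_schmidt :: "(nat \<Rightarrow> 'x \<Rightarrow> complex) \<Rightarrow> nat \<Rightarrow> 'x \<Rightarrow> complex" where
  "gram_schmidt t n = (let r = (\<lambda>x. t n x - (\<Sum>j<n. ip (t n) (gram_schmidt t j) * gram_schmidt t j x))
     in (\<lambda>x. complex_of_real (inverse (nrm r)) * r x))"

declare gram_schmidt.simps [simp del]

definition proj :: "(nat \<Rightarrow> 'x \<Rightarrow> complex) \<Rightarrow> nat \<Rightarrow> ('x \<Rightarrow> complex) \<Rightarrow> 'x \<Rightarrow> complex" where
  "proj e N u = (\<lambda>x. \<Sum>j<N. ip u (e j) * e j x)"

definition orthonormal0 :: "(nat \<Rightarrow> 'x \<Rightarrow> complex) \<Rightarrow> bool" where
  "orthonormal0 e \<longleftrightarrow> (\<forall>n. e n \<in> H) \<and> (\<forall>m n. m \<noteq> n \<longrightarrow> ip (e m) (e n) = 0) \<and>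
     (\<forall>n. ip (e n) (e n) = 1 \<or> nrm (e n) = 0)"

lemma proj_mem [simp]: "(\<And>n. e n \<in> H) \<Longrightarrow> proj e N u \<in> H"
  unfolding proj_def by (rule sum_mem) simp_all

text \<open>Orthogonality is assumed only between \<open>e i\<close> and the other terms below
  \<open>N\<close>, so the lemma can already be applied inside the induction that establishes
  orthogonality of the whole family.\<close>

lemma ip_proj_aux:
  assumes "\<And>n. n < N \<Longrightarrow> e n \<in> H" "u \<in> H" "i < N" "\<And>j. j < N \<Longrightarrow> j \<noteq> i \<Longrightarrow> ip (e j) (e i) = 0"
    and "ip (e i) (e i) = 1 \<or> nrm (e i) = 0"
  shows "ip (proj e N u) (e i) = ip u (e i)"
proof -
  have "ip (proj e N u) (e i) = (\<Sum>j<N. ip u (e j) * ip (e j) (e i))"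
  proof -
    have "e i \<in> H" using assms(1,3) by simp
    then have "ip (\<lambda>x. \<Sum>j<N. ip u (e j) * e j x) (e i) = (\<Sum>j<N. ip (\<lambda>x. ip u (e j) * e j x) (e i))"
      using assms(1) by (intro ip_sum) auto
    also have "\<dots> = (\<Sum>j<N. ip u (e j) * ip (e j) (e i))"
      using assms(1) \<open>e i \<in> H\<close> by (intro sum.cong refl ip_scale) auto
    finally show ?thesis by (simp add: proj_def)
  qed
  also have "\<dots> = (\<Sum>j<N. if j = i then ip u (e i) * ip (e i) (e i) else 0)"
    using assms(4) by (intro sum.cong) auto
  also have "\<dots> = ip u (e i) * ip (e i) (e i)" using assms(3) by simp
  \<comment> \<open>If \<open>e i\<close> is degenerate, both sides vanish by
    \<open>ip_null\<close>.\<close>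
  also have "\<dots> = ip u (e i)" using assms(1,2,3,5) ip_null[of u "e i"] by auto
  finally show ?thesis .
qed

lemma gram_schmidt_mem:
  assumes "\<And>n. t n \<in> H" shows "gram_schmidt t n \<in> H"
proof (induction n rule: less_induct)
  case (less n)
  show ?case
    by (subst gram_schmidt.simps, unfold Let_def)
       (use less assms in \<open>intro scale_mem diff_mem sum_mem\<close>, auto)
qed

lemma gram_schmidt_alt:
  "gram_schmidt t n = (\<lambda>x. complex_of_real (inverse (nrm (\<lambda>x. t n x - proj (gram_schmidt t) n (t n) x)))
       * (t n x - proj (gram_schmidt t) n (t n) x))"
  by (subst gram_schmidt.simps) (simp add: Let_def proj_def)

lemma gram_schmidt_self:
  assumes "\<And>n. t n \<in> H"
  shows "ip (gram_schmidt t n) (gram_schmidt t n) = 1 \<or> nrm (gram_schmidt t n) = 0"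
proof -
  define r where "r = (\<lambda>x. t n x - proj (gram_schmidt t) n (t n) x)"
  have rH: "r \<in> H" unfolding r_def using assms gram_schmidt_mem[OF assms] by simp
  have g: "gram_schmidt t n = (\<lambda>x. complex_of_real (inverse (nrm r)) * r x)"
    by (subst gram_schmidt_alt) (simp add: r_def)
  have n: "nrm (gram_schmidt t n) = \<bar>inverse (nrm r)\<bar> * nrm r"
    unfolding g using nrm_scale[OF rH, of "complex_of_real (inverse (nrm r))"]
    by (simp only: norm_of_real)
  show ?thesis
  proof (cases "nrm r = 0")
    case False
    then have "nrm (gram_schmidt t n) = 1" using n rH by simp
    then show ?thesis using ip_self[OF gram_schmidt_mem[OF assms]] by simp
  qed (use n in simp)
qed

lemma gram_schmidt_orth:
  assumes "\<And>n. t n \<in> H"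
  shows "m < n \<Longrightarrow> ip (gram_schmidt t m) (gram_schmidt t n) = 0 \<and> ip (gram_schmidt t n) (gram_schmidt t m) = 0"
proof (induction n arbitrary: m rule: less_induct)
  case (less n)
  note [simp] = gram_schmidt_mem[OF assms] assms
  let ?e = "gram_schmidt t"
  have "ip (proj ?e n (t n)) (?e m) = ip (t n) (?e m)"
  proof (rule ip_proj_aux)
    \<comment> \<open>Both indices lie below n, so the induction hypothesis applies to the larger of
      the two.\<close>
    show "ip (?e j) (?e m) = 0" if "j < n" "j \<noteq> m" for j
      using less(1)[of j m] less(1)[of m j] that less(2) by (cases "j < m") auto
  qed (use less(2) gram_schmidt_self[OF assms] in auto)
  then have "ip (?e n) (?e m) = 0"
    by (subst gram_schmidt_alt) (simp add: ip_simps)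
  then show ?case using ip_herm[of "?e n" "?e m"] by simp
qed

lemma orthonormal0_gram_schmidt:
  assumes "\<And>n. t n \<in> H" shows "orthonormal0 (gram_schmidt t)"
proof -
  have "ip (gram_schmidt t m) (gram_schmidt t n) = 0" if "m \<noteq> n" for m n
    using gram_schmidt_orth[OF assms, of m n] gram_schmidt_orth[OF assms, of n m] that
    by (cases "m < n") auto
  then show ?thesis
    unfolding orthonormal0_def
    by (intro conjI allI impI gram_schmidt_mem gram_schmidt_self assms)
qed

text \<open>Carries totality from \<open>t\<close> to its orthogonalisation. \<open>t n\<close> is a
  projection plus a residual, and the residual is either a multiple of the n-th term or null; null
  functions are orthogonal to everything by Cauchy-Schwarz.\<close>

lemma gram_schmidt_total:
  assumes t: "\<And>n. t n \<in> H" and w: "w \<in> H" and z: "\<And>n. ip w (gram_schmidt t n) = 0"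
  shows "ip w (t n) = 0"
proof -
  note [simp] = gram_schmidt_mem[OF t] t w
  let ?e = "gram_schmidt t"
  let ?r = "\<lambda>x. t n x - proj ?e n (t n) x"
  have p: "ip w (proj ?e n (t n)) = 0"
  proof -
    have "ip w (proj ?e n (t n)) = (\<Sum>j<n. ip w (\<lambda>x. ip (t n) (?e j) * ?e j x))"
      unfolding proj_def by (intro ip_sum_right) simp_all
    then show ?thesis by (simp add: ip_scale_right z)
  qed
  have "ip w ?r = 0"
  proof (cases "nrm ?r = 0")
    case False
    have "0 = cnj (complex_of_real (inverse (nrm ?r))) * ip w ?r"
      using z[of n] by (subst (asm) gram_schmidt_alt) (subst (asm) ip_scale_right; simp)
    with False show ?thesis by simp
  qed (simp add: ip_null)
  with p show ?thesis by (simp add: ip_simps)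
qed

context
  fixes e
  assumes e: "orthonormal0 e"
begin

lemma e_mem [simp]: "e n \<in> H" and e_orth: "m \<noteq> n \<Longrightarrow> ip (e m) (e n) = 0"
  and e_self: "ip (e n) (e n) = 1 \<or> nrm (e n) = 0"
  using e by (auto simp: orthonormal0_def)

lemma nrm_e_le: "nrm (e n) \<le> 1"
  using e_self[of n] by (auto simp: nrm_def)

lemma ip_proj: "u \<in> H \<Longrightarrow> i < N \<Longrightarrow> ip (proj e N u) (e i) = ip u (e i)"
  by (rule ip_proj_aux) (auto simp: e_orth e_self)

lemma resid_orth: "u \<in> H \<Longrightarrow> i < N \<Longrightarrow> ip (\<lambda>x. u x - proj e N u x) (e i) = 0"
  by (simp add: ip_simps ip_proj)

text \<open>Source of two facts: residuals decrease with the number of terms, and, since the norm of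
  a difference becomes a difference of squared norms, they form a Cauchy sequence.\<close>

lemma resid_pythagoras:
  assumes u: "u \<in> H" and "M \<le> N"
  shows "(nrm (\<lambda>x. u x - proj e M u x))\<^sup>2 = (nrm (\<lambda>x. u x - proj e N u x))\<^sup>2
     + (nrm (\<lambda>x. proj e N u x - proj e M u x))\<^sup>2"
proof -
  have d: "(\<lambda>x. proj e N u x - proj e M u x) = (\<lambda>x. \<Sum>j\<in>{M..<N}. ip u (e j) * e j x)"
  proof
    fix x
    show "proj e N u x - proj e M u x = (\<Sum>j\<in>{M..<N}. ip u (e j) * e j x)"
      unfolding proj_def lessThan_atLeast0
      using sum.atLeastLessThan_concat[of 0 M N "\<lambda>j. ip u (e j) * e j x"] \<open>M \<le> N\<close>
      by (simp add: diff_eq_eq add.commute)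
  qed
  have "ip (\<lambda>x. u x - proj e N u x) (\<lambda>x. \<Sum>j\<in>{M..<N}. ip u (e j) * e j x) = 0"
  proof -
    have "ip (\<lambda>x. u x - proj e N u x) (\<lambda>x. \<Sum>j\<in>{M..<N}. ip u (e j) * e j x)
        = (\<Sum>j\<in>{M..<N}. ip (\<lambda>x. u x - proj e N u x) (\<lambda>x. ip u (e j) * e j x))"
      using u by (intro ip_sum_right) simp_all
    also have "\<dots> = 0"
      using u by (intro sum.neutral) (simp add: ip_scale_right resid_orth)
    finally show ?thesis .
  qed
  then have "ip (\<lambda>x. u x - proj e N u x) (\<lambda>x. proj e N u x - proj e M u x) = 0"
    by (simp add: d)
  then show ?thesis
    using nrm_sq_add[of "\<lambda>x. u x - proj e N u x" "\<lambda>x. proj e N u x - proj e M u x"] u by simp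
qed

lemma resid_antimono: "u \<in> H \<Longrightarrow> M \<le> N \<Longrightarrow>
    nrm (\<lambda>x. u x - proj e N u x) \<le> nrm (\<lambda>x. u x - proj e M u x)"
proof (rule power2_le_imp_le)
  assume "u \<in> H" "M \<le> N"
  then show "(nrm (\<lambda>x. u x - proj e N u x))\<^sup>2 \<le> (nrm (\<lambda>x. u x - proj e M u x))\<^sup>2"
    using resid_pythagoras[of u M N] zero_le_power2[of "nrm (\<lambda>x. proj e N u x - proj e M u x)"] by linarith
qed simp

lemma resid_le: "u \<in> H \<Longrightarrow> nrm (\<lambda>x. u x - proj e N u x) \<le> nrm u"
  using resid_antimono[of u 0 N] by (simp add: proj_def)

lemma proj_add: "u \<in> H \<Longrightarrow> v \<in> H \<Longrightarrow>
    proj e N (\<lambda>x. u x + v x) = (\<lambda>x. proj e N u x + proj e N v x)"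
  by (simp add: proj_def ip_add sum.distrib distrib_right)

lemma proj_scale: "u \<in> H \<Longrightarrow> proj e N (\<lambda>x. c * u x) = (\<lambda>x. c * proj e N u x)"
  by (simp add: proj_def ip_scale sum_distrib_left mult.assoc)

lemma resid_add: "u \<in> H \<Longrightarrow> v \<in> H \<Longrightarrow>
    nrm (\<lambda>x. (u x + v x) - proj e N (\<lambda>x. u x + v x) x)
      \<le> nrm (\<lambda>x. u x - proj e N u x) + nrm (\<lambda>x. v x - proj e N v x)"
  using nrm_triangle[of "\<lambda>x. u x - proj e N u x" "\<lambda>x. v x - proj e N v x"]
  by (simp add: proj_add algebra_simps)

lemma resid_scale: "u \<in> H \<Longrightarrow>
    nrm (\<lambda>x. c * u x - proj e N (\<lambda>x. c * u x) x) = cmod c * nrm (\<lambda>x. u x - proj e N u x)"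
  using nrm_scale[of "\<lambda>x. u x - proj e N u x" c] by (simp add: proj_scale right_diff_distrib)

lemma resid_le_add: "u \<in> H \<Longrightarrow> v \<in> H \<Longrightarrow>
    nrm (\<lambda>x. u x - proj e N u x) \<le> nrm (\<lambda>x. u x - v x) + nrm (\<lambda>x. v x - proj e N v x)"
  using resid_add[of "\<lambda>x. u x - v x" v N] resid_le[of "\<lambda>x. u x - v x" N] by simp

lemma resid_proj: "u \<in> H \<Longrightarrow> nrm (\<lambda>x. proj e N u x - proj e N (proj e N u) x) = 0"
proof -
  assume u: "u \<in> H"
  then have "proj e N (proj e N u) = proj e N u"
    by (subst (1 3) proj_def) (auto simp: ip_proj)
  then show ?thesis by simp
qed

text \<open>Meant for a \<open>q\<close> weaker than \<open>nrm\<close>, namely the L2 norm inside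
  H1. The constant may grow with \<open>N\<close>; keeping it below a multiple of k is the purpose
  of the later choice of \<open>N\<close>.\<close>

lemma nrm_proj_le:
  assumes "u \<in> H" "\<And>n. cmod (ip u (e n)) \<le> K n * q"
  shows "nrm (proj e N u) \<le> (\<Sum>n<N. K n) * q"
proof -
  have "nrm (proj e N u) \<le> (\<Sum>n<N. nrm (\<lambda>x. ip u (e n) * e n x))"
    unfolding proj_def by (rule nrm_sum_le) auto
  also have "\<dots> = (\<Sum>n<N. cmod (ip u (e n)) * nrm (e n))" by (simp add: nrm_scale)
  also have "\<dots> \<le> (\<Sum>n<N. K n * q)"
    using assms(2) nrm_e_le
    by (intro sum_mono) (meson mult_left_le norm_ge_zero order_trans)
  finally show ?thesis by (simp add: sum_distrib_right)
qed

end

text \<open>Each orthogonalised function is a finite combination of \<open>t 0\<close>, ...,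
  \<open>t n\<close> and inherits a bound by \<open>q\<close> with a constant depending on n. That
  constant involves those of all smaller indices, hence the strong induction.\<close>

lemma gram_schmidt_bound:
  assumes t: "\<And>n. t n \<in> H" and b: "\<And>n. \<exists>K. \<forall>u\<in>H. cmod (ip u (t n)) \<le> K * q u"
  shows "\<exists>K. \<forall>u\<in>H. cmod (ip u (gram_schmidt t n)) \<le> K * q u"
proof (induction n rule: less_induct)
  case (less n)
  note [simp] = gram_schmidt_mem[OF t] t
  let ?e = "gram_schmidt t"
  from less obtain K where K: "\<And>m u. m < n \<Longrightarrow> u \<in> H \<Longrightarrow> cmod (ip u (?e m)) \<le> K m * q u" by metis
  obtain L where L: "\<And>u. u \<in> H \<Longrightarrow> cmod (ip u (t n)) \<le> L * q u" using b[of n] by auto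
  define s where "s = inverse (nrm (\<lambda>x. t n x - proj ?e n (t n) x))"
  have "cmod (ip u (?e n)) \<le> (\<bar>s\<bar> * (L + (\<Sum>j<n. cmod (ip (t n) (?e j)) * K j))) * q u"
    if u: "u \<in> H" for u
  proof -
    have "ip u (proj ?e n (t n)) = (\<Sum>j<n. ip u (\<lambda>x. ip (t n) (?e j) * ?e j x))"
      unfolding proj_def using u by (intro ip_sum_right) simp_all
    then have "ip u (proj ?e n (t n)) = (\<Sum>j<n. cnj (ip (t n) (?e j)) * ip u (?e j))"
      using u by (simp add: ip_scale_right)
    then have eq: "ip u (?e n) = complex_of_real s *
        (ip u (t n) - (\<Sum>j<n. cnj (ip (t n) (?e j)) * ip u (?e j)))"
      using u by (subst gram_schmidt_alt) (simp add: ip_scale_right ip_diff_right flip: s_def)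
    have "cmod (\<Sum>j<n. cnj (ip (t n) (?e j)) * ip u (?e j))
       \<le> (\<Sum>j<n. cmod (ip (t n) (?e j)) * (K j * q u))"
      using K u by (intro sum_norm_le) (auto simp: norm_mult intro!: mult_left_mono)
    also have "\<dots> = (\<Sum>j<n. cmod (ip (t n) (?e j)) * K j) * q u"
      by (simp add: sum_distrib_right mult.assoc)
    finally have "cmod (ip u (t n) - (\<Sum>j<n. cnj (ip (t n) (?e j)) * ip u (?e j)))
       \<le> (L + (\<Sum>j<n. cmod (ip (t n) (?e j)) * K j)) * q u"
      using L[OF u] norm_triangle_ineq4[of "ip u (t n)" "\<Sum>j<n. cnj (ip (t n) (?e j)) * ip u (?e j)"]
      by (simp only: distrib_right)
    then show ?thesis unfolding eq by (simp add: norm_mult mult.assoc mult_left_mono)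
  qed
  then show ?case by blast
qed

lemma ip_tendsto:
  assumes "\<And>n. s n \<in> H" "u \<in> H" "v \<in> H" "(\<lambda>n. nrm (\<lambda>x. s n x - u x)) \<longlonglongrightarrow> 0"
  shows "(\<lambda>n. ip v (s n)) \<longlonglongrightarrow> ip v u"
proof -
  have "(\<lambda>n. ip v (s n) - ip v u) \<longlonglongrightarrow> 0"
  proof (rule Lim_null_comparison)
    show "\<forall>\<^sub>F n in sequentially. cmod (ip v (s n) - ip v u) \<le> nrm v * nrm (\<lambda>x. s n x - u x)"
      using assms cauchy_schwarz[of v "\<lambda>x. s n x - u x" for n]
      by (intro always_eventually) (auto simp: ip_diff_right)
    show "(\<lambda>n. nrm v * nrm (\<lambda>x. s n x - u x)) \<longlonglongrightarrow> 0"
      using tendsto_mult_right_zero[OF assms(4)] by simp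
  qed
  then show ?thesis by (simp add: LIM_zero_iff)
qed

end

section \<open>Riesz representation and convergence of projections in complete spaces\<close>

locale semi_hilbert = semi_inner_product +
  assumes complete: "(\<And>n. s n \<in> H) \<Longrightarrow> (\<And>e. 0 < e \<Longrightarrow> \<exists>N. \<forall>m\<ge>N. \<forall>n\<ge>N. nrm (\<lambda>x. s m x - s n x) < e) \<Longrightarrow>
      \<exists>u\<in>H. (\<lambda>n. nrm (\<lambda>x. s n x - u x)) \<longlonglongrightarrow> 0"
begin

text \<open>Variational proof: the representer minimises
  \<open>(nrm u)\<^sup>2 - 2 * Re (l u)\<close>. A minimising sequence is Cauchy by the
  parallelogram law, and the first variation at its limit, taken in all complex directions, is the
  desired identity. The argument goes through for a semi-definite form; the representer is then
  determined up to null functions.\<close>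

lemma riesz:
  fixes l :: "('a \<Rightarrow> complex) \<Rightarrow> complex"
  assumes l_add: "\<And>u v. u \<in> H \<Longrightarrow> v \<in> H \<Longrightarrow> l (\<lambda>x. u x + v x) = l u + l v"
    and l_scale: "\<And>c u. u \<in> H \<Longrightarrow> l (\<lambda>x. c * u x) = c * l u"
    and l_bound: "\<And>u. u \<in> H \<Longrightarrow> cmod (l u) \<le> K * nrm u"
  shows "\<exists>v\<in>H. \<forall>u\<in>H. ip u v = l u"
proof -
  define J where "J u = (nrm u)\<^sup>2 - 2 * Re (l u)" for u
  \<comment> \<open>Completing the square: \<open>(nrm u - K)\<^sup>2\<close> is
    nonnegative.\<close>
  have J_lower: "- K\<^sup>2 \<le> J u" if "u \<in> H" for u
  proof -
    have "Re (l u) \<le> K * nrm u" using l_bound[OF that] complex_Re_le_cmod order_trans by blast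
    moreover have "0 \<le> (nrm u - K)\<^sup>2" by simp
    ultimately show ?thesis unfolding J_def by (simp add: power2_eq_square algebra_simps)
  qed
  define d where "d = Inf (J ` H)"
  have bdd: "bdd_below (J ` H)" using J_lower by (intro bdd_belowI[of _ "- K\<^sup>2"]) auto
  have d_le: "d \<le> J u" if "u \<in> H" for u
    unfolding d_def using bdd that by (intro cInf_lower) auto
  have "\<exists>u\<in>H. J u < d + inverse (real (Suc n))" for n
  proof -
    have "Inf (J ` H) < d + inverse (real (Suc n))" unfolding d_def by simp
    moreover have "J ` H \<noteq> {}" using zero_mem by blast
    ultimately show ?thesis using bdd by (simp add: cInf_less_iff)
  qed
  then obtain s where sH: "\<And>n. s n \<in> H" and sJ: "\<And>n. J (s n) < d + inverse (real (Suc n))" by metis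
  \<comment> \<open>Parallelogram law: the squared distance is twice the sum of the values of J at
    both points minus four times its value at the midpoint, and the midpoint cannot lie below the
    infimum \<open>d\<close>.\<close>
  have par: "(nrm (\<lambda>x. s m x - s n x))\<^sup>2 \<le> 2 * inverse (real (Suc m)) + 2 * inverse (real (Suc n))" for m n
  proof -
    let ?w = "\<lambda>x. (1/2) * (s m x + s n x)"
    have w: "?w \<in> H" using sH by (intro scale_mem add_mem)
    have nw: "nrm ?w = (1/2) * nrm (\<lambda>x. s m x + s n x)"
      using nrm_scale[of "\<lambda>x. s m x + s n x" "1/2"] sH by simp
    have "(nrm ?w)\<^sup>2 = (1/4) * (nrm (\<lambda>x. s m x + s n x))\<^sup>2"
      unfolding nw by (simp add: power_divide)
    moreover have "(nrm (\<lambda>x. s m x + s n x))\<^sup>2 = (nrm (s m))\<^sup>2 + 2 * Re (ip (s m) (s n)) + (nrm (s n))\<^sup>2"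
      using sH by (intro nrm_sq_add)
    moreover have "(nrm (\<lambda>x. s m x - s n x))\<^sup>2 = (nrm (s m))\<^sup>2 - 2 * Re (ip (s m) (s n)) + (nrm (s n))\<^sup>2"
      using nrm_sq_add[of "s m" "\<lambda>x. (-1) * s n x"] nrm_scale[of "s n" "-1"] ip_scale_right[of "s n" "s m" "-1"]
        scale_mem[of "s n" "-1"] sH by simp
    moreover have lw: "l ?w = (1/2) * (l (s m) + l (s n))"
      using l_scale[of "\<lambda>x. s m x + s n x" "1/2"] l_add[of "s m" "s n"] sH by simp
    moreover have "d \<le> J ?w" using w by (rule d_le)
    moreover have "Re (l ?w) = (Re (l (s m)) + Re (l (s n))) / 2" unfolding lw by simp
    ultimately show ?thesis using sJ[of m] sJ[of n] unfolding J_def by argo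
  qed
  have "\<exists>v\<in>H. (\<lambda>n. nrm (\<lambda>x. s n x - v x)) \<longlonglongrightarrow> 0"
  proof (rule complete[OF sH])
    fix e :: real assume "0 < e"
    obtain N where N: "inverse (real (Suc N)) < e\<^sup>2 / 4"
      using reals_Archimedean[of "e\<^sup>2 / 4"] \<open>0 < e\<close> by auto
    have "nrm (\<lambda>x. s m x - s n x) < e" if "m \<ge> N" "n \<ge> N" for m n
    proof -
      have "inverse (real (Suc m)) \<le> inverse (real (Suc N))" "inverse (real (Suc n)) \<le> inverse (real (Suc N))"
        using that by (auto simp: field_simps)
      then have "(nrm (\<lambda>x. s m x - s n x))\<^sup>2 < e\<^sup>2" using par[of m n] N by linarith
      then show ?thesis using \<open>0 < e\<close> power_less_imp_less_base[of _ 2 e] by auto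
    qed
    then show "\<exists>N. \<forall>m\<ge>N. \<forall>n\<ge>N. nrm (\<lambda>x. s m x - s n x) < e" by blast
  qed
  then obtain v where v: "v \<in> H" "(\<lambda>n. nrm (\<lambda>x. s n x - v x)) \<longlonglongrightarrow> 0" by auto
  have "ip u v = l u" if u: "u \<in> H" for u
  proof -
    \<comment> \<open>Moving from \<open>s n\<close> in the direction \<open>c * u\<close> lowers J
      by less than \<open>inverse (real (Suc n))\<close>, since J never falls below
      \<open>d\<close>.\<close>
    have ineq: "- inverse (real (Suc n)) \<le> 2 * Re (c * (ip u (s n) - l u)) + (cmod c)\<^sup>2 * (nrm u)\<^sup>2" for n c
    proof -
      have "d \<le> J (\<lambda>x. s n x + c * u x)" using sH u by (intro d_le) auto
      also have "\<dots> = J (s n) + 2 * Re (ip (s n) (\<lambda>x. c * u x)) + (cmod c)\<^sup>2 * (nrm u)\<^sup>2 - 2 * Re (c * l u)"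
        using nrm_sq_add[of "s n" "\<lambda>x. c * u x"] sH u l_add[of "s n" "\<lambda>x. c * u x"] l_scale[of u c]
        by (simp add: J_def nrm_scale power_mult_distrib)
      also have "ip (s n) (\<lambda>x. c * u x) = cnj (c * ip u (s n))"
        using ip_scale_right[of u "s n" c] ip_herm[of u "s n"] u sH by simp
      finally show ?thesis using sJ[of n] by (simp add: algebra_simps)
    qed
    have lim: "0 \<le> 2 * Re (c * (ip u v - l u)) + (cmod c)\<^sup>2 * (nrm u)\<^sup>2" for c
    proof (rule LIMSEQ_le)
      show "(\<lambda>n. - inverse (real (Suc n))) \<longlonglongrightarrow> 0"
        using tendsto_minus[OF LIMSEQ_inverse_real_of_nat] by simp
      show "(\<lambda>n. 2 * Re (c * (ip u (s n) - l u)) + (cmod c)\<^sup>2 * (nrm u)\<^sup>2)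
          \<longlonglongrightarrow> 2 * Re (c * (ip u v - l u)) + (cmod c)\<^sup>2 * (nrm u)\<^sup>2"
        by (intro tendsto_intros ip_tendsto sH u v)
      show "\<exists>N. \<forall>n\<ge>N. - inverse (real (Suc n)) \<le> 2 * Re (c * (ip u (s n) - l u)) + (cmod c)\<^sup>2 * (nrm u)\<^sup>2"
        using ineq by blast
    qed
    let ?z = "ip u v - l u"
    show ?thesis
    proof (rule ccontr)
      assume "ip u v \<noteq> l u"
      then have z: "cmod ?z > 0" by simp
      \<comment> \<open>With \<open>c\<close> equal to \<open>- t\<close> times the conjugate of the
        defect \<open>?z\<close>, the linear term is negative of order t and the quadratic one of
        order \<open>t\<^sup>2\<close>. This t is small enough for the linear term to win; the 1 in
        the denominator covers \<open>nrm u = 0\<close>.\<close>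
      define t where "t = 1 / (1 + (nrm u)\<^sup>2)"
      have t: "0 < t" "t * (nrm u)\<^sup>2 < 1"
        by (auto simp: t_def add_pos_nonneg field_simps)
      have "- complex_of_real t * cnj ?z * ?z = complex_of_real (- t * (cmod ?z)\<^sup>2)"
        using complex_norm_square[of ?z] by (simp only: of_real_mult of_real_minus mult.assoc mult.commute[of "cnj ?z" ?z])
      then have e1: "Re (- complex_of_real t * cnj ?z * ?z) = - t * (cmod ?z)\<^sup>2"
        by (simp only: Re_complex_of_real)
      have e2: "(cmod (- complex_of_real t * cnj ?z))\<^sup>2 = t\<^sup>2 * (cmod ?z)\<^sup>2"
        by (simp add: norm_mult power_mult_distrib del: complex_cnj_diff)
      have "0 \<le> - 2 * t * (cmod ?z)\<^sup>2 + t\<^sup>2 * (cmod ?z)\<^sup>2 * (nrm u)\<^sup>2"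
        using lim[of "- complex_of_real t * cnj ?z"] unfolding e1 e2 by argo
      also have "\<dots> = t * (cmod ?z)\<^sup>2 * (t * (nrm u)\<^sup>2 - 2)"
        by (simp add: power2_eq_square algebra_simps)
      also have "\<dots> < 0" using t z by (intro mult_pos_neg) auto
      finally show False by simp
    qed
  qed
  with v show ?thesis by blast
qed

text \<open>The squared residual norms decrease, hence converge, and Pythagoras turns this into the
  Cauchy property of the residuals. Their limit is orthogonal to every \<open>e i\<close>, because
  the n-th residual is so as soon as n exceeds i; totality makes the limit null.\<close>

lemma resid_tendsto_zero:
  assumes e: "orthonormal0 e" and u: "u \<in> H"
    and total: "\<And>w. w \<in> H \<Longrightarrow> (\<And>n. ip w (e n) = 0) \<Longrightarrow> nrm w = 0"
  shows "(\<lambda>N. nrm (\<lambda>x. u x - proj e N u x)) \<longlonglongrightarrow> 0"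
proof -
  note [simp] = e_mem[OF e] u
  define r where "r N = (\<lambda>x. u x - proj e N u x)" for N
  have rH [simp]: "r N \<in> H" for N by (simp add: r_def)
  define a where "a N = (nrm (r N))\<^sup>2" for N
  have "decseq a"
    unfolding decseq_def a_def r_def using resid_antimono[OF e u] by (auto intro!: power_mono)
  moreover have "\<forall>n. 0 \<le> a n" by (simp add: a_def)
  ultimately have "convergent a"
    by (metis convergentI decseq_convergent)
  then have ca: "Cauchy a" by (rule convergent_Cauchy)
  have diff: "(nrm (\<lambda>x. r m x - r n x))\<^sup>2 = \<bar>a m - a n\<bar>" for m n
  proof -
    have *: "(nrm (\<lambda>x. r m x - r n x))\<^sup>2 = \<bar>a m - a n\<bar>" if "m \<le> n" for m n
      using resid_pythagoras[OF e u that] by (simp add: a_def r_def)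
    show ?thesis
    proof (cases "m \<le> n")
      case False
      then show ?thesis using *[of n m] nrm_diff_commute[of "r m" "r n"] by simp
    qed (rule *)
  qed
  have "\<exists>w\<in>H. (\<lambda>n. nrm (\<lambda>x. r n x - w x)) \<longlonglongrightarrow> 0"
  proof (rule complete[OF rH])
    fix e :: real assume "0 < e"
    then obtain N where "\<forall>m\<ge>N. \<forall>n\<ge>N. dist (a m) (a n) < e\<^sup>2"
      using ca by (meson Cauchy_def zero_less_power)
    then have "\<forall>m\<ge>N. \<forall>n\<ge>N. (nrm (\<lambda>x. r m x - r n x))\<^sup>2 < e\<^sup>2" by (simp add: diff dist_real_def)
    then show "\<exists>N. \<forall>m\<ge>N. \<forall>n\<ge>N. nrm (\<lambda>x. r m x - r n x) < e"
      using \<open>0 < e\<close> power_less_imp_less_base[of _ 2 e] by (meson less_imp_le)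
  qed
  then obtain w where w: "w \<in> H" "(\<lambda>n. nrm (\<lambda>x. r n x - w x)) \<longlonglongrightarrow> 0" by auto
  have "ip w (e i) = 0" for i
  proof -
    have "(\<lambda>n. ip (e i) (r n)) \<longlonglongrightarrow> ip (e i) w" using w by (intro ip_tendsto) auto
    moreover have "\<forall>\<^sub>F n in sequentially. ip (e i) (r n) = 0"
      using eventually_gt_at_top[of i]
    proof eventually_elim
      case (elim n)
      then have "ip (r n) (e i) = 0" unfolding r_def by (rule resid_orth[OF e u])
      then show ?case using ip_herm[of "r n" "e i"] by simp
    qed
    ultimately have "ip (e i) w = 0"
      using LIMSEQ_unique[OF _ tendsto_eventually] by blast
    then show ?thesis using ip_herm[of "e i" w] w by simp
  qed
  then have nw: "nrm w = 0" using w(1) by (intro total)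
  have "(\<lambda>N. nrm (r N)) \<longlonglongrightarrow> 0"
  proof (rule Lim_null_comparison[OF _ w(2)])
    show "\<forall>\<^sub>F n in sequentially. norm (nrm (r n)) \<le> nrm (\<lambda>x. r n x - w x)"
      using nrm_triangle_diff[OF rH w(1)] w nw by simp
  qed
  then show ?thesis by (simp add: r_def)
qed

end

section \<open>Smooth functions with compact support\<close>

lemma partial_deriv_eq: "(f has_derivative f') (at x) \<Longrightarrow> partial_deriv i f x = f' (axis i 1)"
  unfolding partial_deriv_def using frechet_derivative_at by metis

lemma partial_deriv_const [simp]: "partial_deriv i (\<lambda>x. c) = (\<lambda>x. 0)"
proof
  fix x :: "real^'a"
  have "((\<lambda>x. c) has_derivative (\<lambda>h. 0)) (at x)" by simp
  from partial_deriv_eq[OF this] show "partial_deriv i (\<lambda>x. c) x = 0" .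
qed

lemma partial_deriv_add:
  "f differentiable at x \<Longrightarrow> g differentiable at x \<Longrightarrow>
    partial_deriv i (\<lambda>x. f x + g x) x = partial_deriv i f x + partial_deriv i g x"
  unfolding frechet_derivative_works partial_deriv_def[of i f] partial_deriv_def[of i g]
  by (rule partial_deriv_eq) (rule has_derivative_add)

lemma partial_deriv_mult:
  fixes f g :: "real^'n \<Rightarrow> real"
  shows "f differentiable at x \<Longrightarrow> g differentiable at x \<Longrightarrow>
    partial_deriv i (\<lambda>x. f x * g x) x = f x * partial_deriv i g x + partial_deriv i f x * g x"
  unfolding frechet_derivative_works partial_deriv_def[of i f] partial_deriv_def[of i g]
  by (rule partial_deriv_eq) (rule has_derivative_mult)

lemma partial_deriv_affine:
  fixes f :: "real^'n \<Rightarrow> real"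
  assumes "f differentiable at (c *\<^sub>R x + z)"
  shows "(\<lambda>x. f (c *\<^sub>R x + z)) differentiable at x"
    and "partial_deriv i (\<lambda>x. f (c *\<^sub>R x + z)) x = c * partial_deriv i f (c *\<^sub>R x + z)"
proof -
  have d: "(f has_derivative frechet_derivative f (at (c *\<^sub>R x + z))) (at (c *\<^sub>R x + z))"
    using assms by (simp add: frechet_derivative_works)
  have "((\<lambda>x. c *\<^sub>R x + z) has_derivative (\<lambda>h. c *\<^sub>R h)) (at x)"
    by (auto intro!: derivative_eq_intros)
  from has_derivative_compose[OF this d]
  have *: "((\<lambda>x. f (c *\<^sub>R x + z)) has_derivative (\<lambda>h. frechet_derivative f (at (c *\<^sub>R x + z)) (c *\<^sub>R h))) (at x)" .
  then show "(\<lambda>x. f (c *\<^sub>R x + z)) differentiable at x" by (auto simp: differentiable_def)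
  have "linear (frechet_derivative f (at (c *\<^sub>R x + z)))"
    using d has_derivative_linear by blast
  then show "partial_deriv i (\<lambda>x. f (c *\<^sub>R x + z)) x = c * partial_deriv i f (c *\<^sub>R x + z)"
    using partial_deriv_eq[OF *] by (simp add: partial_deriv_def linear_scale)
qed

lemma Ck_on_differentiable: "Ck_on (Suc l) f UNIV \<Longrightarrow> f differentiable at x"
  by (simp add: differentiable_on_def)

lemma Ck_on_Suc_iff: "Ck_on (Suc l) f UNIV \<longleftrightarrow>
    (\<forall>x. f differentiable at x) \<and> (\<forall>i. Ck_on l (partial_deriv i f) UNIV)"
  by (simp add: differentiable_on_def)

lemma Ck_on_SucD: "Ck_on (Suc l) f UNIV \<Longrightarrow> Ck_on l f UNIV"
proof (induction l arbitrary: f)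
  case 0
  then show ?case by (simp add: differentiable_imp_continuous_on)
next
  case (Suc l)
  then have "f differentiable_on UNIV" and p: "\<And>i. Ck_on (Suc l) (partial_deriv i f) UNIV"
    by (auto simp only: Ck_on.simps)
  then show ?case using Suc.IH by (simp add: Ck_on.simps)
qed

lemma Ck_on_const: "Ck_on l (\<lambda>x. c) UNIV"
  by (induction l arbitrary: c) auto

lemma Ck_on_add: "Ck_on l f UNIV \<Longrightarrow> Ck_on l g UNIV \<Longrightarrow> Ck_on l (\<lambda>x. f x + g x) UNIV"
proof (induction l arbitrary: f g)
  case 0
  then show ?case by (auto intro!: continuous_intros)
next
  case (Suc l)
  have d: "f differentiable at x" "g differentiable at x" for x
    using Suc.prems Ck_on_differentiable by blast+
  then have "partial_deriv i (\<lambda>x. f x + g x) = (\<lambda>x. partial_deriv i f x + partial_deriv i g x)" for i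
    by (auto simp: partial_deriv_add)
  with Suc d show ?case unfolding Ck_on_Suc_iff by auto
qed

lemma Ck_on_mult:
  fixes f g :: "real^'n \<Rightarrow> real"
  shows "Ck_on l f UNIV \<Longrightarrow> Ck_on l g UNIV \<Longrightarrow> Ck_on l (\<lambda>x. f x * g x) UNIV"
proof (induction l arbitrary: f g)
  case 0
  then show ?case by (auto intro!: continuous_intros)
next
  case (Suc l)
  have d: "f differentiable at x" "g differentiable at x" for x
    using Suc.prems Ck_on_differentiable by blast+
  then have p: "partial_deriv i (\<lambda>x. f x * g x) = (\<lambda>x. f x * partial_deriv i g x + partial_deriv i f x * g x)" for i
    by (auto simp: partial_deriv_mult)
  have "Ck_on l f UNIV" "Ck_on l g UNIV" using Suc.prems Ck_on_SucD by blast+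
  moreover have "Ck_on l (partial_deriv i f) UNIV" "Ck_on l (partial_deriv i g) UNIV" for i
    using Suc.prems by (auto simp: Ck_on_Suc_iff)
  ultimately have "Ck_on l (partial_deriv i (\<lambda>x. f x * g x)) UNIV" for i
    unfolding p by (intro Ck_on_add Suc.IH)
  then show ?case unfolding Ck_on_Suc_iff using d by (auto intro: differentiable_mult)
qed

lemma Ck_on_prod:
  fixes f :: "'i \<Rightarrow> real^'n \<Rightarrow> real"
  shows "finite A \<Longrightarrow> (\<And>i. i \<in> A \<Longrightarrow> Ck_on l (f i) UNIV) \<Longrightarrow> Ck_on l (\<lambda>x. \<Prod>i\<in>A. f i x) UNIV"
  by (induction A rule: finite_induct) (auto simp: Ck_on_const Ck_on_mult)

lemma Ck_on_affine:
  fixes f :: "real^'n \<Rightarrow> real"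
  shows "Ck_on l f UNIV \<Longrightarrow> Ck_on l (\<lambda>x. f (c *\<^sub>R x + z)) UNIV"
proof (induction l arbitrary: f)
  case 0
  then show ?case by (auto intro!: continuous_on_compose2[of UNIV f] continuous_intros)
next
  case (Suc l)
  have d: "f differentiable at x" for x
    using Suc.prems Ck_on_differentiable by blast
  then have p: "partial_deriv i (\<lambda>x. f (c *\<^sub>R x + z)) = (\<lambda>x. c * partial_deriv i f (c *\<^sub>R x + z))" for i
    by (auto simp: partial_deriv_affine)
  have "Ck_on l (\<lambda>x. c * partial_deriv i f (c *\<^sub>R x + z)) UNIV" for i
    using Suc by (intro Ck_on_mult Ck_on_const Suc.IH) (auto simp: Ck_on_Suc_iff)
  then show ?case unfolding Ck_on_Suc_iff using d by (auto simp: p partial_deriv_affine)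
qed

section \<open>A smooth bump built from exp(-1/t)\<close>

text \<open>The class \<open>flat p\<close> is closed under differentiation, which makes \<open>flat 1\<close> smooth.\<close>

definition flat :: "real poly \<Rightarrow> real \<Rightarrow> real" where
  "flat p t = (if t > 0 then poly p (1 / t) * exp (- (1 / t)) else 0)"

lemma poly_exp_tendsto_0: "((\<lambda>s. poly p s * exp (- s)) \<longlongrightarrow> 0) at_top" for p :: "real poly"
proof -
  have "((\<lambda>s. \<Sum>i\<le>degree p. coeff p i * (s ^ i / exp s)) \<longlongrightarrow> (\<Sum>i\<le>degree p. coeff p i * 0)) at_top"
    by (intro tendsto_sum tendsto_mult tendsto_const tendsto_power_div_exp_0)
  then show ?thesis by (simp add: poly_altdef sum_distrib_right exp_minus divide_inverse mult.assoc)
qed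

text \<open>In the variable X = 1/t differentiation replaces \<open>p\<close> by X^2 (p - p'), hence
  the coefficient list \<open>[:0, 0, 1:]\<close>. At 0 the difference quotient from the right is
  again a polynomial in 1/h times exp(-1/h), and the exponential wins.\<close>

lemma flat_has_derivative:
  "(flat p has_real_derivative flat ([:0, 0, 1:] * (p - pderiv p)) t) (at t)"
proof -
  consider "t > 0" | "t < 0" | "t = 0" by linarith
  then show ?thesis
  proof cases
    case 1
    have "((\<lambda>t. poly p (1 / t) * exp (- (1 / t))) has_real_derivative
        flat ([:0, 0, 1:] * (p - pderiv p)) t) (at t)"
      using 1 by (auto intro!: derivative_eq_intros simp: flat_def power2_eq_square field_simps)
    moreover have "\<forall>\<^sub>F x in nhds t. flat p x = poly p (1 / x) * exp (- (1 / x))"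
      using eventually_nhds_in_open[of "{0<..}" t] 1 by (auto simp: flat_def elim!: eventually_mono)
    ultimately show ?thesis by (subst DERIV_cong_ev[OF refl _ refl]) auto
  next
    case 2
    have "\<forall>\<^sub>F x in nhds t. flat p x = 0"
      using eventually_nhds_in_open[of "{..<0}" t] 2 by (auto simp: flat_def elim!: eventually_mono)
    then show ?thesis using 2
      by (subst DERIV_cong_ev[OF refl _ refl, of _ "\<lambda>x. 0"]) (auto simp: flat_def)
  next
    case 3
    have "((\<lambda>h. (flat p (0 + h) - flat p 0) / h) \<longlongrightarrow> 0) (at 0)"
    proof (subst filterlim_at_split, intro conjI)
      show "((\<lambda>h. (flat p (0 + h) - flat p 0) / h) \<longlongrightarrow> 0) (at_left 0)"
        by (rule tendsto_eventually) (auto simp: flat_def eventually_at_filter)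
      have "((\<lambda>h. poly (pCons 0 p) (inverse h) * exp (- inverse h)) \<longlongrightarrow> 0) (at_right 0)"
        by (rule filterlim_compose[OF poly_exp_tendsto_0 filterlim_inverse_at_top_right])
      moreover have "\<forall>\<^sub>F h in at_right 0. (flat p (0 + h) - flat p 0) / h =
          poly (pCons 0 p) (inverse h) * exp (- inverse h)"
        by (auto simp: eventually_at_filter flat_def field_simps)
      ultimately show "((\<lambda>h. (flat p (0 + h) - flat p 0) / h) \<longlongrightarrow> 0) (at_right 0)"
        by (subst tendsto_cong)
    qed
    then show ?thesis using 3 by (simp add: DERIV_def flat_def)
  qed
qed

text \<open>The constant from the chain rule is absorbed into the polynomial by
  \<open>smult\<close>, so the family is closed under partial derivatives and the induction runs
  over all \<open>p\<close> at once.\<close>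

lemma Ck_on_flat: "Ck_on l (\<lambda>x :: real^'n. flat p (c * x $ i + d)) UNIV"
proof (induction l arbitrary: p)
  case 0
  have "continuous_on UNIV (flat p)"
    by (intro continuous_at_imp_continuous_on ballI DERIV_isCont[OF flat_has_derivative])
  then show ?case
    by (auto intro!: continuous_on_compose2[of UNIV "flat p"] continuous_intros)
next
  case (Suc l)
  let ?q = "[:0, 0, 1:] * (p - pderiv p)"
  have d: "((\<lambda>x :: real^'n. flat p (c * x $ i + d)) has_derivative
      (\<lambda>h. flat ?q (c * x $ i + d) * (c * h $ i))) (at x)" for x
    by (rule has_derivative_compose[OF _ flat_has_derivative[unfolded has_field_derivative_def]])
       (auto intro!: derivative_eq_intros bounded_linear_imp_has_derivative[OF bounded_linear_vec_nth])
  have "partial_deriv j (\<lambda>x :: real^'n. flat p (c * x $ i + d)) =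
      (\<lambda>x. flat (smult (if j = i then c else 0) ?q) (c * x $ i + d))" for j
    using partial_deriv_eq[OF d] by (auto simp: axis_def flat_def fun_eq_iff)
  then show ?case unfolding Ck_on_Suc_iff using d Suc.IH by (metis differentiableI)
qed

text \<open>For \<open>m > 0\<close> positive exactly inside the open box. The slope
  \<open>m\<close> moves no edge and only steepens the profile, so the bumps converge to the
  indicator of the box as \<open>m\<close> grows.\<close>

definition bump :: "real \<Rightarrow> real^'n \<Rightarrow> real^'n \<Rightarrow> real^'n \<Rightarrow> real" where
  "bump m a b x = (\<Prod>i\<in>UNIV. flat 1 (m * x $ i + (- m * a $ i)) * flat 1 ((- m) * x $ i + m * b $ i))"

lemma Ck_on_bump: "Ck_on l (bump m a b) UNIV"
  unfolding bump_def[abs_def] by (intro Ck_on_prod Ck_on_mult Ck_on_flat) auto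

lemma flat1_bounds: "0 \<le> flat 1 t" "flat 1 t \<le> 1"
  by (auto simp: flat_def)

lemma bump_nonneg: "0 \<le> bump m a b x"
  unfolding bump_def by (intro prod_nonneg mult_nonneg_nonneg ballI flat1_bounds)

lemma bump_le_1: "bump m a b x \<le> 1"
  unfolding bump_def by (intro prod_le_1 conjI mult_nonneg_nonneg mult_le_one flat1_bounds)

lemma bump_eq_0: "0 < m \<Longrightarrow> x \<notin> box a b \<Longrightarrow> bump m a b x = 0"
  unfolding bump_def mem_box_cart
proof (rule prod_zero)
  assume "0 < m" "\<not> (\<forall>i. a $ i < x $ i \<and> x $ i < b $ i)"
  then obtain i where "x $ i \<le> a $ i \<or> b $ i \<le> x $ i" using linorder_not_less by blast
  then have "m * x $ i + (- m * a $ i) \<le> 0 \<or> (- m) * x $ i + m * b $ i \<le> 0"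
    using \<open>0 < m\<close> by auto
  then show "\<exists>i\<in>UNIV. flat 1 (m * x $ i + (- m * a $ i)) * flat 1 ((- m) * x $ i + m * b $ i) = 0"
    by (auto simp: flat_def intro!: exI[of _ i])
qed auto

lemma bump_pos: assumes "0 < m" "x \<in> box a b" shows "0 < bump m a b x"
proof -
  have "0 < m * x $ i + (- m * a $ i)" "0 < (- m) * x $ i + m * b $ i" for i
    using assms by (auto simp: mem_box_cart)
  then show ?thesis unfolding bump_def by (intro prod_pos) (auto simp: flat_def)
qed

lemma bump_tendsto_indicator:
  "(\<lambda>n. bump (real (Suc n)) a b x) \<longlonglongrightarrow> indicator (box a b) x"
proof (cases "x \<in> box a b")
  case True
  have *: "(\<lambda>n. flat 1 (real (Suc n) * c)) \<longlonglongrightarrow> 1" if "0 < c" for c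
  proof -
    have "(\<lambda>n. exp (- (inverse (real (Suc n)) * (1 / c)))) \<longlonglongrightarrow> exp (- (0 * (1 / c)))"
      by (intro tendsto_intros LIMSEQ_inverse_real_of_nat)
    then show ?thesis using that by (simp add: flat_def field_simps add_pos_nonneg del: of_nat_Suc)
  qed
  have "(\<lambda>n. \<Prod>i\<in>UNIV. flat 1 (real (Suc n) * (x $ i - a $ i)) * flat 1 (real (Suc n) * (b $ i - x $ i)))
      \<longlonglongrightarrow> (\<Prod>i\<in>(UNIV::'a set). 1 * 1)"
    using True by (intro tendsto_prod tendsto_mult *) (auto simp: mem_box_cart)
  then show ?thesis using True
    by (simp add: bump_def algebra_simps del: of_nat_Suc)
qed (simp add: bump_eq_0)

text \<open>The class of admissible cutoffs. One derivative is what the boundary cutoffs offer,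
  since their profile has a kink in its derivative, whereas \<open>test_function\<close> asks for
  smoothness of every order.\<close>

definition C1_compact :: "(real^'n::finite) set \<Rightarrow> (real^'n \<Rightarrow> real) \<Rightarrow> bool" where
  "C1_compact \<Omega> \<phi> \<longleftrightarrow> Ck_on 1 \<phi> UNIV \<and> compact (closure {x. \<phi> x \<noteq> 0}) \<and> closure {x. \<phi> x \<noteq> 0} \<subseteq> \<Omega>"

lemma test_function_C1_compact: "test_function \<Omega> \<phi> \<Longrightarrow> C1_compact \<Omega> \<phi>"
  by (simp add: test_function_def C1_compact_def del: Ck_on.simps)

lemma closure_support_subset:
  "closed K \<Longrightarrow> (\<And>x. x \<notin> K \<Longrightarrow> \<phi> x = 0) \<Longrightarrow> closure {x. \<phi> x \<noteq> 0} \<subseteq> K"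
  by (rule closure_minimal) auto

lemma compact_support:
  fixes \<phi> :: "'a::heine_borel \<Rightarrow> 'b::zero"
  assumes "compact K" "\<And>x. x \<notin> K \<Longrightarrow> \<phi> x = 0"
  shows "compact (closure {x. \<phi> x \<noteq> 0})"
  using closure_support_subset[of K \<phi>] assms
  by (metis bounded_subset compact_closure closure_closed compact_eq_bounded_closed closure_subset)

lemma C1_compactI:
  assumes "Ck_on 1 \<phi> UNIV" "compact K" "K \<subseteq> \<Omega>" "\<And>x. x \<notin> K \<Longrightarrow> \<phi> x = 0"
  shows "C1_compact \<Omega> \<phi>"
  using assms closure_support_subset[of K \<phi>] compact_support[of K \<phi>]
  by (auto simp: C1_compact_def compact_imp_closed simp del: Ck_on.simps)

lemma test_functionI:
  assumes "\<And>l. Ck_on l \<phi> UNIV" "compact K" "K \<subseteq> \<Omega>" "\<And>x. x \<notin> K \<Longrightarrow> \<phi> x = 0"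
  shows "test_function \<Omega> \<phi>"
  using assms closure_support_subset[of K \<phi>] compact_support[of K \<phi>]
  by (auto simp: test_function_def compact_imp_closed)

lemma test_function_bump: "0 < m \<Longrightarrow> cbox a b \<subseteq> \<Omega> \<Longrightarrow> test_function \<Omega> (bump m a b)"
  by (rule test_functionI[of _ "cbox a b"])
     (use box_subset_cbox in \<open>auto intro!: Ck_on_bump bump_eq_0\<close>)

lemma Ck_on_1_iff: "Ck_on 1 \<phi> UNIV \<longleftrightarrow> (\<forall>x. \<phi> differentiable at x) \<and> (\<forall>i. continuous_on UNIV (partial_deriv i \<phi>))"
  by (simp add: differentiable_on_def)

lemma C1_compactD:
  assumes "C1_compact \<Omega> \<phi>"
  shows "\<phi> differentiable at x" "continuous_on UNIV \<phi>" "continuous_on UNIV (partial_deriv i \<phi>)"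
proof -
  have C: "Ck_on 1 \<phi> UNIV" using assms by (simp only: C1_compact_def)
  then show d: "\<phi> differentiable at x" and "continuous_on UNIV (partial_deriv i \<phi>)" for x
    unfolding Ck_on_1_iff by blast+
  show "continuous_on UNIV \<phi>"
    using d by (intro differentiable_imp_continuous_on) (simp add: differentiable_on_def)
qed

lemma partial_deriv_support:
  assumes "x \<notin> closure {x. \<phi> x \<noteq> 0}" shows "partial_deriv i \<phi> x = 0"
proof -
  let ?U = "- closure {x. \<phi> x \<noteq> 0}"
  have d: "((\<lambda>x. 0) has_derivative (\<lambda>h. 0)) (at x)" by simp
  have o: "open ?U" by (rule open_Compl) (rule closed_closure)
  have x: "x \<in> ?U" using assms by blast
  have "\<phi> y = 0" if "y \<in> ?U" for y
    using subsetD[OF closure_subset, of y "{x. \<phi> x \<noteq> 0}"] that by blast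
  from has_derivative_transform_within_open[OF d o x this[symmetric]]
  have "(\<phi> has_derivative (\<lambda>h. 0)) (at x)" .
  from partial_deriv_eq[OF this] show ?thesis .
qed

lemma bounded_compact_support:
  fixes f :: "'a::metric_space \<Rightarrow> real"
  assumes "continuous_on UNIV f" "compact K" "\<And>x. x \<notin> K \<Longrightarrow> f x = 0"
  obtains B where "0 < B" "\<And>x. \<bar>f x\<bar> \<le> B"
proof -
  have "compact (f ` K)" using assms by (intro compact_continuous_image) (auto intro: continuous_on_subset)
  then obtain B where B: "\<And>y. y \<in> f ` K \<Longrightarrow> norm y \<le> B" using compact_imp_bounded bounded_iff by metis
  have "\<bar>f x\<bar> \<le> max B 1" for x
    by (cases "x \<in> K") (use B[of "f x"] assms(3)[of x] in auto)
  then show ?thesis using that[of "max B 1"] by auto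
qed

lemma C1_compact_bound:
  assumes "C1_compact \<Omega> \<phi>"
  obtains B where "0 < B" "\<And>x. \<bar>\<phi> x\<bar> \<le> B" "\<And>i x. \<bar>partial_deriv i \<phi> x\<bar> \<le> B"
proof -
  let ?K = "closure {x. \<phi> x \<noteq> 0}"
  have K: "compact ?K" using assms by (simp add: C1_compact_def)
  have "\<phi> x = 0" if "x \<notin> ?K" for x
    using subsetD[OF closure_subset, of x "{x. \<phi> x \<noteq> 0}"] that by blast
  from bounded_compact_support[OF C1_compactD(2)[OF assms] K this]
  obtain B0 where B0: "0 < B0" "\<And>x. \<bar>\<phi> x\<bar> \<le> B0" by blast
  have "\<exists>B>0. \<forall>x. \<bar>partial_deriv i \<phi> x\<bar> \<le> B" for i
    using bounded_compact_support[OF C1_compactD(3)[OF assms, of i] K partial_deriv_support] by metis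
  then obtain B where B: "\<And>i. 0 < B i" "\<And>i x. \<bar>partial_deriv i \<phi> x\<bar> \<le> B i" by metis
  have "\<bar>partial_deriv i \<phi> x\<bar> \<le> B0 + (\<Sum>i\<in>UNIV. B i)" for i x
  proof -
    have "B i \<le> (\<Sum>i\<in>UNIV. B i)" using B(1) by (intro member_le_sum) (auto simp: less_imp_le)
    then show ?thesis using B(2)[of i x] B0(1) by linarith
  qed
  moreover have "0 \<le> (\<Sum>i\<in>UNIV. B i)" using B(1) by (simp add: sum_nonneg less_imp_le)
  ultimately show ?thesis using B0 by (intro that[of "B0 + (\<Sum>i\<in>UNIV. B i)"]) (auto intro: add_increasing2)
qed

section \<open>Mollification and weak derivatives\<close>

text \<open>Rational boxes are stable under intersection and generate the Borel sets, so a
  Dynkin-class argument passes from boxes to all Borel sets, where vanishing integrals force f to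
  vanish almost everywhere. That there are only countably many of them is exploited again when they
  are enumerated for the filtration.\<close>

lemma integral_density_zero_box:
  fixes f :: "'a::euclidean_space \<Rightarrow> 'b::{banach, second_countable_topology}"
  assumes f: "integrable lborel f"
    and z: "\<And>a b. (\<And>i. i \<in> Basis \<Longrightarrow> a \<bullet> i \<in> \<rat>) \<Longrightarrow> (\<And>i. i \<in> Basis \<Longrightarrow> b \<bullet> i \<in> \<rat>) \<Longrightarrow>
      (LINT x|lborel. indicator (box a b) x *\<^sub>R f x) = 0"
  shows "AE x in lborel. f x = 0"
proof (rule sigma_finite_measure.density_zero[OF sigma_finite_lborel f])
  define R where "R = {x::'a. \<forall>i\<in>Basis. x \<bullet> i \<in> \<rat>}"
  define E where "E = (\<lambda>(a,b). box a b) ` (R \<times> R)"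
  have "R \<subseteq> (\<lambda>f. \<Sum>i\<in>Basis. f i *\<^sub>R i) ` (Basis \<rightarrow>\<^sub>E \<rat>)"
  proof
    fix x assume "x \<in> R"
    then show "x \<in> (\<lambda>f. \<Sum>i\<in>Basis. f i *\<^sub>R i) ` (Basis \<rightarrow>\<^sub>E \<rat>)"
      by (intro image_eqI[of _ _ "\<lambda>i\<in>Basis. x \<bullet> i"]) (auto simp: R_def euclidean_representation)
  qed
  moreover have "countable (Basis \<rightarrow>\<^sub>E (\<rat> :: real set) :: ('a \<Rightarrow> real) set)"
    by (intro countable_PiE countable_rat) auto
  ultimately have "countable R" by (rule countable_subset[OF _ countable_image])
  then have cE: "countable E" by (simp add: E_def)
  have "topological_basis E"
  proof (rule topological_basisI)
    fix S :: "'a set" and x assume "open S" "x \<in> S"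
    then obtain e where e: "e > 0" "ball x e \<subseteq> S" by (meson openE)
    from rational_boxes[OF e(1), of x] obtain a b where
      "\<forall>i\<in>Basis. a \<bullet> i \<in> \<rat> \<and> b \<bullet> i \<in> \<rat>" "x \<in> box a b" "box a b \<subseteq> ball x e" by blast
    with e show "\<exists>B'\<in>E. x \<in> B' \<and> B' \<subseteq> S"
      by (intro bexI[of _ "box a b"]) (auto simp: E_def R_def)
  qed (auto simp: E_def)
  with cE have bE: "borel = sigma UNIV E" by (rule borel_eq_countable_basis)
  have sE: "sets (borel :: 'a measure) = sigma_sets UNIV E" by (subst bE) simp
  have iE: "Int_stable E"
  proof (rule Int_stableI)
    fix A B assume "A \<in> E" "B \<in> E"
    then obtain a b c d where *: "A = box a b" "B = box c d" "a \<in> R" "b \<in> R" "c \<in> R" "d \<in> R"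
      by (auto simp: E_def)
    have "A \<inter> B = box (\<Sum>i\<in>Basis. max (a \<bullet> i) (c \<bullet> i) *\<^sub>R i) (\<Sum>i\<in>Basis. min (b \<bullet> i) (d \<bullet> i) *\<^sub>R i)"
      using * by (simp add: box_Int_box)
    moreover have "(\<Sum>i\<in>Basis. max (a \<bullet> i) (c \<bullet> i) *\<^sub>R i) \<in> R" "(\<Sum>i\<in>Basis. min (b \<bullet> i) (d \<bullet> i) *\<^sub>R i) \<in> R"
      using * by (auto simp: R_def max_def min_def)
    ultimately show "A \<inter> B \<in> E" by (auto simp: E_def)
  qed
  have int: "set_integrable lborel A f" if "A \<in> sets borel" for A
    using f that integrable_mult_indicator[of A lborel f] by (simp add: set_integrable_def)
  \<comment> \<open>The complement step of the Dynkin argument requires the integral over the whole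
    space to vanish; the space is exhausted by cubes with integer corners.\<close>
  have total: "(LINT x|lborel. f x) = 0"
  proof -
    have "(\<lambda>n. LINT x|lborel. indicator (box (- (real n *\<^sub>R One)) (real n *\<^sub>R One)) x *\<^sub>R f x)
        \<longlonglongrightarrow> (LINT x|lborel. f x)"
    proof (rule integral_dominated_convergence)
      show "AE x in lborel. (\<lambda>n. indicator (box (- (real n *\<^sub>R One)) (real n *\<^sub>R One)) x *\<^sub>R f x) \<longlonglongrightarrow> f x"
      proof (rule AE_I2, rule tendsto_eventually)
        fix x :: 'a
        obtain N :: nat where N: "norm x < real N" using reals_Archimedean2 by blast
        show "\<forall>\<^sub>F n in sequentially. indicator (box (- (real n *\<^sub>R One)) (real n *\<^sub>R One)) x *\<^sub>R f x = f x"
          using eventually_ge_at_top[of N]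
        proof eventually_elim
          case (elim n)
          have "\<bar>x \<bullet> i\<bar> < real n" if "i \<in> Basis" for i
            using Basis_le_norm[OF that, of x] N elim by linarith
          then have "x \<in> box (- (real n *\<^sub>R One)) (real n *\<^sub>R One)"
            by (auto simp: mem_box abs_less_iff minus_less_iff)
          then show ?case by simp
        qed
      qed
      show "AE x in lborel. norm (indicator (box (- (real n *\<^sub>R One)) (real n *\<^sub>R One)) x *\<^sub>R f x) \<le> norm (f x)" for n
        by (auto simp: indicator_def)
    qed (use f in auto)
    moreover have "(LINT x|lborel. indicator (box (- (real n *\<^sub>R One)) (real n *\<^sub>R One)) x *\<^sub>R f x) = 0" for n
      by (rule z) auto
    ultimately show ?thesis by (simp add: LIMSEQ_const_iff)
  qed
  fix A assume "A \<in> sets (lborel :: 'a measure)"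
  then have A: "A \<in> sigma_sets UNIV E" using sE by simp
  have "E \<subseteq> Pow UNIV" by simp
  from iE this A show "set_lebesgue_integral lborel A f = 0"
  proof (induction rule: sigma_sets_induct_disjoint)
    case (basic A)
    then show ?case unfolding set_lebesgue_integral_def by (auto simp: E_def R_def intro!: z)
  next
    case (compl A)
    then have "A \<in> sets borel" using sE by simp
    have "set_lebesgue_integral lborel (UNIV - A) f = (LINT x|lborel. f x - indicator A x *\<^sub>R f x)"
      unfolding set_lebesgue_integral_def by (intro Bochner_Integration.integral_cong) (auto simp: indicator_def)
    also have "\<dots> = (LINT x|lborel. f x) - set_lebesgue_integral lborel A f"
      unfolding set_lebesgue_integral_def using int[OF \<open>A \<in> sets borel\<close>] f
      by (intro Bochner_Integration.integral_diff) (auto simp: set_integrable_def)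
    finally show ?case using total compl by simp
  next
    case (union A)
    then have m: "A i \<in> sets borel" for i using sE by auto
    have "set_lebesgue_integral lborel (\<Union>i. A i) f = (\<Sum>i. set_lebesgue_integral lborel (A i) f)"
      using union(1) m by (intro lebesgue_integral_countable_add int) (auto simp: disjoint_family_on_def)
    then show ?case using union by simp
  qed (auto simp: E_def set_lebesgue_integral_def)
qed

section \<open>Double integrals against a kernel in x - y\<close>

lemma lborel_reflect:
  fixes f :: "'a::euclidean_space \<Rightarrow> 'b::{banach, second_countable_topology}"
  assumes [measurable]: "f \<in> borel_measurable borel" and c: "\<bar>c\<bar> = 1"
  shows "(LINT x|lborel. f (t + c *\<^sub>R x)) = (LINT x|lborel. f x)"
    and "integrable lborel (\<lambda>x. f (t + c *\<^sub>R x)) \<longleftrightarrow> integrable lborel f"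
proof -
  have l: "lborel = distr lborel borel (\<lambda>x. t + c *\<^sub>R x)"
    using lborel_affine[of c t] c by (auto simp: density_1)
  show "(LINT x|lborel. f (t + c *\<^sub>R x)) = (LINT x|lborel. f x)"
    by (subst (2) l, subst integral_distr) auto
  show "integrable lborel (\<lambda>x. f (t + c *\<^sub>R x)) \<longleftrightarrow> integrable lborel f"
    by (subst (2) l, subst integrable_distr_eq) auto
qed

lemma lborel_reflect_diff:
  fixes f :: "'a::euclidean_space \<Rightarrow> 'b::{banach, second_countable_topology}"
  assumes "f \<in> borel_measurable borel"
  shows "(LINT x|lborel. f (t - x)) = (LINT x|lborel. f x)"
    and "integrable lborel (\<lambda>x. f (t - x)) \<longleftrightarrow> integrable lborel f"
    and "(LINT x|lborel. f (x - t)) = (LINT x|lborel. f x)"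
    and "integrable lborel (\<lambda>x. f (x - t)) \<longleftrightarrow> integrable lborel f"
  using lborel_reflect[OF assms, of "-1" t] lborel_reflect[OF assms, of 1 "-t"] by simp_all

text \<open>For fixed x the inner integral of the kernel is a constant by reflection and translation
  invariance, which yields both integrability on the product and the value. The companion lemma
  exchanges x and y by reflecting the kernel.\<close>

lemma integrable_conv1:
  fixes F \<kappa> :: "'a::euclidean_space \<Rightarrow> real"
  assumes F: "integrable lborel F" and k: "integrable lborel \<kappa>"
  shows "integrable (lborel \<Otimes>\<^sub>M lborel) (\<lambda>(x, y). F x * \<kappa> (x - y))"
    and "(LINT x|lborel. LINT y|lborel. F x * \<kappa> (x - y)) = (LINT x|lborel. F x) * (LINT x|lborel. \<kappa> x)"
proof -
  have [measurable]: "F \<in> borel_measurable borel" "\<kappa> \<in> borel_measurable borel" using assms by auto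
  have k': "integrable lborel (\<lambda>y. \<kappa> (x - y))" "(LINT y|lborel. \<kappa> (x - y)) = (LINT x|lborel. \<kappa> x)"
    "(LINT y|lborel. \<bar>\<kappa> (x - y)\<bar>) = (LINT x|lborel. \<bar>\<kappa> x\<bar>)" for x
    using k lborel_reflect_diff[of \<kappa> x] lborel_reflect_diff[of "\<lambda>y. \<bar>\<kappa> y\<bar>" x] by auto
  show "integrable (lborel \<Otimes>\<^sub>M lborel) (\<lambda>(x, y). F x * \<kappa> (x - y))"
  proof (rule lborel_pair.Fubini_integrable)
    show "integrable lborel (\<lambda>x. LINT y|lborel. norm (case (x, y) of (x, y) \<Rightarrow> F x * \<kappa> (x - y)))"
      using F by (simp add: abs_mult k')
  qed (use k' in auto)
  show "(LINT x|lborel. LINT y|lborel. F x * \<kappa> (x - y)) = (LINT x|lborel. F x) * (LINT x|lborel. \<kappa> x)"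
    by (simp add: k')
qed

lemma integrable_conv2:
  fixes F \<kappa> :: "'a::euclidean_space \<Rightarrow> real"
  assumes F: "integrable lborel F" and k: "integrable lborel \<kappa>"
  shows "integrable (lborel \<Otimes>\<^sub>M lborel) (\<lambda>(x, y). F y * \<kappa> (x - y))"
    and "(LINT x|lborel. LINT y|lborel. F y * \<kappa> (x - y)) = (LINT x|lborel. F x) * (LINT x|lborel. \<kappa> x)"
proof -
  have [measurable]: "F \<in> borel_measurable borel" "\<kappa> \<in> borel_measurable borel" using assms by auto
  have k1: "integrable lborel (\<lambda>y. \<kappa> (- y))" "(LINT y|lborel. \<kappa> (- y)) = (LINT x|lborel. \<kappa> x)"
    using k lborel_reflect_diff[of \<kappa> 0] by auto
  from lborel_pair.integrable_product_swap[OF integrable_conv1(1)[OF F k1(1)]]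
  show *: "integrable (lborel \<Otimes>\<^sub>M lborel) (\<lambda>(x, y). F y * \<kappa> (x - y))"
    by (simp add: split_beta')
  have "(LINT x|lborel. LINT y|lborel. F y * \<kappa> (x - y)) = (LINT y|lborel. LINT x|lborel. F y * \<kappa> (x - y))"
    using lborel_pair.Fubini_integral[OF *] by simp
  then show "(LINT x|lborel. LINT y|lborel. F y * \<kappa> (x - y)) = (LINT x|lborel. F x) * (LINT x|lborel. \<kappa> x)"
    using integrable_conv1(2)[OF F k1(1)] k1(2) by simp
qed

lemma integrable_dominated:
  fixes f :: "'a \<Rightarrow> 'b::{banach, second_countable_topology}"
  assumes "integrable M g" "f \<in> borel_measurable M" "\<And>x. norm (f x) \<le> g x"
  shows "integrable M f"
  using assms by (intro Bochner_Integration.integrable_bound[OF assms(1,2)]) (auto intro!: AE_I2 order_trans[OF assms(3)])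

lemma continuous_integrable_compact_support:
  fixes f :: "'a::euclidean_space \<Rightarrow> real"
  assumes "continuous_on UNIV f" "compact K" "\<And>x. x \<notin> K \<Longrightarrow> f x = 0"
  shows "integrable lborel f"
proof -
  obtain B where B: "\<And>x. \<bar>f x\<bar> \<le> B" using bounded_compact_support[OF assms] by metis
  have "integrable lborel (\<lambda>x. B * indicator K x :: real)"
    using emeasure_bounded_finite[OF compact_imp_bounded[OF assms(2)]] compact_imp_closed[OF assms(2)]
    by (intro integrable_mult_right integrable_real_indicator) auto
  then show ?thesis
  proof (rule integrable_dominated)
    show "norm (f x) \<le> B * indicator K x" for x using B[of x] assms(3)[of x] by (cases "x \<in> K") auto
  qed (use assms(1) in \<open>simp add: borel_measurable_continuous_onI\<close>)
qed

section \<open>Mollifiers and mollified products in L2\<close>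

definition mollifier :: "real \<Rightarrow> (real^'n \<Rightarrow> real) \<Rightarrow> bool" where
  "mollifier \<delta> \<rho> \<longleftrightarrow> (\<forall>l. Ck_on l \<rho> UNIV) \<and> (\<forall>x. 0 \<le> \<rho> x) \<and> (\<forall>x. \<rho> x \<noteq> 0 \<longrightarrow> norm x < \<delta>) \<and>
     integrable lborel \<rho> \<and> (LINT x|lborel. \<rho> x) = 1"

lemma mollifier_exists: assumes "0 < \<delta>" shows "\<exists>\<rho> :: real^'n \<Rightarrow> real. mollifier \<delta> \<rho>"
proof -
  \<comment> \<open>The norm is at most the sum of the absolute values of the coordinates, so the
    open cube of half-width \<open>c\<close> lies in the ball of radius \<delta>.\<close>
  define c where "c = \<delta> / real CARD('n)"
  have c: "0 < c" using assms by (simp add: c_def)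
  define a b :: "real^'n" where "a = (\<chi> i. - c)" and "b = (\<chi> i. c)"
  let ?f = "bump 1 a b"
  have cont: "continuous_on UNIV ?f" using Ck_on_bump[of 0 1 a b] by simp
  then have [measurable]: "?f \<in> borel_measurable borel" by (rule borel_measurable_continuous_onI)
  have int: "integrable lborel ?f"
    by (rule continuous_integrable_compact_support[OF cont compact_cbox[of a b]])
       (use box_subset_cbox in \<open>auto intro!: bump_eq_0\<close>)
  \<comment> \<open>A vanishing integral would make the bump vanish almost everywhere, yet it is
    positive on a box of positive volume.\<close>
  have "0 \<noteq> (LINT x|lborel. ?f x)"
  proof
    assume "0 = (LINT x|lborel. ?f x)"
    then have "AE x in lborel. ?f x = 0"
      using integral_nonneg_eq_0_iff_AE[OF int] bump_nonneg[of 1 a b] by auto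
    then have "AE x in lborel. x \<notin> box a b"
      by (rule AE_mp) (auto intro!: AE_I2 dest: bump_pos[of 1, OF zero_less_one])
    then have "emeasure lborel (box a b) = 0"
      using AE_iff_null_sets[of "box a b" lborel] by auto
    moreover have "0 < emeasure lborel (box a b)"
    proof -
      have "0 < (\<Prod>i\<in>Basis. (b - a) \<bullet> i)"
        using c by (intro prod_pos) (auto simp: a_def b_def Basis_vec_def inner_axis)
      moreover have "a \<bullet> i \<le> b \<bullet> i" if "i \<in> Basis" for i
        using that c by (auto simp: a_def b_def Basis_vec_def inner_axis)
      ultimately show ?thesis using emeasure_lborel_box[of a b] by (metis ennreal_less_zero_iff)
    qed
    ultimately show False by simp
  qed
  moreover have "0 \<le> (LINT x|lborel. ?f x)" by (intro integral_nonneg_AE) (simp add: bump_nonneg)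
  ultimately have Z: "0 < (LINT x|lborel. ?f x)" by linarith
  define \<rho> where "\<rho> = (\<lambda>x. inverse (LINT x|lborel. ?f x) * ?f x)"
  have "norm x < \<delta>" if "\<rho> x \<noteq> 0" for x
  proof -
    have "?f x \<noteq> 0" using that by (simp add: \<rho>_def)
    then have "x \<in> box a b" using bump_eq_0[of 1 x a b] by auto
    then have "\<bar>x $ i\<bar> < c" for i by (auto simp: mem_box_cart a_def b_def abs_less_iff minus_less_iff)
    then have "(\<Sum>i\<in>UNIV. \<bar>x $ i\<bar>) < (\<Sum>i\<in>(UNIV::'n set). c)" by (intro sum_strict_mono) auto
    then show ?thesis using norm_le_l1_cart[of x] by (simp add: c_def)
  qed
  then have "mollifier \<delta> \<rho>"
    using Z int bump_nonneg[of 1 a b]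
    by (auto simp: mollifier_def \<rho>_def intro!: Ck_on_mult Ck_on_const Ck_on_bump)
  then show ?thesis by blast
qed

lemma mollifierD:
  assumes "mollifier \<delta> \<rho>"
  shows "Ck_on l \<rho> UNIV" "0 \<le> \<rho> x" "\<delta> \<le> norm x \<Longrightarrow> \<rho> x = 0" "integrable lborel \<rho>"
    "(LINT x|lborel. \<rho> x) = 1" "continuous_on UNIV \<rho>" "\<rho> \<in> borel_measurable borel"
proof -
  show c: "Ck_on l \<rho> UNIV" for l using assms by (simp add: mollifier_def)
  show "continuous_on UNIV \<rho>" using c[of 0] by simp
  show "0 \<le> \<rho> x" "\<delta> \<le> norm x \<Longrightarrow> \<rho> x = 0" "integrable lborel \<rho>" "(LINT x|lborel. \<rho> x) = 1"
    using assms by (auto simp: mollifier_def)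
  then show "\<rho> \<in> borel_measurable borel" by auto
qed

lemma mollifier_integral_bound:
  fixes g :: "real^'n \<Rightarrow> 'b::{banach, second_countable_topology}"
  assumes m: "mollifier \<delta> \<rho>" and [measurable]: "g \<in> borel_measurable borel" and g: "\<And>y. norm (g y) \<le> B"
  shows "integrable lborel (\<lambda>y. \<rho> (x - y) *\<^sub>R g y)" and "norm (LINT y|lborel. \<rho> (x - y) *\<^sub>R g y) \<le> B"
proof -
  note [measurable] = mollifierD(7)[OF m]
  have i: "integrable lborel (\<lambda>y. B * \<rho> (x - y))"
    using mollifierD(4)[OF m] lborel_reflect_diff(2)[of \<rho> x] by simp
  have b: "norm (\<rho> (x - y) *\<^sub>R g y) \<le> B * \<rho> (x - y)" for y
    using mult_right_mono[OF g mollifierD(2)[OF m], of y "x - y"] mollifierD(2)[OF m] by (simp add: mult.commute)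
  show "integrable lborel (\<lambda>y. \<rho> (x - y) *\<^sub>R g y)"
    by (rule integrable_dominated[OF i _ b]) measurable
  have "norm (LINT y|lborel. \<rho> (x - y) *\<^sub>R g y) \<le> (LINT y|lborel. B * \<rho> (x - y))"
    by (rule Bochner_Integration.integral_norm_bound_integral) (use i b \<open>integrable lborel (\<lambda>y. \<rho> (x - y) *\<^sub>R g y)\<close> in auto)
  also have "\<dots> = B" using mollifierD(5)[OF m] lborel_reflect_diff(1)[of \<rho> x] by simp
  finally show "norm (LINT y|lborel. \<rho> (x - y) *\<^sub>R g y) \<le> B" .
qed

lemma mollifier_tendsto:
  fixes g :: "real^'n \<Rightarrow> 'b::{banach, second_countable_topology}"
  assumes m: "\<And>n. mollifier (\<delta> n) (\<rho> n)" and d: "\<delta> \<longlonglongrightarrow> 0"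
    and g: "continuous_on UNIV g" "\<And>y. norm (g y) \<le> B"
  shows "(\<lambda>n. LINT y|lborel. \<rho> n (x - y) *\<^sub>R g y) \<longlonglongrightarrow> g x"
proof (rule LIMSEQ_I)
  fix e :: real assume "0 < e"
  have gm [measurable]: "g \<in> borel_measurable borel" using g(1) by (rule borel_measurable_continuous_onI)
  have "isCont g x" using g(1) by (simp add: continuous_on_eq_continuous_at)
  then obtain s where s: "0 < s" "\<And>y. norm (y - x) < s \<Longrightarrow> norm (g y - g x) < e / 2"
    using \<open>0 < e\<close> unfolding isCont_def LIM_def dist_norm
    by (metis half_gt_zero diff_self norm_zero)
  obtain N where N: "\<And>n. n \<ge> N \<Longrightarrow> \<delta> n < s"
    using order_tendstoD(2)[OF d s(1)] by (auto simp: eventually_sequentially)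
  have "norm ((LINT y|lborel. \<rho> n (x - y) *\<^sub>R g y) - g x) < e" if "n \<ge> N" for n
  proof -
    note mn = mollifierD[OF m[of n]]
    note [measurable] = mn(7)
    \<comment> \<open>\<open>h\<close> truncates the difference outside the ball where continuity
      makes it small. The kernel already vanishes there, so the integral is unchanged, and the
      general bound for mollified bounded functions applies to \<open>h\<close>.\<close>
    define h where "h y = (if norm (x - y) < s then g y - g x else 0)" for y
    have [measurable]: "h \<in> borel_measurable borel" unfolding h_def by measurable
    have h: "norm (h y) \<le> e / 2" for y using s(2)[of y] \<open>0 < e\<close> by (auto simp: h_def norm_minus_commute less_imp_le)
    have i: "integrable lborel (\<lambda>y. \<rho> n (x - y) *\<^sub>R g y)"
      by (rule mollifier_integral_bound(1)[OF m gm g(2)])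
    have i2: "integrable lborel (\<lambda>y. \<rho> n (x - y) *\<^sub>R g x)"
      by (rule mollifier_integral_bound(1)[OF m, where B = "norm (g x)"]) auto
    have "(LINT y|lborel. \<rho> n (x - y) *\<^sub>R g x) = g x"
      using mn(4,5) lborel_reflect_diff(1,2)[OF mn(7), of x] by simp
    then have "(LINT y|lborel. \<rho> n (x - y) *\<^sub>R g y) - g x =
        (LINT y|lborel. \<rho> n (x - y) *\<^sub>R g y - \<rho> n (x - y) *\<^sub>R g x)"
      using i i2 by simp
    also have "\<dots> = (LINT y|lborel. \<rho> n (x - y) *\<^sub>R h y)"
    proof (rule Bochner_Integration.integral_cong[OF refl])
      fix y show "\<rho> n (x - y) *\<^sub>R g y - \<rho> n (x - y) *\<^sub>R g x = \<rho> n (x - y) *\<^sub>R h y"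
        using mn(3)[of "x - y"] N[OF that] by (auto simp: h_def scaleR_diff_right)
    qed
    also have "norm \<dots> \<le> e / 2" by (rule mollifier_integral_bound(2)[OF m _ h]) measurable
    finally show ?thesis using \<open>0 < e\<close> by simp
  qed
  then show "\<exists>N. \<forall>n\<ge>N. norm ((LINT y|lborel. \<rho> n (x - y) *\<^sub>R g y) - g x) < e" by blast
qed

text \<open>G is cut off in height and in space; the bounded result is approximated almost
  everywhere by continuous functions, which are pushed back under one integrable majorant so that
  dominated convergence gives convergence in L2. Two errors below e/4 add up to less than e, since
  the square of a sum costs a factor 2.\<close>

lemma L2_continuous_dense:
  fixes G :: "'a::euclidean_space \<Rightarrow> 'b::euclidean_space"
  assumes [measurable]: "G \<in> borel_measurable borel"
    and G2: "integrable lborel (\<lambda>x. (norm (G x))\<^sup>2)" and "0 < e"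
  obtains H B where "continuous_on UNIV H" "\<And>x. norm (H x) \<le> B"
    "integrable lborel (\<lambda>x. (norm (H x))\<^sup>2)" "(LINT x|lborel. (norm (G x - H x))\<^sup>2) < e"
proof -
  define T where "T m x = (if norm (G x) \<le> real m \<and> norm x \<le> real m then G x else 0)" for m :: nat and x
  have Tm [measurable]: "T m \<in> borel_measurable borel" for m unfolding T_def by measurable
  have "(\<lambda>m. LINT x|lborel. (norm (G x - T m x))\<^sup>2) \<longlonglongrightarrow> (LINT x|(lborel::'a measure). 0)"
  proof (rule integral_dominated_convergence[where w = "\<lambda>x. (norm (G x))\<^sup>2"])
    show "AE x in lborel. (\<lambda>m. (norm (G x - T m x))\<^sup>2) \<longlonglongrightarrow> 0"
    proof (rule AE_I2, rule tendsto_eventually)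
      fix x
      obtain N :: nat where N: "max (norm (G x)) (norm x) \<le> real N" using real_arch_simple by blast
      show "\<forall>\<^sub>F m in sequentially. (norm (G x - T m x))\<^sup>2 = 0"
        using eventually_ge_at_top[of N]
      proof eventually_elim
        case (elim m)
        then have "real N \<le> real m" by simp
        then show ?case using N by (auto simp: T_def)
      qed
    qed
  qed (use G2 in \<open>auto simp: T_def\<close>)
  then obtain m0 where m0: "\<And>m. m \<ge> m0 \<Longrightarrow> (LINT x|lborel. (norm (G x - T m x))\<^sup>2) < e / 4"
    using order_tendstoD(2)[of _ 0 sequentially "e/4"] \<open>0 < e\<close> by (auto simp: eventually_sequentially)
  \<comment> \<open>The successor keeps \<open>m\<close> positive, as the division in
    \<open>h\<close> requires.\<close>
  define m where "m = Suc m0"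
  have m: "(LINT x|lborel. (norm (G x - T m x))\<^sup>2) < e / 4" "0 < real m" using m0[of m] by (auto simp: m_def)
  have "T m \<in> borel_measurable (lebesgue_on UNIV)"
    by (simp add: lebesgue_on_UNIV_eq measurable_completion)
  then have "T m measurable_on UNIV" by (simp add: measurable_on_iff_borel_measurable)
  then obtain N g where N: "negligible N" and g: "\<And>n. continuous_on UNIV (g n)"
    "\<And>x. x \<notin> N \<Longrightarrow> (\<lambda>n. g n x) \<longlonglongrightarrow> T m x"
    unfolding measurable_on_def by auto
  have aeN: "AE x in lborel. x \<notin> N"
    using N unfolding negligible_iff_null_sets by (metis AE_completion_iff AE_not_in)
  define cutoff where "cutoff x = max 0 (min 1 (real m + 1 - norm x))" for x :: 'a
  \<comment> \<open>The factor \<open>real m / max (real m) (norm (g n x))\<close> is the radial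
    retraction onto the ball of radius \<open>m\<close>. Like the spatial cutoff it leaves
    \<open>T m\<close> unchanged, so convergence to \<open>T m\<close> survives.\<close>
  define h where "h n x = (cutoff x * (real m / max (real m) (norm (g n x)))) *\<^sub>R g n x" for n x
  have hc: "continuous_on UNIV (h n)" for n
    unfolding h_def cutoff_def using m(2) by (intro continuous_intros g) auto
  have hm [measurable]: "h n \<in> borel_measurable borel" for n
    using hc by (rule borel_measurable_continuous_onI)
  have hb: "norm (h n x) \<le> real m * indicator (cball 0 (real m + 1)) x" for n x
  proof (cases "x \<in> cball 0 (real m + 1)")
    case True
    have "real m / max (real m) (norm (g n x)) * norm (g n x) \<le> real m"
      using m(2) by (simp add: divide_simps max_def)
    moreover have "0 \<le> cutoff x" "cutoff x \<le> 1" by (auto simp: cutoff_def)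
    ultimately have "cutoff x * (real m / max (real m) (norm (g n x)) * norm (g n x)) \<le> 1 * real m"
      using m(2) by (intro mult_mono) auto
    then show ?thesis using True m(2) \<open>0 \<le> cutoff x\<close>
      by (simp add: h_def abs_mult mult.assoc)
  qed (auto simp: h_def cutoff_def)
  have hb1: "norm (h n x) \<le> real m" for n x
    using hb[of n x] m(2) by (cases "norm x \<le> real m + 1") auto
  have ind: "integrable lborel (indicator (cball (0::'a) (real m + 1)) :: 'a \<Rightarrow> real)"
    using emeasure_bounded_finite[OF bounded_cball[of "0::'a" "real m + 1"]] by (intro integrable_real_indicator) auto
  have Tb: "norm (T m x) \<le> real m * indicator (cball 0 (real m + 1)) x" for x
    by (auto simp: T_def indicator_def)
  have lim: "(\<lambda>n. h n x) \<longlonglongrightarrow> T m x" if "x \<notin> N" for x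
  proof -
    have "(\<lambda>n. h n x) \<longlonglongrightarrow> (cutoff x * (real m / max (real m) (norm (T m x)))) *\<^sub>R T m x"
      unfolding h_def using m(2) by (intro tendsto_intros g(2)[OF that]) auto
    moreover have "(cutoff x * (real m / max (real m) (norm (T m x)))) *\<^sub>R T m x = T m x"
      using m(2) by (auto simp: T_def cutoff_def max_def)
    ultimately show ?thesis by simp
  qed
  have "(\<lambda>n. LINT x|lborel. (norm (T m x - h n x))\<^sup>2) \<longlonglongrightarrow> (LINT x|(lborel::'a measure). 0)"
  proof (rule integral_dominated_convergence[where w = "\<lambda>x. (2 * real m)\<^sup>2 * indicator (cball 0 (real m + 1)) x"])
    show "AE x in lborel. (\<lambda>n. (norm (T m x - h n x))\<^sup>2) \<longlonglongrightarrow> 0"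
      using aeN
    proof (rule AE_mp, intro AE_I2 impI)
      fix x assume "x \<notin> N"
      then have "(\<lambda>n. (norm (T m x - h n x))\<^sup>2) \<longlonglongrightarrow> (norm (T m x - T m x))\<^sup>2"
        by (intro tendsto_intros lim)
      then show "(\<lambda>n. (norm (T m x - h n x))\<^sup>2) \<longlonglongrightarrow> 0" by simp
    qed
    show "AE x in lborel. norm ((norm (T m x - h n x))\<^sup>2) \<le> (2 * real m)\<^sup>2 * indicator (cball 0 (real m + 1)) x" for n
    proof (rule AE_I2)
      fix x
      have "norm (T m x - h n x) \<le> 2 * real m * indicator (cball 0 (real m + 1)) x"
        using norm_triangle_ineq4[of "T m x" "h n x"] Tb[of x] hb[of n x] by linarith
      then have "(norm (T m x - h n x))\<^sup>2 \<le> (2 * real m * indicator (cball 0 (real m + 1)) x)\<^sup>2"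
        by (rule power_mono) simp
      also have "\<dots> = (2 * real m)\<^sup>2 * indicator (cball 0 (real m + 1)) x"
        by (simp add: indicator_def)
      finally show "norm ((norm (T m x - h n x))\<^sup>2) \<le> (2 * real m)\<^sup>2 * indicator (cball 0 (real m + 1)) x"
        by simp
    qed
  qed (use ind in auto)
  then obtain n where n: "(LINT x|lborel. (norm (T m x - h n x))\<^sup>2) < e / 4"
    using order_tendstoD(2)[of _ 0 sequentially "e/4"] \<open>0 < e\<close> by (auto simp: eventually_sequentially)
  have Tint: "integrable lborel (\<lambda>x. (norm (G x - T m x))\<^sup>2)"
    by (rule integrable_dominated[OF G2]) (auto simp: T_def)
  have sq: "(norm (f x))\<^sup>2 \<le> (real m)\<^sup>2 * indicator (cball 0 (real m + 1)) x"
    if "norm (f x) \<le> real m * indicator (cball 0 (real m + 1)) x" for f :: "'a \<Rightarrow> 'b" and x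
    using power_mono[OF that, of 2] by (auto simp: indicator_def split: if_splits)
  have hint: "integrable lborel (\<lambda>x. (norm (h n x))\<^sup>2)"
  proof (rule integrable_dominated)
    show "integrable lborel (\<lambda>x. (real m)\<^sup>2 * indicator (cball (0::'a) (real m + 1)) x)" using ind by simp
    show "norm ((norm (h n x))\<^sup>2) \<le> (real m)\<^sup>2 * indicator (cball 0 (real m + 1)) x" for x
      using sq[of "h n" x, OF hb] by simp
  qed auto
  have Thint: "integrable lborel (\<lambda>x. (norm (T m x - h n x))\<^sup>2)"
  proof (rule integrable_dominated)
    show "integrable lborel (\<lambda>x. 2 * ((real m)\<^sup>2 * indicator (cball (0::'a) (real m + 1)) x) + 2 * ((real m)\<^sup>2 * indicator (cball (0::'a) (real m + 1)) x))"
      using ind by simp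
    show "norm ((norm (T m x - h n x))\<^sup>2) \<le> 2 * ((real m)\<^sup>2 * indicator (cball 0 (real m + 1)) x) + 2 * ((real m)\<^sup>2 * indicator (cball (0::'a) (real m + 1)) x)" for x
    proof -
      have "(norm (T m x - h n x))\<^sup>2 \<le> (norm (T m x) + norm (h n x))\<^sup>2"
        by (intro power_mono norm_triangle_ineq4) simp
      also have "\<dots> \<le> 2 * (norm (T m x))\<^sup>2 + 2 * (norm (h n x))\<^sup>2"
        using sum_squares_bound[of "norm (T m x)" "norm (h n x)"] by (simp add: power2_sum)
      finally show ?thesis using sq[of "T m" x, OF Tb] sq[of "h n" x, OF hb] by simp
    qed
  qed auto
  have "(LINT x|lborel. (norm (G x - h n x))\<^sup>2)
      \<le> (LINT x|lborel. 2 * (norm (G x - T m x))\<^sup>2 + 2 * (norm (T m x - h n x))\<^sup>2)"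
  proof (rule integral_mono')
    show "(norm (G x - h n x))\<^sup>2 \<le> 2 * (norm (G x - T m x))\<^sup>2 + 2 * (norm (T m x - h n x))\<^sup>2" for x
    proof -
      have "(norm (G x - h n x))\<^sup>2 \<le> (norm (G x - T m x) + norm (T m x - h n x))\<^sup>2"
        using norm_triangle_ineq[of "G x - T m x" "T m x - h n x"] by (intro power_mono) auto
      also have "\<dots> \<le> 2 * (norm (G x - T m x))\<^sup>2 + 2 * (norm (T m x - h n x))\<^sup>2"
        using sum_squares_bound[of "norm (G x - T m x)" "norm (T m x - h n x)"] by (simp add: power2_sum)
      finally show ?thesis .
    qed
  qed (use Tint Thint in auto)
  also have "\<dots> = 2 * (LINT x|lborel. (norm (G x - T m x))\<^sup>2) + 2 * (LINT x|lborel. (norm (T m x - h n x))\<^sup>2)"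
    using Tint Thint by simp
  also have "\<dots> < e" using m(1) n by linarith
  finally show ?thesis using that[OF hc hb1 hint] by blast
qed

lemma integrable_square_diff:
  fixes f g :: "'a \<Rightarrow> 'b::{banach, second_countable_topology}"
  assumes "integrable M (\<lambda>x. (norm (f x))\<^sup>2)" "integrable M (\<lambda>x. (norm (g x))\<^sup>2)"
    and [measurable]: "f \<in> borel_measurable M" "g \<in> borel_measurable M"
  shows "integrable M (\<lambda>x. (norm (f x - g x))\<^sup>2)"
proof (rule integrable_dominated)
  show "integrable M (\<lambda>x. 2 * (norm (f x))\<^sup>2 + 2 * (norm (g x))\<^sup>2)" using assms by simp
  show "norm ((norm (f x - g x))\<^sup>2) \<le> 2 * (norm (f x))\<^sup>2 + 2 * (norm (g x))\<^sup>2" for x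
  proof -
    have "(norm (f x - g x))\<^sup>2 \<le> (norm (f x) + norm (g x))\<^sup>2"
      by (intro power_mono norm_triangle_ineq4) simp
    also have "\<dots> \<le> 2 * (norm (f x))\<^sup>2 + 2 * (norm (g x))\<^sup>2"
      using sum_squares_bound[of "norm (f x)" "norm (g x)"] by (simp add: power2_sum)
    finally show ?thesis by simp
  qed
qed measurable

lemma young: "0 < (s::real) \<Longrightarrow> a * b \<le> (s * a\<^sup>2 + b\<^sup>2 / s) / 2"
proof -
  assume "0 < s"
  have "0 \<le> (s * a - b)\<^sup>2" by simp
  then have "2 * (s * (a * b)) \<le> s * (s * a\<^sup>2) + b\<^sup>2" by (simp add: power2_eq_square algebra_simps)
  with \<open>0 < s\<close> show ?thesis by (simp add: field_simps power2_eq_square)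
qed

lemma integrable_mult_L2:
  fixes f g :: "'a \<Rightarrow> complex"
  assumes "integrable M (\<lambda>x. (cmod (f x))\<^sup>2)" "integrable M (\<lambda>x. (cmod (g x))\<^sup>2)"
    and [measurable]: "f \<in> borel_measurable M" "g \<in> borel_measurable M"
  shows "integrable M (\<lambda>x. f x * g x)"
proof (rule integrable_dominated)
  show "integrable M (\<lambda>x. (1 * (cmod (f x))\<^sup>2 + (cmod (g x))\<^sup>2 / 1) / 2)" using assms by simp
  show "norm (f x * g x) \<le> (1 * (cmod (f x))\<^sup>2 + (cmod (g x))\<^sup>2 / 1) / 2" for x
    unfolding norm_mult by (rule young) simp
qed measurable

text \<open>A Schur-type bound: a weighted Young inequality under the kernel takes the place of
  Cauchy-Schwarz, and each of the two terms integrates to a squared L2 norm because the kernel has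
  integral 1 in either variable. The bound is uniform in the mollifier, and the free weight
  \<open>s\<close> balances a large factor against a small one.\<close>

lemma mollified_product_bound:
  fixes F H :: "real^'n \<Rightarrow> complex"
  assumes m: "mollifier \<delta> \<rho>" and [measurable]: "F \<in> borel_measurable borel" "H \<in> borel_measurable borel"
    and F2: "integrable lborel (\<lambda>x. (cmod (F x))\<^sup>2)" and H2: "integrable lborel (\<lambda>x. (cmod (H x))\<^sup>2)"
  shows "integrable (lborel \<Otimes>\<^sub>M lborel) (\<lambda>(x, y). \<rho> (x - y) *\<^sub>R (F x * H y))"
    and "0 < s \<Longrightarrow> cmod (LINT x|lborel. LINT y|lborel. \<rho> (x - y) *\<^sub>R (F x * H y))
      \<le> (s * (LINT x|lborel. (cmod (F x))\<^sup>2) + (LINT x|lborel. (cmod (H x))\<^sup>2) / s) / 2"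
proof -
  note [measurable] = mollifierD(7)[OF m]
  have i1: "integrable (lborel \<Otimes>\<^sub>M lborel) (\<lambda>(x, y). (s * (cmod (F x))\<^sup>2) * \<rho> (x - y))" for s
    using integrable_conv1(1)[OF integrable_mult_right[OF F2] mollifierD(4)[OF m], of s] by simp
  have i2: "integrable (lborel \<Otimes>\<^sub>M lborel) (\<lambda>(x, y). ((cmod (H y))\<^sup>2 / s) * \<rho> (x - y))" for s
    using integrable_conv2(1)[OF integrable_divide_zero[OF H2] mollifierD(4)[OF m], of s] by simp
  let ?D = "\<lambda>s (x, y). ((s * (cmod (F x))\<^sup>2) * \<rho> (x - y) + ((cmod (H y))\<^sup>2 / s) * \<rho> (x - y)) / 2"
  have iD: "integrable (lborel \<Otimes>\<^sub>M lborel) (?D s)" for s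
    using Bochner_Integration.integrable_add[OF i1[of s] i2[of s]] by (simp add: split_beta')
  have b: "norm (case z of (x, y) \<Rightarrow> \<rho> (x - y) *\<^sub>R (F x * H y)) \<le> ?D s z" if "0 < s" for s z
  proof (cases z)
    case (Pair x y)
    have "\<rho> (x - y) * (cmod (F x) * cmod (H y)) \<le> \<rho> (x - y) * ((s * (cmod (F x))\<^sup>2 + (cmod (H y))\<^sup>2 / s) / 2)"
      by (intro mult_left_mono young that mollifierD(2)[OF m])
    then show ?thesis using mollifierD(2)[OF m, of "x - y"]
      by (simp add: Pair norm_mult field_simps)
  qed
  show int: "integrable (lborel \<Otimes>\<^sub>M lborel) (\<lambda>(x, y). \<rho> (x - y) *\<^sub>R (F x * H y))"
    by (rule integrable_dominated[OF iD[of 1] _ b[of 1]]) auto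
  assume s: "0 < s"
  have "(LINT x|lborel. LINT y|lborel. \<rho> (x - y) *\<^sub>R (F x * H y))
      = (LINT z|(lborel \<Otimes>\<^sub>M lborel). (case z of (x, y) \<Rightarrow> \<rho> (x - y) *\<^sub>R (F x * H y)))"
    using lborel_pair.integral_fst'[OF int] by simp
  also have "cmod \<dots> \<le> (LINT z|(lborel \<Otimes>\<^sub>M lborel). ?D s z)"
    using integral_norm_bound[of "lborel \<Otimes>\<^sub>M lborel" "\<lambda>z. case z of (x, y) \<Rightarrow> \<rho> (x - y) *\<^sub>R (F x * H y)"]
      integral_mono[OF integrable_norm[OF int] iD b[OF s]] by linarith
  also have "\<dots> = ((LINT z|(lborel \<Otimes>\<^sub>M lborel). (case z of (x, y) \<Rightarrow> (s * (cmod (F x))\<^sup>2) * \<rho> (x - y)))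
      + (LINT z|(lborel \<Otimes>\<^sub>M lborel). (case z of (x, y) \<Rightarrow> ((cmod (H y))\<^sup>2 / s) * \<rho> (x - y)))) / 2"
    using Bochner_Integration.integral_add[OF i1[of s] i2[of s]] by (simp add: split_beta')
  also have "\<dots> = (s * (LINT x|lborel. (cmod (F x))\<^sup>2) + (LINT x|lborel. (cmod (H x))\<^sup>2) / s) / 2"
    using lborel_pair.integral_fst'[OF i1[of s]] lborel_pair.integral_fst'[OF i2[of s]]
      integrable_conv1(2)[OF integrable_mult_right[OF F2] mollifierD(4)[OF m], of s]
      integrable_conv2(2)[OF integrable_divide_zero[OF H2] mollifierD(4)[OF m], of s]
      mollifierD(5)[OF m] by simp
  finally show "cmod (LINT x|lborel. LINT y|lborel. \<rho> (x - y) *\<^sub>R (F x * H y))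
      \<le> (s * (LINT x|lborel. (cmod (F x))\<^sup>2) + (LINT x|lborel. (cmod (H x))\<^sup>2) / s) / 2" .
qed

text \<open>For bounded continuous functions the mollifications converge pointwise and boundedly. A
  general G is approximated in L2 by such an H, and the error is controlled uniformly in n by the
  preceding bound.\<close>

lemma mollified_product_tendsto:
  fixes F G :: "real^'n \<Rightarrow> complex"
  assumes m: "\<And>n. mollifier (\<delta> n) (\<rho> n)" and d: "\<delta> \<longlonglongrightarrow> 0"
    and F: "integrable lborel F" and F2: "integrable lborel (\<lambda>x. (cmod (F x))\<^sup>2)"
    and [measurable]: "G \<in> borel_measurable borel" and G2: "integrable lborel (\<lambda>x. (cmod (G x))\<^sup>2)"
  shows "(\<lambda>n. LINT x|lborel. LINT y|lborel. \<rho> n (x - y) *\<^sub>R (F x * G y)) \<longlonglongrightarrow> (LINT x|lborel. F x * G x)"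
proof (rule LIMSEQ_I)
  fix e :: real assume e: "0 < e"
  have [measurable]: "F \<in> borel_measurable borel" using F by auto
  let ?A = "LINT x|lborel. (cmod (F x))\<^sup>2"
  have A: "0 \<le> ?A" by simp
  \<comment> \<open>With this weight \<open>s * ?A\<close> is at most e/2, the 1 guarding against
    \<open>?A = 0\<close>. An H within \<open>s * (e / 8)\<close> of G makes the other term e/8, so
    each exchange of G and H costs at most 5e/16; twice that plus e/8 stays below e.\<close>
  define s where "s = e / (2 * (?A + 1))"
  have s: "0 < s" using e A by (simp add: s_def add_nonneg_pos)
  have sA: "s * ?A \<le> e / 2"
  proof -
    have "s * ?A \<le> s * (?A + 1)" using s by simp
    also have "\<dots> = e / 2"
    proof -
      have "?A + 1 \<noteq> 0" using A by linarith
      moreover have "e / (2 * b) * b = e / 2" if "b \<noteq> 0" for b using that by simp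
      ultimately show ?thesis unfolding s_def by blast
    qed
    finally show ?thesis .
  qed
  obtain H B where H: "continuous_on UNIV H" "\<And>x. cmod (H x) \<le> B"
    "integrable lborel (\<lambda>x. (cmod (H x))\<^sup>2)" "(LINT x|lborel. (cmod (G x - H x))\<^sup>2) < s * (e / 8)"
    by (rule L2_continuous_dense[of G "s * (e / 8)"]) (use s e G2 in auto)
  have Hm [measurable]: "H \<in> borel_measurable borel" using H(1) by (rule borel_measurable_continuous_onI)
  have GH: "integrable lborel (\<lambda>x. (cmod (G x - H x))\<^sup>2)"
    by (rule integrable_square_diff[OF G2 H(3)]) measurable
  have small: "(s * ?A + (LINT x|lborel. (cmod (G x - H x))\<^sup>2) / s) / 2 \<le> 5 * e / 16"
  proof -
    have "(LINT x|lborel. (cmod (G x - H x))\<^sup>2) / s \<le> e / 8"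
      using H(4) s by (simp add: field_simps)
    moreover have "(a + b) / 2 \<le> 5 * e / 16" if "a \<le> e / 2" "b \<le> e / 8" for a b using that by argo
    ultimately show ?thesis using sA by blast
  qed
  have "(\<lambda>n. LINT x|lborel. F x * (LINT y|lborel. \<rho> n (x - y) *\<^sub>R H y)) \<longlonglongrightarrow> (LINT x|lborel. F x * H x)"
  proof (rule integral_dominated_convergence[where w = "\<lambda>x. B * cmod (F x)"])
    note [measurable] = mollifierD(7)[OF m]
    show "(\<lambda>x. F x * (LINT y|lborel. \<rho> n (x - y) *\<^sub>R H y)) \<in> borel_measurable lborel" for n by measurable
    show "AE x in lborel. (\<lambda>n. F x * (LINT y|lborel. \<rho> n (x - y) *\<^sub>R H y)) \<longlonglongrightarrow> F x * H x"
      by (intro AE_I2 tendsto_mult tendsto_const mollifier_tendsto[OF m d H(1,2)])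
    show "AE x in lborel. norm (F x * (LINT y|lborel. \<rho> n (x - y) *\<^sub>R H y)) \<le> B * cmod (F x)" for n
      using mollifier_integral_bound(2)[OF m Hm H(2)]
      by (intro AE_I2) (auto simp: norm_mult mult.commute[of B] intro!: mult_left_mono)
  qed (use F in auto)
  from LIMSEQ_D[OF this, of "e / 8"] e obtain N where N: "\<And>n. n \<ge> N \<Longrightarrow>
      cmod ((LINT x|lborel. F x * (LINT y|lborel. \<rho> n (x - y) *\<^sub>R H y)) - (LINT x|lborel. F x * H x)) < e / 8"
    by auto
  have "cmod ((LINT x|lborel. LINT y|lborel. \<rho> n (x - y) *\<^sub>R (F x * G y)) - (LINT x|lborel. F x * G x)) < e"
    if "n \<ge> N" for n
  proof -
    note [measurable] = mollifierD(7)[OF m[of n]]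
    have iG: "integrable (lborel \<Otimes>\<^sub>M lborel) (\<lambda>(x, y). \<rho> n (x - y) *\<^sub>R (F x * G y))"
      and iH: "integrable (lborel \<Otimes>\<^sub>M lborel) (\<lambda>(x, y). \<rho> n (x - y) *\<^sub>R (F x * H y))"
      and iGH: "integrable (lborel \<Otimes>\<^sub>M lborel) (\<lambda>(x, y). \<rho> n (x - y) *\<^sub>R (F x * (G y - H y)))"
      by (intro mollified_product_bound(1)[OF m] F2 G2 H GH; measurable)+
    have eq: "(LINT x|lborel. LINT y|lborel. \<rho> n (x - y) *\<^sub>R (F x * G y))
        - (LINT x|lborel. LINT y|lborel. \<rho> n (x - y) *\<^sub>R (F x * H y))
        = (LINT x|lborel. LINT y|lborel. \<rho> n (x - y) *\<^sub>R (F x * (G y - H y)))"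
      unfolding lborel_pair.integral_fst'[OF iG, simplified] lborel_pair.integral_fst'[OF iH, simplified]
        lborel_pair.integral_fst'[OF iGH, simplified]
      using Bochner_Integration.integral_diff[OF iG iH]
      by (simp add: split_beta' scaleR_diff_right right_diff_distrib)
    have "cmod (LINT x|lborel. LINT y|lborel. \<rho> n (x - y) *\<^sub>R (F x * (G y - H y)))
        \<le> (s * ?A + (LINT x|lborel. (cmod (G x - H x))\<^sup>2) / s) / 2"
      by (rule mollified_product_bound(2)[OF m _ _ F2 GH s]) measurable
    then have 1: "cmod ((LINT x|lborel. LINT y|lborel. \<rho> n (x - y) *\<^sub>R (F x * G y))
        - (LINT x|lborel. LINT y|lborel. \<rho> n (x - y) *\<^sub>R (F x * H y))) \<le> 5 * e / 16"
      unfolding eq using small by (rule order_trans)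
    have 2: "(LINT x|lborel. LINT y|lborel. \<rho> n (x - y) *\<^sub>R (F x * H y))
        = (LINT x|lborel. F x * (LINT y|lborel. \<rho> n (x - y) *\<^sub>R H y))"
    proof (rule Bochner_Integration.integral_cong[OF refl])
      fix x
      have "(LINT y|lborel. \<rho> n (x - y) *\<^sub>R (F x * H y)) = (LINT y|lborel. F x * (\<rho> n (x - y) *\<^sub>R H y))" by simp
      also have "\<dots> = F x * (LINT y|lborel. \<rho> n (x - y) *\<^sub>R H y)"
        by (rule integral_mult_right_zero)
      finally show "(LINT y|lborel. \<rho> n (x - y) *\<^sub>R (F x * H y)) = F x * (LINT y|lborel. \<rho> n (x - y) *\<^sub>R H y)" .
    qed
    have 3: "cmod ((LINT x|lborel. F x * H x) - (LINT x|lborel. F x * G x)) \<le> 5 * e / 16"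
    proof -
      have i: "integrable lborel (\<lambda>x. F x * H x)" "integrable lborel (\<lambda>x. F x * G x)"
        by (intro integrable_mult_L2 F2 H(3) G2; measurable)+
      have "(LINT x|lborel. F x * H x) - (LINT x|lborel. F x * G x) = (LINT x|lborel. F x * H x - F x * G x)"
        using i by simp
      also have "cmod \<dots> \<le> (LINT x|lborel. cmod (F x * H x - F x * G x))" by (rule integral_norm_bound)
      also have "\<dots> \<le> (LINT x|lborel. (s * (cmod (F x))\<^sup>2 + (cmod (G x - H x))\<^sup>2 / s) / 2)"
      proof (rule integral_mono)
        show "cmod (F x * H x - F x * G x) \<le> (s * (cmod (F x))\<^sup>2 + (cmod (G x - H x))\<^sup>2 / s) / 2" for x
          unfolding right_diff_distrib[symmetric] norm_mult norm_minus_commute[of "H x" "G x"]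
          by (rule young[OF s])
      qed (use i F2 GH in auto)
      also have "\<dots> = (s * ?A + (LINT x|lborel. (cmod (G x - H x))\<^sup>2) / s) / 2"
        using F2 GH by simp
      finally show ?thesis using small by linarith
    qed
    have tri: "cmod (a - d) \<le> cmod (a - b) + cmod (b - c) + cmod (c - d)" for a b c d :: complex
      using norm_triangle_ineq[of "a - b" "b - d"] norm_triangle_ineq[of "b - c" "c - d"] by simp
    from N[OF that] have 4: "cmod ((LINT x|lborel. LINT y|lborel. \<rho> n (x - y) *\<^sub>R (F x * H y)) - (LINT x|lborel. F x * H x)) < e / 8"
      unfolding 2 .
    show ?thesis
      by (rule le_less_trans[OF tri[where b = "LINT x|lborel. LINT y|lborel. \<rho> n (x - y) *\<^sub>R (F x * H y)"
          and c = "LINT x|lborel. F x * H x"]]) (use 1 3 4 e in linarith)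
  qed
  then show "\<exists>N. \<forall>n\<ge>N. cmod ((LINT x|lborel. LINT y|lborel. \<rho> n (x - y) *\<^sub>R (F x * G y)) - (LINT x|lborel. F x * G x)) < e"
    by blast
qed

section \<open>Integration by parts and weak derivatives on the whole space\<close>

lemma partial_deriv_line:
  fixes F :: "real^'n \<Rightarrow> real"
  assumes "F differentiable at (x + t *\<^sub>R axis i 1)"
  shows "((\<lambda>t. F (x + t *\<^sub>R axis i 1)) has_real_derivative partial_deriv i F (x + t *\<^sub>R axis i 1)) (at t)"
proof -
  let ?y = "x + t *\<^sub>R axis i (1::real)"
  have d: "(F has_derivative frechet_derivative F (at ?y)) (at ?y)"
    using assms by (simp add: frechet_derivative_works)
  have "((\<lambda>t. x + t *\<^sub>R axis i (1::real)) has_derivative (\<lambda>s. s *\<^sub>R axis i 1)) (at t)"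
    by (auto intro!: derivative_eq_intros)
  from has_derivative_compose[OF this d]
  have *: "((\<lambda>t. F (x + t *\<^sub>R axis i 1)) has_derivative (\<lambda>s. frechet_derivative F (at ?y) (s *\<^sub>R axis i 1))) (at t)" .
  have "linear (frechet_derivative F (at ?y))" using d has_derivative_linear by blast
  then have "(\<lambda>s. frechet_derivative F (at ?y) (s *\<^sub>R axis i 1)) = (*) (partial_deriv i F ?y)"
    by (auto simp: partial_deriv_def linear_scale fun_eq_iff)
  then show ?thesis using * by (simp add: has_field_derivative_def)
qed

lemma C1_compact_integrable:
  assumes "C1_compact \<Omega> F"
  shows "integrable lborel F" "integrable lborel (partial_deriv i F)"
proof -
  let ?K = "closure {x. F x \<noteq> 0}"
  have K: "compact ?K" using assms by (simp only: C1_compact_def)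
  have "F x = 0" if "x \<notin> ?K" for x
    using subsetD[OF closure_subset, of x "{x. F x \<noteq> 0}"] that by blast
  then show "integrable lborel F"
    by (rule continuous_integrable_compact_support[OF C1_compactD(2)[OF assms] K])
  show "integrable lborel (partial_deriv i F)"
    by (rule continuous_integrable_compact_support[OF C1_compactD(3)[OF assms] K partial_deriv_support])
qed

text \<open>Difference quotients have integral 0 by translation invariance. The mean value theorem
  bounds them by the supremum of the derivative, and they live in a ball one larger than the support
  because the steps are at most 1.\<close>

lemma integral_partial_deriv_eq_0:
  assumes F: "C1_compact \<Omega> F"
  shows "(LINT x|lborel. partial_deriv i F x) = 0"
proof -
  obtain B where B: "0 < B" "\<And>i x. \<bar>partial_deriv i F x\<bar> \<le> B" using C1_compact_bound[OF F] by metis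
  let ?K = "closure {x. F x \<noteq> 0}"
  let ?e = "axis i (1::real) :: real^'a"
  have "compact ?K" using F by (simp only: C1_compact_def)
  then have "bounded ?K" by (rule compact_imp_bounded)
  then obtain R where R: "\<And>x. x \<in> ?K \<Longrightarrow> norm x \<le> R" unfolding bounded_iff by blast
  have F0: "F x = 0" if "R < norm x" for x
    using subsetD[OF closure_subset, of x "{x. F x \<noteq> 0}"] R[of x] that by fastforce
  have [measurable]: "F \<in> borel_measurable borel"
    using C1_compact_integrable(1)[OF F] by auto
  define h where "h n = inverse (real (Suc n))" for n
  have h: "0 < h n" "h n \<le> 1" for n by (auto simp: h_def inverse_le_1_iff)
  define D where "D n x = (F (x + h n *\<^sub>R ?e) - F x) / h n" for n x
  have "(\<lambda>n. LINT x|lborel. D n x) \<longlonglongrightarrow> (LINT x|lborel. partial_deriv i F x)"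
  proof (rule integral_dominated_convergence[where w = "\<lambda>x. B * indicator (cball 0 (R + 1)) x"])
    show "AE x in lborel. (\<lambda>n. D n x) \<longlonglongrightarrow> partial_deriv i F x"
    proof (rule AE_I2)
      fix x
      have "((\<lambda>t. F (x + t *\<^sub>R ?e)) has_real_derivative partial_deriv i F (x + 0 *\<^sub>R ?e)) (at 0)"
        by (rule partial_deriv_line) (rule C1_compactD[OF F])
      then have "((\<lambda>t. (F (x + (0 + t) *\<^sub>R ?e) - F (x + 0 *\<^sub>R ?e)) / t) \<longlongrightarrow> partial_deriv i F (x + 0 *\<^sub>R ?e)) (at 0)"
        by (rule DERIV_D)
      moreover have "filterlim h (at 0) sequentially"
        by (rule filterlim_atI) (use h LIMSEQ_inverse_real_of_nat in \<open>auto simp: h_def[abs_def]\<close>)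
      ultimately show "(\<lambda>n. D n x) \<longlonglongrightarrow> partial_deriv i F x"
        using filterlim_compose[of "\<lambda>t. (F (x + (0 + t) *\<^sub>R ?e) - F (x + 0 *\<^sub>R ?e)) / t" _ "at 0" h sequentially]
        by (simp add: D_def)
    qed
    show "AE x in lborel. norm (D n x) \<le> B * indicator (cball 0 (R + 1)) x" for n
    proof (rule AE_I2)
      fix x
      show "norm (D n x) \<le> B * indicator (cball 0 (R + 1)) x"
      proof (cases "x \<in> cball 0 (R + 1)")
        case True
        have "\<exists>z>0. z < h n \<and> F (x + h n *\<^sub>R ?e) - F (x + 0 *\<^sub>R ?e) = (h n - 0) * partial_deriv i F (x + z *\<^sub>R ?e)"
          by (rule MVT2[OF h(1)]) (intro partial_deriv_line C1_compactD[OF F])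
        then obtain z where "F (x + h n *\<^sub>R ?e) - F x = h n * partial_deriv i F (x + z *\<^sub>R ?e)" by auto
        then have "D n x = partial_deriv i F (x + z *\<^sub>R ?e)" using h(1)[of n] by (simp add: D_def)
        then show ?thesis using True B(2) by simp
      next
        case False
        have "norm x \<le> norm (x + h n *\<^sub>R ?e) + h n * norm ?e"
          using norm_triangle_ineq4[of "x + h n *\<^sub>R ?e" "h n *\<^sub>R ?e"] h(1)[of n] by simp
        moreover have "norm ?e = 1" by simp
        ultimately have "R < norm (x + h n *\<^sub>R ?e)" "R < norm x" using False h(2)[of n] by auto
        then show ?thesis using False F0 by (simp add: D_def)
      qed
    qed
    show "integrable lborel (\<lambda>x. B * indicator (cball (0::real^'a) (R + 1)) x)"
      using emeasure_bounded_finite[OF bounded_cball[of "0::real^'a" "R + 1"]]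
      by (intro integrable_mult_right integrable_real_indicator) auto
    show "partial_deriv i F \<in> borel_measurable lborel"
      using C1_compact_integrable(2)[OF F] by auto
  qed (simp add: D_def)
  moreover have "(LINT x|lborel. D n x) = 0" for n
  proof -
    have "integrable lborel (\<lambda>x. F (x + h n *\<^sub>R ?e))" "(LINT x|lborel. F (x + h n *\<^sub>R ?e)) = (LINT x|lborel. F x)"
      using lborel_reflect[of F 1 "h n *\<^sub>R ?e"] C1_compact_integrable(1)[OF F] by (auto simp: add.commute)
    then show ?thesis using C1_compact_integrable(1)[OF F] by (simp add: D_def)
  qed
  ultimately show ?thesis by (simp add: LIMSEQ_const_iff)
qed

text \<open>The weak-derivative relation for functions integrable over the whole space, tested only
  by smooth functions vanishing off \<open>K\<close>. Integrals are over \<open>lborel\<close>,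
  where Fubini and translation invariance are at hand.\<close>

definition weak_pair :: "(real^'n::finite) set \<Rightarrow> 'n \<Rightarrow> (real^'n \<Rightarrow> complex) \<Rightarrow> (real^'n \<Rightarrow> complex) \<Rightarrow> bool" where
  "weak_pair K i U V \<longleftrightarrow> integrable lborel U \<and> integrable lborel V \<and>
     (\<forall>\<phi>. (\<forall>l. Ck_on l \<phi> UNIV) \<and> (\<forall>x. x \<notin> K \<longrightarrow> \<phi> x = 0) \<longrightarrow>
       (LINT x|lborel. partial_deriv i \<phi> x *\<^sub>R U x) = - (LINT x|lborel. \<phi> x *\<^sub>R V x))"

lemma smooth_C1_compact:
  assumes "\<And>l. Ck_on l \<phi> UNIV" "compact K" "\<And>x. x \<notin> K \<Longrightarrow> \<phi> x = 0"
  shows "C1_compact K \<phi>"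
  by (rule C1_compactI[OF assms(1,2) subset_refl assms(3)])

lemma mollifier_C1_compact: "mollifier \<delta> \<rho> \<Longrightarrow> C1_compact (cball 0 \<delta>) \<rho>"
proof (rule smooth_C1_compact)
  assume m: "mollifier \<delta> \<rho>"
  show "Ck_on l \<rho> UNIV" for l by (rule mollifierD(1)[OF m])
  show "\<rho> x = 0" if "x \<notin> cball 0 \<delta>" for x using mollifierD(3)[OF m, of x] that by simp
qed simp

lemma partial_deriv_translate:
  fixes \<rho> :: "real^'n \<Rightarrow> real"
  assumes "Ck_on 1 \<rho> UNIV"
  shows "partial_deriv i (\<lambda>x. \<rho> (x - y)) = (\<lambda>x. partial_deriv i \<rho> (x - y))"
    and "partial_deriv i (\<lambda>y. \<rho> (x - y)) = (\<lambda>y. - partial_deriv i \<rho> (x - y))"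
    and "(\<lambda>x. \<rho> (x - y)) differentiable at z"
    and "(\<lambda>y. \<rho> (x - y)) differentiable at z"
proof -
  have d: "\<rho> differentiable at z" for z using assms Ck_on_differentiable[of 0 \<rho>] by simp
  show "partial_deriv i (\<lambda>x. \<rho> (x - y)) = (\<lambda>x. partial_deriv i \<rho> (x - y))" "(\<lambda>x. \<rho> (x - y)) differentiable at z"
    using partial_deriv_affine[where c = 1 and z = "- y" and f = \<rho>, OF d] by auto
  show "partial_deriv i (\<lambda>y. \<rho> (x - y)) = (\<lambda>y. - partial_deriv i \<rho> (x - y))" "(\<lambda>y. \<rho> (x - y)) differentiable at z"
    using partial_deriv_affine[where c = "-1" and z = x and f = \<rho>, OF d] by auto
qed

lemma Ck_on_translate:
  fixes \<rho> :: "real^'n \<Rightarrow> real"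
  assumes "Ck_on l \<rho> UNIV"
  shows "Ck_on l (\<lambda>x. \<rho> (x - y)) UNIV" "Ck_on l (\<lambda>y. \<rho> (x - y)) UNIV"
  using Ck_on_affine[OF assms, of 1 "-y"] Ck_on_affine[OF assms, of "-1" x] by simp_all

text \<open>Instead of showing that a mollification of \<phi> is smooth, each translate of the
  kernel, smooth by construction, serves as a test function, and the resulting identities are
  averaged over y with weight \<open>\<phi> y\<close>. \<open>K\<close> contains a
  \<delta>-neighbourhood of \<open>S\<close> so that these translates are admissible.\<close>

lemma weak_pair_C1:
  assumes w: "weak_pair K i U V" and \<phi>: "C1_compact S \<phi>" and \<delta>: "0 < \<delta>"
    and SK: "\<And>x y. y \<in> S \<Longrightarrow> norm (x - y) < \<delta> \<Longrightarrow> x \<in> K"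
  shows "(LINT x|lborel. partial_deriv i \<phi> x *\<^sub>R U x) = - (LINT x|lborel. \<phi> x *\<^sub>R V x)"
proof -
  have U: "integrable lborel U" and V: "integrable lborel V"
    and T: "\<And>\<phi>. (\<And>l. Ck_on l \<phi> UNIV) \<Longrightarrow> (\<And>x. x \<notin> K \<Longrightarrow> \<phi> x = 0) \<Longrightarrow>
       (LINT x|lborel. partial_deriv i \<phi> x *\<^sub>R U x) = - (LINT x|lborel. \<phi> x *\<^sub>R V x)"
    using w by (auto simp: weak_pair_def)
  have [measurable]: "U \<in> borel_measurable borel" "V \<in> borel_measurable borel" using U V by auto
  obtain B where B: "0 < B" "\<And>x. norm (\<phi> x) \<le> B" "\<And>i x. norm (partial_deriv i \<phi> x) \<le> B"
    using C1_compact_bound[OF \<phi>] by (metis real_norm_def)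
  have \<phi>m [measurable]: "\<phi> \<in> borel_measurable borel" "partial_deriv i \<phi> \<in> borel_measurable borel"
    using C1_compact_integrable[OF \<phi>] by auto
  have \<phi>S: "\<phi> y = 0" if "y \<notin> S" for y
    using \<phi> closure_subset[of "{x. \<phi> x \<noteq> 0}"] that unfolding C1_compact_def by blast
  define \<epsilon> where "\<epsilon> n = \<delta> * inverse (real (Suc n))" for n
  have \<epsilon>: "0 < \<epsilon> n" "\<epsilon> n \<le> \<delta>" for n
    using \<delta> by (auto simp: \<epsilon>_def field_simps)
  have \<epsilon>0: "\<epsilon> \<longlonglongrightarrow> 0"
    unfolding \<epsilon>_def[abs_def] using tendsto_mult_right_zero[OF LIMSEQ_inverse_real_of_nat] by simp
  obtain \<rho> :: "nat \<Rightarrow> real^'a \<Rightarrow> real" where m: "\<And>n. mollifier (\<epsilon> n) (\<rho> n)"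
    using mollifier_exists[OF \<epsilon>(1)] by metis
  have key: "(LINT x|lborel. (LINT y|lborel. \<rho> n (x - y) *\<^sub>R partial_deriv i \<phi> y) *\<^sub>R U x)
      = - (LINT x|lborel. (LINT y|lborel. \<rho> n (x - y) *\<^sub>R \<phi> y) *\<^sub>R V x)" for n
  proof -
    note mn = mollifierD[OF m[of n]]
    note c = mollifier_C1_compact[OF m[of n]]
    have \<rho>m [measurable]: "\<rho> n \<in> borel_measurable borel" "partial_deriv i (\<rho> n) \<in> borel_measurable borel"
      using C1_compact_integrable[OF c] by auto
    have r1: "Ck_on 1 (\<rho> n) UNIV" by (rule mn(1))
    have test: "\<phi> y * (LINT x|lborel. partial_deriv i (\<rho> n) (x - y) *\<^sub>R U x)
        = - (\<phi> y * (LINT x|lborel. \<rho> n (x - y) *\<^sub>R V x))" for y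
    proof (cases "y \<in> S")
      case True
      have "(LINT x|lborel. partial_deriv i (\<lambda>x. \<rho> n (x - y)) x *\<^sub>R U x) = - (LINT x|lborel. \<rho> n (x - y) *\<^sub>R V x)"
      proof (rule T)
        show "Ck_on l (\<lambda>x. \<rho> n (x - y)) UNIV" for l by (intro Ck_on_translate mn)
        show "\<rho> n (x - y) = 0" if "x \<notin> K" for x
          using SK[OF True, of x] that \<epsilon>(2)[of n] by (intro mn(3)) fastforce
      qed
      then show ?thesis unfolding partial_deriv_translate(1)[OF r1] by simp
    qed (simp add: \<phi>S)
    have i1: "integrable (lborel \<Otimes>\<^sub>M lborel) (\<lambda>(x, y). (\<phi> y * g (x - y)) *\<^sub>R W x)"
      if g: "integrable lborel g" and W: "integrable lborel W" for g :: "real^'a \<Rightarrow> real" and W :: "real^'a \<Rightarrow> complex"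
    proof (rule integrable_dominated)
      have [measurable]: "g \<in> borel_measurable borel" "W \<in> borel_measurable borel" using g W by auto
      show "integrable (lborel \<Otimes>\<^sub>M lborel) (\<lambda>(x, y). (B * cmod (W x)) * \<bar>g (x - y)\<bar>)"
        by (rule integrable_conv1(1)) (use g W in auto)
      show "(\<lambda>(x, y). (\<phi> y * g (x - y)) *\<^sub>R W x) \<in> borel_measurable (lborel \<Otimes>\<^sub>M lborel)" by measurable
      show "norm (case z of (x, y) \<Rightarrow> (\<phi> y * g (x - y)) *\<^sub>R W x) \<le> (case z of (x, y) \<Rightarrow> (B * cmod (W x)) * \<bar>g (x - y)\<bar>)" for z
      proof (cases z)
        case (Pair x y)
        have "\<bar>\<phi> y\<bar> * (\<bar>g (x - y)\<bar> * cmod (W x)) \<le> B * (\<bar>g (x - y)\<bar> * cmod (W x))"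
          using B(2)[of y] by (intro mult_right_mono) auto
        then show ?thesis by (simp add: Pair abs_mult mult_ac)
      qed
    qed
    \<comment> \<open>The bound on \<open>g\<close> makes the inner integral in y finite for every x
      and not only for almost every x.\<close>
    have swap: "(LINT y|lborel. \<phi> y * (LINT x|lborel. g (x - y) *\<^sub>R W x))
        = (LINT x|lborel. (LINT y|lborel. \<phi> y * g (x - y)) *\<^sub>R W x)"
      if g: "integrable lborel g" and gb: "\<And>x. \<bar>g x\<bar> \<le> b" and W: "integrable lborel W"
      for g :: "real^'a \<Rightarrow> real" and W :: "real^'a \<Rightarrow> complex" and b
    proof -
      have [measurable]: "g \<in> borel_measurable borel" "W \<in> borel_measurable borel" using g W by auto
      have "(LINT y|lborel. \<phi> y * (LINT x|lborel. g (x - y) *\<^sub>R W x))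
          = (LINT y|lborel. LINT x|lborel. (\<phi> y * g (x - y)) *\<^sub>R W x)"
      proof (rule Bochner_Integration.integral_cong[OF refl])
        fix y
        have "\<phi> y * (LINT x|lborel. g (x - y) *\<^sub>R W x) = (LINT x|lborel. \<phi> y * (g (x - y) *\<^sub>R W x))"
          by (rule integral_mult_right_zero[symmetric])
        then show "\<phi> y * (LINT x|lborel. g (x - y) *\<^sub>R W x) = (LINT x|lborel. (\<phi> y * g (x - y)) *\<^sub>R W x)"
          by (simp add: scaleR_conv_of_real mult.assoc)
      qed
      also have "\<dots> = (LINT x|lborel. LINT y|lborel. (\<phi> y * g (x - y)) *\<^sub>R W x)"
        by (rule lborel_pair.Fubini_integral[OF i1[OF g W]])
      also have "\<dots> = (LINT x|lborel. (LINT y|lborel. \<phi> y * g (x - y)) *\<^sub>R W x)"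
      proof (intro Bochner_Integration.integral_cong refl integral_scaleR_left)
        fix x
        show "integrable lborel (\<lambda>y. \<phi> y * g (x - y))"
        proof (rule integrable_dominated)
          show "integrable lborel (\<lambda>y. \<bar>\<phi> y\<bar> * b)" using C1_compact_integrable(1)[OF \<phi>] by simp
          show "norm (\<phi> y * g (x - y)) \<le> \<bar>\<phi> y\<bar> * b" for y
            using gb by (simp add: abs_mult mult_left_mono)
        qed measurable
      qed
      finally show ?thesis .
    qed
    obtain b where b: "\<And>x. \<bar>\<rho> n x\<bar> \<le> b" "\<And>x. \<bar>partial_deriv i (\<rho> n) x\<bar> \<le> b"
      by (rule C1_compact_bound[OF c]) blast
    \<comment> \<open>The derivative of the kernel changes sign with the variable, so an integration
      by parts in y moves it onto \<phi>.\<close>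
    have parts: "(LINT y|lborel. \<phi> y * partial_deriv i (\<rho> n) (x - y)) = (LINT y|lborel. \<rho> n (x - y) *\<^sub>R partial_deriv i \<phi> y)" for x
    proof -
      let ?F = "\<lambda>y. \<phi> y * \<rho> n (x - y)"
      have "C1_compact UNIV ?F"
      proof (rule C1_compactI)
        show "Ck_on 1 ?F UNIV"
          using \<phi> by (intro Ck_on_mult Ck_on_translate mn(1)) (simp only: C1_compact_def)
        show "compact (closure {x. \<phi> x \<noteq> 0})" using \<phi> by (simp only: C1_compact_def)
        show "?F y = 0" if "y \<notin> closure {x. \<phi> x \<noteq> 0}" for y
          using subsetD[OF closure_subset, of y "{x. \<phi> x \<noteq> 0}"] that by auto
      qed simp
      then have "0 = (LINT y|lborel. partial_deriv i ?F y)" by (simp add: integral_partial_deriv_eq_0)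
      also have "\<dots> = (LINT y|lborel. \<rho> n (x - y) *\<^sub>R partial_deriv i \<phi> y - \<phi> y * partial_deriv i (\<rho> n) (x - y))"
        using C1_compactD(1)[OF \<phi>] partial_deriv_translate(2,4)[OF r1]
        by (intro Bochner_Integration.integral_cong refl) (simp add: partial_deriv_mult)
      also have "\<dots> = (LINT y|lborel. \<rho> n (x - y) *\<^sub>R partial_deriv i \<phi> y) - (LINT y|lborel. \<phi> y * partial_deriv i (\<rho> n) (x - y))"
      proof (rule Bochner_Integration.integral_diff)
        show "integrable lborel (\<lambda>y. \<rho> n (x - y) *\<^sub>R partial_deriv i \<phi> y)"
          by (rule mollifier_integral_bound(1)[OF m \<phi>m(2) B(3)])
        show "integrable lborel (\<lambda>y. \<phi> y * partial_deriv i (\<rho> n) (x - y))"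
        proof (rule integrable_dominated)
          show "integrable lborel (\<lambda>y. \<bar>\<phi> y\<bar> * b)" using C1_compact_integrable(1)[OF \<phi>] by simp
          show "norm (\<phi> y * partial_deriv i (\<rho> n) (x - y)) \<le> \<bar>\<phi> y\<bar> * b" for y
            using b(2) by (simp add: abs_mult mult_left_mono)
        qed measurable
      qed
      finally show ?thesis by simp
    qed
    have "(LINT x|lborel. (LINT y|lborel. \<rho> n (x - y) *\<^sub>R partial_deriv i \<phi> y) *\<^sub>R U x)
        = (LINT y|lborel. \<phi> y * (LINT x|lborel. partial_deriv i (\<rho> n) (x - y) *\<^sub>R U x))"
      unfolding parts[symmetric] by (rule swap[symmetric, OF C1_compact_integrable(2)[OF c] b(2) U])
    also have "\<dots> = - (LINT y|lborel. \<phi> y * (LINT x|lborel. \<rho> n (x - y) *\<^sub>R V x))"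
      unfolding test by simp
    also have "(LINT y|lborel. \<phi> y * (LINT x|lborel. \<rho> n (x - y) *\<^sub>R V x))
        = (LINT x|lborel. (LINT y|lborel. \<phi> y * \<rho> n (x - y)) *\<^sub>R V x)"
      by (rule swap[OF mn(4) b(1) V])
    finally show ?thesis by (simp add: mult.commute)
  qed
  have lim: "(\<lambda>n. LINT x|lborel. (LINT y|lborel. \<rho> n (x - y) *\<^sub>R g y) *\<^sub>R W x) \<longlonglongrightarrow> (LINT x|lborel. g x *\<^sub>R W x)"
    if g: "continuous_on UNIV g" "\<And>x. norm (g x) \<le> B" and W: "integrable lborel W"
    for g :: "real^'a \<Rightarrow> real" and W :: "real^'a \<Rightarrow> complex"
  proof (rule integral_dominated_convergence[where w = "\<lambda>x. B * cmod (W x)"])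
    have gm [measurable]: "g \<in> borel_measurable borel" using g(1) by (rule borel_measurable_continuous_onI)
    have [measurable]: "W \<in> borel_measurable borel" using W by auto
    note [measurable] = mollifierD(7)[OF m]
    show "(\<lambda>x. (LINT y|lborel. \<rho> n (x - y) *\<^sub>R g y) *\<^sub>R W x) \<in> borel_measurable lborel" for n by measurable
    show "(\<lambda>x. g x *\<^sub>R W x) \<in> borel_measurable lborel" by measurable
    show "AE x in lborel. (\<lambda>n. (LINT y|lborel. \<rho> n (x - y) *\<^sub>R g y) *\<^sub>R W x) \<longlonglongrightarrow> g x *\<^sub>R W x"
      by (intro AE_I2 tendsto_scaleR tendsto_const mollifier_tendsto[OF m \<epsilon>0 g])
    show "AE x in lborel. norm ((LINT y|lborel. \<rho> n (x - y) *\<^sub>R g y) *\<^sub>R W x) \<le> B * cmod (W x)" for n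
      using mollifier_integral_bound(2)[OF m gm g(2)]
      by (intro AE_I2) (simp add: mult_right_mono)
  qed (use W in auto)
  have "(\<lambda>n. - (LINT x|lborel. (LINT y|lborel. \<rho> n (x - y) *\<^sub>R \<phi> y) *\<^sub>R V x)) \<longlonglongrightarrow> - (LINT x|lborel. \<phi> x *\<^sub>R V x)"
    by (intro tendsto_minus lim C1_compactD[OF \<phi>] B(2) V)
  moreover have "(\<lambda>n. - (LINT x|lborel. (LINT y|lborel. \<rho> n (x - y) *\<^sub>R \<phi> y) *\<^sub>R V x)) \<longlonglongrightarrow> (LINT x|lborel. partial_deriv i \<phi> x *\<^sub>R U x)"
    unfolding key[symmetric] by (intro lim C1_compactD[OF \<phi>] B(3) U)
  ultimately show ?thesis by (rule LIMSEQ_unique[rotated])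
qed

lemma kernel_product_integrable:
  fixes F H :: "real^'n \<Rightarrow> complex" and \<kappa> :: "real^'n \<Rightarrow> real"
  assumes k: "integrable lborel \<kappa>" and [measurable]: "F \<in> borel_measurable borel" "H \<in> borel_measurable borel"
    and F2: "integrable lborel (\<lambda>x. (cmod (F x))\<^sup>2)" and H2: "integrable lborel (\<lambda>x. (cmod (H x))\<^sup>2)"
  shows "integrable (lborel \<Otimes>\<^sub>M lborel) (\<lambda>(x, y). \<kappa> (x - y) *\<^sub>R (F x * H y))"
proof -
  have [measurable]: "\<kappa> \<in> borel_measurable borel" using k by auto
  have k': "integrable lborel (\<lambda>x. \<bar>\<kappa> x\<bar>)" using k by simp
  let ?D = "\<lambda>(x, y). (cmod (F x))\<^sup>2 * \<bar>\<kappa> (x - y)\<bar> + (cmod (H y))\<^sup>2 * \<bar>\<kappa> (x - y)\<bar>"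
  have iD: "integrable (lborel \<Otimes>\<^sub>M lborel) ?D"
    using Bochner_Integration.integrable_add[OF integrable_conv1(1)[OF F2 k'] integrable_conv2(1)[OF H2 k']]
    by (simp add: split_beta')
  show ?thesis
  proof (rule integrable_dominated[OF iD])
    show "norm (case z of (x, y) \<Rightarrow> \<kappa> (x - y) *\<^sub>R (F x * H y)) \<le> ?D z" for z
    proof (cases z)
      case (Pair x y)
      have "cmod (F x) * cmod (H y) \<le> (1 * (cmod (F x))\<^sup>2 + (cmod (H y))\<^sup>2 / 1) / 2"
        by (rule young) simp
      also have "\<dots> \<le> (cmod (F x))\<^sup>2 + (cmod (H y))\<^sup>2" by simp
      finally have "\<bar>\<kappa> (x - y)\<bar> * (cmod (F x) * cmod (H y)) \<le> \<bar>\<kappa> (x - y)\<bar> * ((cmod (F x))\<^sup>2 + (cmod (H y))\<^sup>2)"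
        by (rule mult_left_mono) simp
      then show ?thesis by (simp add: Pair norm_mult algebra_simps)
    qed
  qed measurable
qed

lemma smooth_bound:
  assumes "C1_compact S \<phi>"
  shows "\<exists>B. (\<forall>x. \<bar>\<phi> x\<bar> \<le> B) \<and> (\<forall>x. \<bar>partial_deriv i \<phi> x\<bar> \<le> B)"
  by (rule C1_compact_bound[OF assms]) blast

lemma bounded_mult_L2:
  fixes U :: "'a::euclidean_space \<Rightarrow> complex"
  assumes [measurable]: "g \<in> borel_measurable borel" and g: "\<And>x. \<bar>g x\<bar> \<le> B"
    and [measurable]: "U \<in> borel_measurable borel"
  shows "integrable lborel U \<Longrightarrow> integrable lborel (\<lambda>x. g x *\<^sub>R U x)"
    and "integrable lborel (\<lambda>x. (cmod (U x))\<^sup>2) \<Longrightarrow> integrable lborel (\<lambda>x. (cmod (g x *\<^sub>R U x))\<^sup>2)"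
proof -
  assume i: "integrable lborel U"
  show "integrable lborel (\<lambda>x. g x *\<^sub>R U x)"
  proof (rule integrable_dominated)
    show "integrable lborel (\<lambda>x. B * cmod (U x))" using i by simp
    show "norm (g x *\<^sub>R U x) \<le> B * cmod (U x)" for x using g by (simp add: mult_right_mono)
  qed measurable
next
  assume i: "integrable lborel (\<lambda>x. (cmod (U x))\<^sup>2)"
  show "integrable lborel (\<lambda>x. (cmod (g x *\<^sub>R U x))\<^sup>2)"
  proof (rule integrable_dominated)
    show "integrable lborel (\<lambda>x. B\<^sup>2 * (cmod (U x))\<^sup>2)" using i by simp
    show "norm ((cmod (g x *\<^sub>R U x))\<^sup>2) \<le> B\<^sup>2 * (cmod (U x))\<^sup>2" for x
    proof -
      have "(g x)\<^sup>2 \<le> B\<^sup>2" using power_mono[OF g[of x], of 2] by simp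
      then show ?thesis by (simp add: power_mult_distrib mult_right_mono)
    qed
  qed measurable
qed

text \<open>Friedrichs' argument in integrated form: only smoothness of \<open>\<phi> (x) \<rho> (x - y)\<close> in each variable
  is used, so no smooth approximation of \<open>V\<close> has to be constructed.\<close>

lemma weak_pair_mult:
  assumes wU: "weak_pair K i U Ui" and wV: "weak_pair K i V Vi"
    and U2: "integrable lborel (\<lambda>x. (cmod (U x))\<^sup>2)" "integrable lborel (\<lambda>x. (cmod (Ui x))\<^sup>2)"
    and V2: "integrable lborel (\<lambda>x. (cmod (V x))\<^sup>2)" "integrable lborel (\<lambda>x. (cmod (Vi x))\<^sup>2)"
    and S: "compact S" and \<delta>: "0 < \<delta>" and SK: "\<And>x y. y \<in> S \<Longrightarrow> norm (x - y) < \<delta> \<Longrightarrow> x \<in> K"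
  shows "weak_pair S i (\<lambda>x. U x * V x) (\<lambda>x. Ui x * V x + U x * Vi x)"
  unfolding weak_pair_def
proof (intro conjI allI impI)
  have U: "integrable lborel U" "integrable lborel Ui" and V: "integrable lborel V" "integrable lborel Vi"
    and TU: "\<And>\<phi>. (\<And>l. Ck_on l \<phi> UNIV) \<Longrightarrow> (\<And>x. x \<notin> K \<Longrightarrow> \<phi> x = 0) \<Longrightarrow>
       (LINT x|lborel. partial_deriv i \<phi> x *\<^sub>R U x) = - (LINT x|lborel. \<phi> x *\<^sub>R Ui x)"
    and TV: "\<And>\<phi>. (\<And>l. Ck_on l \<phi> UNIV) \<Longrightarrow> (\<And>x. x \<notin> K \<Longrightarrow> \<phi> x = 0) \<Longrightarrow>
       (LINT x|lborel. partial_deriv i \<phi> x *\<^sub>R V x) = - (LINT x|lborel. \<phi> x *\<^sub>R Vi x)"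
    using wU wV by (auto simp: weak_pair_def)
  have M [measurable]: "U \<in> borel_measurable borel" "Ui \<in> borel_measurable borel"
    "V \<in> borel_measurable borel" "Vi \<in> borel_measurable borel" using U V by auto
  have UV: "integrable lborel (\<lambda>x. U x * V x)" "integrable lborel (\<lambda>x. Ui x * V x)" "integrable lborel (\<lambda>x. U x * Vi x)"
    by (intro integrable_mult_L2 U2 V2; measurable)+
  show "integrable lborel (\<lambda>x. U x * V x)" by (rule UV)
  show "integrable lborel (\<lambda>x. Ui x * V x + U x * Vi x)" using UV by simp
  fix \<phi> :: "real^'a \<Rightarrow> real"
  assume *: "(\<forall>l. Ck_on l \<phi> UNIV) \<and> (\<forall>x. x \<notin> S \<longrightarrow> \<phi> x = 0)"
  then have sm: "Ck_on l \<phi> UNIV" and \<phi>S: "x \<notin> S \<Longrightarrow> \<phi> x = 0" for l x by blast+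
  have c\<phi>: "C1_compact S \<phi>" by (rule smooth_C1_compact[OF sm S \<phi>S])
  obtain B where B: "\<And>x. \<bar>\<phi> x\<bar> \<le> B" "\<And>x. \<bar>partial_deriv i \<phi> x\<bar> \<le> B"
    using smooth_bound[OF c\<phi>, of i] by blast
  have \<phi>m [measurable]: "\<phi> \<in> borel_measurable borel" "partial_deriv i \<phi> \<in> borel_measurable borel"
    using C1_compact_integrable[OF c\<phi>] by auto
  have SK': "x \<in> K" if "x \<in> S" for x using SK[OF that, of x] \<delta> by simp
  define \<epsilon> where "\<epsilon> n = \<delta> * inverse (real (Suc n))" for n
  have \<epsilon>: "0 < \<epsilon> n" "\<epsilon> n \<le> \<delta>" for n
    using \<delta> by (auto simp: \<epsilon>_def field_simps)
  have \<epsilon>0: "\<epsilon> \<longlonglongrightarrow> 0"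
    unfolding \<epsilon>_def[abs_def] using tendsto_mult_right_zero[OF LIMSEQ_inverse_real_of_nat] by simp
  obtain \<rho> :: "nat \<Rightarrow> real^'a \<Rightarrow> real" where m: "\<And>n. mollifier (\<epsilon> n) (\<rho> n)"
    using mollifier_exists[OF \<epsilon>(1)] by metis
  let ?A = "\<lambda>F G n. LINT x|lborel. LINT y|lborel. \<rho> n (x - y) *\<^sub>R (F x * G y)"
  \<comment> \<open>The derivative of the kernel appears when U is tested in x and is removed by
    testing V in y, so only derivatives of \<phi>, U and V remain for the limit.\<close>
  have key: "?A (\<lambda>x. partial_deriv i \<phi> x *\<^sub>R U x) V n + ?A (\<lambda>x. \<phi> x *\<^sub>R U x) Vi n
      = - ?A (\<lambda>x. \<phi> x *\<^sub>R Ui x) V n" for n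
  proof -
    note mn = mollifierD[OF m[of n]]
    note c = mollifier_C1_compact[OF m[of n]]
    have r1: "Ck_on 1 (\<rho> n) UNIV" by (rule mn(1))
    note ci = C1_compact_integrable[OF c]
    have \<rho>m [measurable]: "\<rho> n \<in> borel_measurable borel" "partial_deriv i (\<rho> n) \<in> borel_measurable borel"
      using ci by auto
    define G1 where "G1 = (\<lambda>(x, y). \<rho> n (x - y) *\<^sub>R ((partial_deriv i \<phi> x *\<^sub>R U x) * V y))"
    define G2 where "G2 = (\<lambda>(x, y). partial_deriv i (\<rho> n) (x - y) *\<^sub>R ((\<phi> x *\<^sub>R U x) * V y))"
    define G3 where "G3 = (\<lambda>(x, y). \<rho> n (x - y) *\<^sub>R ((\<phi> x *\<^sub>R Ui x) * V y))"
    define G4 where "G4 = (\<lambda>(x, y). \<rho> n (x - y) *\<^sub>R ((\<phi> x *\<^sub>R U x) * Vi y))"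
    have i1: "integrable (lborel \<Otimes>\<^sub>M lborel) G1" unfolding G1_def
      by (intro kernel_product_integrable bounded_mult_L2(2)[OF \<phi>m(2) B(2)] U2 V2 ci M; measurable)
    have i2: "integrable (lborel \<Otimes>\<^sub>M lborel) G2" unfolding G2_def
      by (intro kernel_product_integrable bounded_mult_L2(2)[OF \<phi>m(1) B(1)] U2 V2 ci M; measurable)
    have i3: "integrable (lborel \<Otimes>\<^sub>M lborel) G3" unfolding G3_def
      by (intro kernel_product_integrable bounded_mult_L2(2)[OF \<phi>m(1) B(1)] U2 V2 ci M; measurable)
    have i4: "integrable (lborel \<Otimes>\<^sub>M lborel) G4" unfolding G4_def
      by (intro kernel_product_integrable bounded_mult_L2(2)[OF \<phi>m(1) B(1)] U2 V2 ci M; measurable)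
    \<comment> \<open>For fixed y, test U with \<phi> times the kernel and multiply by
      \<open>V y\<close>.\<close>
    have e1: "(LINT x|lborel. G1 (x, y) + G2 (x, y)) = - (LINT x|lborel. G3 (x, y))" for y
    proof -
      let ?f = "\<lambda>x. \<phi> x * \<rho> n (x - y)"
      have d: "partial_deriv i ?f x = \<phi> x * partial_deriv i (\<rho> n) (x - y) + partial_deriv i \<phi> x * \<rho> n (x - y)" for x
        using C1_compactD(1)[OF c\<phi>] partial_deriv_translate(1,3)[OF r1] by (simp add: partial_deriv_mult)
      have "(LINT x|lborel. partial_deriv i ?f x *\<^sub>R U x) = - (LINT x|lborel. ?f x *\<^sub>R Ui x)"
      proof (rule TU)
        show "Ck_on l ?f UNIV" for l by (intro Ck_on_mult Ck_on_translate sm mn(1))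
        show "?f x = 0" if "x \<notin> K" for x using \<phi>S[of x] SK'[of x] that by auto
      qed
      then have "(LINT x|lborel. partial_deriv i ?f x *\<^sub>R U x) * V y = - (LINT x|lborel. ?f x *\<^sub>R Ui x) * V y" by simp
      then have "(LINT x|lborel. (partial_deriv i ?f x *\<^sub>R U x) * V y) = - (LINT x|lborel. (?f x *\<^sub>R Ui x) * V y)"
        by (simp only: integral_mult_left_zero mult_minus_left)
      moreover have "(partial_deriv i ?f x *\<^sub>R U x) * V y = G1 (x, y) + G2 (x, y)" for x
        unfolding d G1_def G2_def by (simp add: scaleR_conv_of_real algebra_simps)
      moreover have "(?f x *\<^sub>R Ui x) * V y = G3 (x, y)" for x
        unfolding G3_def by (simp add: scaleR_conv_of_real algebra_simps)
      ultimately show ?thesis by simp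
    qed
    \<comment> \<open>For fixed x, test V with the kernel: the sign from differentiating in y
      cancels the sign in the definition of a weak derivative.\<close>
    have e2: "(LINT y|lborel. G2 (x, y)) = (LINT y|lborel. G4 (x, y))" for x
    proof (cases "x \<in> S")
      case True
      have "(LINT y|lborel. partial_deriv i (\<lambda>y. \<rho> n (x - y)) y *\<^sub>R V y) = - (LINT y|lborel. \<rho> n (x - y) *\<^sub>R Vi y)"
      proof (rule TV)
        show "Ck_on l (\<lambda>y. \<rho> n (x - y)) UNIV" for l by (intro Ck_on_translate mn(1))
        show "\<rho> n (x - y) = 0" if "y \<notin> K" for y
          using SK[OF True, of y] that \<epsilon>(2)[of n] by (intro mn(3)) (fastforce simp: norm_minus_commute)
      qed
      then have "(LINT y|lborel. partial_deriv i (\<rho> n) (x - y) *\<^sub>R V y) = (LINT y|lborel. \<rho> n (x - y) *\<^sub>R Vi y)"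
        unfolding partial_deriv_translate(2)[OF r1] by simp
      then have "(\<phi> x *\<^sub>R U x) * (LINT y|lborel. partial_deriv i (\<rho> n) (x - y) *\<^sub>R V y)
          = (\<phi> x *\<^sub>R U x) * (LINT y|lborel. \<rho> n (x - y) *\<^sub>R Vi y)" by simp
      then have "(LINT y|lborel. (\<phi> x *\<^sub>R U x) * (partial_deriv i (\<rho> n) (x - y) *\<^sub>R V y))
          = (LINT y|lborel. (\<phi> x *\<^sub>R U x) * (\<rho> n (x - y) *\<^sub>R Vi y))"
        by (simp only: integral_mult_right_zero)
      then show ?thesis by (simp add: G2_def G4_def)
    qed (simp add: G2_def G4_def \<phi>S)
    let ?P = "lborel \<Otimes>\<^sub>M (lborel :: (real^'a) measure)"
    have "integral\<^sup>L ?P G1 + integral\<^sup>L ?P G2 = integral\<^sup>L ?P (\<lambda>(x, y). G1 (x, y) + G2 (x, y))"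
      using Bochner_Integration.integral_add[OF i1 i2] by (simp add: split_beta')
    also have "\<dots> = (LINT y|lborel. LINT x|lborel. G1 (x, y) + G2 (x, y))"
      by (rule lborel_pair.integral_snd[symmetric]) (use i1 i2 in \<open>simp add: split_beta'\<close>)
    also have "\<dots> = - (LINT y|lborel. LINT x|lborel. G3 (x, y))" unfolding e1 by simp
    also have "(LINT y|lborel. LINT x|lborel. G3 (x, y)) = integral\<^sup>L ?P (\<lambda>(x, y). G3 (x, y))"
      by (rule lborel_pair.integral_snd) (use i3 in \<open>simp add: split_beta'\<close>)
    finally have "integral\<^sup>L ?P G1 + integral\<^sup>L ?P G2 = - integral\<^sup>L ?P G3" by (simp add: split_beta')
    moreover have "integral\<^sup>L ?P G2 = integral\<^sup>L ?P G4"
      using lborel_pair.integral_fst'[OF i2] lborel_pair.integral_fst'[OF i4] e2 by simp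
    ultimately have "integral\<^sup>L ?P G1 + integral\<^sup>L ?P G4 = - integral\<^sup>L ?P G3" by simp
    then show ?thesis
      using lborel_pair.integral_fst'[OF i1] lborel_pair.integral_fst'[OF i3] lborel_pair.integral_fst'[OF i4]
      by (simp add: G1_def G3_def G4_def)
  qed
  have lim: "?A (\<lambda>x. g x *\<^sub>R W x) Z \<longlonglongrightarrow> (LINT x|lborel. (g x *\<^sub>R W x) * Z x)"
    if "g \<in> borel_measurable borel" "\<And>x. \<bar>g x\<bar> \<le> B" "W \<in> borel_measurable borel" "integrable lborel W"
      "integrable lborel (\<lambda>x. (cmod (W x))\<^sup>2)" "Z \<in> borel_measurable borel" "integrable lborel (\<lambda>x. (cmod (Z x))\<^sup>2)"
    for g W Z
    by (rule mollified_product_tendsto[OF m \<epsilon>0 bounded_mult_L2(1)[OF that(1,2,3,4)]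
          bounded_mult_L2(2)[OF that(1,2,3,5)] that(6,7)])
  have "(\<lambda>n. ?A (\<lambda>x. partial_deriv i \<phi> x *\<^sub>R U x) V n + ?A (\<lambda>x. \<phi> x *\<^sub>R U x) Vi n) \<longlonglongrightarrow>
      (LINT x|lborel. (partial_deriv i \<phi> x *\<^sub>R U x) * V x) + (LINT x|lborel. (\<phi> x *\<^sub>R U x) * Vi x)"
    by (intro tendsto_add lim \<phi>m B M U V U2 V2)
  moreover have "(\<lambda>n. ?A (\<lambda>x. partial_deriv i \<phi> x *\<^sub>R U x) V n + ?A (\<lambda>x. \<phi> x *\<^sub>R U x) Vi n) \<longlonglongrightarrow>
      - (LINT x|lborel. (\<phi> x *\<^sub>R Ui x) * V x)"
    unfolding key by (intro tendsto_minus lim \<phi>m B M U V U2 V2)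
  ultimately have eq: "(LINT x|lborel. (partial_deriv i \<phi> x *\<^sub>R U x) * V x) + (LINT x|lborel. (\<phi> x *\<^sub>R U x) * Vi x)
      = - (LINT x|lborel. (\<phi> x *\<^sub>R Ui x) * V x)" by (rule LIMSEQ_unique)
  have sp: "(LINT x|lborel. \<phi> x *\<^sub>R (Ui x * V x + U x * Vi x)) = (LINT x|lborel. \<phi> x *\<^sub>R (Ui x * V x)) + (LINT x|lborel. \<phi> x *\<^sub>R (U x * Vi x))"
    unfolding scaleR_add_right
    by (intro Bochner_Integration.integral_add bounded_mult_L2(1)[OF \<phi>m(1) B(1)] UV; measurable)
  show "(LINT x|lborel. partial_deriv i \<phi> x *\<^sub>R (U x * V x)) = - (LINT x|lborel. \<phi> x *\<^sub>R (Ui x * V x + U x * Vi x))"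
  proof -
    have ar: "p = - (r + q)" if "p + q = - r" for p q r :: complex using that by algebra
    show ?thesis unfolding sp using eq by (intro ar) simp
  qed
qed

section \<open>Borel representatives and localisation to compact sets\<close>

text \<open>Borel functions stay measurable under the compositions and products needed for Fubini,
  and extension by zero turns integrals over \<open>K\<close> into integrals over the whole
  space.\<close>

definition borel_rep :: "'a::euclidean_space set \<Rightarrow> ('a \<Rightarrow> complex) \<Rightarrow> ('a \<Rightarrow> complex) \<Rightarrow> bool" where
  "borel_rep K u U \<longleftrightarrow> U \<in> borel_measurable borel \<and> (\<forall>x. x \<notin> K \<longrightarrow> U x = 0) \<and>
     (AE x in lborel. x \<in> K \<longrightarrow> U x = u x)"

lemma borel_rep_exists:
  assumes u: "u \<in> borel_measurable (lebesgue_on K)" and K [measurable]: "K \<in> sets borel"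
  shows "\<exists>U. borel_rep K u U"
proof -
  have Kl: "K \<in> sets lebesgue" using K by simp
  have m [measurable]: "(\<lambda>x. indicator K x *\<^sub>R u x) \<in> borel_measurable lebesgue"
    using u Kl by (simp add: borel_measurable_restrict_space_iff)
  have "(\<lambda>x. Re (indicator K x *\<^sub>R u x)) \<in> borel_measurable lebesgue"
    "(\<lambda>x. Im (indicator K x *\<^sub>R u x)) \<in> borel_measurable lebesgue"
    by (rule measurable_compose[OF m]; simp)+
  from this[THEN completion_ex_borel_measurable_real]
  obtain R I where [measurable]: "R \<in> borel_measurable lborel" "I \<in> borel_measurable lborel"
    and RI: "AE x in lborel. Re (indicator K x *\<^sub>R u x) = R x" "AE x in lborel. Im (indicator K x *\<^sub>R u x) = I x"
    by blast
  have "borel_rep K u (\<lambda>x. indicator K x *\<^sub>R (complex_of_real (R x) + \<i> * complex_of_real (I x)))"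
    unfolding borel_rep_def
  proof (intro conjI)
    show "(\<lambda>x. indicator K x *\<^sub>R (complex_of_real (R x) + \<i> * complex_of_real (I x))) \<in> borel_measurable borel"
      by measurable
    show "AE x in lborel. x \<in> K \<longrightarrow> indicator K x *\<^sub>R (complex_of_real (R x) + \<i> * complex_of_real (I x)) = u x"
      using RI by eventually_elim (auto simp: complex_eq_iff)
  qed simp
  then show ?thesis by blast
qed

lemma AE_lebesgue_on_iff:
  assumes "S \<in> sets lebesgue"
  shows "(AE x in lebesgue_on S. P x) \<longleftrightarrow> (AE x in lborel. x \<in> S \<longrightarrow> P x)"
  using assms AE_restrict_space_iff[of S lebesgue P] AE_completion_iff[where M = lborel and P = "\<lambda>x. x \<in> S \<longrightarrow> P x"] by simp

text \<open>The integrand has the form \<open>h x (u x)\<close> so that one transfer covers the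
  function itself, its squared modulus and its products with test functions. Because
  \<open>h\<close> vanishes off \<open>K\<close>, it does not matter that \<open>u\<close> is
  represented only there.\<close>

lemma borel_rep_transfer:
  fixes u :: "'a::euclidean_space \<Rightarrow> complex" and h :: "'a \<Rightarrow> complex \<Rightarrow> 'b::euclidean_space"
  assumes r: "borel_rep K u U" and K: "K \<in> sets lebesgue" and S: "S \<in> sets lebesgue" "K \<subseteq> S"
    and h: "(\<lambda>x. h x (U x)) \<in> borel_measurable borel" "\<And>x z. x \<notin> K \<Longrightarrow> h x z = 0"
  shows "integral\<^sup>L (lebesgue_on S) (\<lambda>x. h x (u x)) = (LINT x|lborel. h x (U x))"
    and "integrable (lebesgue_on S) (\<lambda>x. h x (u x)) \<longleftrightarrow> integrable lborel (\<lambda>x. h x (U x))"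
proof -
  have ml: "(\<lambda>x. h x (U x)) \<in> borel_measurable lebesgue"
    using h(1) by (simp add: measurable_completion)
  have "AE x in lborel. x \<in> K \<longrightarrow> U x = u x" using r by (simp add: borel_rep_def)
  then have "AE x in lborel. h x (U x) = indicator S x *\<^sub>R h x (u x)"
    by eventually_elim (use h(2) S(2) in \<open>fastforce simp: indicator_def\<close>)
  then have ae: "AE x in lebesgue. h x (U x) = indicator S x *\<^sub>R h x (u x)"
    by (simp add: AE_completion_iff)
  have mu: "(\<lambda>x. indicator S x *\<^sub>R h x (u x)) \<in> borel_measurable lebesgue"
    by (rule borel_measurable_AE[OF ml ae])
  have "integral\<^sup>L (lebesgue_on S) (\<lambda>x. h x (u x)) = integral\<^sup>L lebesgue (\<lambda>x. indicator S x *\<^sub>R h x (u x))"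
    using S by (simp add: integral_restrict_space)
  also have "\<dots> = integral\<^sup>L lebesgue (\<lambda>x. h x (U x))"
    using ae by (intro integral_cong_AE mu ml) auto
  also have "\<dots> = (LINT x|lborel. h x (U x))" using h(1) by (simp add: integral_completion)
  finally show "integral\<^sup>L (lebesgue_on S) (\<lambda>x. h x (u x)) = (LINT x|lborel. h x (U x))" .
  have "integrable (lebesgue_on S) (\<lambda>x. h x (u x)) \<longleftrightarrow> integrable lebesgue (\<lambda>x. indicator S x *\<^sub>R h x (u x))"
    using S by (simp add: integrable_restrict_space)
  also have "\<dots> \<longleftrightarrow> integrable lebesgue (\<lambda>x. h x (U x))"
    using ae by (intro integrable_cong_AE mu ml) auto
  also have "\<dots> \<longleftrightarrow> integrable lborel (\<lambda>x. h x (U x))" using h(1) by (simp add: integrable_completion)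
  finally show "integrable (lebesgue_on S) (\<lambda>x. h x (u x)) \<longleftrightarrow> integrable lborel (\<lambda>x. h x (U x))" .
qed

lemma borel_rep_transfer_scaleR:
  fixes u :: "'a::euclidean_space \<Rightarrow> complex" and g :: "'a \<Rightarrow> real"
  assumes r: "borel_rep K u U" and "K \<in> sets lebesgue" "S \<in> sets lebesgue" "K \<subseteq> S"
    and [measurable]: "g \<in> borel_measurable borel" and g: "\<And>x. x \<notin> K \<Longrightarrow> g x = 0"
  shows "integral\<^sup>L (lebesgue_on S) (\<lambda>x. g x *\<^sub>R u x) = (LINT x|lborel. g x *\<^sub>R U x)"
proof (rule borel_rep_transfer(1)[OF r assms(2-4), where h = "\<lambda>x z. g x *\<^sub>R z"])
  have [measurable]: "U \<in> borel_measurable borel" using r by (simp add: borel_rep_def)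
  show "(\<lambda>x. g x *\<^sub>R U x) \<in> borel_measurable borel" by measurable
qed (simp add: g)

lemma borel_rep_integrable:
  assumes r: "borel_rep K u U" and K: "K \<in> sets lebesgue"
  shows "integrable (lebesgue_on K) u \<longleftrightarrow> integrable lborel U"
    and "integrable (lebesgue_on K) (\<lambda>x. (cmod (u x))\<^sup>2) \<longleftrightarrow> integrable lborel (\<lambda>x. (cmod (U x))\<^sup>2)"
proof -
  have [measurable]: "U \<in> borel_measurable borel" and U0: "\<And>x. x \<notin> K \<Longrightarrow> U x = 0"
    using r by (auto simp: borel_rep_def)
  have m: "(\<lambda>x. if x \<in> K then U x else 0) = U" using U0 by auto
  have "integrable (lebesgue_on K) (\<lambda>x. if x \<in> K then u x else 0) \<longleftrightarrow> integrable lborel (\<lambda>x. if x \<in> K then U x else 0)"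
    by (rule borel_rep_transfer(2)[OF r K K, where h = "\<lambda>x z. if x \<in> K then z else 0"]) (auto simp: m)
  moreover have "integrable (lebesgue_on K) (\<lambda>x. if x \<in> K then u x else 0) \<longleftrightarrow> integrable (lebesgue_on K) u"
    by (rule Bochner_Integration.integrable_cong) auto
  ultimately show "integrable (lebesgue_on K) u \<longleftrightarrow> integrable lborel U" by (simp add: m)
  have m2: "(\<lambda>x. if x \<in> K then (cmod (U x))\<^sup>2 else 0) = (\<lambda>x. (cmod (U x))\<^sup>2)" using U0 by auto
  have "integrable (lebesgue_on K) (\<lambda>x. if x \<in> K then (cmod (u x))\<^sup>2 else 0) \<longleftrightarrow> integrable lborel (\<lambda>x. if x \<in> K then (cmod (U x))\<^sup>2 else 0)"
    by (rule borel_rep_transfer(2)[OF r K K, where h = "\<lambda>x z. if x \<in> K then (cmod z)\<^sup>2 else 0"]) (auto simp: m2)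
  moreover have "integrable (lebesgue_on K) (\<lambda>x. if x \<in> K then (cmod (u x))\<^sup>2 else 0) \<longleftrightarrow> integrable (lebesgue_on K) (\<lambda>x. (cmod (u x))\<^sup>2)"
    by (rule Bochner_Integration.integrable_cong) auto
  ultimately show "integrable (lebesgue_on K) (\<lambda>x. (cmod (u x))\<^sup>2) \<longleftrightarrow> integrable lborel (\<lambda>x. (cmod (U x))\<^sup>2)"
    by (simp add: m2)
qed

lemma compact_sets_lebesgue: "compact K \<Longrightarrow> K \<in> sets lebesgue" for K :: "'a::euclidean_space set"
  by (simp add: compact_imp_closed borel_closed)

lemma locally_integrable_rep:
  fixes u :: "real^'n \<Rightarrow> complex"
  assumes "locally_integrable_on u \<Omega>" "compact K" "K \<subseteq> \<Omega>"
  obtains U where "borel_rep K u U" "integrable lborel U"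
proof -
  have i: "integrable (lebesgue_on K) u" using assms by (simp add: locally_integrable_on_def)
  then have "u \<in> borel_measurable (lebesgue_on K)" by auto
  moreover have "K \<in> sets borel" using assms(2) by (simp add: compact_imp_closed borel_closed)
  ultimately obtain U where "borel_rep K u U" using borel_rep_exists by blast
  then show ?thesis using that i borel_rep_integrable(1) compact_sets_lebesgue[OF assms(2)] by blast
qed

lemma has_weak_partial_weak_pair:
  fixes u v :: "real^'n \<Rightarrow> complex"
  assumes w: "has_weak_partial \<Omega> i u v" and \<Omega>: "open \<Omega>" and K: "compact K" "K \<subseteq> \<Omega>"
    and U: "borel_rep K u U" and V: "borel_rep K v V"
  shows "weak_pair K i U V"
  unfolding weak_pair_def
proof (intro conjI allI impI)
  note Kl = compact_sets_lebesgue[OF K(1)]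
  have \<Omega>l: "\<Omega> \<in> sets lebesgue" using \<Omega> by simp
  show "integrable lborel U" "integrable lborel V"
    using w K borel_rep_integrable(1)[OF U Kl] borel_rep_integrable(1)[OF V Kl]
    by (auto simp: has_weak_partial_def locally_integrable_on_def)
  fix \<phi> :: "real^'n \<Rightarrow> real"
  assume *: "(\<forall>l. Ck_on l \<phi> UNIV) \<and> (\<forall>x. x \<notin> K \<longrightarrow> \<phi> x = 0)"
  then have sm: "Ck_on l \<phi> UNIV" and \<phi>K: "x \<notin> K \<Longrightarrow> \<phi> x = 0" for l x by blast+
  have c: "C1_compact K \<phi>" by (rule smooth_C1_compact[OF sm K(1) \<phi>K])
  have sub: "closure {x. \<phi> x \<noteq> 0} \<subseteq> K" using c by (simp only: C1_compact_def)
  have "test_function \<Omega> \<phi>" by (rule test_functionI[OF sm K \<phi>K])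
  then have "integral\<^sup>L (lebesgue_on \<Omega>) (\<lambda>x. partial_deriv i \<phi> x *\<^sub>R u x)
        = - integral\<^sup>L (lebesgue_on \<Omega>) (\<lambda>x. \<phi> x *\<^sub>R v x)"
    using w by (simp add: has_weak_partial_def)
  moreover have "integral\<^sup>L (lebesgue_on \<Omega>) (\<lambda>x. partial_deriv i \<phi> x *\<^sub>R u x) = (LINT x|lborel. partial_deriv i \<phi> x *\<^sub>R U x)"
  proof (rule borel_rep_transfer_scaleR[OF U Kl \<Omega>l K(2)])
    show "partial_deriv i \<phi> \<in> borel_measurable borel" using C1_compact_integrable(2)[OF c] by auto
    show "partial_deriv i \<phi> x = 0" if "x \<notin> K" for x
      using partial_deriv_support[of x \<phi> i] that sub by blast
  qed
  moreover have "integral\<^sup>L (lebesgue_on \<Omega>) (\<lambda>x. \<phi> x *\<^sub>R v x) = (LINT x|lborel. \<phi> x *\<^sub>R V x)"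
  proof (rule borel_rep_transfer_scaleR[OF V Kl \<Omega>l K(2) _ \<phi>K])
    show "\<phi> \<in> borel_measurable borel" using C1_compact_integrable(1)[OF c] by auto
  qed
  ultimately show "(LINT x|lborel. partial_deriv i \<phi> x *\<^sub>R U x) = - (LINT x|lborel. \<phi> x *\<^sub>R V x)" by simp
qed

text \<open>The support of a cutoff must be surrounded by room for the mollifier, and the enlarged
  set must stay compact because the functions are only locally integrable.\<close>

lemma compact_thickening:
  fixes S :: "'a::euclidean_space set"
  assumes "compact S" "S \<subseteq> \<Omega>" "open \<Omega>"
  obtains K \<delta> where "compact K" "K \<subseteq> \<Omega>" "0 < \<delta>" "\<And>x y. y \<in> S \<Longrightarrow> norm (x - y) < \<delta> \<Longrightarrow> x \<in> K"
proof -
  obtain \<delta> where \<delta>: "0 < \<delta>" "(\<Union>x\<in>S. cball x \<delta>) \<subseteq> \<Omega>"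
    using compact_subset_open_imp_cball_epsilon_subset[OF assms(1,3,2)] by blast
  let ?K = "{x + y |x y. x \<in> S \<and> y \<in> cball 0 \<delta>}"
  show ?thesis
  proof (rule that[of ?K \<delta>])
    show "compact ?K" by (rule compact_sums[OF assms(1) compact_cball])
    show "?K \<subseteq> \<Omega>"
    proof
      fix z assume "z \<in> ?K"
      then obtain x y where "z = x + y" "x \<in> S" "norm y \<le> \<delta>" by auto
      then have "z \<in> cball x \<delta>" by (simp add: dist_norm)
      then show "z \<in> \<Omega>" using \<delta>(2) \<open>x \<in> S\<close> by blast
    qed
    show "x \<in> ?K" if "y \<in> S" "norm (x - y) < \<delta>" for x y
    proof -
      have "x = y + (x - y)" "x - y \<in> cball 0 \<delta>" using that by auto
      then show ?thesis using that(1) by blast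
    qed
  qed (rule \<delta>)
qed

lemma C1_compact_closure:
  "C1_compact \<Omega> \<phi> \<Longrightarrow> C1_compact (closure {x. \<phi> x \<noteq> 0}) \<phi>"
  by (simp only: C1_compact_def) simp

lemma C1_compact_outside: "C1_compact \<Omega> \<phi> \<Longrightarrow> x \<notin> \<Omega> \<Longrightarrow> \<phi> x = 0 \<and> partial_deriv i \<phi> x = 0"
  using partial_deriv_support[of x \<phi> i] closure_subset[of "{x. \<phi> x \<noteq> 0}"] unfolding C1_compact_def by blast

lemma has_weak_partial_C1:
  fixes u v :: "real^'n \<Rightarrow> complex"
  assumes w: "has_weak_partial \<Omega> i u v" and \<Omega>: "open \<Omega>" and \<phi>: "C1_compact \<Omega> \<phi>"
  shows "integral\<^sup>L (lebesgue_on \<Omega>) (\<lambda>x. partial_deriv i \<phi> x *\<^sub>R u x)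
        = - integral\<^sup>L (lebesgue_on \<Omega>) (\<lambda>x. \<phi> x *\<^sub>R v x)"
proof -
  let ?S = "closure {x. \<phi> x \<noteq> 0}"
  have S: "compact ?S" "?S \<subseteq> \<Omega>" using \<phi> by (simp_all only: C1_compact_def)
  note cS = C1_compact_closure[OF \<phi>]
  obtain K \<delta> where K: "compact K" "K \<subseteq> \<Omega>" and \<delta>: "0 < \<delta>" and SK: "\<And>x y. y \<in> ?S \<Longrightarrow> norm (x - y) < \<delta> \<Longrightarrow> x \<in> K"
    using compact_thickening[OF S \<Omega>] by metis
  have SK': "?S \<subseteq> K" using SK \<delta> by fastforce
  obtain U V where U: "borel_rep K u U" and V: "borel_rep K v V"
    using locally_integrable_rep[OF _ K] w unfolding has_weak_partial_def by metis
  note Kl = compact_sets_lebesgue[OF K(1)]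
  have \<Omega>l: "\<Omega> \<in> sets lebesgue" using \<Omega> by simp
  have "(LINT x|lborel. partial_deriv i \<phi> x *\<^sub>R U x) = - (LINT x|lborel. \<phi> x *\<^sub>R V x)"
    by (rule weak_pair_C1[OF has_weak_partial_weak_pair[OF w \<Omega> K U V] cS \<delta> SK])
  moreover have "integral\<^sup>L (lebesgue_on \<Omega>) (\<lambda>x. partial_deriv i \<phi> x *\<^sub>R u x) = (LINT x|lborel. partial_deriv i \<phi> x *\<^sub>R U x)"
  proof (rule borel_rep_transfer_scaleR[OF U Kl \<Omega>l K(2)])
    show "partial_deriv i \<phi> \<in> borel_measurable borel" using C1_compact_integrable(2)[OF \<phi>] by auto
    show "partial_deriv i \<phi> x = 0" if "x \<notin> K" for x
      using C1_compact_outside[OF cS, of x i] that SK' by blast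
  qed
  moreover have "integral\<^sup>L (lebesgue_on \<Omega>) (\<lambda>x. \<phi> x *\<^sub>R v x) = (LINT x|lborel. \<phi> x *\<^sub>R V x)"
  proof (rule borel_rep_transfer_scaleR[OF V Kl \<Omega>l K(2)])
    show "\<phi> \<in> borel_measurable borel" using C1_compact_integrable(1)[OF \<phi>] by auto
    show "\<phi> x = 0" if "x \<notin> K" for x
      using C1_compact_outside[OF cS, of x] that SK' by blast
  qed
  ultimately show ?thesis by simp
qed

lemma integrable_lebesgue_on_subset:
  fixes f :: "'a::euclidean_space \<Rightarrow> 'b::euclidean_space"
  assumes "integrable (lebesgue_on S) f" "T \<subseteq> S" "T \<in> sets lebesgue" "S \<in> sets lebesgue"
  shows "integrable (lebesgue_on T) f"
proof -
  have "integrable lebesgue (\<lambda>x. indicator S x *\<^sub>R f x)"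
    using assms(1,4) by (simp add: integrable_restrict_space)
  from integrable_mult_indicator[OF assms(3) this]
  have "integrable lebesgue (\<lambda>x. indicator T x *\<^sub>R (indicator S x *\<^sub>R f x))" .
  moreover have "(\<lambda>x. indicator T x *\<^sub>R (indicator S x *\<^sub>R f x)) = (\<lambda>x. indicator T x *\<^sub>R f x)"
    using assms(2) by (auto simp: indicator_def fun_eq_iff)
  ultimately have "integrable lebesgue (\<lambda>x. indicator T x *\<^sub>R f x)" by (simp only:)
  then show ?thesis using assms(3) by (simp add: integrable_restrict_space)
qed

lemma L2D:
  assumes "u \<in> L2 \<Omega>"
  shows "u \<in> borel_measurable (lebesgue_on \<Omega>)" "integrable (lebesgue_on \<Omega>) (\<lambda>x. (cmod (u x))\<^sup>2)"
  using assms by (auto simp: L2_def)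

lemma L2_mult_integrable: "u \<in> L2 \<Omega> \<Longrightarrow> v \<in> L2 \<Omega> \<Longrightarrow> integrable (lebesgue_on \<Omega>) (\<lambda>x. u x * v x)"
  by (intro integrable_mult_L2) (auto dest: L2D)

lemma integrable_imp_locally_integrable:
  fixes f :: "real^'n \<Rightarrow> complex"
  assumes "integrable (lebesgue_on \<Omega>) f" "open \<Omega>"
  shows "locally_integrable_on f \<Omega>"
  unfolding locally_integrable_on_def
proof (intro allI impI)
  fix K assume "compact K \<and> K \<subseteq> \<Omega>"
  then show "integrable (lebesgue_on K) f"
    using assms(2) compact_sets_lebesgue[of K] by (intro integrable_lebesgue_on_subset[OF assms(1)]) simp_all
qed

text \<open>Square integrability of all four functions makes the products integrable. For each test
  function the identity is the product rule for Borel representatives on a compact neighbourhood of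
  its support.\<close>

lemma has_weak_partial_mult:
  fixes u v :: "real^'n \<Rightarrow> complex"
  assumes u: "has_weak_partial \<Omega> i u ui" and v: "has_weak_partial \<Omega> i v vi" and \<Omega>: "open \<Omega>"
    and L: "u \<in> L2 \<Omega>" "ui \<in> L2 \<Omega>" "v \<in> L2 \<Omega>" "vi \<in> L2 \<Omega>"
  shows "has_weak_partial \<Omega> i (\<lambda>x. u x * v x) (\<lambda>x. ui x * v x + u x * vi x)"
  unfolding has_weak_partial_def
proof (intro conjI allI impI)
  have \<Omega>l: "\<Omega> \<in> sets lebesgue" using \<Omega> by simp
  show "locally_integrable_on (\<lambda>x. u x * v x) \<Omega>"
    by (intro integrable_imp_locally_integrable L2_mult_integrable L \<Omega>)
  show "locally_integrable_on (\<lambda>x. ui x * v x + u x * vi x) \<Omega>"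
    by (intro integrable_imp_locally_integrable Bochner_Integration.integrable_add L2_mult_integrable L \<Omega>)
  fix \<phi> :: "real^'n \<Rightarrow> real" assume "test_function \<Omega> \<phi>"
  then have sm: "Ck_on l \<phi> UNIV" and S: "compact (closure {x. \<phi> x \<noteq> 0})" "closure {x. \<phi> x \<noteq> 0} \<subseteq> \<Omega>" for l
    by (auto simp: test_function_def)
  let ?S = "closure {x. \<phi> x \<noteq> 0}"
  have \<phi>S: "\<phi> x = 0" if "x \<notin> ?S" for x using that closure_subset[of "{x. \<phi> x \<noteq> 0}"] by blast
  have cS: "C1_compact ?S \<phi>" by (rule smooth_C1_compact[OF sm S(1) \<phi>S])
  obtain K \<delta> where K: "compact K" "K \<subseteq> \<Omega>" and \<delta>: "0 < \<delta>" and SK: "\<And>x y. y \<in> ?S \<Longrightarrow> norm (x - y) < \<delta> \<Longrightarrow> x \<in> K"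
    using compact_thickening[OF S \<Omega>] by metis
  have SK': "?S \<subseteq> K" using SK \<delta> by fastforce
  note Kl = compact_sets_lebesgue[OF K(1)]
  obtain U Ui V Vi where rep: "borel_rep K u U" "borel_rep K ui Ui" "borel_rep K v V" "borel_rep K vi Vi"
    using locally_integrable_rep[OF _ K] u v unfolding has_weak_partial_def by metis
  have m [measurable]: "U \<in> borel_measurable borel" "Ui \<in> borel_measurable borel" "V \<in> borel_measurable borel" "Vi \<in> borel_measurable borel"
    using rep by (auto simp: borel_rep_def)
  have sq: "integrable lborel (\<lambda>x. (cmod (W x))\<^sup>2)" if "w \<in> L2 \<Omega>" "borel_rep K w W" for w W
    using borel_rep_integrable(2)[OF that(2) Kl] integrable_lebesgue_on_subset[OF L2D(2)[OF that(1)] K(2) Kl \<Omega>l] by simp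
  have "weak_pair ?S i (\<lambda>x. U x * V x) (\<lambda>x. Ui x * V x + U x * Vi x)"
    by (rule weak_pair_mult[OF has_weak_partial_weak_pair[OF u \<Omega> K rep(1,2)] has_weak_partial_weak_pair[OF v \<Omega> K rep(3,4)]
        sq[OF L(1) rep(1)] sq[OF L(2) rep(2)] sq[OF L(3) rep(3)] sq[OF L(4) rep(4)] S(1) \<delta> SK])
  then have "(LINT x|lborel. partial_deriv i \<phi> x *\<^sub>R (U x * V x)) = - (LINT x|lborel. \<phi> x *\<^sub>R (Ui x * V x + U x * Vi x))"
    unfolding weak_pair_def using sm \<phi>S by blast
  moreover have "borel_rep K (\<lambda>x. u x * v x) (\<lambda>x. U x * V x)"
    unfolding borel_rep_def
  proof (intro conjI)
    have "AE x in lborel. x \<in> K \<longrightarrow> U x = u x" "AE x in lborel. x \<in> K \<longrightarrow> V x = v x"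
      using rep by (auto simp: borel_rep_def)
    then show "AE x in lborel. x \<in> K \<longrightarrow> U x * V x = u x * v x" by eventually_elim auto
  qed (use rep in \<open>auto simp: borel_rep_def\<close>)
  moreover have "borel_rep K (\<lambda>x. ui x * v x + u x * vi x) (\<lambda>x. Ui x * V x + U x * Vi x)"
    unfolding borel_rep_def
  proof (intro conjI)
    have "AE x in lborel. x \<in> K \<longrightarrow> U x = u x" "AE x in lborel. x \<in> K \<longrightarrow> V x = v x"
      "AE x in lborel. x \<in> K \<longrightarrow> Ui x = ui x" "AE x in lborel. x \<in> K \<longrightarrow> Vi x = vi x"
      using rep by (auto simp: borel_rep_def)
    then show "AE x in lborel. x \<in> K \<longrightarrow> Ui x * V x + U x * Vi x = ui x * v x + u x * vi x" by eventually_elim auto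
  qed (use rep in \<open>auto simp: borel_rep_def\<close>)
  moreover have "partial_deriv i \<phi> \<in> borel_measurable borel" "\<phi> \<in> borel_measurable borel"
    using C1_compact_integrable[OF cS] by auto
  moreover have "\<phi> x = 0" "partial_deriv i \<phi> x = 0" if "x \<notin> K" for x
    using C1_compact_outside[OF cS, of x i] that SK' by blast+
  ultimately show "integral\<^sup>L (lebesgue_on \<Omega>) (\<lambda>x. partial_deriv i \<phi> x *\<^sub>R (u x * v x))
        = - integral\<^sup>L (lebesgue_on \<Omega>) (\<lambda>x. \<phi> x *\<^sub>R (ui x * v x + u x * vi x))"
    using borel_rep_transfer_scaleR[OF _ Kl \<Omega>l K(2)] by simp
qed

text \<open>Fundamental lemma of the calculus of variations. Sharpened bumps turn the hypothesis
  into vanishing integrals over boxes inside a closed box; an open set is a countable union of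
  closed boxes, so the exceptional null sets can be collected.\<close>

lemma AE_zero_if_test_integrals_zero:
  fixes f :: "real^'n \<Rightarrow> complex"
  assumes loc: "locally_integrable_on f \<Omega>" and \<Omega>: "open \<Omega>"
    and z: "\<And>\<phi>. test_function \<Omega> \<phi> \<Longrightarrow> integral\<^sup>L (lebesgue_on \<Omega>) (\<lambda>x. \<phi> x *\<^sub>R f x) = 0"
  shows "AE x in lebesgue_on \<Omega>. f x = 0"
proof -
  have \<Omega>l: "\<Omega> \<in> sets lebesgue" using \<Omega> by simp
  have local: "AE x in lborel. x \<in> cbox a b \<longrightarrow> f x = 0" if sub: "cbox a b \<subseteq> \<Omega>" for a b
  proof -
    let ?C = "cbox a b"
    obtain F where F: "borel_rep ?C f F" "integrable lborel F"
      using locally_integrable_rep[OF loc compact_cbox sub] by blast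
    have [measurable]: "F \<in> borel_measurable borel" using F by auto
    have Cl: "?C \<in> sets lebesgue" by simp
    have F0: "F x = 0" if "x \<notin> ?C" for x using F(1) that by (simp add: borel_rep_def)
    have box0: "(LINT x|lborel. indicator (box c d) x *\<^sub>R F x) = 0" if "box c d \<subseteq> ?C" "box c d \<noteq> {}" for c d
    proof -
      have cd: "cbox c d \<subseteq> ?C" using closure_minimal[OF that(1) closed_cbox] closure_box[OF that(2)] by simp
      have "(LINT x|lborel. bump (real (Suc n)) c d x *\<^sub>R F x) = 0" for n
      proof -
        have "integral\<^sup>L (lebesgue_on \<Omega>) (\<lambda>x. bump (real (Suc n)) c d x *\<^sub>R f x) = (LINT x|lborel. bump (real (Suc n)) c d x *\<^sub>R F x)"
        proof (rule borel_rep_transfer_scaleR[OF F(1) Cl \<Omega>l sub])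
          show "bump (real (Suc n)) c d \<in> borel_measurable borel"
            using Ck_on_bump[of 0 "real (Suc n)" c d] by (simp add: borel_measurable_continuous_onI)
          show "bump (real (Suc n)) c d x = 0" if "x \<notin> ?C" for x
            using that \<open>box c d \<subseteq> ?C\<close> by (intro bump_eq_0) auto
        qed
        moreover have "test_function \<Omega> (bump (real (Suc n)) c d)"
          using cd sub by (intro test_function_bump) auto
        ultimately show ?thesis using z by simp
      qed
      moreover have "(\<lambda>n. LINT x|lborel. bump (real (Suc n)) c d x *\<^sub>R F x) \<longlonglongrightarrow> (LINT x|lborel. indicator (box c d) x *\<^sub>R F x)"
      proof (rule integral_dominated_convergence[where w = "\<lambda>x. cmod (F x)"])
        have "bump (real (Suc n)) c d \<in> borel_measurable borel" for n
          using Ck_on_bump[of 0 "real (Suc n)" c d] by (simp add: borel_measurable_continuous_onI)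
        note [measurable] = this
        show "(\<lambda>x. bump (real (Suc n)) c d x *\<^sub>R F x) \<in> borel_measurable lborel" for n by measurable
        show "AE x in lborel. (\<lambda>n. bump (real (Suc n)) c d x *\<^sub>R F x) \<longlonglongrightarrow> indicator (box c d) x *\<^sub>R F x"
          by (intro AE_I2 tendsto_scaleR tendsto_const bump_tendsto_indicator)
        show "AE x in lborel. norm (bump (real (Suc n)) c d x *\<^sub>R F x) \<le> cmod (F x)" for n
          by (intro AE_I2) (simp add: bump_nonneg bump_le_1 mult_left_le_one_le)
      qed (use F(2) in auto)
      ultimately show ?thesis by (simp add: LIMSEQ_const_iff)
    qed
    have "AE x in lborel. F x = 0"
    proof (rule integral_density_zero_box[OF F(2)])
      fix c d :: "real^'n"
      \<comment> \<open>An arbitrary box is cut down to one inside \<open>cbox a b\<close>: F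
        vanishes outside, and the closed box differs from the open one by a null set.\<close>
      let ?c = "\<Sum>i\<in>Basis. max (c \<bullet> i) (a \<bullet> i) *\<^sub>R i" and ?d = "\<Sum>i\<in>Basis. min (d \<bullet> i) (b \<bullet> i) *\<^sub>R i"
      have i: "box c d \<inter> box a b = box ?c ?d" by (simp add: box_Int_box)
      have "?C - box a b \<in> null_sets lborel"
      proof -
        have "negligible (?C - box a b)" by (rule negligible_frontier_interval)
        then have "?C - box a b \<in> null_sets lebesgue" by (simp add: negligible_iff_null_sets)
        then show ?thesis by (subst (asm) null_sets_completion_iff) auto
      qed
      then have "AE x in lborel. x \<notin> ?C - box a b" by (rule AE_not_in)
      then have "AE x in lborel. indicator (box c d) x *\<^sub>R F x = indicator (box ?c ?d) x *\<^sub>R F x"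
        unfolding i[symmetric] by eventually_elim (use F0 in \<open>auto simp: indicator_def\<close>)
      then have "(LINT x|lborel. indicator (box c d) x *\<^sub>R F x) = (LINT x|lborel. indicator (box ?c ?d) x *\<^sub>R F x)"
        by (intro integral_cong_AE) auto
      also have "\<dots> = 0"
      proof (cases "box ?c ?d = {}")
        case False
        then show ?thesis using i box_subset_cbox[of a b] by (intro box0) auto
      qed simp
      finally show "(LINT x|lborel. indicator (box c d) x *\<^sub>R F x) = 0" .
    qed
    moreover have "AE x in lborel. x \<in> ?C \<longrightarrow> F x = f x" using F(1) by (simp add: borel_rep_def)
    ultimately show ?thesis by eventually_elim auto
  qed
  obtain \<D> where \<D>: "countable \<D>" "\<D> \<subseteq> Pow \<Omega>" "\<And>X. X \<in> \<D> \<Longrightarrow> \<exists>a b. X = cbox a b" "\<Union>\<D> = \<Omega>"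
    using open_countable_Union_open_cbox[OF \<Omega>] by metis
  have "AE x in lborel. \<forall>X\<in>\<D>. x \<in> X \<longrightarrow> f x = 0"
    unfolding AE_ball_countable[OF \<D>(1)] using local \<D>(2,3) by (metis PowD subsetD)
  then have "AE x in lborel. x \<in> \<Omega> \<longrightarrow> f x = 0"
    by eventually_elim (use \<D>(4) in blast)
  then show ?thesis by (simp add: AE_lebesgue_on_iff[OF \<Omega>l])
qed

section \<open>\<open>L\<^sup>2\<close> and the Sobolev space of order one\<close>

lemma finite_measure_lebesgue_on:
  assumes "bounded S" "S \<in> sets lebesgue" shows "finite_measure (lebesgue_on S)"
proof (rule finite_measureI)
  have "emeasure lebesgue S < \<infinity>"
    using bounded_set_imp_lmeasurable[OF assms] by (auto simp: fmeasurable_def)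
  then show "emeasure (lebesgue_on S) (space (lebesgue_on S)) \<noteq> \<infinity>"
    using assms(2) by (simp add: emeasure_restrict_space)
qed

lemma Linfty_L2:
  assumes f: "f \<in> Linfty \<Omega>" and \<Omega>: "bounded \<Omega>" "\<Omega> \<in> sets lebesgue"
  shows "f \<in> L2 \<Omega>"
proof -
  interpret finite_measure "lebesgue_on \<Omega>" by (rule finite_measure_lebesgue_on[OF \<Omega>])
  obtain B where m [measurable]: "f \<in> borel_measurable (lebesgue_on \<Omega>)" and B: "AE x in lebesgue_on \<Omega>. cmod (f x) \<le> B"
    using f by (auto simp: Linfty_def)
  have "integrable (lebesgue_on \<Omega>) (\<lambda>x. (cmod (f x))\<^sup>2)"
  proof (rule integrable_const_bound)
    show "AE x in lebesgue_on \<Omega>. norm ((cmod (f x))\<^sup>2) \<le> B\<^sup>2"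
      using B by eventually_elim (simp add: power_mono)
  qed measurable
  with m show ?thesis by (simp add: L2_def)
qed

lemma borel_measurable_lebesgue_on_AE:
  fixes f g :: "'a::euclidean_space \<Rightarrow> complex"
  assumes f: "f \<in> borel_measurable (lebesgue_on S)" and ae: "AE x in lebesgue_on S. f x = g x" and S: "S \<in> sets lebesgue"
  shows "g \<in> borel_measurable (lebesgue_on S)"
proof -
  have "(\<lambda>x. indicator S x *\<^sub>R f x) \<in> borel_measurable lebesgue"
    using f S by (simp add: borel_measurable_restrict_space_iff)
  moreover have "AE x in lebesgue. indicator S x *\<^sub>R f x = indicator S x *\<^sub>R g x"
  proof -
    have "AE x in lborel. x \<in> S \<longrightarrow> f x = g x" using ae by (simp only: AE_lebesgue_on_iff[OF S])
    then have "AE x in lborel. indicator S x *\<^sub>R f x = indicator S x *\<^sub>R g x"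
      by eventually_elim (auto simp: indicator_def)
    then show ?thesis by (rule AE_completion)
  qed
  ultimately have "(\<lambda>x. indicator S x *\<^sub>R g x) \<in> borel_measurable lebesgue"
    by (rule borel_measurable_AE)
  then show ?thesis using S by (simp add: borel_measurable_restrict_space_iff)
qed

lemma L2_cong_AE:
  assumes u: "u \<in> L2 \<Omega>" and ae: "AE x in lebesgue_on \<Omega>. u x = v x" and \<Omega>: "\<Omega> \<in> sets lebesgue"
  shows "v \<in> L2 \<Omega>"
proof -
  note L2D(1)[OF u, measurable]
  have v [measurable]: "v \<in> borel_measurable (lebesgue_on \<Omega>)"
    by (rule borel_measurable_lebesgue_on_AE[OF L2D(1)[OF u] ae \<Omega>])
  have "integrable (lebesgue_on \<Omega>) (\<lambda>x. (cmod (v x))\<^sup>2)"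
  proof (rule integrable_cong_AE_imp[OF L2D(2)[OF u]])
    show "AE x in lebesgue_on \<Omega>. (cmod (u x))\<^sup>2 = (cmod (v x))\<^sup>2" using ae by eventually_elim simp
  qed measurable
  with v show ?thesis by (simp add: L2_def)
qed

lemma L2_add: assumes "u \<in> L2 \<Omega>" "v \<in> L2 \<Omega>" shows "(\<lambda>x. u x + v x) \<in> L2 \<Omega>"
proof -
  note L2D(1)[OF assms(1), measurable] L2D(1)[OF assms(2), measurable]
  have "integrable (lebesgue_on \<Omega>) (\<lambda>x. (cmod (u x - - v x))\<^sup>2)"
    by (rule integrable_square_diff) (use L2D[OF assms(1)] L2D[OF assms(2)] in auto)
  then show ?thesis by (simp add: L2_def)
qed

lemma L2_scale: assumes "u \<in> L2 \<Omega>" shows "(\<lambda>x. c * u x) \<in> L2 \<Omega>"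
  using L2D[OF assms] by (auto simp: L2_def norm_mult power_mult_distrib)

lemma L2_cnj: assumes "u \<in> L2 \<Omega>" shows "(\<lambda>x. cnj (u x)) \<in> L2 \<Omega>"
proof -
  have "(\<lambda>x. cnj (u x)) \<in> borel_measurable (lebesgue_on \<Omega>)"
    by (rule measurable_compose[OF L2D(1)[OF assms]]) (intro borel_measurable_continuous_onI continuous_intros)
  then show ?thesis using L2D[OF assms] by (simp add: L2_def)
qed

lemma L2_zero: "(\<lambda>x. 0) \<in> L2 \<Omega>"
  by (simp add: L2_def)

definition ip0 :: "(real^'n::finite) set \<Rightarrow> (real^'n \<Rightarrow> complex) \<Rightarrow> (real^'n \<Rightarrow> complex) \<Rightarrow> complex" where
  "ip0 \<Omega> u v = integral\<^sup>L (lebesgue_on \<Omega>) (\<lambda>x. u x * cnj (v x))"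

lemma ip0_integrable: "u \<in> L2 \<Omega> \<Longrightarrow> v \<in> L2 \<Omega> \<Longrightarrow> integrable (lebesgue_on \<Omega>) (\<lambda>x. u x * cnj (v x))"
  by (rule L2_mult_integrable[OF _ L2_cnj])

lemma ip0_self: "ip0 \<Omega> u u = complex_of_real (integral\<^sup>L (lebesgue_on \<Omega>) (\<lambda>x. (cmod (u x))\<^sup>2))"
  unfolding ip0_def complex_norm_square[symmetric] by (rule integral_complex_of_real)

lemma semi_inner_product_L2: "semi_inner_product (L2 \<Omega>) (ip0 \<Omega>)"
proof
  show "ip0 \<Omega> (\<lambda>x. u x + v x) w = ip0 \<Omega> u w + ip0 \<Omega> v w"
    if "u \<in> L2 \<Omega>" "v \<in> L2 \<Omega>" "w \<in> L2 \<Omega>" for u v w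
    unfolding ip0_def distrib_right using that by (intro Bochner_Integration.integral_add ip0_integrable)
  show "ip0 \<Omega> (\<lambda>x. c * u x) w = c * ip0 \<Omega> u w" for c u w
    unfolding ip0_def mult.assoc by (rule integral_mult_right_zero)
  show "ip0 \<Omega> v u = cnj (ip0 \<Omega> u v)" for u v
    unfolding ip0_def Bochner_Integration.integral_cnj[symmetric] by (simp add: mult.commute)
  show "0 \<le> Re (ip0 \<Omega> u u)" for u unfolding ip0_self by simp
qed (auto intro: L2_zero L2_add L2_scale)

text \<open>The rewrite makes the abstract norm facts speak of \<open>L2_norm\<close> itself. The
  analogous identity for H1, \<open>nrm_ip1\<close>, is applied by hand, since there the form is a
  semi-inner product only after \<Omega> is known to be open.\<close>

interpretation L2: semi_inner_product "L2 \<Omega>" "ip0 \<Omega>"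
  rewrites "semi_inner_product.nrm (ip0 \<Omega>) = L2_norm \<Omega>"
  for \<Omega> :: "(real^'n::finite) set"
proof -
  interpret semi_inner_product "L2 \<Omega>" "ip0 \<Omega>" by (rule semi_inner_product_L2)
  show "semi_inner_product (L2 \<Omega>) (ip0 \<Omega>)" by (rule semi_inner_product_L2)
  show "nrm = L2_norm \<Omega>" by (rule ext) (simp add: nrm_def L2_norm_def ip0_self)
qed

lemma ip0_cong_AE:
  assumes "u \<in> L2 \<Omega>" "u' \<in> L2 \<Omega>" "v \<in> L2 \<Omega>" "v' \<in> L2 \<Omega>"
    "AE x in lebesgue_on \<Omega>. u x = u' x" "AE x in lebesgue_on \<Omega>. v x = v' x"
  shows "ip0 \<Omega> u v = ip0 \<Omega> u' v'"
  unfolding ip0_def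
proof (rule integral_cong_AE)
  show "AE x in lebesgue_on \<Omega>. u x * cnj (v x) = u' x * cnj (v' x)"
    using assms(5,6) by eventually_elim simp
qed (use ip0_integrable assms(1-4) in \<open>blast intro: borel_measurable_integrable\<close>)+

text \<open>Riesz-Fischer. On a bounded set a Cauchy sequence in L2 is Cauchy in L1, which supplies
  an almost everywhere convergent subsequence. Fatou's lemma bounds the L2 distance of the original
  terms to its limit.\<close>

lemma L2_complete:
  assumes \<Omega>: "\<Omega> \<in> sets lebesgue" "bounded \<Omega>" and s: "\<And>n. s n \<in> L2 \<Omega>"
    and C: "\<And>e. 0 < e \<Longrightarrow> \<exists>N. \<forall>m\<ge>N. \<forall>n\<ge>N. L2_norm \<Omega> (\<lambda>x. s m x - s n x) < e"
  shows "\<exists>u\<in>L2 \<Omega>. (\<lambda>n. L2_norm \<Omega> (\<lambda>x. s n x - u x)) \<longlonglongrightarrow> 0"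
proof -
  let ?M = "lebesgue_on \<Omega>"
  interpret finite_measure ?M by (rule finite_measure_lebesgue_on[OF \<Omega>(2,1)])
  note [measurable] = L2D(1)[OF s]
  have one: "(\<lambda>x. 1) \<in> L2 \<Omega>" by (simp add: L2_def)
  have L1: "integrable ?M f" "integral\<^sup>L ?M (\<lambda>x. cmod (f x)) \<le> L2_norm \<Omega> f * L2_norm \<Omega> (\<lambda>x. 1)" if f: "f \<in> L2 \<Omega>" for f
  proof -
    show i: "integrable ?M f" using ip0_integrable[OF f one] by simp
    have a: "(\<lambda>x. complex_of_real (cmod (f x))) \<in> L2 \<Omega>" using L2D[OF f] by (auto simp: L2_def)
    have "ip0 \<Omega> (\<lambda>x. complex_of_real (cmod (f x))) (\<lambda>x. 1) = complex_of_real (integral\<^sup>L ?M (\<lambda>x. cmod (f x)))"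
      by (simp add: ip0_def)
    then have "integral\<^sup>L ?M (\<lambda>x. cmod (f x)) \<le> cmod (ip0 \<Omega> (\<lambda>x. complex_of_real (cmod (f x))) (\<lambda>x. 1))" by simp
    also have "\<dots> \<le> L2_norm \<Omega> (\<lambda>x. complex_of_real (cmod (f x))) * L2_norm \<Omega> (\<lambda>x. 1)"
      by (rule L2.cauchy_schwarz[OF a one])
    finally show "integral\<^sup>L ?M (\<lambda>x. cmod (f x)) \<le> L2_norm \<Omega> f * L2_norm \<Omega> (\<lambda>x. 1)"
      by (simp add: L2_norm_def)
  qed
  obtain r where r: "strict_mono r" and ae: "AE x in ?M. Cauchy (\<lambda>i. s (r i) x)"
  proof (rule cauchy_L1_AE_cauchy_subseq[of ?M s])
    show "integrable ?M (s n)" for n by (rule L1(1)[OF s])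
    fix e :: real assume e: "0 < e"
    \<comment> \<open>The 1 keeps the divisor positive when \<Omega> has measure 0.\<close>
    let ?c = "L2_norm \<Omega> (\<lambda>x. 1) + 1"
    have c: "0 < ?c" using L2.nrm_nonneg[OF one] by linarith
    obtain N where N: "\<And>m n. m \<ge> N \<Longrightarrow> n \<ge> N \<Longrightarrow> L2_norm \<Omega> (\<lambda>x. s m x - s n x) < e / ?c"
      using C[of "e / ?c"] e c by (meson divide_pos_pos)
    have "integral\<^sup>L ?M (\<lambda>x. cmod (s m x - s n x)) < e" if "m \<ge> N" "n \<ge> N" for m n
    proof -
      have d: "(\<lambda>x. s m x - s n x) \<in> L2 \<Omega>" using s by simp
      have "integral\<^sup>L ?M (\<lambda>x. cmod (s m x - s n x)) \<le> L2_norm \<Omega> (\<lambda>x. s m x - s n x) * L2_norm \<Omega> (\<lambda>x. 1)"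
        by (rule L1(2)[OF d])
      also have "\<dots> \<le> L2_norm \<Omega> (\<lambda>x. s m x - s n x) * ?c"
        using L2.nrm_nonneg[OF d] by (intro mult_left_mono) auto
      also have "\<dots> < e" using N[OF that] c by (simp add: pos_less_divide_eq)
      finally show ?thesis .
    qed
    then show "\<exists>N. \<forall>i\<ge>N. \<forall>j\<ge>N. integral\<^sup>L ?M (\<lambda>x. cmod (s i x - s j x)) < e" by blast
  qed
  define u where "u x = lim (\<lambda>i. s (r i) x)" for x
  have um [measurable]: "u \<in> borel_measurable ?M" unfolding u_def by measurable
  have lim: "AE x in ?M. (\<lambda>i. s (r i) x) \<longlonglongrightarrow> u x"
    using ae by eventually_elim (simp add: u_def Cauchy_convergent_iff convergent_LIMSEQ_iff)
  \<comment> \<open>Fatou's lemma along the subsequence, whose indices are eventually at least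
    N.\<close>
  have bound: "(\<integral>\<^sup>+x. ennreal ((cmod (s n x - u x))\<^sup>2) \<partial>?M) \<le> ennreal (e\<^sup>2)"
    if e: "0 < e" and N: "\<And>m. m \<ge> N \<Longrightarrow> L2_norm \<Omega> (\<lambda>x. s n x - s m x) < e" for n N e
  proof -
    have "(\<integral>\<^sup>+x. ennreal ((cmod (s n x - u x))\<^sup>2) \<partial>?M)
        = (\<integral>\<^sup>+x. liminf (\<lambda>i. ennreal ((cmod (s n x - s (r i) x))\<^sup>2)) \<partial>?M)"
    proof (rule nn_integral_cong_AE)
      show "AE x in ?M. ennreal ((cmod (s n x - u x))\<^sup>2) = liminf (\<lambda>i. ennreal ((cmod (s n x - s (r i) x))\<^sup>2))"
        using lim
      proof eventually_elim
        case (elim x)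
        have "(\<lambda>i. ennreal ((cmod (s n x - s (r i) x))\<^sup>2)) \<longlonglongrightarrow> ennreal ((cmod (s n x - u x))\<^sup>2)"
          by (intro tendsto_ennrealI tendsto_intros elim)
        then show ?case by (rule lim_imp_Liminf[symmetric, OF sequentially_bot])
      qed
    qed
    also have "\<dots> \<le> liminf (\<lambda>i. \<integral>\<^sup>+x. ennreal ((cmod (s n x - s (r i) x))\<^sup>2) \<partial>?M)"
      by (rule nn_integral_liminf) measurable
    also have "\<dots> \<le> ennreal (e\<^sup>2)"
    proof (rule Liminf_le)
      show "\<forall>\<^sub>F i in sequentially. (\<integral>\<^sup>+x. ennreal ((cmod (s n x - s (r i) x))\<^sup>2) \<partial>?M) \<le> ennreal (e\<^sup>2)"
        using eventually_ge_at_top[of N]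
      proof eventually_elim
        case (elim i)
        then have ri: "r i \<ge> N" using strict_mono_imp_increasing[OF r, of i] by linarith
        have d: "(\<lambda>x. s n x - s (r i) x) \<in> L2 \<Omega>" using s by simp
        have "(\<integral>\<^sup>+x. ennreal ((cmod (s n x - s (r i) x))\<^sup>2) \<partial>?M) = ennreal (integral\<^sup>L ?M (\<lambda>x. (cmod (s n x - s (r i) x))\<^sup>2))"
          by (rule nn_integral_eq_integral[OF L2D(2)[OF d]]) simp
        also have "integral\<^sup>L ?M (\<lambda>x. (cmod (s n x - s (r i) x))\<^sup>2) = (L2_norm \<Omega> (\<lambda>x. s n x - s (r i) x))\<^sup>2"
          by (simp add: L2_norm_def)
        also have "ennreal \<dots> \<le> ennreal (e\<^sup>2)"
          using N[OF ri] L2.nrm_nonneg[OF d] by (intro ennreal_leI power_mono) auto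
        finally show ?case .
      qed
    qed simp
    finally show ?thesis .
  qed
  have diff: "(\<lambda>x. s n x - u x) \<in> L2 \<Omega> \<and> L2_norm \<Omega> (\<lambda>x. s n x - u x) \<le> e"
    if e: "0 < e" and N: "\<And>m. m \<ge> N \<Longrightarrow> L2_norm \<Omega> (\<lambda>x. s n x - s m x) < e" for n N e
  proof -
    have b: "(\<integral>\<^sup>+x. ennreal ((cmod (s n x - u x))\<^sup>2) \<partial>?M) \<le> ennreal (e\<^sup>2)"
      by (rule bound[OF e N])
    then have b': "(\<integral>\<^sup>+x. ennreal ((cmod (s n x - u x))\<^sup>2) \<partial>?M) < \<infinity>"
      by (rule le_less_trans) simp
    have i: "integrable ?M (\<lambda>x. (cmod (s n x - u x))\<^sup>2)"
      by (rule integrableI_bounded) (use b' in auto)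
    have "ennreal (integral\<^sup>L ?M (\<lambda>x. (cmod (s n x - u x))\<^sup>2)) \<le> ennreal (e\<^sup>2)"
      using b nn_integral_eq_integral[OF i] by simp
    then have "integral\<^sup>L ?M (\<lambda>x. (cmod (s n x - u x))\<^sup>2) \<le> e\<^sup>2" by (simp add: ennreal_le_iff)
    then have "L2_norm \<Omega> (\<lambda>x. s n x - u x) \<le> e"
      unfolding L2_norm_def using e by (simp add: real_le_lsqrt real_sqrt_le_iff)
    then show ?thesis using i by (simp add: L2_def)
  qed
  obtain N1 where "\<And>m n. m \<ge> N1 \<Longrightarrow> n \<ge> N1 \<Longrightarrow> L2_norm \<Omega> (\<lambda>x. s m x - s n x) < 1" using C[of 1] by auto
  then have d1: "(\<lambda>x. s N1 x - u x) \<in> L2 \<Omega>" using diff[of 1 N1 N1] by simp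
  have "(\<lambda>x. s N1 x - (s N1 x - u x)) \<in> L2 \<Omega>" by (intro L2.diff_mem s d1)
  then have uL: "u \<in> L2 \<Omega>" by simp
  have "(\<lambda>n. L2_norm \<Omega> (\<lambda>x. s n x - u x)) \<longlonglongrightarrow> 0"
  proof (rule LIMSEQ_I)
    fix e :: real assume "0 < e"
    then obtain N where N: "\<And>m n. m \<ge> N \<Longrightarrow> n \<ge> N \<Longrightarrow> L2_norm \<Omega> (\<lambda>x. s m x - s n x) < e / 2"
      using C[of "e / 2"] by auto
    have "norm (L2_norm \<Omega> (\<lambda>x. s n x - u x) - 0) < e" if "n \<ge> N" for n
      using diff[of "e / 2" N n] N[OF that] \<open>0 < e\<close> L2.nrm_nonneg[OF L2.diff_mem[OF s uL]] by fastforce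
    then show "\<exists>N. \<forall>n\<ge>N. norm (L2_norm \<Omega> (\<lambda>x. s n x - u x) - 0) < e" by blast
  qed
  with uL show ?thesis by blast
qed

section \<open>Calculus of weak derivatives\<close>

lemma test_mult_integrable:
  fixes g :: "real^'n \<Rightarrow> complex"
  assumes g: "locally_integrable_on g \<Omega>" and \<phi>: "C1_compact \<Omega> \<phi>" and \<Omega>: "\<Omega> \<in> sets lebesgue"
  shows "integrable (lebesgue_on \<Omega>) (\<lambda>x. \<phi> x *\<^sub>R g x)"
    and "integrable (lebesgue_on \<Omega>) (\<lambda>x. partial_deriv i \<phi> x *\<^sub>R g x)"
proof -
  let ?S = "closure {x. \<phi> x \<noteq> 0}"
  have S: "compact ?S" "?S \<subseteq> \<Omega>" using \<phi> by (simp_all only: C1_compact_def)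
  note cS = C1_compact_closure[OF \<phi>]
  obtain G where G: "borel_rep ?S g G" "integrable lborel G" using locally_integrable_rep[OF g S] by blast
  have [measurable]: "G \<in> borel_measurable borel" using G by auto
  obtain B where B: "\<And>x. \<bar>\<phi> x\<bar> \<le> B" "\<And>x. \<bar>partial_deriv i \<phi> x\<bar> \<le> B"
    using smooth_bound[OF \<phi>, of i] by blast
  have [measurable]: "\<phi> \<in> borel_measurable borel" "partial_deriv i \<phi> \<in> borel_measurable borel"
    using C1_compact_integrable[OF \<phi>] by auto
  have "integrable lborel (\<lambda>x. \<phi> x *\<^sub>R G x)" by (rule bounded_mult_L2(1)[OF _ B(1) _ G(2)]) measurable
  then show "integrable (lebesgue_on \<Omega>) (\<lambda>x. \<phi> x *\<^sub>R g x)"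
  proof (rule iffD2[OF borel_rep_transfer(2)[OF G(1) compact_sets_lebesgue[OF S(1)] \<Omega> S(2), where h = "\<lambda>x z. \<phi> x *\<^sub>R z"], rotated 2])
    show "\<phi> x *\<^sub>R z = 0" if "x \<notin> ?S" for x and z :: complex
      using C1_compact_outside[OF cS that, of i] by (simp only: scaleR_zero_left)
  qed measurable
  have "integrable lborel (\<lambda>x. partial_deriv i \<phi> x *\<^sub>R G x)" by (rule bounded_mult_L2(1)[OF _ B(2) _ G(2)]) measurable
  then show "integrable (lebesgue_on \<Omega>) (\<lambda>x. partial_deriv i \<phi> x *\<^sub>R g x)"
  proof (rule iffD2[OF borel_rep_transfer(2)[OF G(1) compact_sets_lebesgue[OF S(1)] \<Omega> S(2), where h = "\<lambda>x z. partial_deriv i \<phi> x *\<^sub>R z"], rotated 2])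
    show "partial_deriv i \<phi> x *\<^sub>R z = 0" if "x \<notin> ?S" for x and z :: complex
      using C1_compact_outside[OF cS that, of i] by (simp only: scaleR_zero_left)
  qed measurable
qed

lemma locally_integrable_add:
  "locally_integrable_on f \<Omega> \<Longrightarrow> locally_integrable_on g \<Omega> \<Longrightarrow> locally_integrable_on (\<lambda>x. f x + g x) \<Omega>"
  by (simp add: locally_integrable_on_def)

lemma locally_integrable_scale:
  fixes f :: "real^'n \<Rightarrow> complex"
  shows "locally_integrable_on f \<Omega> \<Longrightarrow> locally_integrable_on (\<lambda>x. c * f x) \<Omega>"
  by (simp add: locally_integrable_on_def)

lemma L2_locally_integrable:
  assumes "u \<in> L2 \<Omega>" "open \<Omega>" shows "locally_integrable_on u \<Omega>"
  unfolding locally_integrable_on_def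
proof (intro allI impI)
  fix K assume K: "compact K \<and> K \<subseteq> \<Omega>"
  have Kl: "K \<in> sets lebesgue" "K \<in> sets borel" using K compact_sets_lebesgue by (auto simp: compact_imp_closed borel_closed)
  have fin: "emeasure lebesgue K < \<infinity>"
    using K lmeasurable_compact[of K] by (auto simp: fmeasurable_def)
  have m: "u \<in> borel_measurable (lebesgue_on K)"
    using measurable_restrict_mono[OF L2D(1)[OF assms(1)], of K] K by simp
  have "integrable (lebesgue_on K) (\<lambda>x. (cmod (u x))\<^sup>2)"
    using integrable_lebesgue_on_subset[OF L2D(2)[OF assms(1)] _ Kl(1)] K assms(2) by simp
  moreover have "integrable (lebesgue_on K) (\<lambda>x. (cmod 1)\<^sup>2)"
  proof (rule finite_measure.integrable_const)
    show "finite_measure (lebesgue_on K)"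
      by (rule finite_measureI) (use fin Kl in \<open>simp add: emeasure_restrict_space\<close>)
  qed
  ultimately have "integrable (lebesgue_on K) (\<lambda>x. u x * 1)"
    by (rule integrable_mult_L2) (use m in auto)
  then show "integrable (lebesgue_on K) u" by simp
qed

lemma has_weak_partial_add:
  fixes u v :: "real^'n \<Rightarrow> complex"
  assumes u: "has_weak_partial \<Omega> i u g" and v: "has_weak_partial \<Omega> i v h" and \<Omega>: "\<Omega> \<in> sets lebesgue"
  shows "has_weak_partial \<Omega> i (\<lambda>x. u x + v x) (\<lambda>x. g x + h x)"
  unfolding has_weak_partial_def
proof (intro conjI allI impI)
  have L: "locally_integrable_on u \<Omega>" "locally_integrable_on v \<Omega>" "locally_integrable_on g \<Omega>" "locally_integrable_on h \<Omega>"
    using u v by (auto simp: has_weak_partial_def)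
  show "locally_integrable_on (\<lambda>x. u x + v x) \<Omega>" "locally_integrable_on (\<lambda>x. g x + h x) \<Omega>"
    using L by (auto intro: locally_integrable_add)
  fix \<phi> assume \<phi>: "test_function \<Omega> \<phi>"
  note c = test_function_C1_compact[OF \<phi>]
  show "integral\<^sup>L (lebesgue_on \<Omega>) (\<lambda>x. partial_deriv i \<phi> x *\<^sub>R (u x + v x))
        = - integral\<^sup>L (lebesgue_on \<Omega>) (\<lambda>x. \<phi> x *\<^sub>R (g x + h x))"
    using u v \<phi> test_mult_integrable(2)[OF L(1) c \<Omega>, of i] test_mult_integrable(2)[OF L(2) c \<Omega>, of i]
      test_mult_integrable(1)[OF L(3) c \<Omega>] test_mult_integrable(1)[OF L(4) c \<Omega>]
    by (simp add: scaleR_add_right has_weak_partial_def)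
qed

lemma has_weak_partial_scale:
  fixes u :: "real^'n \<Rightarrow> complex"
  assumes u: "has_weak_partial \<Omega> i u g"
  shows "has_weak_partial \<Omega> i (\<lambda>x. c * u x) (\<lambda>x. c * g x)"
proof -
  have s: "r *\<^sub>R (c * z) = c * (r *\<^sub>R z)" for r z by simp
  show ?thesis using u unfolding has_weak_partial_def s integral_mult_right_zero
    by (auto intro: locally_integrable_scale simp: mult_scaleR_right[symmetric] simp del: mult_scaleR_right)
qed

lemma has_weak_partial_cnj:
  fixes u :: "real^'n \<Rightarrow> complex"
  assumes u: "has_weak_partial \<Omega> i u g"
  shows "has_weak_partial \<Omega> i (\<lambda>x. cnj (u x)) (\<lambda>x. cnj (g x))"
proof -
  have s: "r *\<^sub>R cnj z = cnj (r *\<^sub>R z)" for r z by simp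
  show ?thesis using u unfolding has_weak_partial_def s Bochner_Integration.integral_cnj
    by (simp add: locally_integrable_on_def complex_cnj_minus[symmetric] del: complex_cnj_minus complex_cnj_scaleR)
qed

lemma has_weak_partial_of_real:
  fixes u :: "real^'n \<Rightarrow> real"
  assumes u: "has_weak_partial \<Omega> i u g"
  shows "has_weak_partial \<Omega> i (\<lambda>x. complex_of_real (u x)) (\<lambda>x. complex_of_real (g x))"
proof -
  have s: "r *\<^sub>R complex_of_real z = complex_of_real (r *\<^sub>R z)" for r z by (simp add: scaleR_conv_of_real)
  show ?thesis using u unfolding has_weak_partial_def s integral_complex_of_real
    by (simp add: locally_integrable_on_def)
qed

lemma has_weak_partial_unique:
  fixes u :: "real^'n \<Rightarrow> complex"
  assumes g: "has_weak_partial \<Omega> i u g" and h: "has_weak_partial \<Omega> i u h" and \<Omega>: "open \<Omega>"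
  shows "AE x in lebesgue_on \<Omega>. g x = h x"
proof -
  have \<Omega>l: "\<Omega> \<in> sets lebesgue" using \<Omega> by simp
  have L: "locally_integrable_on g \<Omega>" "locally_integrable_on h \<Omega>"
    using g h by (auto simp: has_weak_partial_def)
  have L': "locally_integrable_on (\<lambda>x. (-1) * h x) \<Omega>" using L(2) by (rule locally_integrable_scale)
  have "AE x in lebesgue_on \<Omega>. g x + (-1) * h x = 0"
  proof (rule AE_zero_if_test_integrals_zero[OF locally_integrable_add[OF L(1) L'] \<Omega>])
    fix \<phi> assume \<phi>: "test_function \<Omega> \<phi>"
    note c = test_function_C1_compact[OF \<phi>]
    have "integral\<^sup>L (lebesgue_on \<Omega>) (\<lambda>x. \<phi> x *\<^sub>R (g x + (-1) * h x))
      = integral\<^sup>L (lebesgue_on \<Omega>) (\<lambda>x. \<phi> x *\<^sub>R g x) - integral\<^sup>L (lebesgue_on \<Omega>) (\<lambda>x. \<phi> x *\<^sub>R h x)"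
      using test_mult_integrable(1)[OF L(1) c \<Omega>l] test_mult_integrable(1)[OF L(2) c \<Omega>l]
      by (simp add: scaleR_diff_right)
    also have "\<dots> = 0" using g h \<phi> by (simp add: has_weak_partial_def)
    finally show "integral\<^sup>L (lebesgue_on \<Omega>) (\<lambda>x. \<phi> x *\<^sub>R (g x + (-1) * h x)) = 0" .
  qed
  then show ?thesis by eventually_elim simp
qed

lemma weak_partial_works: "has_weak_partial \<Omega> i u g \<Longrightarrow> has_weak_partial \<Omega> i u (weak_partial \<Omega> i u)"
  unfolding weak_partial_def by (rule someI[of "has_weak_partial \<Omega> i u"])

lemma weak_partial_AE:
  fixes u :: "real^'n \<Rightarrow> complex"
  shows "open \<Omega> \<Longrightarrow> has_weak_partial \<Omega> i u g \<Longrightarrow> AE x in lebesgue_on \<Omega>. weak_partial \<Omega> i u x = g x"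
  by (rule has_weak_partial_unique[OF weak_partial_works])

text \<open>\<open>weak_partial\<close> picks an arbitrary representative. Uniqueness almost
  everywhere transfers to it the square integrability of the derivative that membership in
  \<open>sobolev 1\<close> provides.\<close>

lemma sobolev_1D:
  assumes u: "u \<in> sobolev 1 \<Omega>" and \<Omega>: "open \<Omega>"
  shows "u \<in> L2 \<Omega>" "has_weak_partial \<Omega> i u (weak_partial \<Omega> i u)" "weak_partial \<Omega> i u \<in> L2 \<Omega>"
proof -
  show "u \<in> L2 \<Omega>" using u by simp
  obtain g where g: "g \<in> L2 \<Omega>" "has_weak_partial \<Omega> i u g" using u by auto
  show "has_weak_partial \<Omega> i u (weak_partial \<Omega> i u)" by (rule weak_partial_works[OF g(2)])
  have "AE x in lebesgue_on \<Omega>. g x = weak_partial \<Omega> i u x"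
    using weak_partial_AE[OF \<Omega> g(2)] by eventually_elim simp
  then show "weak_partial \<Omega> i u \<in> L2 \<Omega>" by (rule L2_cong_AE[OF g(1)]) (use \<Omega> in simp)
qed

lemma sobolev_1I:
  "u \<in> L2 \<Omega> \<Longrightarrow> (\<And>i. g i \<in> L2 \<Omega>) \<Longrightarrow> (\<And>i. has_weak_partial \<Omega> i u (g i)) \<Longrightarrow> u \<in> sobolev 1 \<Omega>"
  by auto

lemma sobolev_1_add:
  assumes "u \<in> sobolev 1 \<Omega>" "v \<in> sobolev 1 \<Omega>" and \<Omega>: "open \<Omega>"
  shows "(\<lambda>x. u x + v x) \<in> sobolev 1 \<Omega>"
    and "AE x in lebesgue_on \<Omega>. weak_partial \<Omega> i (\<lambda>x. u x + v x) x = weak_partial \<Omega> i u x + weak_partial \<Omega> i v x"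
proof -
  note u = sobolev_1D[OF assms(1) \<Omega>] and v = sobolev_1D[OF assms(2) \<Omega>]
  have \<Omega>l: "\<Omega> \<in> sets lebesgue" using \<Omega> by simp
  have w: "has_weak_partial \<Omega> i (\<lambda>x. u x + v x) (\<lambda>x. weak_partial \<Omega> i u x + weak_partial \<Omega> i v x)" for i
    by (rule has_weak_partial_add[OF u(2) v(2) \<Omega>l])
  show "(\<lambda>x. u x + v x) \<in> sobolev 1 \<Omega>" by (rule sobolev_1I[OF L2_add[OF u(1) v(1)] L2_add[OF u(3) v(3)] w])
  show "AE x in lebesgue_on \<Omega>. weak_partial \<Omega> i (\<lambda>x. u x + v x) x = weak_partial \<Omega> i u x + weak_partial \<Omega> i v x"
    by (rule weak_partial_AE[OF \<Omega> w])
qed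

lemma sobolev_1_scale:
  assumes "u \<in> sobolev 1 \<Omega>" and \<Omega>: "open \<Omega>"
  shows "(\<lambda>x. c * u x) \<in> sobolev 1 \<Omega>"
    and "AE x in lebesgue_on \<Omega>. weak_partial \<Omega> i (\<lambda>x. c * u x) x = c * weak_partial \<Omega> i u x"
proof -
  note u = sobolev_1D[OF assms]
  have w: "has_weak_partial \<Omega> i (\<lambda>x. c * u x) (\<lambda>x. c * weak_partial \<Omega> i u x)" for i
    by (rule has_weak_partial_scale[OF u(2)])
  show "(\<lambda>x. c * u x) \<in> sobolev 1 \<Omega>" by (rule sobolev_1I[OF L2_scale[OF u(1)] L2_scale[OF u(3)] w])
  show "AE x in lebesgue_on \<Omega>. weak_partial \<Omega> i (\<lambda>x. c * u x) x = c * weak_partial \<Omega> i u x"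
    by (rule weak_partial_AE[OF \<Omega> w])
qed

lemma sobolev_1_zero: "(\<lambda>x. 0) \<in> sobolev 1 \<Omega>"
proof (rule sobolev_1I[OF L2_zero L2_zero])
  show "has_weak_partial \<Omega> i (\<lambda>x. 0) (\<lambda>x. 0 :: complex)" for i
    by (simp add: has_weak_partial_def locally_integrable_on_def)
qed

lemma has_weak_partial_cong_AE:
  fixes u v :: "real^'n \<Rightarrow> complex"
  assumes v: "has_weak_partial \<Omega> i v d" and u: "u \<in> L2 \<Omega>" and \<Omega>: "open \<Omega>"
    and ae: "AE x in lebesgue_on \<Omega>. u x = v x"
  shows "has_weak_partial \<Omega> i u d"
  unfolding has_weak_partial_def
proof (intro conjI allI impI)
  have \<Omega>l: "\<Omega> \<in> sets lebesgue" using \<Omega> by simp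
  show L: "locally_integrable_on u \<Omega>" by (rule L2_locally_integrable[OF u \<Omega>])
  show "locally_integrable_on d \<Omega>" using v by (auto simp: has_weak_partial_def)
  have Lv: "locally_integrable_on v \<Omega>" using v by (auto simp: has_weak_partial_def)
  fix \<phi> assume \<phi>: "test_function \<Omega> \<phi>"
  note c = test_function_C1_compact[OF \<phi>]
  have "integral\<^sup>L (lebesgue_on \<Omega>) (\<lambda>x. partial_deriv i \<phi> x *\<^sub>R u x) = integral\<^sup>L (lebesgue_on \<Omega>) (\<lambda>x. partial_deriv i \<phi> x *\<^sub>R v x)"
  proof (rule integral_cong_AE)
    show "AE x in lebesgue_on \<Omega>. partial_deriv i \<phi> x *\<^sub>R u x = partial_deriv i \<phi> x *\<^sub>R v x"
      using ae by eventually_elim simp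
    show "(\<lambda>x. partial_deriv i \<phi> x *\<^sub>R u x) \<in> borel_measurable (lebesgue_on \<Omega>)"
      by (rule borel_measurable_integrable[OF test_mult_integrable(2)[OF L c \<Omega>l]])
    show "(\<lambda>x. partial_deriv i \<phi> x *\<^sub>R v x) \<in> borel_measurable (lebesgue_on \<Omega>)"
      by (rule borel_measurable_integrable[OF test_mult_integrable(2)[OF Lv c \<Omega>l]])
  qed
  then show "integral\<^sup>L (lebesgue_on \<Omega>) (\<lambda>x. partial_deriv i \<phi> x *\<^sub>R u x)
      = - integral\<^sup>L (lebesgue_on \<Omega>) (\<lambda>x. \<phi> x *\<^sub>R d x)"
    using v \<phi> by (simp add: has_weak_partial_def)
qed

lemma weak_partial_cong_AE:
  assumes u: "u \<in> sobolev 1 \<Omega>" and v: "v \<in> sobolev 1 \<Omega>" and \<Omega>: "open \<Omega>"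
    and ae: "AE x in lebesgue_on \<Omega>. u x = v x"
  shows "AE x in lebesgue_on \<Omega>. weak_partial \<Omega> i u x = weak_partial \<Omega> i v x"
  by (rule weak_partial_AE[OF \<Omega> has_weak_partial_cong_AE[OF sobolev_1D(2)[OF v \<Omega>] sobolev_1D(1)[OF u \<Omega>] \<Omega> ae]])

section \<open>Inner product and completeness of H1\<close>

definition ip1 :: "(real^'n::finite) set \<Rightarrow> (real^'n \<Rightarrow> complex) \<Rightarrow> (real^'n \<Rightarrow> complex) \<Rightarrow> complex" where
  "ip1 \<Omega> u v = ip0 \<Omega> u v + (\<Sum>i\<in>UNIV. ip0 \<Omega> (weak_partial \<Omega> i u) (weak_partial \<Omega> i v))"

lemma L2_norm_sq: "(L2_norm \<Omega> u)\<^sup>2 = Re (ip0 \<Omega> u u)"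
  by (simp add: ip0_self L2_norm_def)

lemma L2_norm_nonneg: "0 \<le> L2_norm \<Omega> u"
  by (simp add: L2_norm_def)

lemma sobolev_norm_1: "sobolev_norm 1 \<Omega> u = sqrt ((L2_norm \<Omega> u)\<^sup>2 + (\<Sum>i\<in>UNIV. (L2_norm \<Omega> (weak_partial \<Omega> i u))\<^sup>2))"
  by simp

lemma sobolev_norm_1_nonneg: "0 \<le> sobolev_norm 1 \<Omega> u"
  unfolding sobolev_norm_1 by (simp add: sum_nonneg)

lemma L2_norm_le_sobolev_norm_1: "L2_norm \<Omega> u \<le> sobolev_norm 1 \<Omega> u"
  unfolding sobolev_norm_1 by (rule real_le_rsqrt) (simp add: sum_nonneg)

lemma weak_partial_le_sobolev_norm_1: "L2_norm \<Omega> (weak_partial \<Omega> i u) \<le> sobolev_norm 1 \<Omega> u"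
  unfolding sobolev_norm_1
proof (rule real_le_rsqrt)
  have "(L2_norm \<Omega> (weak_partial \<Omega> i u))\<^sup>2 \<le> (\<Sum>i\<in>UNIV. (L2_norm \<Omega> (weak_partial \<Omega> i u))\<^sup>2)"
    by (rule member_le_sum[of i UNIV "\<lambda>i. (L2_norm \<Omega> (weak_partial \<Omega> i u))\<^sup>2"]) auto
  then show "(L2_norm \<Omega> (weak_partial \<Omega> i u))\<^sup>2 \<le> (L2_norm \<Omega> u)\<^sup>2 + (\<Sum>i\<in>UNIV. (L2_norm \<Omega> (weak_partial \<Omega> i u))\<^sup>2)"
    by (simp add: add_increasing)
qed

lemma nrm_ip1: "semi_inner_product.nrm (ip1 \<Omega>) = sobolev_norm 1 \<Omega>" if "semi_inner_product (sobolev 1 \<Omega>) (ip1 \<Omega>)"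
proof -
  interpret semi_inner_product "sobolev 1 \<Omega>" "ip1 \<Omega>" by (rule that)
  show ?thesis by (rule ext) (simp only: nrm_def sobolev_norm_1 ip1_def plus_complex.sel Re_sum L2_norm_sq)
qed

lemma semi_inner_product_H1:
  assumes \<Omega>: "open \<Omega>" shows "semi_inner_product (sobolev 1 \<Omega>) (ip1 \<Omega>)"
proof
  note D = sobolev_1D[OF _ \<Omega>] and A = sobolev_1_add[OF _ _ \<Omega>] and S = sobolev_1_scale[OF _ \<Omega>]
  show "(\<lambda>x. 0) \<in> sobolev 1 \<Omega>" by (rule sobolev_1_zero)
  show "(\<lambda>x. u x + v x) \<in> sobolev 1 \<Omega>" if "u \<in> sobolev 1 \<Omega>" "v \<in> sobolev 1 \<Omega>" for u v using that by (rule A)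
  show "(\<lambda>x. c * u x) \<in> sobolev 1 \<Omega>" if "u \<in> sobolev 1 \<Omega>" for u c using that by (rule S)
  show "ip1 \<Omega> (\<lambda>x. u x + v x) w = ip1 \<Omega> u w + ip1 \<Omega> v w"
    if u: "u \<in> sobolev 1 \<Omega>" and v: "v \<in> sobolev 1 \<Omega>" and w: "w \<in> sobolev 1 \<Omega>" for u v w
  proof -
    have "ip0 \<Omega> (weak_partial \<Omega> i (\<lambda>x. u x + v x)) (weak_partial \<Omega> i w)
        = ip0 \<Omega> (\<lambda>x. weak_partial \<Omega> i u x + weak_partial \<Omega> i v x) (weak_partial \<Omega> i w)" for i
      by (rule ip0_cong_AE[OF D(3)[OF A(1)[OF u v]] L2_add[OF D(3)[OF u] D(3)[OF v]] D(3)[OF w] D(3)[OF w] A(2)[OF u v]]) simp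
    then show ?thesis
      using u v w by (simp add: ip1_def L2.ip_add D(1,3) sum.distrib del: sobolev.simps)
  qed
  show "ip1 \<Omega> (\<lambda>x. c * u x) w = c * ip1 \<Omega> u w"
    if u: "u \<in> sobolev 1 \<Omega>" and w: "w \<in> sobolev 1 \<Omega>" for u w c
  proof -
    have "ip0 \<Omega> (weak_partial \<Omega> i (\<lambda>x. c * u x)) (weak_partial \<Omega> i w)
        = ip0 \<Omega> (\<lambda>x. c * weak_partial \<Omega> i u x) (weak_partial \<Omega> i w)" for i
      by (rule ip0_cong_AE[OF D(3)[OF S(1)[OF u]] L2_scale[OF D(3)[OF u]] D(3)[OF w] D(3)[OF w] S(2)[OF u]]) simp
    then show ?thesis
      using u w by (simp add: ip1_def L2.ip_scale D(1,3) sum_distrib_left distrib_left del: sobolev.simps)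
  qed
  show "ip1 \<Omega> v u = cnj (ip1 \<Omega> u v)" if u: "u \<in> sobolev 1 \<Omega>" and v: "v \<in> sobolev 1 \<Omega>" for u v
    using L2.ip_herm[OF D(1)[OF u] D(1)[OF v]] L2.ip_herm[OF D(3)[OF u] D(3)[OF v]]
    by (simp add: ip1_def)
  show "0 \<le> Re (ip1 \<Omega> u u)" for u
    by (simp add: ip1_def ip0_self sum_nonneg)
qed

lemma L2_norm_cong_AE:
  assumes "u \<in> L2 \<Omega>" "v \<in> L2 \<Omega>" "AE x in lebesgue_on \<Omega>. u x = v x"
  shows "L2_norm \<Omega> u = L2_norm \<Omega> v"
proof (rule power2_eq_imp_eq)
  show "(L2_norm \<Omega> u)\<^sup>2 = (L2_norm \<Omega> v)\<^sup>2"
    unfolding L2_norm_sq using ip0_cong_AE[OF assms(1,2,1,2,3,3)] by simp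
qed (rule L2_norm_nonneg)+

lemma sobolev_norm_1_cong_AE:
  assumes "u \<in> sobolev 1 \<Omega>" "v \<in> sobolev 1 \<Omega>" "open \<Omega>" "AE x in lebesgue_on \<Omega>. u x = v x"
  shows "sobolev_norm 1 \<Omega> u = sobolev_norm 1 \<Omega> v"
proof -
  note D = sobolev_1D[OF assms(1,3)] sobolev_1D[OF assms(2,3)]
  have "L2_norm \<Omega> (weak_partial \<Omega> i u) = L2_norm \<Omega> (weak_partial \<Omega> i v)" for i
    by (rule L2_norm_cong_AE[OF D(3,6) weak_partial_cong_AE[OF assms]])
  then show ?thesis using L2_norm_cong_AE[OF D(1,4) assms(4)] by (simp only: sobolev_norm_1)
qed

text \<open>The functions and their derivatives converge separately in L2. The identity defining a
  weak derivative is an equality of L2 products with bounded functions, so it survives in the limit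
  and identifies the limits of the derivatives.\<close>

lemma semi_hilbert_H1:
  assumes \<Omega>: "open \<Omega>" "bounded \<Omega>" shows "semi_hilbert (sobolev 1 \<Omega>) (ip1 \<Omega>)"
proof -
  interpret H: semi_inner_product "sobolev 1 \<Omega>" "ip1 \<Omega>" by (rule semi_inner_product_H1[OF \<Omega>(1)])
  note nrm = nrm_ip1[OF H.semi_inner_product_axioms]
  have \<Omega>l: "\<Omega> \<in> sets lebesgue" using \<Omega> by simp
  note D = sobolev_1D[OF _ \<Omega>(1)]
  have Ddiff: "AE x in lebesgue_on \<Omega>. weak_partial \<Omega> i (\<lambda>x. u x - v x) x = weak_partial \<Omega> i u x - weak_partial \<Omega> i v x"
    if "u \<in> sobolev 1 \<Omega>" "v \<in> sobolev 1 \<Omega>" for u v i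
  proof -
    have "AE x in lebesgue_on \<Omega>. weak_partial \<Omega> i (\<lambda>x. u x + (-1) * v x) x = weak_partial \<Omega> i u x + weak_partial \<Omega> i (\<lambda>x. (-1) * v x) x"
      by (rule sobolev_1_add(2)[OF that(1) sobolev_1_scale(1)[OF that(2) \<Omega>(1)] \<Omega>(1)])
    moreover have "AE x in lebesgue_on \<Omega>. weak_partial \<Omega> i (\<lambda>x. (-1) * v x) x = (-1) * weak_partial \<Omega> i v x"
      by (rule sobolev_1_scale(2)[OF that(2) \<Omega>(1)])
    ultimately show ?thesis by eventually_elim simp
  qed
  show ?thesis
  proof (unfold_locales, unfold nrm)
    fix s :: "nat \<Rightarrow> real^'a \<Rightarrow> complex"
    assume s: "\<And>n. s n \<in> sobolev 1 \<Omega>"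
      and C: "\<And>e. 0 < e \<Longrightarrow> \<exists>N. \<forall>m\<ge>N. \<forall>n\<ge>N. sobolev_norm 1 \<Omega> (\<lambda>x. s m x - s n x) < e"
    have "\<exists>u\<in>L2 \<Omega>. (\<lambda>n. L2_norm \<Omega> (\<lambda>x. s n x - u x)) \<longlonglongrightarrow> 0"
    proof (rule L2_complete[OF \<Omega>l \<Omega>(2) D(1)[OF s]])
      fix e :: real assume "0 < e"
      from C[OF this] show "\<exists>N. \<forall>m\<ge>N. \<forall>n\<ge>N. L2_norm \<Omega> (\<lambda>x. s m x - s n x) < e"
        by (meson L2_norm_le_sobolev_norm_1 le_less_trans)
    qed
    then obtain u where u: "u \<in> L2 \<Omega>" "(\<lambda>n. L2_norm \<Omega> (\<lambda>x. s n x - u x)) \<longlonglongrightarrow> 0" by blast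
    have "\<exists>g\<in>L2 \<Omega>. (\<lambda>n. L2_norm \<Omega> (\<lambda>x. weak_partial \<Omega> i (s n) x - g x)) \<longlonglongrightarrow> 0" for i
    proof (rule L2_complete[OF \<Omega>l \<Omega>(2) D(3)[OF s]])
      fix e :: real assume "0 < e"
      then obtain N where N: "\<forall>m\<ge>N. \<forall>n\<ge>N. sobolev_norm 1 \<Omega> (\<lambda>x. s m x - s n x) < e" using C by blast
      have "L2_norm \<Omega> (\<lambda>x. weak_partial \<Omega> i (s m) x - weak_partial \<Omega> i (s n) x) \<le> sobolev_norm 1 \<Omega> (\<lambda>x. s m x - s n x)" for m n
      proof -
        have "L2_norm \<Omega> (\<lambda>x. weak_partial \<Omega> i (s m) x - weak_partial \<Omega> i (s n) x) = L2_norm \<Omega> (weak_partial \<Omega> i (\<lambda>x. s m x - s n x))"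
        proof (rule L2_norm_cong_AE)
          show "AE x in lebesgue_on \<Omega>. weak_partial \<Omega> i (s m) x - weak_partial \<Omega> i (s n) x = weak_partial \<Omega> i (\<lambda>x. s m x - s n x) x"
            using Ddiff[OF s s, of i m n] by eventually_elim simp
          show "(\<lambda>x. weak_partial \<Omega> i (s m) x - weak_partial \<Omega> i (s n) x) \<in> L2 \<Omega>"
            by (rule L2.diff_mem[OF D(3)[OF s] D(3)[OF s]])
          show "weak_partial \<Omega> i (\<lambda>x. s m x - s n x) \<in> L2 \<Omega>"
            by (rule D(3)[OF H.diff_mem[OF s s]])
        qed
        then show ?thesis by (simp only: weak_partial_le_sobolev_norm_1)
      qed
      then show "\<exists>N. \<forall>m\<ge>N. \<forall>n\<ge>N. L2_norm \<Omega> (\<lambda>x. weak_partial \<Omega> i (s m) x - weak_partial \<Omega> i (s n) x) < e"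
        using N by (meson le_less_trans)
    qed
    then have "\<forall>i. \<exists>g. g \<in> L2 \<Omega> \<and> (\<lambda>n. L2_norm \<Omega> (\<lambda>x. weak_partial \<Omega> i (s n) x - g x)) \<longlonglongrightarrow> 0" by blast
    from choice[OF this] obtain g where g: "\<And>i. g i \<in> L2 \<Omega>"
      "\<And>i. (\<lambda>n. L2_norm \<Omega> (\<lambda>x. weak_partial \<Omega> i (s n) x - g i x)) \<longlonglongrightarrow> 0" by blast
    have w: "has_weak_partial \<Omega> i u (g i)" for i
      unfolding has_weak_partial_def
    proof (intro conjI allI impI)
      show "locally_integrable_on u \<Omega>" "locally_integrable_on (g i) \<Omega>"
        using u g \<Omega> by (auto intro: L2_locally_integrable)
      fix \<phi> assume \<phi>: "test_function \<Omega> \<phi>"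
      note c = test_function_C1_compact[OF \<phi>]
      have tL: "(\<lambda>x. complex_of_real (h x)) \<in> L2 \<Omega>" if "h \<in> borel_measurable borel" "\<And>x. \<bar>h x\<bar> \<le> B" for h B
      proof -
        have [measurable]: "h \<in> borel_measurable (lebesgue_on \<Omega>)"
          using that(1) by (intro measurable_restrict_space1 measurable_completion) simp
        have "(\<lambda>x. complex_of_real (h x)) \<in> Linfty \<Omega>" using that(2) by (auto simp: Linfty_def)
        then show ?thesis by (rule Linfty_L2[OF _ \<Omega>(2) \<Omega>l])
      qed
      obtain B where B: "\<And>x. \<bar>\<phi> x\<bar> \<le> B" "\<And>x. \<bar>partial_deriv i \<phi> x\<bar> \<le> B"
        using smooth_bound[OF c, of i] by blast
      have p: "(\<lambda>x. complex_of_real (\<phi> x)) \<in> L2 \<Omega>" "(\<lambda>x. complex_of_real (partial_deriv i \<phi> x)) \<in> L2 \<Omega>"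
        using C1_compact_integrable[OF c, THEN borel_measurable_integrable] B by (auto intro!: tL)
      have conv: "integral\<^sup>L (lebesgue_on \<Omega>) (\<lambda>x. h x *\<^sub>R f x) = cnj (ip0 \<Omega> (\<lambda>x. complex_of_real (h x)) f)" for h f
        unfolding ip0_def Bochner_Integration.integral_cnj[symmetric] by (simp add: scaleR_conv_of_real)
      have "(\<lambda>n. cnj (ip0 \<Omega> (\<lambda>x. complex_of_real (partial_deriv i \<phi> x)) (s n))) \<longlonglongrightarrow> cnj (ip0 \<Omega> (\<lambda>x. complex_of_real (partial_deriv i \<phi> x)) u)"
        by (intro tendsto_intros L2.ip_tendsto[OF D(1)[OF s] u(1) p(2) u(2)])
      moreover have "(\<lambda>n. - cnj (ip0 \<Omega> (\<lambda>x. complex_of_real (\<phi> x)) (weak_partial \<Omega> i (s n)))) \<longlonglongrightarrow> - cnj (ip0 \<Omega> (\<lambda>x. complex_of_real (\<phi> x)) (g i))"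
        by (intro tendsto_intros L2.ip_tendsto[OF D(3)[OF s] g(1) p(1) g(2)])
      moreover have "cnj (ip0 \<Omega> (\<lambda>x. complex_of_real (partial_deriv i \<phi> x)) (s n)) = - cnj (ip0 \<Omega> (\<lambda>x. complex_of_real (\<phi> x)) (weak_partial \<Omega> i (s n)))" for n
        using D(2)[OF s, of i n] \<phi> unfolding has_weak_partial_def conv[symmetric] by blast
      ultimately have "cnj (ip0 \<Omega> (\<lambda>x. complex_of_real (partial_deriv i \<phi> x)) u) = - cnj (ip0 \<Omega> (\<lambda>x. complex_of_real (\<phi> x)) (g i))"
        by (simp only: LIMSEQ_unique)
      then show "integral\<^sup>L (lebesgue_on \<Omega>) (\<lambda>x. partial_deriv i \<phi> x *\<^sub>R u x)
        = - integral\<^sup>L (lebesgue_on \<Omega>) (\<lambda>x. \<phi> x *\<^sub>R g i x)" unfolding conv .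
    qed
    have uH: "u \<in> sobolev 1 \<Omega>" by (rule sobolev_1I[OF u(1) g(1) w])
    have "(\<lambda>n. sobolev_norm 1 \<Omega> (\<lambda>x. s n x - u x)) \<longlonglongrightarrow> sqrt (0\<^sup>2 + (\<Sum>i\<in>(UNIV::'a set). 0\<^sup>2))"
      unfolding sobolev_norm_1
    proof (intro tendsto_intros u(2))
      fix i
      have "L2_norm \<Omega> (weak_partial \<Omega> i (\<lambda>x. s n x - u x)) = L2_norm \<Omega> (\<lambda>x. weak_partial \<Omega> i (s n) x - g i x)" for n
      proof (rule L2_norm_cong_AE)
        show "AE x in lebesgue_on \<Omega>. weak_partial \<Omega> i (\<lambda>x. s n x - u x) x = weak_partial \<Omega> i (s n) x - g i x"
          using Ddiff[OF s uH, of i n] weak_partial_AE[OF \<Omega>(1) w, of i] by eventually_elim simp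
        show "weak_partial \<Omega> i (\<lambda>x. s n x - u x) \<in> L2 \<Omega>"
          by (rule D(3)[OF H.diff_mem[OF s uH]])
        show "(\<lambda>x. weak_partial \<Omega> i (s n) x - g i x) \<in> L2 \<Omega>"
          by (rule L2.diff_mem[OF D(3)[OF s] g(1)])
      qed
      then show "(\<lambda>n. L2_norm \<Omega> (weak_partial \<Omega> i (\<lambda>x. s n x - u x))) \<longlonglongrightarrow> 0" using g(2)[of i] by simp
    qed
    then have "(\<lambda>n. sobolev_norm 1 \<Omega> (\<lambda>x. s n x - u x)) \<longlonglongrightarrow> 0" by simp
    with uH show "\<exists>u\<in>sobolev 1 \<Omega>. (\<lambda>n. sobolev_norm 1 \<Omega> (\<lambda>x. s n x - u x)) \<longlonglongrightarrow> 0" by blast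
  qed
qed

section \<open>The filtration of the Sobolev space\<close>

text \<open>The last clause is the one used for absorption, with \<open>c\<close> chosen small
  against the constant of the first estimate: the part of \<open>u\<close> captured by the k-th
  subspace costs only a small multiple of k times the L2 norm.\<close>

lemma frequency_filtration:
  fixes \<Omega> :: "(real^'n::finite) set"
  assumes \<Omega>: "open \<Omega>" "bounded \<Omega>" and c: "0 < c"
  shows "\<exists>(V :: real \<Rightarrow> (real^'n \<Rightarrow> complex) set) (p :: real \<Rightarrow> (real^'n \<Rightarrow> complex) \<Rightarrow> real).
         (\<forall>k\<ge>1. closed_sobolev_subspace 1 \<Omega> (V k)) \<and>
         (\<forall>k1\<ge>1. \<forall>k2\<ge>k1. V k1 \<subseteq> V k2) \<and>
         sobolev_closure 1 \<Omega> (\<Union>k\<in>{1..}. V k) = sobolev 1 \<Omega> \<and>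
         (\<forall>k\<ge>1. sobolev_seminorm 1 \<Omega> (p k)) \<and>
         (\<forall>k\<ge>1. \<forall>u \<in> V k. p k u = 0) \<and>
         (\<forall>k1\<ge>1. \<forall>k2\<ge>k1. \<forall>u \<in> sobolev 1 \<Omega>. p k2 u \<le> p k1 u) \<and>
         (\<forall>k\<ge>1. \<forall>u \<in> sobolev 1 \<Omega>. sobolev_norm 1 \<Omega> u \<le> c * k * L2_norm \<Omega> u + p k u)"
proof -
  let ?H = "sobolev 1 \<Omega>"
  have \<Omega>l: "\<Omega> \<in> sets lebesgue" using \<Omega> by simp
  note D = sobolev_1D[OF _ \<Omega>(1)]
  interpret H: semi_hilbert ?H "ip1 \<Omega>" by (rule semi_hilbert_H1[OF \<Omega>])
  note nrm = nrm_ip1[OF H.semi_inner_product_axioms]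
  define R where "R = {x::real^'n. \<forall>i\<in>Basis. x \<bullet> i \<in> \<rat>}"
  define E where "E = (\<lambda>(a, b). indicator (box a b) :: real^'n \<Rightarrow> complex) ` (R \<times> R)"
  have "R \<subseteq> (\<lambda>f. \<Sum>i\<in>Basis. f i *\<^sub>R i) ` (Basis \<rightarrow>\<^sub>E \<rat>)"
  proof
    fix x assume "x \<in> R"
    then show "x \<in> (\<lambda>f. \<Sum>i\<in>Basis. f i *\<^sub>R i) ` (Basis \<rightarrow>\<^sub>E \<rat>)"
      by (intro image_eqI[of _ _ "\<lambda>i\<in>Basis. x \<bullet> i"]) (auto simp: R_def euclidean_representation)
  qed
  moreover have "countable (Basis \<rightarrow>\<^sub>E (\<rat> :: real set) :: (real^'n \<Rightarrow> real) set)"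
    by (intro countable_PiE countable_rat) auto
  ultimately have "countable R" by (rule countable_subset[OF _ countable_image])
  then have cE: "countable E" by (simp add: E_def)
  \<comment> \<open>The enumeration by \<open>from_nat_into\<close> requires a non-empty
    set.\<close>
  have "0 \<in> R" by (simp add: R_def)
  then have neE: "E \<noteq> {}" by (auto simp: E_def)
  define g where "g = from_nat_into E"
  have rg: "range g = E" unfolding g_def using neE cE by (rule range_from_nat_into)
  have gL: "g n \<in> L2 \<Omega>" for n
  proof (rule Linfty_L2[OF _ \<Omega>(2) \<Omega>l])
    have "g n \<in> E" using rg by blast
    then obtain a b where ab: "g n = indicator (box a b)" by (auto simp: E_def)
    have "(indicator (box a b) :: real^'n \<Rightarrow> complex) \<in> borel_measurable (lebesgue_on \<Omega>)"
      by (intro measurable_restrict_space1 measurable_completion) simp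
    moreover have "AE x in lebesgue_on \<Omega>. cmod (indicator (box a b) x) \<le> 1" by (intro AE_I2) (simp add: indicator_def)
    ultimately show "g n \<in> Linfty \<Omega>" unfolding Linfty_def ab by blast
  qed
  have gbound: "cmod (ip0 \<Omega> u (g n)) \<le> L2_norm \<Omega> (g n) * L2_norm \<Omega> u" if "u \<in> ?H" for u n
    using L2.cauchy_schwarz[OF D(1)[OF that] gL] by (simp add: mult.commute)
  \<comment> \<open>The L2 product with \<open>g n\<close> is a bounded functional on H1, because
    the L2 norm lies below the H1 norm.\<close>
  have "\<exists>v\<in>?H. \<forall>u\<in>?H. ip1 \<Omega> u v = ip0 \<Omega> u (g n)" for n
  proof (rule H.riesz)
    show "ip0 \<Omega> (\<lambda>x. u x + v x) (g n) = ip0 \<Omega> u (g n) + ip0 \<Omega> v (g n)" if "u \<in> ?H" "v \<in> ?H" for u v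
      by (rule L2.ip_add[OF D(1)[OF that(1)] D(1)[OF that(2)] gL])
    show "ip0 \<Omega> (\<lambda>x. d * u x) (g n) = d * ip0 \<Omega> u (g n)" if "u \<in> ?H" for d u
      by (rule L2.ip_scale[OF D(1)[OF that] gL])
    show "cmod (ip0 \<Omega> u (g n)) \<le> L2_norm \<Omega> (g n) * H.nrm u" if "u \<in> ?H" for u
      unfolding nrm by (rule order_trans[OF gbound[OF that] mult_left_mono[OF L2_norm_le_sobolev_norm_1 L2_norm_nonneg]])
  qed
  then have "\<forall>n. \<exists>v. v \<in> ?H \<and> (\<forall>u\<in>?H. ip1 \<Omega> u v = ip0 \<Omega> u (g n))" by blast
  from choice[OF this] obtain t where t: "\<And>n. t n \<in> ?H" and tg: "\<And>n u. u \<in> ?H \<Longrightarrow> ip1 \<Omega> u (t n) = ip0 \<Omega> u (g n)"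
    by blast
  define e where "e = H.gram_schmidt t"
  have eo: "H.orthonormal0 e" unfolding e_def by (rule H.orthonormal0_gram_schmidt[OF t])
  have eH: "e n \<in> ?H" for n by (rule H.e_mem[OF eo])
  have "\<exists>K. \<forall>u\<in>?H. cmod (ip1 \<Omega> u (t n)) \<le> K * L2_norm \<Omega> u" for n
    using gbound tg by (intro exI[of _ "L2_norm \<Omega> (g n)"] ballI) (simp only:)
  then have "\<exists>K. \<forall>u\<in>?H. cmod (ip1 \<Omega> u (e n)) \<le> K * L2_norm \<Omega> u" for n
    unfolding e_def by (intro H.gram_schmidt_bound t)
  then have "\<forall>n. \<exists>K. \<forall>u\<in>?H. cmod (ip1 \<Omega> u (e n)) \<le> K * L2_norm \<Omega> u" by blast
  from choice[OF this] obtain K0 where K0: "\<And>n u. u \<in> ?H \<Longrightarrow> cmod (ip1 \<Omega> u (e n)) \<le> K0 n * L2_norm \<Omega> u" by blast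
  define K where "K n = \<bar>K0 n\<bar>" for n
  have K: "cmod (ip1 \<Omega> u (e n)) \<le> K n * L2_norm \<Omega> u" if "u \<in> ?H" for u n
    using K0[OF that, of n] mult_right_mono[OF abs_ge_self[of "K0 n"] L2_norm_nonneg[of \<Omega> u]] unfolding K_def by linarith
  \<comment> \<open>Orthogonality to all \<open>e n\<close> passes back to the representers
    \<open>t n\<close>, that is, to integrals over rational boxes, and these determine
    \<open>w\<close> almost everywhere.\<close>
  have total: "H.nrm w = 0" if w: "w \<in> ?H" and z: "\<And>n. ip1 \<Omega> w (e n) = 0" for w
  proof -
    have g0: "ip0 \<Omega> w (g n) = 0" for n
      using H.gram_schmidt_total[OF t w z[unfolded e_def]] tg[OF w] by simp
    have \<Omega>b: "\<Omega> \<in> sets borel" using \<Omega> by simp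
    obtain W where W: "borel_rep \<Omega> w W" using borel_rep_exists[OF L2D(1)[OF D(1)[OF w]] \<Omega>b] by blast
    have [measurable]: "W \<in> borel_measurable borel" using W by (simp add: borel_rep_def)
    have W0: "W x = 0" if "x \<notin> \<Omega>" for x using W that by (simp add: borel_rep_def)
    have one: "(\<lambda>x. 1) \<in> L2 \<Omega>"
      by (rule Linfty_L2[OF _ \<Omega>(2) \<Omega>l]) (auto simp: Linfty_def)
    have "integrable (lebesgue_on \<Omega>) w" using ip0_integrable[OF D(1)[OF w] one] by simp
    then have iW: "integrable lborel W" by (simp add: borel_rep_integrable(1)[OF W \<Omega>l])
    have "AE x in lborel. W x = 0"
    proof (rule integral_density_zero_box[OF iW])
      fix a b :: "real^'n" assume "\<And>i. i \<in> Basis \<Longrightarrow> a \<bullet> i \<in> \<rat>" "\<And>i. i \<in> Basis \<Longrightarrow> b \<bullet> i \<in> \<rat>"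
      then have "(indicator (box a b) :: real^'n \<Rightarrow> complex) \<in> E" by (auto simp: E_def R_def)
      then have "indicator (box a b) \<in> range g" by (simp only: rg)
      then obtain n where n: "g n = indicator (box a b)" by force
      have Weq: "(\<lambda>x. if x \<in> \<Omega> then W x * cnj (indicator (box a b) x) else 0) = (\<lambda>x. indicator (box a b) x *\<^sub>R W x)"
        using W0 by (auto simp: fun_eq_iff indicator_def)
      have "(LINT x|lborel. (if x \<in> \<Omega> then W x * cnj (indicator (box a b) x) else 0)) =
          integral\<^sup>L (lebesgue_on \<Omega>) (\<lambda>x. if x \<in> \<Omega> then w x * cnj (indicator (box a b) x) else 0)"
        by (rule borel_rep_transfer(1)[symmetric, OF W \<Omega>l \<Omega>l subset_refl,
              where h = "\<lambda>x z. if x \<in> \<Omega> then z * cnj (indicator (box a b) x) else 0"]) (auto simp: Weq)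
      also have "\<dots> = ip0 \<Omega> w (g n)"
        unfolding ip0_def n by (rule Bochner_Integration.integral_cong) auto
      finally show "(LINT x|lborel. indicator (box a b) x *\<^sub>R W x) = 0" unfolding Weq using g0 by simp
    qed
    moreover have "AE x in lborel. x \<in> \<Omega> \<longrightarrow> W x = w x" using W by (simp add: borel_rep_def)
    ultimately have "AE x in lborel. x \<in> \<Omega> \<longrightarrow> w x = 0" by eventually_elim auto
    then have "AE x in lebesgue_on \<Omega>. w x = 0" by (simp add: AE_lebesgue_on_iff[OF \<Omega>l])
    then have "sobolev_norm 1 \<Omega> w = sobolev_norm 1 \<Omega> (\<lambda>x. 0)"
      by (rule sobolev_norm_1_cong_AE[OF w sobolev_1_zero \<Omega>(1)])
    also have "\<dots> = 0" using H.nrm_zero unfolding nrm .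
    finally show ?thesis unfolding nrm .
  qed
  define P where "P = H.proj e"
  define q where "q N u = sobolev_norm 1 \<Omega> (\<lambda>x. u x - P N u x)" for N u
  have PH: "P N u \<in> ?H" for N u unfolding P_def by (rule H.proj_mem[OF eH])
  have q_tendsto: "(\<lambda>N. q N u) \<longlonglongrightarrow> 0" if "u \<in> ?H" for u
    using H.resid_tendsto_zero[OF eo that total] unfolding q_def P_def nrm .
  have q_mono: "q N u \<le> q M u" if "u \<in> ?H" "M \<le> N" for u M N
    using H.resid_antimono[OF eo that] unfolding q_def P_def nrm .
  have q_add: "q N (\<lambda>x. u x + v x) \<le> q N u + q N v" if "u \<in> ?H" "v \<in> ?H" for u v N
    using H.resid_add[OF eo that] unfolding q_def P_def nrm .
  have q_scale: "q N (\<lambda>x. d * u x) = cmod d * q N u" if "u \<in> ?H" for u d N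
    using H.resid_scale[OF eo that] unfolding q_def P_def nrm .
  have q_le: "q N u \<le> sobolev_norm 1 \<Omega> (\<lambda>x. u x - v x) + q N v" if "u \<in> ?H" "v \<in> ?H" for u v N
    using H.resid_le_add[OF eo that] unfolding q_def P_def nrm .
  have q_P: "q N (P N u) = 0" if "u \<in> ?H" for u N
    using H.resid_proj[OF eo that] unfolding q_def P_def nrm .
  have q_nonneg: "0 \<le> q N u" for N u unfolding q_def by (rule sobolev_norm_1_nonneg)
  define M where "M N = (\<Sum>n<N. K n)" for N
  have split: "sobolev_norm 1 \<Omega> u \<le> M N * L2_norm \<Omega> u + q N u" if u: "u \<in> ?H" for u N
  proof -
    have "sobolev_norm 1 \<Omega> u \<le> q N u + sobolev_norm 1 \<Omega> (P N u)"
      using H.nrm_triangle_diff[OF u PH[of N u]] unfolding q_def nrm .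
    moreover have "sobolev_norm 1 \<Omega> (P N u) \<le> M N * L2_norm \<Omega> u"
      using H.nrm_proj_le[OF eo u K[OF u], of N] unfolding P_def M_def nrm .
    ultimately show ?thesis by linarith
  qed
  \<comment> \<open>The largest number of terms whose projection constant is still at most
    \<open>c * k\<close>. The clause \<open>real n \<le> k\<close> keeps the set finite however
    slowly \<open>M\<close> grows, and 0 belongs to it because \<open>M 0 = 0\<close>. Both
    conditions relax as k grows, so \<open>N\<close> is monotone, and every n is reached
    eventually.\<close>
  define N where "N k = Max {n. real n \<le> k \<and> M n \<le> c * k}" for k :: real
  have fin: "finite {n. real n \<le> k \<and> M n \<le> c * k}" for k
  proof (rule finite_subset[of _ "{..nat \<lceil>k\<rceil>}"])
    show "{n. real n \<le> k \<and> M n \<le> c * k} \<subseteq> {..nat \<lceil>k\<rceil>}" by (auto simp: le_nat_iff) linarith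
  qed simp
  have zero_in: "0 \<in> {n. real n \<le> k \<and> M n \<le> c * k}" if "1 \<le> k" for k using that c by (auto simp: M_def)
  have N_in: "M (N k) \<le> c * k" if "1 \<le> k" for k
    using Max_in[OF fin[of k]] zero_in[OF that] unfolding N_def by blast
  have N_mono: "N k1 \<le> N k2" if "1 \<le> k1" "k1 \<le> k2" for k1 k2
    unfolding N_def
  proof (rule Max_mono[OF _ _ fin])
    have "c * k1 \<le> c * k2" using that c by simp
    then show "{n. real n \<le> k1 \<and> M n \<le> c * k1} \<subseteq> {n. real n \<le> k2 \<and> M n \<le> c * k2}"
      using that by auto
    show "{n. real n \<le> k1 \<and> M n \<le> c * k1} \<noteq> {}" using zero_in[OF that(1)] by blast
  qed
  have N_large: "\<exists>k\<ge>1. n \<le> N k" for n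
  proof -
    define k where "k = max 1 (max (real n) (M n / c))"
    have "M n / c \<le> k" "real n \<le> k" by (auto simp: k_def)
    then have "M n \<le> c * k" using c by (simp add: pos_divide_le_eq mult.commute)
    then have "n \<le> N k" unfolding N_def using \<open>real n \<le> k\<close> fin by (intro Max_ge) auto
    moreover have "1 \<le> k" by (simp add: k_def)
    ultimately show ?thesis by blast
  qed
  \<comment> \<open>The kernel of the semi-norm and not a span: it is closed and stable under
    changes on null sets, and it contains every projection \<open>P (N k) u\<close>.\<close>
  define V where "V k = {u \<in> ?H. q (N k) u = 0}" for k
  have V_closed: "closed_sobolev_subspace 1 \<Omega> (V k)" for k
    unfolding closed_sobolev_subspace_def
  proof (intro conjI ballI allI)
    show "V k \<subseteq> ?H" unfolding V_def by blast
    have "q (N k) (\<lambda>x. 0 * 0) = cmod 0 * q (N k) (\<lambda>x. 0)" by (rule q_scale[OF sobolev_1_zero])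
    then show "(\<lambda>x. 0) \<in> V k" unfolding V_def using sobolev_1_zero by simp
    show "(\<lambda>x. u x + v x) \<in> V k" if "u \<in> V k" "v \<in> V k" for u v
    proof -
      have H: "u \<in> ?H" "v \<in> ?H" "q (N k) u = 0" "q (N k) v = 0" using that unfolding V_def by blast+
      have "q (N k) (\<lambda>x. u x + v x) = 0"
        using q_add[OF H(1,2), of "N k"] q_nonneg[of "N k" "\<lambda>x. u x + v x"] H(3,4) by linarith
      then show ?thesis unfolding V_def using H.add_mem[OF H(1,2)] by blast
    qed
    show "(\<lambda>x. d * u x) \<in> V k" if "u \<in> V k" for d u
    proof -
      have H: "u \<in> ?H" "q (N k) u = 0" using that unfolding V_def by blast+
      then show ?thesis unfolding V_def using H.scale_mem[OF H(1), of d] q_scale[OF H(1), of "N k" d] by simp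
    qed
    show "sobolev_closure 1 \<Omega> (V k) = V k"
    proof
      show "V k \<subseteq> sobolev_closure 1 \<Omega> (V k)"
      proof
        fix u assume u: "u \<in> V k"
        have "sobolev_norm 1 \<Omega> (\<lambda>x. u x - u x) = 0" using H.nrm_zero unfolding nrm by simp
        then have "\<forall>e>0. \<exists>v\<in>V k. sobolev_norm 1 \<Omega> (\<lambda>x. u x - v x) < e" using u by metis
        then show "u \<in> sobolev_closure 1 \<Omega> (V k)" unfolding sobolev_closure_def using u V_def by blast
      qed
      show "sobolev_closure 1 \<Omega> (V k) \<subseteq> V k"
      proof
        fix u assume "u \<in> sobolev_closure 1 \<Omega> (V k)"
        then have u: "u \<in> ?H" and cl: "\<And>e. 0 < e \<Longrightarrow> \<exists>v\<in>V k. sobolev_norm 1 \<Omega> (\<lambda>x. u x - v x) < e"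
          unfolding sobolev_closure_def by blast+
        have "q (N k) u \<le> 0"
        proof (rule field_le_epsilon)
          fix e :: real assume "0 < e"
          from cl[OF this] obtain v where v: "v \<in> V k" "sobolev_norm 1 \<Omega> (\<lambda>x. u x - v x) < e" by blast
          then have "v \<in> ?H" "q (N k) v = 0" unfolding V_def by blast+
          then show "q (N k) u \<le> 0 + e" using q_le[OF u, of v "N k"] v(2) by linarith
        qed
        then have "q (N k) u = 0" using q_nonneg[of "N k" u] by linarith
        with u show "u \<in> V k" unfolding V_def by blast
      qed
    qed
  qed
  have V_mono: "V k1 \<subseteq> V k2" if "1 \<le> k1" "k1 \<le> k2" for k1 k2
  proof
    fix u assume "u \<in> V k1"
    then have u: "u \<in> ?H" "q (N k1) u = 0" unfolding V_def by blast+
    then have "q (N k2) u = 0" using q_mono[OF u(1) N_mono[OF that]] q_nonneg[of "N k2" u] by linarith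
    with u show "u \<in> V k2" unfolding V_def by blast
  qed
  have V_dense: "sobolev_closure 1 \<Omega> (\<Union>k\<in>{1..}. V k) = ?H"
  proof
    show "sobolev_closure 1 \<Omega> (\<Union>k\<in>{1..}. V k) \<subseteq> ?H" unfolding sobolev_closure_def by blast
    show "?H \<subseteq> sobolev_closure 1 \<Omega> (\<Union>k\<in>{1..}. V k)"
    proof
      fix u assume u: "u \<in> ?H"
      have "\<exists>v\<in>(\<Union>k\<in>{1..}. V k). sobolev_norm 1 \<Omega> (\<lambda>x. u x - v x) < e" if e: "0 < e" for e
      proof -
        obtain n where n: "q n u < e"
          using order_tendstoD(2)[OF q_tendsto[OF u] e] by (auto simp: eventually_sequentially)
        obtain k where k: "1 \<le> k" "n \<le> N k" using N_large by blast
        have "P (N k) u \<in> V k" unfolding V_def using PH q_P[OF u] by blast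
        moreover have "sobolev_norm 1 \<Omega> (\<lambda>x. u x - P (N k) u x) < e"
          using q_mono[OF u k(2)] n unfolding q_def by linarith
        ultimately show ?thesis using k(1) by (intro bexI[of _ "P (N k) u"]) auto
      qed
      with u show "u \<in> sobolev_closure 1 \<Omega> (\<Union>k\<in>{1..}. V k)" unfolding sobolev_closure_def by blast
    qed
  qed
  have p_semi: "sobolev_seminorm 1 \<Omega> (q (N k))" for k
    unfolding sobolev_seminorm_def
  proof (intro conjI ballI allI impI)
    show "0 \<le> q (N k) u" for u by (rule q_nonneg)
    show "q (N k) (\<lambda>x. u x + v x) \<le> q (N k) u + q (N k) v" if "u \<in> ?H" "v \<in> ?H" for u v by (rule q_add[OF that])
    show "q (N k) (\<lambda>x. d * u x) = cmod d * q (N k) u" if "u \<in> ?H" for d u by (rule q_scale[OF that])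
    fix u v assume u: "u \<in> ?H" and v: "v \<in> ?H" and ae: "AE x in lebesgue_on \<Omega>. u x = v x"
    have z: "sobolev_norm 1 \<Omega> (\<lambda>x. f x - h x) = 0" if "f \<in> ?H" "h \<in> ?H" "AE x in lebesgue_on \<Omega>. f x = h x" for f h
    proof -
      have "AE x in lebesgue_on \<Omega>. f x - h x = 0" using that(3) by eventually_elim simp
      then have "sobolev_norm 1 \<Omega> (\<lambda>x. f x - h x) = sobolev_norm 1 \<Omega> (\<lambda>x. 0)"
        by (rule sobolev_norm_1_cong_AE[OF H.diff_mem[OF that(1,2)] sobolev_1_zero \<Omega>(1)])
      then show ?thesis using H.nrm_zero unfolding nrm by (rule trans)
    qed
    have ae': "AE x in lebesgue_on \<Omega>. v x = u x" using ae by eventually_elim simp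
    show "q (N k) u = q (N k) v"
      using q_le[OF u v, of "N k"] q_le[OF v u, of "N k"] z[OF u v ae] z[OF v u ae'] by linarith
  qed
  show ?thesis
  proof (intro exI[of _ V] exI[of _ "\<lambda>k. q (N k)"] conjI allI impI ballI)
    show "closed_sobolev_subspace 1 \<Omega> (V k)" for k by (rule V_closed)
    show "V k1 \<subseteq> V k2" if "1 \<le> k1" "k1 \<le> k2" for k1 k2 by (rule V_mono[OF that])
    show "sobolev_closure 1 \<Omega> (\<Union>k\<in>{1..}. V k) = ?H" by (rule V_dense)
    show "sobolev_seminorm 1 \<Omega> (q (N k))" for k by (rule p_semi)
    show "q (N k) u = 0" if "u \<in> V k" for k u using that unfolding V_def by blast
    show "q (N k2) u \<le> q (N k1) u" if "1 \<le> k1" "k1 \<le> k2" "u \<in> ?H" for k1 k2 u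
      by (rule q_mono[OF that(3) N_mono[OF that(1,2)]])
    show "sobolev_norm 1 \<Omega> u \<le> c * k * L2_norm \<Omega> u + q (N k) u" if "1 \<le> k" "u \<in> ?H" for k u
      using split[OF that(2), of "N k"] mult_right_mono[OF N_in[OF that(1)] L2_norm_nonneg[of \<Omega> u]] by linarith
  qed
qed

section \<open>The energy estimate\<close>

lemma mult_bounded_L2:
  assumes [measurable]: "m \<in> borel_measurable (lebesgue_on \<Omega>)" and A: "AE x in lebesgue_on \<Omega>. cmod (m x) \<le> A"
    and f: "f \<in> L2 \<Omega>"
  shows "(\<lambda>x. m x * f x) \<in> L2 \<Omega>" "0 \<le> A \<Longrightarrow> L2_norm \<Omega> (\<lambda>x. m x * f x) \<le> A * L2_norm \<Omega> f"
proof -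
  note L2D(1)[OF f, measurable]
  have ae: "AE x in lebesgue_on \<Omega>. (cmod (m x * f x))\<^sup>2 \<le> A\<^sup>2 * (cmod (f x))\<^sup>2"
    using A
  proof eventually_elim
    case (elim x)
    then have "(cmod (m x))\<^sup>2 \<le> A\<^sup>2" by (intro power_mono) auto
    then show ?case by (simp add: norm_mult power_mult_distrib mult_right_mono)
  qed
  have i: "integrable (lebesgue_on \<Omega>) (\<lambda>x. A\<^sup>2 * (cmod (f x))\<^sup>2)" using L2D(2)[OF f] by simp
  have i2: "integrable (lebesgue_on \<Omega>) (\<lambda>x. (cmod (m x * f x))\<^sup>2)"
  proof (rule Bochner_Integration.integrable_bound[OF i])
    show "AE x in lebesgue_on \<Omega>. norm ((cmod (m x * f x))\<^sup>2) \<le> norm (A\<^sup>2 * (cmod (f x))\<^sup>2)"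
      using ae by eventually_elim simp
  qed measurable
  then show "(\<lambda>x. m x * f x) \<in> L2 \<Omega>" by (simp add: L2_def)
  assume "0 \<le> A"
  have "integral\<^sup>L (lebesgue_on \<Omega>) (\<lambda>x. (cmod (m x * f x))\<^sup>2) \<le> integral\<^sup>L (lebesgue_on \<Omega>) (\<lambda>x. A\<^sup>2 * (cmod (f x))\<^sup>2)"
    by (rule integral_mono_AE[OF i2 i ae])
  then have "integral\<^sup>L (lebesgue_on \<Omega>) (\<lambda>x. (cmod (m x * f x))\<^sup>2) \<le> A\<^sup>2 * integral\<^sup>L (lebesgue_on \<Omega>) (\<lambda>x. (cmod (f x))\<^sup>2)"
    by (simp only: integral_mult_right_zero)
  moreover have sq: "(L2_norm \<Omega> h)\<^sup>2 = integral\<^sup>L (lebesgue_on \<Omega>) (\<lambda>x. (cmod (h x))\<^sup>2)" for h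
    by (simp add: L2_norm_def)
  ultimately have "(L2_norm \<Omega> (\<lambda>x. m x * f x))\<^sup>2 \<le> (A * L2_norm \<Omega> f)\<^sup>2"
    by (simp only: power_mult_distrib sq)
  then show "L2_norm \<Omega> (\<lambda>x. m x * f x) \<le> A * L2_norm \<Omega> f"
    by (rule power2_le_imp_le) (intro mult_nonneg_nonneg \<open>0 \<le> A\<close> L2_norm_nonneg)
qed

lemma L2_norm_cnj: "L2_norm \<Omega> (\<lambda>x. cnj (f x)) = L2_norm \<Omega> f"
  by (simp add: L2_norm_def)

text \<open>Each term of the tested equation is a bounded coefficient times two L2 functions. The
  bound keeps the constant of the coefficient explicit, since for the gradient of a cutoff it is of
  order k.\<close>

lemma triple_bound:
  assumes m: "m \<in> borel_measurable (lebesgue_on \<Omega>)" "AE x in lebesgue_on \<Omega>. cmod (m x) \<le> A" "0 \<le> A"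
    and f: "f \<in> L2 \<Omega>" and g: "g \<in> L2 \<Omega>"
  shows "integrable (lebesgue_on \<Omega>) (\<lambda>x. m x * f x * g x)"
    and "cmod (integral\<^sup>L (lebesgue_on \<Omega>) (\<lambda>x. m x * f x * g x)) \<le> A * L2_norm \<Omega> f * L2_norm \<Omega> g"
proof -
  note mf = mult_bounded_L2[OF m(1,2) f]
  show "integrable (lebesgue_on \<Omega>) (\<lambda>x. m x * f x * g x)" by (rule L2_mult_integrable[OF mf(1) g])
  have "cmod (ip0 \<Omega> (\<lambda>x. m x * f x) (\<lambda>x. cnj (g x))) \<le> L2_norm \<Omega> (\<lambda>x. m x * f x) * L2_norm \<Omega> (\<lambda>x. cnj (g x))"
    by (rule L2.cauchy_schwarz[OF mf(1) L2_cnj[OF g]])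
  also have "\<dots> \<le> (A * L2_norm \<Omega> f) * L2_norm \<Omega> g"
    unfolding L2_norm_cnj by (intro mult_right_mono mf(2) m L2_norm_nonneg)
  finally show "cmod (integral\<^sup>L (lebesgue_on \<Omega>) (\<lambda>x. m x * f x * g x)) \<le> A * L2_norm \<Omega> f * L2_norm \<Omega> g"
    by (simp add: ip0_def)
qed

lemma borel_lebesgue_on: "h \<in> borel_measurable borel \<Longrightarrow> h \<in> borel_measurable (lebesgue_on \<Omega>)"
  by (intro measurable_restrict_space1 measurable_completion) simp

lemma C1_compact_measurable:
  assumes "C1_compact \<Omega> \<phi>"
  shows "\<phi> \<in> borel_measurable (lebesgue_on S)" "partial_deriv i \<phi> \<in> borel_measurable (lebesgue_on S)"
  using C1_compact_integrable[OF assms, THEN borel_measurable_integrable] by (auto intro: borel_lebesgue_on)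

lemma coefficient_bound:
  assumes [measurable]: "h \<in> borel_measurable (lebesgue_on \<Omega>)" and h: "\<And>x. \<bar>h x\<bar> \<le> B"
    and [measurable]: "b \<in> borel_measurable (lebesgue_on \<Omega>)" and b: "AE x in lebesgue_on \<Omega>. cmod (b x) \<le> A"
  shows "(\<lambda>x. complex_of_real (h x) * b x) \<in> borel_measurable (lebesgue_on \<Omega>)"
    and "AE x in lebesgue_on \<Omega>. cmod (complex_of_real (h x) * b x) \<le> B * A"
proof -
  show "(\<lambda>x. complex_of_real (h x) * b x) \<in> borel_measurable (lebesgue_on \<Omega>)" by measurable
  have "0 \<le> B" using h[of undefined] by (meson abs_ge_zero order_trans)
  show "AE x in lebesgue_on \<Omega>. cmod (complex_of_real (h x) * b x) \<le> B * A"
    using b by eventually_elim (use h \<open>0 \<le> B\<close> in \<open>auto simp: norm_mult intro!: mult_mono\<close>)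
qed

text \<open>For the second-order part: \<open>w\<close> will be a first derivative of the solution,
  \<open>v\<close> the conjugate of the solution and \<open>b\<close> a leading coefficient. The
  derivative leaves \<open>w\<close> and falls on the cutoff, on \<open>b\<close> or on
  \<open>v\<close>; only the first case carries \<open>B\<close>, the bound that grows with
  k.\<close>

lemma weighted_ibp_bound:
  fixes w v b b' :: "real^'n \<Rightarrow> complex"
  assumes \<Omega>: "open \<Omega>" "bounded \<Omega>"
    and w: "w \<in> L2 \<Omega>" "w' \<in> L2 \<Omega>" "has_weak_partial \<Omega> j w w'"
    and v: "v \<in> L2 \<Omega>" "v' \<in> L2 \<Omega>" "has_weak_partial \<Omega> j v v'"
    and b: "b \<in> borel_measurable (lebesgue_on \<Omega>)" "AE x in lebesgue_on \<Omega>. cmod (b x) \<le> A"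
    and b': "b' \<in> borel_measurable (lebesgue_on \<Omega>)" "AE x in lebesgue_on \<Omega>. cmod (b' x) \<le> A"
    and bb': "has_weak_partial \<Omega> j b b'" and A: "0 \<le> A"
    and \<phi>: "C1_compact \<Omega> \<phi>" "\<And>x. \<bar>\<phi> x\<bar> \<le> 1" "\<And>x. \<bar>partial_deriv j \<phi> x\<bar> \<le> B"
  shows "cmod (integral\<^sup>L (lebesgue_on \<Omega>) (\<lambda>x. (complex_of_real (\<phi> x) * b x) * w' x * v x))
    \<le> B * A * L2_norm \<Omega> w * L2_norm \<Omega> v + A * L2_norm \<Omega> w * L2_norm \<Omega> v + A * L2_norm \<Omega> w * L2_norm \<Omega> v'"
proof -
  let ?M = "lebesgue_on \<Omega>"
  have \<Omega>l: "\<Omega> \<in> sets lebesgue" using \<Omega> by simp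
  have bL: "b \<in> L2 \<Omega>" "b' \<in> L2 \<Omega>"
  proof -
    have "b \<in> Linfty \<Omega>" "b' \<in> Linfty \<Omega>" unfolding Linfty_def using b b' by blast+
    then show "b \<in> L2 \<Omega>" "b' \<in> L2 \<Omega>" using Linfty_L2[OF _ \<Omega>(2) \<Omega>l] by blast+
  qed
  have B: "0 \<le> B" using \<phi>(3)[of undefined] by (meson abs_ge_zero order_trans)
  note m\<phi> = C1_compact_measurable[OF \<phi>(1)]
  note c1 = coefficient_bound[OF m\<phi>(1) \<phi>(2) b, simplified]
  note c2 = coefficient_bound[OF m\<phi>(1) \<phi>(2) b', simplified]
  note c3 = coefficient_bound[OF m\<phi>(2) \<phi>(3) b]
  have BA: "0 \<le> B * A" using B A by simp
  \<comment> \<open>\<open>b * v\<close> lies in L2 because \<open>b\<close> is bounded, so the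
    product rule can be applied a second time, to \<open>w\<close> and \<open>b * v\<close>.\<close>
  have bv: "has_weak_partial \<Omega> j (\<lambda>x. b x * v x) (\<lambda>x. b' x * v x + b x * v' x)"
    by (rule has_weak_partial_mult[OF bb' v(3) \<Omega>(1) bL v(1,2)])
  note bvL = mult_bounded_L2(1)[OF b v(1)] L2_add[OF mult_bounded_L2(1)[OF b' v(1)] mult_bounded_L2(1)[OF b v(2)]]
  note wbv = has_weak_partial_mult[OF w(3) bv \<Omega>(1) w(1,2) bvL]
  have eq: "integral\<^sup>L ?M (\<lambda>x. partial_deriv j \<phi> x *\<^sub>R (w x * (b x * v x)))
    = - integral\<^sup>L ?M (\<lambda>x. \<phi> x *\<^sub>R (w' x * (b x * v x) + w x * (b' x * v x + b x * v' x)))"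
    by (rule has_weak_partial_C1[OF wbv \<Omega>(1) \<phi>(1)])
  let ?I1 = "integral\<^sup>L ?M (\<lambda>x. (complex_of_real (\<phi> x) * b x) * w' x * v x)"
  let ?I2 = "integral\<^sup>L ?M (\<lambda>x. (complex_of_real (\<phi> x) * b' x) * w x * v x)"
  let ?I3 = "integral\<^sup>L ?M (\<lambda>x. (complex_of_real (\<phi> x) * b x) * w x * v' x)"
  let ?I4 = "integral\<^sup>L ?M (\<lambda>x. (complex_of_real (partial_deriv j \<phi> x) * b x) * w x * v x)"
  have "?I4 = - (?I1 + ?I2 + ?I3)"
  proof -
    have "integral\<^sup>L ?M (\<lambda>x. partial_deriv j \<phi> x *\<^sub>R (w x * (b x * v x))) = ?I4"
      by (rule Bochner_Integration.integral_cong) (auto simp: scaleR_conv_of_real mult_ac)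
    moreover have "integral\<^sup>L ?M (\<lambda>x. \<phi> x *\<^sub>R (w' x * (b x * v x) + w x * (b' x * v x + b x * v' x)))
      = integral\<^sup>L ?M (\<lambda>x. (complex_of_real (\<phi> x) * b x) * w' x * v x + (complex_of_real (\<phi> x) * b' x) * w x * v x
          + (complex_of_real (\<phi> x) * b x) * w x * v' x)"
      by (rule Bochner_Integration.integral_cong) (auto simp: scaleR_conv_of_real algebra_simps)
    moreover have "\<dots> = ?I1 + ?I2 + ?I3"
      using triple_bound(1)[OF c1 A w(2) v(1)] triple_bound(1)[OF c2 A w(1) v(1)] triple_bound(1)[OF c1 A w(1) v(2)]
      by simp
    ultimately show ?thesis using eq by simp
  qed
  moreover have "cmod p \<le> cmod s + cmod q + cmod r" if "s = - (p + q + r)" for p q r s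
  proof -
    have "p = - s - q - r" using that by algebra
    then show ?thesis using norm_triangle_ineq4[of "- s - q" r] norm_triangle_ineq4[of "- s" q] by simp
  qed
  ultimately have "cmod ?I1 \<le> cmod ?I4 + cmod ?I2 + cmod ?I3" by blast
  then show ?thesis
    using triple_bound(2)[OF c3 BA w(1) v(1)] triple_bound(2)[OF c2 A w(1) v(1)] triple_bound(2)[OF c1 A w(1) v(2)]
    by linarith
qed

text \<open>The definition yields some first derivatives in H1; the representatives chosen by
  \<open>weak_partial\<close> agree with them almost everywhere and inherit their weak
  derivatives.\<close>

lemma sobolev_2D:
  assumes u: "u \<in> sobolev 2 \<Omega>" and \<Omega>: "open \<Omega>"
  shows "u \<in> sobolev 1 \<Omega>" "weak_partial \<Omega> i u \<in> sobolev 1 \<Omega>"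
proof -
  have two: "sobolev 2 \<Omega> = {u \<in> L2 \<Omega>. \<forall>i. \<exists>g \<in> sobolev 1 \<Omega>. has_weak_partial \<Omega> i u g}"
    by (simp add: numeral_2_eq_2)
  have uL: "u \<in> L2 \<Omega>" using u unfolding two by blast
  have ex: "\<exists>g. g \<in> sobolev 1 \<Omega> \<and> has_weak_partial \<Omega> i u g" for i using u unfolding two by blast
  obtain G where G: "\<And>i. G i \<in> sobolev 1 \<Omega>" "\<And>i. has_weak_partial \<Omega> i u (G i)" using ex by metis
  show uH: "u \<in> sobolev 1 \<Omega>" by (rule sobolev_1I[OF uL sobolev_1D(1)[OF G(1) \<Omega>] G(2)])
  note w = sobolev_1D(3)[OF uH \<Omega>]
  show "weak_partial \<Omega> i u \<in> sobolev 1 \<Omega>"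
    by (rule sobolev_1I[OF w sobolev_1D(3)[OF G(1) \<Omega>]
        has_weak_partial_cong_AE[OF sobolev_1D(2)[OF G(1) \<Omega>] w \<Omega> weak_partial_AE[OF \<Omega> G(2)]]])
qed

lemma Linfty_common_bound:
  assumes "finite I" "\<And>i. i \<in> I \<Longrightarrow> f i \<in> Linfty \<Omega>"
  shows "\<exists>A\<ge>0. \<forall>i\<in>I. AE x in lebesgue_on \<Omega>. norm (f i x) \<le> A"
  using assms
proof (induction I rule: finite_induct)
  case (insert i I)
  then obtain A where A: "0 \<le> A" "\<forall>i\<in>I. AE x in lebesgue_on \<Omega>. norm (f i x) \<le> A" by auto
  obtain B where B: "AE x in lebesgue_on \<Omega>. norm (f i x) \<le> B" using insert.prems[of i] by (auto simp: Linfty_def)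
  have "AE x in lebesgue_on \<Omega>. norm (f l x) \<le> max A B" if "l \<in> insert i I" for l
  proof (cases "l = i")
    case True
    show ?thesis unfolding True using B by eventually_elim simp
  next
    case False
    then have "AE x in lebesgue_on \<Omega>. norm (f l x) \<le> A" using A that by blast
    then show ?thesis by eventually_elim simp
  qed
  then show ?case using A(1) by (intro exI[of _ "max A B"]) auto
qed auto

definition energy_bound :: "(real^'n::finite) set \<Rightarrow> real \<Rightarrow> (real^'n \<Rightarrow> complex) \<Rightarrow> (real^'n \<Rightarrow> complex) \<Rightarrow> real" where
  "energy_bound \<Omega> k u f = k * L2_norm \<Omega> u * (L2_norm \<Omega> f + sobolev_norm 1 \<Omega> u) + (sobolev_norm 1 \<Omega> u)\<^sup>2"

text \<open>The equation is tested with \<open>\<phi> \<sqdot> cnj u\<close>. Gradients of \<open>\<phi>\<close> of order \<open>k\<close> are harmless, because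
  they only meet products of \<open>u\<close> with a first derivative of \<open>u\<close>.\<close>

lemma energy_estimate:
  fixes \<Omega> :: "(real^'n::finite) set"
  assumes \<Omega>: "open \<Omega>" "bounded \<Omega>"
    and a2_bounded: "\<forall>j m. a2 j m \<in> Linfty \<Omega>"
    and deriv_a2_bounded: "\<forall>p j m. \<exists>g \<in> Linfty \<Omega>. has_weak_partial \<Omega> p (a2 j m :: real^'n \<Rightarrow> real) g"
    and lower: "\<forall>j. a1 j \<in> Linfty \<Omega>" "a \<in> Linfty \<Omega>" "a0 \<in> Linfty \<Omega>" and G: "0 \<le> G"
  shows "\<exists>C\<ge>0. \<forall>k\<ge>1. \<forall>u f \<phi>. solves_helmholtz \<Omega> a2 a1 a a0 k u f \<longrightarrow> C1_compact \<Omega> \<phi> \<longrightarrow>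
      (\<forall>x. \<bar>\<phi> x\<bar> \<le> 1) \<longrightarrow> (\<forall>i x. \<bar>partial_deriv i \<phi> x\<bar> \<le> G * k) \<longrightarrow>
      k\<^sup>2 * integral\<^sup>L (lebesgue_on \<Omega>) (\<lambda>x. \<phi> x * (cmod (u x))\<^sup>2) \<le> C * energy_bound \<Omega> k u f"
proof -
  let ?M = "lebesgue_on \<Omega>"
  obtain d where d: "\<And>p j m. d p j m \<in> Linfty \<Omega>" "\<And>p j m. has_weak_partial \<Omega> p (a2 j m) (d p j m)"
    using deriv_a2_bounded by metis
  obtain A1 where A1: "0 \<le> A1" "\<And>j m. AE x in ?M. norm (a2 j m x) \<le> A1"
    using Linfty_common_bound[of UNIV "\<lambda>(j, m). a2 j m" \<Omega>] a2_bounded by auto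
  obtain A2 where A2: "0 \<le> A2" "\<And>p j m. AE x in ?M. norm (d p j m x) \<le> A2"
    using Linfty_common_bound[of UNIV "\<lambda>(p, j, m). d p j m" \<Omega>] d(1) by auto
  obtain A3 where A3: "0 \<le> A3" "\<And>j. AE x in ?M. norm (a1 j x) \<le> A3"
    using Linfty_common_bound[of UNIV a1 \<Omega>] lower by auto
  obtain A4 where A4: "0 \<le> A4" "AE x in ?M. norm (a x) \<le> A4" "AE x in ?M. norm (a0 x) \<le> A4"
    using Linfty_common_bound[of "{a, a0}" "\<lambda>f. f" \<Omega>] lower by auto
  define A where "A = A1 + A2 + A3 + A4"
  have A: "0 \<le> A" using A1 A2 A3 A4 by (simp add: A_def)
  have up: "AE x in ?M. h x \<le> A" if "AE x in ?M. h x \<le> B" "B \<le> A" for h :: "real^'n \<Rightarrow> real" and B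
    using that(1) by eventually_elim (use that(2) in linarith)
  have le: "A1 \<le> A" "A2 \<le> A" "A3 \<le> A" "A4 \<le> A" using A1(1) A2(1) A3(1) A4(1) by (auto simp: A_def)
  have Ab: "AE x in ?M. cmod (complex_of_real (a2 j m x)) \<le> A" "AE x in ?M. cmod (complex_of_real (d p j m x)) \<le> A"
    "AE x in ?M. cmod (a1 j x) \<le> A" "AE x in ?M. cmod (a x) \<le> A" "AE x in ?M. cmod (a0 x) \<le> A" for p j m
    unfolding norm_of_real real_norm_def[symmetric]
    by (rule up[OF A1(2) le(1)] up[OF A2(2) le(2)] up[OF A3(2) le(3)] up[OF A4(2) le(4)] up[OF A4(3) le(4)])+
  have meas: "(\<lambda>x. complex_of_real (a2 j m x)) \<in> borel_measurable ?M" "(\<lambda>x. complex_of_real (d p j m x)) \<in> borel_measurable ?M"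
    "a1 j \<in> borel_measurable ?M" "a \<in> borel_measurable ?M" "a0 \<in> borel_measurable ?M" for p j m
  proof -
    have "a2 j m \<in> borel_measurable ?M" "d p j m \<in> borel_measurable ?M"
      using a2_bounded d(1) by (auto simp: Linfty_def)
    then show "(\<lambda>x. complex_of_real (a2 j m x)) \<in> borel_measurable ?M" "(\<lambda>x. complex_of_real (d p j m x)) \<in> borel_measurable ?M"
      by measurable
  qed (use lower in \<open>auto simp: Linfty_def\<close>)
  define n where "n = real CARD('n)"
  \<comment> \<open>1 for the right-hand side f; for each of the n^2 second-order terms
    \<open>G * A\<close> when the derivative meets the cutoff and \<open>2 * A\<close> when it meets
    the coefficient or the solution; \<open>n * A\<close> for the first-order terms;
    \<open>A\<close> each for \<open>a\<close> and \<open>a0\<close>.\<close>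
  define C where "C = 1 + n * n * (G * A + 2 * A) + n * A + 2 * A"
  show ?thesis
  proof (intro exI[of _ C] conjI allI impI)
    show "0 \<le> C" using G A by (simp add: C_def n_def)
    fix k :: real and u f \<phi>
    assume k: "1 \<le> k" and sol: "solves_helmholtz \<Omega> a2 a1 a a0 k u f" and \<phi>: "C1_compact \<Omega> \<phi>"
      and \<phi>1: "\<forall>x. \<bar>\<phi> x\<bar> \<le> 1" and \<phi>G: "\<forall>i x. \<bar>partial_deriv i \<phi> x\<bar> \<le> G * k"
    have u2: "u \<in> sobolev 2 \<Omega>" and fL: "f \<in> L2 \<Omega>"
      and eq: "AE x in ?M. elliptic_op \<Omega> a2 a1 a u x - \<i> * a0 x * of_real k * u x + (of_real k)\<^sup>2 * u x = f x"
      using sol by (auto simp only: solves_helmholtz_def)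
    note u1 = sobolev_2D[OF u2 \<Omega>(1)]
    note uD = sobolev_1D[OF u1(1) \<Omega>(1)] and uDD = sobolev_1D[OF u1(2) \<Omega>(1)]
    let ?D = "\<lambda>i. weak_partial \<Omega> i u"
    let ?DD = "\<lambda>j m. weak_partial \<Omega> j (weak_partial \<Omega> m u)"
    let ?X = "L2_norm \<Omega> u" and ?Y = "sobolev_norm 1 \<Omega> u" and ?F = "L2_norm \<Omega> f"
    let ?v = "\<lambda>x. cnj (u x)"
    note vL = L2_cnj[OF uD(1)]
    note m\<phi> = C1_compact_measurable(1)[OF \<phi>]
    have cb: "(\<lambda>x. complex_of_real (\<phi> x) * b x) \<in> borel_measurable ?M" "AE x in ?M. cmod (complex_of_real (\<phi> x) * b x) \<le> A"
      if "b \<in> borel_measurable ?M" "AE x in ?M. cmod (b x) \<le> A" for b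
      using coefficient_bound[OF m\<phi> _ that, of 1] \<phi>1 by auto
    define T2 where "T2 j m x = (complex_of_real (\<phi> x) * complex_of_real (a2 j m x)) * ?DD j m x * ?v x" for j m x
    define T1 where "T1 j x = (complex_of_real (\<phi> x) * a1 j x) * ?D j x * ?v x" for j x
    define Ta where "Ta x = (complex_of_real (\<phi> x) * a x) * u x * ?v x" for x
    define T0 where "T0 x = (complex_of_real (\<phi> x) * a0 x) * u x * ?v x" for x
    define Tf where "Tf x = complex_of_real (\<phi> x) * f x * ?v x" for x
    define I where "I = integral\<^sup>L ?M (\<lambda>x. \<phi> x * (cmod (u x))\<^sup>2)"
    have X: "0 \<le> ?X" and XY: "?X \<le> ?Y" and Y: "0 \<le> ?Y" and F: "0 \<le> ?F"
      by (rule L2_norm_nonneg L2_norm_le_sobolev_norm_1 sobolev_norm_1_nonneg)+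
    have DY: "L2_norm \<Omega> (?D i) \<le> ?Y" for i by (rule weak_partial_le_sobolev_norm_1)
    have int2: "integrable ?M (T2 j m)" for j m
      unfolding T2_def by (rule triple_bound(1)[OF cb[OF meas(1) Ab(1)] A uDD(3) vL])
    have int1: "integrable ?M (T1 j)" and b1: "cmod (integral\<^sup>L ?M (T1 j)) \<le> A * L2_norm \<Omega> (?D j) * ?X" for j
      unfolding T1_def using triple_bound[OF cb[OF meas(3) Ab(3)] A uD(3) vL] by (simp_all only: L2_norm_cnj)
    have inta: "integrable ?M Ta" and ba: "cmod (integral\<^sup>L ?M Ta) \<le> A * ?X * ?X"
      unfolding Ta_def using triple_bound[OF cb[OF meas(4) Ab(4)] A uD(1) vL] by (simp_all only: L2_norm_cnj)
    have int0: "integrable ?M T0" and b0: "cmod (integral\<^sup>L ?M T0) \<le> A * ?X * ?X"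
      unfolding T0_def using triple_bound[OF cb[OF meas(5) Ab(5)] A uD(1) vL] by (simp_all only: L2_norm_cnj)
    have mof: "(\<lambda>x. complex_of_real (\<phi> x)) \<in> borel_measurable ?M" "AE x in ?M. cmod (complex_of_real (\<phi> x)) \<le> 1"
      using m\<phi> \<phi>1 by (measurable, simp)
    have intf: "integrable ?M Tf" and bf: "cmod (integral\<^sup>L ?M Tf) \<le> 1 * ?F * ?X"
      unfolding Tf_def using triple_bound[OF mof zero_le_one fL vL] by (simp_all only: L2_norm_cnj)
    have b2: "cmod (integral\<^sup>L ?M (T2 j m)) \<le> G * k * A * ?Y * ?X + A * ?Y * ?X + A * ?Y * ?Y" for j m
    proof -
      have w: "has_weak_partial \<Omega> j (\<lambda>x. complex_of_real (a2 j m x)) (\<lambda>x. complex_of_real (d j j m x))"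
        by (rule has_weak_partial_of_real[OF d(2)])
      have "cmod (integral\<^sup>L ?M (T2 j m)) \<le> G * k * A * L2_norm \<Omega> (?D m) * L2_norm \<Omega> ?v
          + A * L2_norm \<Omega> (?D m) * L2_norm \<Omega> ?v + A * L2_norm \<Omega> (?D m) * L2_norm \<Omega> (\<lambda>x. cnj (?D j x))"
        unfolding T2_def
        by (rule weighted_ibp_bound[OF \<Omega> uD(3) uDD(3) uDD(2) vL L2_cnj[OF uD(3)] has_weak_partial_cnj[OF uD(2)]
            meas(1) Ab(1) meas(2) Ab(2) w A \<phi>]) (use \<phi>1 \<phi>G in auto)
      also have "\<dots> \<le> G * k * A * ?Y * ?X + A * ?Y * ?X + A * ?Y * ?Y"
        unfolding L2_norm_cnj using G k A X Y DY L2_norm_nonneg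
        by (intro add_mono mult_mono mult_nonneg_nonneg order_refl) auto
      finally show ?thesis .
    qed
    \<comment> \<open>The tested equation, solved for the term with
      \<open>k\<^sup>2\<close>.\<close>
    have "complex_of_real (k\<^sup>2 * I) = integral\<^sup>L ?M (\<lambda>x. complex_of_real (k\<^sup>2 * (\<phi> x * (cmod (u x))\<^sup>2)))"
      by (simp only: I_def integral_complex_of_real integral_mult_right_zero)
    also have "\<dots> = integral\<^sup>L ?M (\<lambda>x. Tf x - (\<Sum>j\<in>UNIV. \<Sum>m\<in>UNIV. T2 j m x) - (\<Sum>j\<in>UNIV. T1 j x) - Ta x + \<i> * of_real k * T0 x)"
    proof (rule integral_cong_AE)
      show "AE x in ?M. complex_of_real (k\<^sup>2 * (\<phi> x * (cmod (u x))\<^sup>2))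
          = Tf x - (\<Sum>j\<in>UNIV. \<Sum>m\<in>UNIV. T2 j m x) - (\<Sum>j\<in>UNIV. T1 j x) - Ta x + \<i> * of_real k * T0 x"
        using eq
      proof eventually_elim
        case (elim x)
        have "Tf x = complex_of_real (\<phi> x) * (elliptic_op \<Omega> a2 a1 a u x - \<i> * a0 x * of_real k * u x + (of_real k)\<^sup>2 * u x) * ?v x"
          unfolding elim Tf_def ..
        also have "\<dots> = (\<Sum>j\<in>UNIV. \<Sum>m\<in>UNIV. T2 j m x) + (\<Sum>j\<in>UNIV. T1 j x) + Ta x - \<i> * of_real k * T0 x
            + complex_of_real (k\<^sup>2) * complex_of_real (\<phi> x) * (u x * ?v x)"
          unfolding elliptic_op_def T2_def T1_def Ta_def T0_def
          by (simp add: algebra_simps sum_distrib_left sum_distrib_right)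
        also have "u x * ?v x = complex_of_real ((cmod (u x))\<^sup>2)" by (rule complex_norm_square[symmetric])
        finally show ?case by (simp add: algebra_simps)
      qed
      have "(\<lambda>x. \<phi> x * (cmod (u x))\<^sup>2) \<in> borel_measurable ?M"
        using m\<phi> L2D(1)[OF uD(1)] by measurable
      then show "(\<lambda>x. complex_of_real (k\<^sup>2 * (\<phi> x * (cmod (u x))\<^sup>2))) \<in> borel_measurable ?M" by measurable
      note [measurable] = intf[THEN borel_measurable_integrable] int2[THEN borel_measurable_integrable]
        int1[THEN borel_measurable_integrable] inta[THEN borel_measurable_integrable] int0[THEN borel_measurable_integrable]
      show "(\<lambda>x. Tf x - (\<Sum>j\<in>UNIV. \<Sum>m\<in>UNIV. T2 j m x) - (\<Sum>j\<in>UNIV. T1 j x) - Ta x + \<i> * of_real k * T0 x) \<in> borel_measurable ?M"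
        by measurable
    qed
    also have "\<dots> = integral\<^sup>L ?M Tf - (\<Sum>j\<in>UNIV. \<Sum>m\<in>UNIV. integral\<^sup>L ?M (T2 j m)) - (\<Sum>j\<in>UNIV. integral\<^sup>L ?M (T1 j))
        - integral\<^sup>L ?M Ta + \<i> * of_real k * integral\<^sup>L ?M T0"
      using intf int2 int1 inta int0 by simp
    finally have main: "complex_of_real (k\<^sup>2 * I) = \<dots>" .
    have s2: "cmod (\<Sum>j\<in>UNIV. \<Sum>m\<in>UNIV. integral\<^sup>L ?M (T2 j m)) \<le> n * (n * (G * k * A * ?Y * ?X + A * ?Y * ?X + A * ?Y * ?Y))"
      unfolding n_def by (rule sum_norm_bound, rule sum_norm_bound, rule b2)
    have s1: "cmod (\<Sum>j\<in>UNIV. integral\<^sup>L ?M (T1 j)) \<le> n * (A * ?Y * ?X)"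
      unfolding n_def
    proof (rule sum_norm_bound)
      fix j
      have "A * L2_norm \<Omega> (?D j) * ?X \<le> A * ?Y * ?X" by (intro mult_mono mult_nonneg_nonneg Y A X DY L2_norm_nonneg order_refl)
      with b1[of j] show "cmod (integral\<^sup>L ?M (T1 j)) \<le> A * ?Y * ?X" by linarith
    qed
    have s0: "cmod (\<i> * of_real k * integral\<^sup>L ?M T0) \<le> k * (A * ?X * ?X)"
      using b0 k by (simp add: norm_mult)
    define Q where "Q = energy_bound \<Omega> k u f"
    \<comment> \<open>Every product that occurs lies below \<open>Q\<close>: those with a factor k
      by the first summand of \<open>energy_bound\<close>, the square of the H1 norm by the second,
      and the rest because k is at least 1 and the L2 norm lies below the H1 norm.\<close>
    have kXY: "k * ?X * ?Y \<le> Q" and kXF: "k * ?X * ?F \<le> Q" and YY: "?Y * ?Y \<le> Q"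
      using k X Y F by (auto simp: Q_def energy_bound_def distrib_left power2_eq_square intro: add_increasing2 add_increasing)
    have XYk: "?X * ?Y \<le> k * ?X * ?Y" using k X Y by (simp add: mult_right_mono mult_le_cancel_right1)
    have XX: "?X * ?X \<le> ?X * ?Y" using X XY by (rule mult_left_mono[rotated])
    have XF: "?F * ?X \<le> k * ?X * ?F" using mult_right_mono[OF k, of "?X * ?F"] X F by (simp add: mult_ac)
    have kXX: "k * (?X * ?X) \<le> k * ?X * ?Y" using XX k by (simp add: mult.assoc mult_left_mono)
    have Q1: "?Y * ?X \<le> Q" "k * ?Y * ?X \<le> Q" "?X * ?X \<le> Q" "k * (?X * ?X) \<le> Q" "?F * ?X \<le> Q"
      using kXY XYk XX XF kXF kXX by (auto simp: mult_ac)
    have "k\<^sup>2 * I \<le> cmod (complex_of_real (k\<^sup>2 * I))" by (simp only: norm_of_real abs_ge_self)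
    also have "\<dots> \<le> cmod (integral\<^sup>L ?M Tf) + cmod (\<Sum>j\<in>UNIV. \<Sum>m\<in>UNIV. integral\<^sup>L ?M (T2 j m)) + cmod (\<Sum>j\<in>UNIV. integral\<^sup>L ?M (T1 j))
        + cmod (integral\<^sup>L ?M Ta) + cmod (\<i> * of_real k * integral\<^sup>L ?M T0)"
      unfolding main
      by (intro norm_triangle_le order_trans[OF norm_triangle_ineq4] add_mono order_refl)
    also have "\<dots> \<le> Q + n * (n * (G * A * Q + A * Q + A * Q)) + n * (A * Q) + A * Q + A * Q"
    proof -
      have n: "0 \<le> n" by (simp add: n_def)
      have "cmod (integral\<^sup>L ?M Tf) \<le> Q" using bf Q1(5) by linarith
      moreover have "n * (n * (G * k * A * ?Y * ?X + A * ?Y * ?X + A * ?Y * ?Y)) \<le> n * (n * (G * A * Q + A * Q + A * Q))"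
      proof (intro mult_left_mono n add_mono)
        have "G * A * (k * ?Y * ?X) \<le> G * A * Q" using G A by (intro mult_left_mono Q1) auto
        then show "G * k * A * ?Y * ?X \<le> G * A * Q" by (simp only: mult_ac)
        have "A * (?Y * ?X) \<le> A * Q" "A * (?Y * ?Y) \<le> A * Q" by (rule mult_left_mono[OF Q1(1) A] mult_left_mono[OF YY A])+
        then show "A * ?Y * ?X \<le> A * Q" "A * ?Y * ?Y \<le> A * Q" by (simp_all only: mult.assoc)
      qed
      moreover have "n * (A * ?Y * ?X) \<le> n * (A * Q)"
        using mult_left_mono[OF mult_left_mono[OF Q1(1) A] n] by (simp only: mult.assoc)
      moreover have "A * ?X * ?X \<le> A * Q" using mult_left_mono[OF Q1(3) A] by (simp only: mult.assoc)
      moreover have "k * (A * ?X * ?X) \<le> A * Q"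
      proof -
        have "A * (k * (?X * ?X)) \<le> A * Q" by (rule mult_left_mono[OF Q1(4) A])
        then show ?thesis by (simp only: mult_ac)
      qed
      ultimately show ?thesis using s2 s1 s0 ba by linarith
    qed
    also have "\<dots> = C * Q" by (simp add: C_def algebra_simps)
    finally show "k\<^sup>2 * integral\<^sup>L ?M (\<lambda>x. \<phi> x * (cmod (u x))\<^sup>2) \<le> C * energy_bound \<Omega> k u f"
      by (simp add: I_def Q_def)
  qed
qed

text \<open>The derivative moves from \<phi> to the squared modulus of \<open>u\<close>, so the
  steepness of \<phi> does not enter. A cutoff with a transversal derivative of size k thus controls
  k times the mass of its steep region.\<close>

lemma transport_estimate:
  fixes \<Omega> :: "(real^'n::finite) set"
  assumes \<Omega>: "open \<Omega>" and u: "u \<in> sobolev 1 \<Omega>" and \<phi>: "C1_compact \<Omega> \<phi>" and \<phi>1: "\<And>x. \<bar>\<phi> x\<bar> \<le> 1"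
  shows "\<bar>integral\<^sup>L (lebesgue_on \<Omega>) (\<lambda>x. partial_deriv i \<phi> x * (cmod (u x))\<^sup>2)\<bar> \<le> 2 * L2_norm \<Omega> u * sobolev_norm 1 \<Omega> u"
proof -
  let ?M = "lebesgue_on \<Omega>"
  note uD = sobolev_1D[OF u \<Omega>]
  let ?D = "weak_partial \<Omega> i u"
  note w = has_weak_partial_mult[OF uD(2) has_weak_partial_cnj[OF uD(2)] \<Omega> uD(1,3) L2_cnj[OF uD(1)] L2_cnj[OF uD(3)]]
  have mof: "(\<lambda>x. complex_of_real (\<phi> x)) \<in> borel_measurable ?M" "AE x in ?M. cmod (complex_of_real (\<phi> x)) \<le> 1"
    using C1_compact_measurable(1)[OF \<phi>, of \<Omega>] \<phi>1 by (measurable, simp)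
  note t1 = triple_bound[OF mof zero_le_one uD(3) L2_cnj[OF uD(1)], unfolded L2_norm_cnj]
  note t2 = triple_bound[OF mof zero_le_one uD(1) L2_cnj[OF uD(3)], unfolded L2_norm_cnj]
  have "complex_of_real (integral\<^sup>L ?M (\<lambda>x. partial_deriv i \<phi> x * (cmod (u x))\<^sup>2))
      = integral\<^sup>L ?M (\<lambda>x. partial_deriv i \<phi> x *\<^sub>R (u x * cnj (u x)))"
    by (simp only: complex_norm_square[symmetric] scaleR_conv_of_real of_real_mult[symmetric] integral_complex_of_real)
  also have "\<dots> = - integral\<^sup>L ?M (\<lambda>x. \<phi> x *\<^sub>R (?D x * cnj (u x) + u x * cnj (?D x)))"
    by (rule has_weak_partial_C1[OF w \<Omega> \<phi>])
  also have "integral\<^sup>L ?M (\<lambda>x. \<phi> x *\<^sub>R (?D x * cnj (u x) + u x * cnj (?D x)))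
      = integral\<^sup>L ?M (\<lambda>x. complex_of_real (\<phi> x) * ?D x * cnj (u x) + complex_of_real (\<phi> x) * u x * cnj (?D x))"
    by (rule Bochner_Integration.integral_cong) (auto simp: scaleR_conv_of_real algebra_simps)
  also have "\<dots> = integral\<^sup>L ?M (\<lambda>x. complex_of_real (\<phi> x) * ?D x * cnj (u x)) + integral\<^sup>L ?M (\<lambda>x. complex_of_real (\<phi> x) * u x * cnj (?D x))"
    by (rule Bochner_Integration.integral_add[OF t1(1) t2(1)])
  finally have eq: "complex_of_real (integral\<^sup>L ?M (\<lambda>x. partial_deriv i \<phi> x * (cmod (u x))\<^sup>2))
      = - (integral\<^sup>L ?M (\<lambda>x. complex_of_real (\<phi> x) * ?D x * cnj (u x)) + integral\<^sup>L ?M (\<lambda>x. complex_of_real (\<phi> x) * u x * cnj (?D x)))" .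
  have "cmod (complex_of_real (integral\<^sup>L ?M (\<lambda>x. partial_deriv i \<phi> x * (cmod (u x))\<^sup>2)))
      \<le> 1 * L2_norm \<Omega> ?D * L2_norm \<Omega> u + 1 * L2_norm \<Omega> u * L2_norm \<Omega> ?D"
    unfolding eq norm_minus_cancel by (rule order_trans[OF norm_triangle_ineq add_mono[OF t1(2) t2(2)]])
  then have "\<bar>integral\<^sup>L ?M (\<lambda>x. partial_deriv i \<phi> x * (cmod (u x))\<^sup>2)\<bar> \<le> 2 * L2_norm \<Omega> u * L2_norm \<Omega> ?D"
    unfolding norm_of_real by (simp add: mult_ac)
  also have "\<dots> \<le> 2 * L2_norm \<Omega> u * sobolev_norm 1 \<Omega> u"
    by (intro mult_left_mono weak_partial_le_sobolev_norm_1) (simp add: L2_norm_nonneg)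
  finally show ?thesis .
qed

section \<open>Estimates up to the boundary\<close>

text \<open>The profile 1 - exp(-s) with a modified exponent. For s \<ge> a the exponent
  \<open>(s - a)\<^sup>2 / s\<close> vanishes to second order at s = a, so the extension by 0 is of
  class C1 and the cutoff keeps away from the boundary. Its derivative
  \<open>1 - (a / s)\<^sup>2\<close> lies between 0 and 1, which makes all bounds uniform in a, and
  the exponent tends to s as a tends to 0.\<close>

definition layer :: "real \<Rightarrow> real \<Rightarrow> real" where
  "layer a s = 1 - exp (- ((max a s - a)\<^sup>2 / max a s))"

definition layer' :: "real \<Rightarrow> real \<Rightarrow> real" where
  "layer' a s = exp (- ((max a s - a)\<^sup>2 / max a s)) * (1 - (a / max a s)\<^sup>2)"

text \<open>The layer and its derivative add up to 1 minus the exponential times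
  \<open>(a / max a s)\<^sup>2\<close>. For s > 0 this tends to 1 as a tends to 0, which is the
  regularised form of H + H' = 1.\<close>

lemma layer_bounds:
  assumes "0 < a"
  shows "0 \<le> layer a s" "layer a s \<le> 1" "0 \<le> layer' a s" "layer' a s \<le> 1"
    "layer a s + layer' a s \<le> 1" "a \<le> s \<Longrightarrow> 1 - (a / s)\<^sup>2 \<le> layer a s + layer' a s" "s \<le> a \<Longrightarrow> layer a s = 0"
proof -
  let ?E = "exp (- ((max a s - a)\<^sup>2 / max a s))" and ?q = "(a / max a s)\<^sup>2"
  have m: "0 < max a s" using assms by simp
  have E: "0 < ?E" "?E \<le> 1" using m by auto
  have q: "0 \<le> ?q" "?q \<le> 1" using m assms by (auto intro!: power_le_one simp: divide_le_eq)
  show "0 \<le> layer a s" "layer a s \<le> 1" using E by (auto simp: layer_def)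
  show "0 \<le> layer' a s" using E q by (simp add: layer'_def)
  show "layer' a s \<le> 1" unfolding layer'_def using E q by (intro mult_le_one) auto
  have s: "layer a s + layer' a s = 1 - ?E * ?q" by (simp add: layer_def layer'_def algebra_simps)
  show "layer a s + layer' a s \<le> 1" unfolding s using E q by simp
  have "?E * ?q \<le> 1 * ?q" using E q by (intro mult_right_mono) auto
  then show "a \<le> s \<Longrightarrow> 1 - (a / s)\<^sup>2 \<le> layer a s + layer' a s" unfolding s by (simp add: max_def split: if_splits)
  show "s \<le> a \<Longrightarrow> layer a s = 0" by (simp add: layer_def max_def)
qed

lemma layer_has_derivative:
  assumes a: "0 < a" shows "(layer a has_real_derivative layer' a s) (at s)"
proof -
  consider "a < s" | "s < a" | "s = a" by linarith
  then show ?thesis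
  proof cases
    case 1
    have "((\<lambda>s. 1 - exp (- ((s - a)\<^sup>2 / s))) has_real_derivative layer' a s) (at s)"
    proof -
      have d: "((\<lambda>s. (s - a)\<^sup>2 / s) has_real_derivative 1 - (a / s)\<^sup>2) (at s)"
        using 1 a by (auto intro!: derivative_eq_intros simp: field_simps power2_eq_square)
      have "((\<lambda>s. 1 - exp (- ((s - a)\<^sup>2 / s))) has_real_derivative exp (- ((s - a)\<^sup>2 / s)) * (1 - (a / s)\<^sup>2)) (at s)"
        using DERIV_diff[OF DERIV_const[of 1] DERIV_fun_exp[OF DERIV_minus[OF d]]]
        by (simp only: mult_minus_right diff_minus_eq_add add_0_left)
      then show ?thesis using 1 by (simp add: layer'_def)
    qed
    moreover have "\<forall>\<^sub>F x in nhds s. layer a x = 1 - exp (- ((x - a)\<^sup>2 / x))"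
      using eventually_nhds_in_open[of "{a<..}" s] 1 by (auto simp: layer_def elim!: eventually_mono)
    ultimately show ?thesis by (subst DERIV_cong_ev[OF refl _ refl]) auto
  next
    case 2
    have "\<forall>\<^sub>F x in nhds s. layer a x = 0"
      using eventually_nhds_in_open[of "{..<a}" s] 2 by (auto simp: layer_def elim!: eventually_mono)
    then show ?thesis using 2 a
      by (subst DERIV_cong_ev[OF refl _ refl, of _ "\<lambda>x. 0"]) (auto simp: layer'_def)
  next
    case 3
    \<comment> \<open>At the junction s = a the layer is bounded by \<open>h\<^sup>2 / a\<close>, so
      its derivative there is 0.\<close>
    have b: "\<bar>layer a (a + h)\<bar> \<le> \<bar>h\<bar> * (\<bar>h\<bar> / a)" for h
    proof -
      have m: "a \<le> max a (a + h)" by simp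
      have "(max a (a + h) - a)\<^sup>2 / max a (a + h) \<le> h\<^sup>2 / a"
      proof (rule frac_le)
        have "\<bar>max a (a + h) - a\<bar> \<le> \<bar>h\<bar>" by (simp add: max_def)
        then show "(max a (a + h) - a)\<^sup>2 \<le> h\<^sup>2" by (simp only: abs_le_square_iff)
      qed (use a m in auto)
      moreover have "layer a (a + h) \<le> (max a (a + h) - a)\<^sup>2 / max a (a + h)"
        using exp_ge_add_one_self[of "- ((max a (a + h) - a)\<^sup>2 / max a (a + h))"] unfolding layer_def by linarith
      ultimately show ?thesis using layer_bounds(1)[OF a, of "a + h"] by (simp add: power2_eq_square)
    qed
    have "((\<lambda>h. (layer a (a + h) - layer a a) / h) \<longlongrightarrow> 0) (at 0)"
    proof (rule Lim_null_comparison)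
      show "\<forall>\<^sub>F h in at 0. norm ((layer a (a + h) - layer a a) / h) \<le> \<bar>h\<bar> / a"
        using eventually_neq_at_within[of 0 0 UNIV]
      proof eventually_elim
        case (elim h)
        have "layer a a = 0" using layer_bounds(7)[OF a] by simp
        moreover have "\<bar>layer a (a + h)\<bar> / \<bar>h\<bar> \<le> \<bar>h\<bar> / a" using b[of h] elim by (simp add: pos_divide_le_eq mult.commute)
        ultimately show ?case by (simp add: abs_divide)
      qed
      have "((\<lambda>h. \<bar>h\<bar> / a) \<longlongrightarrow> \<bar>0\<bar> / a) (at 0)" using a by (intro tendsto_intros) auto
      then show "((\<lambda>h. \<bar>h\<bar> / a) \<longlongrightarrow> 0) (at 0)" by simp
    qed
    moreover have "layer' a s = 0" using 3 a by (simp add: layer'_def)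
    ultimately show ?thesis using 3 by (simp add: DERIV_def)
  qed
qed

lemma continuous_layer': "0 < a \<Longrightarrow> continuous_on UNIV (layer' a)"
  unfolding layer'_def by (intro continuous_intros) (auto simp: max_def)

lemma continuous_layer: "0 < a \<Longrightarrow> continuous_on UNIV (layer a)"
  unfolding layer_def by (intro continuous_intros) (auto simp: max_def)

section \<open>Weighted estimates in a single box\<close>

text \<open>The constant may depend on the weight \<xi>, since only finitely many weights are summed
  in the end.\<close>

definition local_bound :: "(real^'n::finite) set \<Rightarrow> (real \<Rightarrow> (real^'n \<Rightarrow> complex) \<Rightarrow> (real^'n \<Rightarrow> complex) \<Rightarrow> bool)
    \<Rightarrow> (real^'n \<Rightarrow> real) \<Rightarrow> bool" where
  "local_bound \<Omega> sol \<xi> \<longleftrightarrow> (\<exists>C\<ge>0. \<forall>k\<ge>1. \<forall>u f. sol k u f \<longrightarrow>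
      k\<^sup>2 * integral\<^sup>L (lebesgue_on \<Omega>) (\<lambda>x. \<xi> x * (cmod (u x))\<^sup>2) \<le> C * energy_bound \<Omega> k u f)"

lemma bounded_weight_integrable:
  assumes u: "u \<in> L2 \<Omega>" and [measurable]: "h \<in> borel_measurable (lebesgue_on \<Omega>)" and h: "\<And>x. \<bar>h x\<bar> \<le> B"
  shows "integrable (lebesgue_on \<Omega>) (\<lambda>x. h x * (cmod (u x))\<^sup>2)"
    and "\<bar>integral\<^sup>L (lebesgue_on \<Omega>) (\<lambda>x. h x * (cmod (u x))\<^sup>2)\<bar> \<le> B * (L2_norm \<Omega> u)\<^sup>2"
proof -
  note L2D(1)[OF u, measurable]
  have i: "integrable (lebesgue_on \<Omega>) (\<lambda>x. B * (cmod (u x))\<^sup>2)" using L2D(2)[OF u] by simp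
  have b: "norm (h x * (cmod (u x))\<^sup>2) \<le> B * (cmod (u x))\<^sup>2" for x
    using h[of x] by (simp add: abs_mult mult_right_mono)
  show i2: "integrable (lebesgue_on \<Omega>) (\<lambda>x. h x * (cmod (u x))\<^sup>2)"
    by (rule integrable_dominated[OF i _ b]) measurable
  have "norm (integral\<^sup>L (lebesgue_on \<Omega>) (\<lambda>x. h x * (cmod (u x))\<^sup>2)) \<le> integral\<^sup>L (lebesgue_on \<Omega>) (\<lambda>x. B * (cmod (u x))\<^sup>2)"
    by (rule Bochner_Integration.integral_norm_bound_integral[OF i2 i b])
  also have "\<dots> = B * (L2_norm \<Omega> u)\<^sup>2" by (simp add: L2_norm_def)
  finally show "\<bar>integral\<^sup>L (lebesgue_on \<Omega>) (\<lambda>x. h x * (cmod (u x))\<^sup>2)\<bar> \<le> B * (L2_norm \<Omega> u)\<^sup>2" by simp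
qed

lemma energy_bound_ge:
  assumes "1 \<le> k"
  shows "k * (L2_norm \<Omega> u)\<^sup>2 \<le> energy_bound \<Omega> k u f"
    "k * (L2_norm \<Omega> u * sobolev_norm 1 \<Omega> u) \<le> energy_bound \<Omega> k u f" "0 \<le> energy_bound \<Omega> k u f"
proof -
  let ?X = "L2_norm \<Omega> u" and ?Y = "sobolev_norm 1 \<Omega> u" and ?F = "L2_norm \<Omega> f"
  have X: "0 \<le> ?X" and XY: "?X \<le> ?Y" and Y: "0 \<le> ?Y" and F: "0 \<le> ?F"
    by (rule L2_norm_nonneg L2_norm_le_sobolev_norm_1 sobolev_norm_1_nonneg)+
  have "0 \<le> k * ?X * ?F" using X F assms by (intro mult_nonneg_nonneg) auto
  then show e: "k * (?X * ?Y) \<le> energy_bound \<Omega> k u f"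
    unfolding energy_bound_def distrib_left mult.assoc using zero_le_power2[of ?Y] by linarith
  have "?X\<^sup>2 \<le> ?X * ?Y" unfolding power2_eq_square by (rule mult_left_mono[OF XY X])
  then have "k * ?X\<^sup>2 \<le> k * (?X * ?Y)" using assms by (intro mult_left_mono) auto
  with e show e2: "k * ?X\<^sup>2 \<le> energy_bound \<Omega> k u f" by linarith
  have "0 \<le> k * ?X\<^sup>2" using assms by simp
  with e2 show "0 \<le> energy_bound \<Omega> k u f" by linarith
qed

context
  fixes \<Omega> :: "(real^'n::finite) set" and a2 :: "'n \<Rightarrow> 'n \<Rightarrow> real^'n \<Rightarrow> real"
    and a1 :: "'n \<Rightarrow> real^'n \<Rightarrow> complex" and a a0 :: "real^'n \<Rightarrow> complex"
  assumes \<Omega>: "open \<Omega>" "bounded \<Omega>"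
    and a2_bounded: "\<forall>j m. a2 j m \<in> Linfty \<Omega>"
    and deriv_a2_bounded: "\<forall>p j m. \<exists>g \<in> Linfty \<Omega>. has_weak_partial \<Omega> p (a2 j m) g"
    and lower: "\<forall>j. a1 j \<in> Linfty \<Omega>" "a \<in> Linfty \<Omega>" "a0 \<in> Linfty \<Omega>"
begin

text \<open>A fixed bump inside \<Omega> is itself admissible in the energy estimate: its gradient
  is bounded by some \<open>G\<close>, hence by \<open>G * k\<close> for k \<ge> 1.\<close>

lemma local_bound_interior:
  assumes sub: "cbox b c \<subseteq> \<Omega>"
  shows "local_bound \<Omega> (solves_helmholtz \<Omega> a2 a1 a a0) (bump 1 b c)"
proof -
  have \<phi>: "C1_compact \<Omega> (bump 1 b c)"
    by (rule test_function_C1_compact[OF test_function_bump[OF zero_less_one sub]])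
  obtain G where G: "0 < G" "\<And>i x. \<bar>partial_deriv i (bump 1 b c) x\<bar> \<le> G"
    by (rule C1_compact_bound[OF \<phi>]) blast
  obtain C where C: "0 \<le> C" and CC: "\<And>k u f \<phi>. 1 \<le> k \<Longrightarrow> solves_helmholtz \<Omega> a2 a1 a a0 k u f \<Longrightarrow> C1_compact \<Omega> \<phi> \<Longrightarrow>
      (\<forall>x. \<bar>\<phi> x\<bar> \<le> 1) \<Longrightarrow> (\<forall>i x. \<bar>partial_deriv i \<phi> x\<bar> \<le> G * k) \<Longrightarrow>
      k\<^sup>2 * integral\<^sup>L (lebesgue_on \<Omega>) (\<lambda>x. \<phi> x * (cmod (u x))\<^sup>2) \<le> C * energy_bound \<Omega> k u f"
    using energy_estimate[OF \<Omega> a2_bounded deriv_a2_bounded lower, of G] G(1) by auto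
  show ?thesis
    unfolding local_bound_def
  proof (intro exI[of _ C] conjI allI impI C CC \<phi>)
    show "\<bar>bump 1 b c x\<bar> \<le> 1" for x using bump_nonneg[of 1 b c x] bump_le_1[of 1 b c x] by simp
    fix k :: real and i x assume k: "1 \<le> k"
    have "G * 1 \<le> G * k" using G(1) k by (intro mult_left_mono) auto
    then show "\<bar>partial_deriv i (bump 1 b c) x\<bar> \<le> G * k" using G(2)[of i x] by linarith
  qed
qed

text \<open>Near the boundary the energy estimate degenerates, since \<open>\<phi>\<close> must vanish there. With
  \<open>\<phi> = \<xi> \<sqdot> H(k\<eta>)\<close>, where \<open>\<eta>\<close> is the height above the boundary and \<open>H(s) = 1 - exp(-s)\<close>, the
  missing part \<open>\<xi> \<sqdot> H'(k\<eta>)\<close> is recovered from the derivative of \<open>\<phi>\<close> in the transversal direction,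
  because \<open>H + H' = 1\<close>. The function \<open>layer a\<close> approximates \<open>H\<close> as \<open>a\<close> tends to 0.\<close>

lemma local_bound_boundary:
  fixes \<gamma> :: "real^'n \<Rightarrow> real"
  assumes \<sigma>: "\<sigma> \<in> {1, -1}" and \<gamma>: "Ck_on 2 \<gamma> UNIV"
    and indep: "\<And>x y. (\<forall>i. i \<noteq> j \<longrightarrow> x $ i = y $ i) \<Longrightarrow> \<gamma> x = \<gamma> y"
    and graph: "\<Omega> \<inter> ball x0 r = {x \<in> ball x0 r. \<sigma> * x $ j > \<gamma> x}"
    and sub: "cbox b c \<subseteq> ball x0 r"
  shows "local_bound \<Omega> (solves_helmholtz \<Omega> a2 a1 a a0) (bump 1 b c)"
proof -
  let ?M = "lebesgue_on \<Omega>"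
  let ?\<xi> = "bump 1 b c"
  define \<eta> where "\<eta> x = \<sigma> * x $ j - \<gamma> x" for x
  have \<gamma>d: "\<gamma> differentiable at x" for x using \<gamma> by (simp add: numeral_2_eq_2 differentiable_on_def)
  have \<gamma>c: "continuous_on UNIV (partial_deriv i \<gamma>)" for i
    using \<gamma> by (auto simp: numeral_2_eq_2 intro!: differentiable_imp_continuous_on)
  have \<eta>D: "(\<eta> has_derivative (\<lambda>h. \<sigma> * h $ j - frechet_derivative \<gamma> (at x) h)) (at x)" for x
    unfolding \<eta>_def using \<gamma>d[of x, unfolded frechet_derivative_works]
    by (auto intro!: derivative_eq_intros bounded_linear_imp_has_derivative[OF bounded_linear_vec_nth])
  have \<eta>p: "partial_deriv i \<eta> x = \<sigma> * (if i = j then 1 else 0) - partial_deriv i \<gamma> x" for i x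
    using partial_deriv_eq[OF \<eta>D, of i x] by (auto simp: partial_deriv_def axis_def)
  have \<eta>c: "continuous_on UNIV \<eta>"
    by (intro differentiable_imp_continuous_on) (use \<eta>D in \<open>auto simp: differentiable_on_def differentiable_def\<close>)
  have \<eta>pc: "continuous_on UNIV (partial_deriv i \<eta>)" for i
    unfolding \<eta>p[abs_def] by (intro continuous_intros \<gamma>c)
  \<comment> \<open>\<gamma> does not depend on coordinate j, so the derivative of \<eta> in that
    direction is the constant \<sigma>, of modulus 1: this is the transversal direction.\<close>
  have \<gamma>j: "partial_deriv j \<gamma> x = 0" for x
  proof -
    have "((\<lambda>t. \<gamma> (x + t *\<^sub>R axis j 1)) has_real_derivative partial_deriv j \<gamma> (x + 0 *\<^sub>R axis j 1)) (at 0)"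
      by (rule partial_deriv_line[OF \<gamma>d])
    moreover have "(\<lambda>t. \<gamma> (x + t *\<^sub>R axis j 1)) = (\<lambda>t. \<gamma> x)"
      by (rule ext, rule indep) (simp add: axis_def)
    ultimately have "((\<lambda>t :: real. \<gamma> x) has_real_derivative partial_deriv j \<gamma> x) (at 0)" by simp
    then show ?thesis using DERIV_const DERIV_unique by blast
  qed
  have \<xi>C1: "C1_compact UNIV ?\<xi>" by (rule test_function_C1_compact[OF test_function_bump]) auto
  obtain G1 where G1: "0 < G1" "\<And>i x. \<bar>partial_deriv i ?\<xi> x\<bar> \<le> G1" by (rule C1_compact_bound[OF \<xi>C1]) blast
  have \<xi>0: "?\<xi> x = 0" if "x \<notin> cbox b c" for x using that box_subset_cbox[of b c] by (intro bump_eq_0) auto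
  \<comment> \<open>The gradient of \<eta> may be unbounded on the whole space; multiplied by the
    bump it is continuous with compact support.\<close>
  have "\<exists>B. 0 < B \<and> (\<forall>x. \<bar>?\<xi> x * partial_deriv i \<eta> x\<bar> \<le> B)" for i
  proof -
    obtain B where "0 < B" "\<And>x. \<bar>?\<xi> x * partial_deriv i \<eta> x\<bar> \<le> B"
      by (rule bounded_compact_support[of "\<lambda>x. ?\<xi> x * partial_deriv i \<eta> x" "cbox b c"])
         (use C1_compactD(2)[OF \<xi>C1] \<eta>pc \<xi>0 in \<open>auto intro!: continuous_intros\<close>)
    then show ?thesis by blast
  qed
  then obtain B where B: "\<And>i. 0 < B i" "\<And>i x. \<bar>?\<xi> x * partial_deriv i \<eta> x\<bar> \<le> B i" by metis
  \<comment> \<open>\<open>G1\<close> covers the derivative falling on \<xi>, and \<open>B i\<close>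
    the one falling on the layer, which brings the factor k. G depends neither on k nor on the
    regularisation e, so a single constant from the energy estimate serves them all.\<close>
  define G where "G = G1 + (\<Sum>i\<in>UNIV. B i)"
  have BG: "B i \<le> (\<Sum>i\<in>UNIV. B i)" for i using B(1) by (intro member_le_sum) (auto simp: less_imp_le)
  have G: "0 \<le> G" using G1(1) B(1) by (simp add: G_def sum_nonneg less_imp_le)
  obtain C where C: "0 \<le> C" and CC: "\<And>k u f \<phi>. 1 \<le> k \<Longrightarrow> solves_helmholtz \<Omega> a2 a1 a a0 k u f \<Longrightarrow> C1_compact \<Omega> \<phi> \<Longrightarrow>
      (\<forall>x. \<bar>\<phi> x\<bar> \<le> 1) \<Longrightarrow> (\<forall>i x. \<bar>partial_deriv i \<phi> x\<bar> \<le> G * k) \<Longrightarrow>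
      k\<^sup>2 * integral\<^sup>L ?M (\<lambda>x. \<phi> x * (cmod (u x))\<^sup>2) \<le> C * energy_bound \<Omega> k u f"
    using energy_estimate[OF \<Omega> a2_bounded deriv_a2_bounded lower G] by auto
  show ?thesis
    unfolding local_bound_def
  \<comment> \<open>C comes from the energy estimate, 2 from the transport estimate and G1 from the
    part of the derivative that falls on \<xi>.\<close>
  proof (intro exI[of _ "C + 2 + G1"] conjI allI impI)
    show "0 \<le> C + 2 + G1" using C G1 by simp
    fix k :: real and u f
    assume k: "1 \<le> k" and sol: "solves_helmholtz \<Omega> a2 a1 a a0 k u f"
    have u1: "u \<in> sobolev 1 \<Omega>" using sol sobolev_2D(1)[OF _ \<Omega>(1)] by (auto simp only: solves_helmholtz_def)
    have uL: "u \<in> L2 \<Omega>" by (rule sobolev_1D(1)[OF u1 \<Omega>(1)])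
    note [measurable] = L2D(1)[OF uL]
    let ?Q = "energy_bound \<Omega> k u f"
    define W where "W e x = layer e (k * \<eta> x) + layer' e (k * \<eta> x)" for e x
    have cm: "h \<in> borel_measurable ?M" if "continuous_on UNIV h" for h :: "real^'n \<Rightarrow> real"
      by (rule borel_lebesgue_on[OF borel_measurable_continuous_onI[OF that]])
    have kc: "continuous_on UNIV (\<lambda>x. k * \<eta> x)" by (intro continuous_intros \<eta>c)
    have lc: "continuous_on UNIV (\<lambda>x. layer e (k * \<eta> x))" "continuous_on UNIV (\<lambda>x. layer' e (k * \<eta> x))" if "0 < e" for e
      using continuous_on_compose2[OF continuous_layer[OF that] kc] continuous_on_compose2[OF continuous_layer'[OF that] kc] by auto
    have \<xi>c: "continuous_on UNIV ?\<xi>" by (rule C1_compactD(2)[OF \<xi>C1])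
    have \<xi>b: "0 \<le> ?\<xi> x" "?\<xi> x \<le> 1" for x by (rule bump_nonneg bump_le_1)+
    have step: "k\<^sup>2 * integral\<^sup>L ?M (\<lambda>x. (?\<xi> x * W e x) * (cmod (u x))\<^sup>2) \<le> (C + 2 + G1) * ?Q" if e: "0 < e" for e
    proof -
      define \<phi> where "\<phi> x = ?\<xi> x * layer e (k * \<eta> x)" for x
      note lb = layer_bounds[OF e]
      have \<phi>D: "partial_deriv i \<phi> x = ?\<xi> x * (layer' e (k * \<eta> x) * (k * partial_deriv i \<eta> x)) + partial_deriv i ?\<xi> x * layer e (k * \<eta> x)"
        and \<phi>d: "\<phi> differentiable at x" for i x
      proof -
        have "((\<lambda>x. k * \<eta> x) has_derivative (\<lambda>h. k * (\<sigma> * h $ j - frechet_derivative \<gamma> (at x) h))) (at x)"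
          by (rule has_derivative_mult_right[OF \<eta>D])
        from has_derivative_compose[OF this layer_has_derivative[OF e, unfolded has_field_derivative_def]]
        have ld: "((\<lambda>x. layer e (k * \<eta> x)) has_derivative (\<lambda>h. layer' e (k * \<eta> x) * (k * (\<sigma> * h $ j - frechet_derivative \<gamma> (at x) h)))) (at x)" .
        have lp: "partial_deriv i (\<lambda>x. layer e (k * \<eta> x)) x = layer' e (k * \<eta> x) * (k * partial_deriv i \<eta> x)"
          using partial_deriv_eq[OF ld] partial_deriv_eq[OF \<eta>D] by simp
        have dl: "(\<lambda>x. layer e (k * \<eta> x)) differentiable at x" using ld by (auto simp: differentiable_def)
        have dx: "?\<xi> differentiable at x" by (rule C1_compactD(1)[OF \<xi>C1])
        show "\<phi> differentiable at x" unfolding \<phi>_def[abs_def] by (rule differentiable_mult[OF dx dl])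
        show "partial_deriv i \<phi> x = ?\<xi> x * (layer' e (k * \<eta> x) * (k * partial_deriv i \<eta> x)) + partial_deriv i ?\<xi> x * layer e (k * \<eta> x)"
          unfolding \<phi>_def[abs_def] partial_deriv_mult[OF dx dl] lp ..
      qed
      \<comment> \<open>The layer vanishes where \<open>k * \<eta> x\<close> is at most e, so the
        support stays in a closed part of the box lying strictly above the boundary graph.\<close>
      have \<phi>C: "C1_compact \<Omega> \<phi>"
      proof (rule C1_compactI)
        show "Ck_on 1 \<phi> UNIV"
          unfolding Ck_on_1_iff \<phi>D[abs_def]
          by (intro conjI allI \<phi>d continuous_intros lc e \<eta>pc \<xi>c C1_compactD(3)[OF \<xi>C1])
        show "compact (cbox b c \<inter> {x. e \<le> k * \<eta> x})"
          by (intro compact_Int_closed compact_cbox closed_Collect_le continuous_intros kc)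
        show "cbox b c \<inter> {x. e \<le> k * \<eta> x} \<subseteq> \<Omega>"
        proof
          fix x assume x: "x \<in> cbox b c \<inter> {x. e \<le> k * \<eta> x}"
          then have "0 < k * \<eta> x" using e by auto
          then have "0 < \<eta> x" using k by (simp add: zero_less_mult_iff)
          then have "x \<in> {x \<in> ball x0 r. \<sigma> * x $ j > \<gamma> x}" using x sub by (auto simp: \<eta>_def)
          then show "x \<in> \<Omega>" using graph by blast
        qed
        show "\<phi> x = 0" if "x \<notin> cbox b c \<inter> {x. e \<le> k * \<eta> x}" for x
          using that \<xi>0[of x] lb(7)[of "k * \<eta> x"] by (auto simp: \<phi>_def)
      qed
      have \<phi>1: "\<bar>\<phi> x\<bar> \<le> 1" for x
        using \<xi>b[of x] lb(1,2)[of "k * \<eta> x"] by (simp add: \<phi>_def abs_mult mult_le_one)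
      have \<phi>G: "\<bar>partial_deriv i \<phi> x\<bar> \<le> G * k" for i x
      proof -
        have "\<bar>?\<xi> x * (layer' e (k * \<eta> x) * (k * partial_deriv i \<eta> x))\<bar> = layer' e (k * \<eta> x) * (k * \<bar>?\<xi> x * partial_deriv i \<eta> x\<bar>)"
          using k lb(3)[of "k * \<eta> x"] by (simp add: abs_mult mult_ac)
        also have "\<dots> \<le> 1 * (k * B i)"
          using k lb(3,4)[of "k * \<eta> x"] B(2)[of x i] by (intro mult_mono mult_left_mono) auto
        finally have 1: "\<bar>?\<xi> x * (layer' e (k * \<eta> x) * (k * partial_deriv i \<eta> x))\<bar> \<le> k * B i" by simp
        have "\<bar>partial_deriv i ?\<xi> x * layer e (k * \<eta> x)\<bar> \<le> G1 * 1"
          unfolding abs_mult using G1 lb(1,2)[of "k * \<eta> x"] by (intro mult_mono) auto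
        also have "\<dots> \<le> k * G1" using k G1(1) by simp
        finally have 2: "\<bar>partial_deriv i ?\<xi> x * layer e (k * \<eta> x)\<bar> \<le> k * G1" .
        have "k * B i + k * G1 \<le> G * k"
          using BG[of i] k by (simp add: G_def algebra_simps mult_left_mono)
        then show ?thesis unfolding \<phi>D using 1 2 abs_triangle_ineq[of "?\<xi> x * (layer' e (k * \<eta> x) * (k * partial_deriv i \<eta> x))" "partial_deriv i ?\<xi> x * layer e (k * \<eta> x)"]
          by linarith
      qed
      have E1: "k\<^sup>2 * integral\<^sup>L ?M (\<lambda>x. \<phi> x * (cmod (u x))\<^sup>2) \<le> C * ?Q"
        by (rule CC[OF k sol \<phi>C]) (use \<phi>1 \<phi>G in auto)
      define P where "P x = partial_deriv j ?\<xi> x * layer e (k * \<eta> x)" for x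
      define R where "R x = ?\<xi> x * layer' e (k * \<eta> x)" for x
      have Pb: "\<bar>P x\<bar> \<le> G1" for x
      proof -
        have "\<bar>partial_deriv j ?\<xi> x * layer e (k * \<eta> x)\<bar> \<le> G1 * 1"
          unfolding abs_mult using G1 lb(1,2)[of "k * \<eta> x"] by (intro mult_mono) auto
        then show ?thesis by (simp add: P_def)
      qed
      have Rb: "\<bar>R x\<bar> \<le> 1" for x
        using \<xi>b[of x] lb(3,4)[of "k * \<eta> x"] by (simp add: R_def abs_mult mult_le_one)
      have Pm: "P \<in> borel_measurable ?M" unfolding P_def
        by (intro cm continuous_intros lc e C1_compactD(3)[OF \<xi>C1])
      have Rm: "R \<in> borel_measurable ?M" unfolding R_def
        by (intro cm continuous_intros lc e \<xi>c)
      \<comment> \<open>The transversal derivative exhibits \<open>R\<close> with the factor k, and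
        \<open>R\<close> is exactly what \<phi> lacks in the weight
        \<open>?\<xi> x * W e x\<close>.\<close>
      have pj: "partial_deriv j \<phi> x = k * \<sigma> * R x + P x" for x
        unfolding \<phi>D \<eta>p \<gamma>j by (simp add: P_def R_def)
      note iR = bounded_weight_integrable[OF uL Rm Rb] and iP = bounded_weight_integrable[OF uL Pm Pb]
      have "integral\<^sup>L ?M (\<lambda>x. partial_deriv j \<phi> x * (cmod (u x))\<^sup>2)
          = integral\<^sup>L ?M (\<lambda>x. k * \<sigma> * (R x * (cmod (u x))\<^sup>2) + P x * (cmod (u x))\<^sup>2)"
        unfolding pj by (simp add: algebra_simps)
      also have "\<dots> = k * \<sigma> * integral\<^sup>L ?M (\<lambda>x. R x * (cmod (u x))\<^sup>2) + integral\<^sup>L ?M (\<lambda>x. P x * (cmod (u x))\<^sup>2)"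
        using iR(1) iP(1) by simp
      finally have id: "integral\<^sup>L ?M (\<lambda>x. partial_deriv j \<phi> x * (cmod (u x))\<^sup>2)
          = k * \<sigma> * integral\<^sup>L ?M (\<lambda>x. R x * (cmod (u x))\<^sup>2) + integral\<^sup>L ?M (\<lambda>x. P x * (cmod (u x))\<^sup>2)" .
      let ?IR = "integral\<^sup>L ?M (\<lambda>x. R x * (cmod (u x))\<^sup>2)" and ?IP = "integral\<^sup>L ?M (\<lambda>x. P x * (cmod (u x))\<^sup>2)"
      have "\<bar>k * \<sigma> * ?IR + ?IP\<bar> \<le> 2 * L2_norm \<Omega> u * sobolev_norm 1 \<Omega> u"
        using transport_estimate[OF \<Omega>(1) u1 \<phi>C \<phi>1, of j] unfolding id .
      then have "\<bar>k * \<sigma> * ?IR\<bar> \<le> 2 * L2_norm \<Omega> u * sobolev_norm 1 \<Omega> u + G1 * (L2_norm \<Omega> u)\<^sup>2"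
        using iP(2) by linarith
      moreover have "\<bar>k * \<sigma> * ?IR\<bar> = k * \<bar>?IR\<bar>" using k \<sigma> by (auto simp: abs_mult)
      ultimately have "k * ?IR \<le> 2 * L2_norm \<Omega> u * sobolev_norm 1 \<Omega> u + G1 * (L2_norm \<Omega> u)\<^sup>2"
        using mult_left_mono[OF abs_ge_self[of ?IR], of k] k by linarith
      then have "k * (k * ?IR) \<le> k * (2 * L2_norm \<Omega> u * sobolev_norm 1 \<Omega> u + G1 * (L2_norm \<Omega> u)\<^sup>2)"
        using k by (intro mult_left_mono) auto
      also have "\<dots> = 2 * (k * (L2_norm \<Omega> u * sobolev_norm 1 \<Omega> u)) + G1 * (k * (L2_norm \<Omega> u)\<^sup>2)"
        by (simp only: distrib_left mult_ac)
      also have "\<dots> \<le> 2 * ?Q + G1 * ?Q"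
        using energy_bound_ge[OF k, of \<Omega> u f] G1(1) by (intro add_mono mult_left_mono) auto
      finally have E2: "k\<^sup>2 * ?IR \<le> (2 + G1) * ?Q" by (simp add: power2_eq_square distrib_right mult.assoc)
      have \<phi>m: "\<phi> \<in> borel_measurable ?M" by (rule C1_compact_measurable(1)[OF \<phi>C])
      have "integral\<^sup>L ?M (\<lambda>x. (?\<xi> x * W e x) * (cmod (u x))\<^sup>2) = integral\<^sup>L ?M (\<lambda>x. \<phi> x * (cmod (u x))\<^sup>2 + R x * (cmod (u x))\<^sup>2)"
        by (simp add: W_def \<phi>_def R_def algebra_simps)
      also have "\<dots> = integral\<^sup>L ?M (\<lambda>x. \<phi> x * (cmod (u x))\<^sup>2) + ?IR"
        by (rule Bochner_Integration.integral_add[OF bounded_weight_integrable(1)[OF uL \<phi>m \<phi>1] iR(1)])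
      finally show ?thesis using E1 E2 by (simp add: algebra_simps)
    qed
    define e where "e n = inverse (real (Suc n))" for n
    have e: "0 < e n" for n by (simp add: e_def)
    have e0: "e \<longlonglongrightarrow> 0" unfolding e_def[abs_def] by (rule LIMSEQ_inverse_real_of_nat)
    \<comment> \<open>As e tends to 0 the weights tend to \<xi> at every point of \<Omega>, since
      \<eta> is positive there inside the box; the bound in \<open>step\<close> is uniform in
      e.\<close>
    have "(\<lambda>n. integral\<^sup>L ?M (\<lambda>x. (?\<xi> x * W (e n) x) * (cmod (u x))\<^sup>2)) \<longlonglongrightarrow> integral\<^sup>L ?M (\<lambda>x. ?\<xi> x * (cmod (u x))\<^sup>2)"
    proof (rule integral_dominated_convergence[where w = "\<lambda>x. (cmod (u x))\<^sup>2"])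
      have [measurable]: "?\<xi> \<in> borel_measurable ?M" by (rule cm[OF \<xi>c])
      have [measurable]: "W (e n) \<in> borel_measurable ?M" for n
        unfolding W_def by (intro cm continuous_intros lc e)
      show "(\<lambda>x. ?\<xi> x * (cmod (u x))\<^sup>2) \<in> borel_measurable ?M" by measurable
      show "(\<lambda>x. ?\<xi> x * W (e n) x * (cmod (u x))\<^sup>2) \<in> borel_measurable ?M" for n by measurable
      show "integrable ?M (\<lambda>x. (cmod (u x))\<^sup>2)" by (rule L2D(2)[OF uL])
      have W01: "0 \<le> W (e n) x" "W (e n) x \<le> 1" for n x
        using layer_bounds(1,3,5)[OF e[of n], of "k * \<eta> x"] by (auto simp: W_def)
      show "AE x in ?M. norm (?\<xi> x * W (e n) x * (cmod (u x))\<^sup>2) \<le> (cmod (u x))\<^sup>2" for n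
      proof (rule AE_I2)
        fix x
        have "?\<xi> x * W (e n) x \<le> 1" using \<xi>b[of x] W01[of n x] by (simp add: mult_le_one)
        then have "?\<xi> x * W (e n) x * (cmod (u x))\<^sup>2 \<le> 1 * (cmod (u x))\<^sup>2" by (rule mult_right_mono) simp
        then show "norm (?\<xi> x * W (e n) x * (cmod (u x))\<^sup>2) \<le> (cmod (u x))\<^sup>2"
          using \<xi>b[of x] W01[of n x] by (simp add: abs_mult)
      qed
      show "AE x in ?M. (\<lambda>n. ?\<xi> x * W (e n) x * (cmod (u x))\<^sup>2) \<longlonglongrightarrow> ?\<xi> x * (cmod (u x))\<^sup>2"
      proof (rule AE_I2)
        fix x assume "x \<in> space ?M"
        then have x\<Omega>: "x \<in> \<Omega>" by simp
        show "(\<lambda>n. ?\<xi> x * W (e n) x * (cmod (u x))\<^sup>2) \<longlonglongrightarrow> ?\<xi> x * (cmod (u x))\<^sup>2"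
        proof (cases "x \<in> cbox b c")
          case True
          then have "x \<in> \<Omega> \<inter> ball x0 r" using x\<Omega> sub by blast
          then have "0 < \<eta> x" unfolding graph by (auto simp: \<eta>_def)
          then have s: "0 < k * \<eta> x" using k by simp
          let ?s = "k * \<eta> x"
          have "(\<lambda>n. W (e n) x) \<longlonglongrightarrow> 1"
          proof (rule tendsto_sandwich)
            have "(\<lambda>n. 1 - (e n / ?s)\<^sup>2) \<longlonglongrightarrow> 1 - (0 / ?s)\<^sup>2" using s by (intro tendsto_intros e0) auto
            then show "(\<lambda>n. 1 - (e n / ?s)\<^sup>2) \<longlonglongrightarrow> 1" by simp
            show "\<forall>\<^sub>F n in sequentially. 1 - (e n / ?s)\<^sup>2 \<le> W (e n) x"
              using order_tendstoD(2)[OF e0 s]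
            proof eventually_elim
              case (elim n)
              then show ?case unfolding W_def by (intro layer_bounds(6)[OF e]) simp
            qed
            show "\<forall>\<^sub>F n in sequentially. W (e n) x \<le> 1" using W01 by simp
          qed simp
          then have "(\<lambda>n. ?\<xi> x * W (e n) x * (cmod (u x))\<^sup>2) \<longlonglongrightarrow> ?\<xi> x * 1 * (cmod (u x))\<^sup>2" by (intro tendsto_intros)
          then show ?thesis by simp
        next
          case False
          then show ?thesis by (simp add: \<xi>0)
        qed
      qed
    qed
    then have "(\<lambda>n. k\<^sup>2 * integral\<^sup>L ?M (\<lambda>x. (?\<xi> x * W (e n) x) * (cmod (u x))\<^sup>2)) \<longlonglongrightarrow> k\<^sup>2 * integral\<^sup>L ?M (\<lambda>x. ?\<xi> x * (cmod (u x))\<^sup>2)"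
      by (intro tendsto_intros)
    then show "k\<^sup>2 * integral\<^sup>L ?M (\<lambda>x. ?\<xi> x * (cmod (u x))\<^sup>2) \<le> (C + 2 + G1) * ?Q"
      by (rule LIMSEQ_le_const2) (use step[OF e] in blast)
  qed
qed

end

section \<open>From local bounds to the global estimate\<close>

text \<open>Finitely many boxes cover the compact closure of \<Omega>, so the sum of their bumps has
  a positive minimum there and the local bounds add up to one for the full L2 norm. What remains is
  a quadratic inequality for \<open>k * L2_norm \<Omega> u\<close>.\<close>

lemma helmholtz_bound:
  fixes \<Omega> :: "(real^'n::finite) set" and a2 :: "'n \<Rightarrow> 'n \<Rightarrow> real^'n \<Rightarrow> real"
    and a1 :: "'n \<Rightarrow> real^'n \<Rightarrow> complex" and a a0 :: "real^'n \<Rightarrow> complex"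
  assumes \<Omega>: "open \<Omega>" "bounded \<Omega>" "\<Omega> \<noteq> {}" and boundary: "C2_boundary \<Omega>"
    and a2_bounded: "\<forall>j m. a2 j m \<in> Linfty \<Omega>"
    and deriv_a2_bounded: "\<forall>p j m. \<exists>g \<in> Linfty \<Omega>. has_weak_partial \<Omega> p (a2 j m) g"
    and lower: "\<forall>j. a1 j \<in> Linfty \<Omega>" "a \<in> Linfty \<Omega>" "a0 \<in> Linfty \<Omega>"
  obtains C where "0 < C" "\<And>k u f. 1 \<le> k \<Longrightarrow> solves_helmholtz \<Omega> a2 a1 a a0 k u f \<Longrightarrow>
      k * L2_norm \<Omega> u \<le> C * (L2_norm \<Omega> f + sobolev_norm 1 \<Omega> u)"
proof -
  let ?M = "lebesgue_on \<Omega>" and ?sol = "solves_helmholtz \<Omega> a2 a1 a a0"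
  note coeff = \<Omega>(1,2) a2_bounded deriv_a2_bounded lower
  have "\<exists>b c. x \<in> box b c \<and> local_bound \<Omega> ?sol (bump 1 b c)" if "x \<in> closure \<Omega>" for x
  proof (cases "x \<in> \<Omega>")
    case True
    then obtain b c where bc: "cbox b c \<subseteq> \<Omega>" "x \<in> box b c" using open_contains_cbox[OF \<Omega>(1)] by blast
    show ?thesis using local_bound_interior[OF coeff bc(1)] bc(2) by blast
  next
    case False
    then have fr: "x \<in> frontier \<Omega>" using that \<Omega>(1) by (simp add: frontier_def interior_open)
    obtain r j \<sigma> and \<gamma> :: "real^'n \<Rightarrow> real" where r: "0 < r" and \<sigma>: "\<sigma> \<in> {1, -1}" and \<gamma>: "Ck_on 2 \<gamma> UNIV"
      and indep: "\<forall>x y. (\<forall>i. i \<noteq> j \<longrightarrow> x $ i = y $ i) \<longrightarrow> \<gamma> x = \<gamma> y"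
      and graph: "\<Omega> \<inter> ball x r = {y \<in> ball x r. \<sigma> * y $ j > \<gamma> y}"
      using bspec[OF boundary[unfolded C2_boundary_def] fr] by (elim exE conjE bexE)
    obtain b c where bc: "cbox b c \<subseteq> ball x r" "x \<in> box b c"
      by (rule open_contains_cbox[of "ball x r" x]) (use r in auto)
    have "local_bound \<Omega> ?sol (bump 1 b c)"
      by (rule local_bound_boundary[OF coeff \<sigma> \<gamma> _ graph bc(1)]) (use indep in blast)
    then show ?thesis using bc(2) by blast
  qed
  then have "\<forall>x\<in>closure \<Omega>. \<exists>q. x \<in> box (fst q) (snd q) \<and> local_bound \<Omega> ?sol (bump 1 (fst q) (snd q))" by auto
  from bchoice[OF this] obtain q where q: "\<And>x. x \<in> closure \<Omega> \<Longrightarrow> x \<in> box (fst (q x)) (snd (q x))"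
    "\<And>x. x \<in> closure \<Omega> \<Longrightarrow> local_bound \<Omega> ?sol (bump 1 (fst (q x)) (snd (q x)))" by blast
  have cpt: "compact (closure \<Omega>)" using \<Omega>(2) by (simp add: compact_closure)
  have "closure \<Omega> \<subseteq> (\<Union>x\<in>closure \<Omega>. box (fst (q x)) (snd (q x)))" using q(1) by blast
  then obtain D where D: "D \<subseteq> closure \<Omega>" "finite D" "closure \<Omega> \<subseteq> (\<Union>x\<in>D. box (fst (q x)) (snd (q x)))"
    by (rule compactE_image[OF cpt open_box])
  define \<xi> where "\<xi> x = bump 1 (fst (q x)) (snd (q x))" for x
  define g where "g y = (\<Sum>x\<in>D. \<xi> x y)" for y
  have \<xi>c: "continuous_on S (\<xi> x)" for x S
    using C1_compactD(2)[OF test_function_C1_compact[OF test_function_bump[of 1 _ _ UNIV]]]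
    by (auto simp: \<xi>_def intro: continuous_on_subset)
  have \<xi>1: "\<bar>\<xi> x y\<bar> \<le> 1" for x y
    using bump_nonneg[of 1 "fst (q x)" "snd (q x)" y] bump_le_1[of 1 "fst (q x)" "snd (q x)" y] by (simp add: \<xi>_def)
  have gc: "continuous_on (closure \<Omega>) g" unfolding g_def by (intro continuous_intros \<xi>c)
  have gpos: "0 < g y" if y: "y \<in> closure \<Omega>" for y
  proof -
    obtain x where x: "x \<in> D" "y \<in> box (fst (q x)) (snd (q x))" using D(3) y by blast
    have "0 < \<xi> x y" unfolding \<xi>_def by (rule bump_pos[OF zero_less_one x(2)])
    also have "\<dots> \<le> g y" unfolding g_def
      by (rule member_le_sum[OF x(1) _ D(2)]) (simp add: \<xi>_def bump_nonneg)
    finally show ?thesis .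
  qed
  have ne: "closure \<Omega> \<noteq> {}" using \<Omega>(3) by (simp add: closure_eq_empty)
  obtain y0 where y0: "y0 \<in> closure \<Omega>" "\<And>y. y \<in> closure \<Omega> \<Longrightarrow> g y0 \<le> g y"
    using continuous_attains_inf[OF cpt ne gc] by blast
  define m where "m = g y0"
  have m: "0 < m" unfolding m_def by (rule gpos[OF y0(1)])
  let ?bd = "\<lambda>x K. 0 \<le> K \<and> (\<forall>k\<ge>1. \<forall>u f. ?sol k u f \<longrightarrow>
      k\<^sup>2 * integral\<^sup>L ?M (\<lambda>y. \<xi> x y * (cmod (u y))\<^sup>2) \<le> K * energy_bound \<Omega> k u f)"
  have "\<forall>x\<in>D. \<exists>K. ?bd x K"
  proof
    fix x assume "x \<in> D"
    then have "local_bound \<Omega> ?sol (bump 1 (fst (q x)) (snd (q x)))" using q(2) D(1) by blast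
    then show "\<exists>K. ?bd x K" by (simp only: local_bound_def \<xi>_def)
  qed
  from bchoice[OF this] obtain K where bd: "\<forall>x\<in>D. ?bd x (K x)" by (rule exE)
  have K: "0 \<le> K x" "1 \<le> k \<Longrightarrow> ?sol k u f \<Longrightarrow>
      k\<^sup>2 * integral\<^sup>L ?M (\<lambda>y. \<xi> x y * (cmod (u y))\<^sup>2) \<le> K x * energy_bound \<Omega> k u f" if "x \<in> D" for x k u f
    using bspec[OF bd that] by simp_all
  define L where "L = (\<Sum>x\<in>D. K x) / m"
  have L: "0 \<le> L" using K(1) m by (simp add: L_def sum_nonneg)
  show ?thesis
  proof (rule that[of "1 + L"])
    show "0 < 1 + L" using L by simp
    fix k u f assume k: "1 \<le> k" and sol: "?sol k u f"
    have uL: "u \<in> L2 \<Omega>"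
      using sol sobolev_1D(1)[OF sobolev_2D(1)[OF _ \<Omega>(1)] \<Omega>(1)] by (auto simp only: solves_helmholtz_def)
    have int: "integrable ?M (\<lambda>y. \<xi> x y * (cmod (u y))\<^sup>2)" for x
      by (rule bounded_weight_integrable(1)[OF uL borel_lebesgue_on[OF borel_measurable_continuous_onI[OF \<xi>c]] \<xi>1])
    have "m * (L2_norm \<Omega> u)\<^sup>2 = integral\<^sup>L ?M (\<lambda>y. m * (cmod (u y))\<^sup>2)" by (simp add: L2_norm_def)
    also have "\<dots> \<le> integral\<^sup>L ?M (\<lambda>y. \<Sum>x\<in>D. \<xi> x y * (cmod (u y))\<^sup>2)"
    proof (rule integral_mono)
      show "integrable ?M (\<lambda>y. m * (cmod (u y))\<^sup>2)" using L2D(2)[OF uL] by simp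
      show "integrable ?M (\<lambda>y. \<Sum>x\<in>D. \<xi> x y * (cmod (u y))\<^sup>2)" using int by simp
      fix y assume "y \<in> space ?M"
      then have "m \<le> g y" using y0(2) closure_subset[of \<Omega>] by (auto simp: m_def)
      then show "m * (cmod (u y))\<^sup>2 \<le> (\<Sum>x\<in>D. \<xi> x y * (cmod (u y))\<^sup>2)"
        unfolding sum_distrib_right[symmetric] g_def by (rule mult_right_mono) simp
    qed
    also have "\<dots> = (\<Sum>x\<in>D. integral\<^sup>L ?M (\<lambda>y. \<xi> x y * (cmod (u y))\<^sup>2))" using int by simp
    finally have "k\<^sup>2 * (m * (L2_norm \<Omega> u)\<^sup>2) \<le> k\<^sup>2 * (\<Sum>x\<in>D. integral\<^sup>L ?M (\<lambda>y. \<xi> x y * (cmod (u y))\<^sup>2))"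
      by (intro mult_left_mono) auto
    also have "\<dots> \<le> (\<Sum>x\<in>D. K x * energy_bound \<Omega> k u f)"
      unfolding sum_distrib_left by (intro sum_mono K(2) k sol)
    also have "\<dots> = m * (L * energy_bound \<Omega> k u f)" using m by (simp add: L_def sum_distrib_right)
    finally have "m * (k * L2_norm \<Omega> u)\<^sup>2 \<le> m * (L * energy_bound \<Omega> k u f)"
      by (simp only: power_mult_distrib mult.left_commute)
    then have *: "(k * L2_norm \<Omega> u)\<^sup>2 \<le> L * energy_bound \<Omega> k u f" using m by (simp only: mult_le_cancel_left_pos)
    define z where "z = k * L2_norm \<Omega> u"
    define S where "S = L2_norm \<Omega> f + sobolev_norm 1 \<Omega> u"
    have YS: "sobolev_norm 1 \<Omega> u \<le> S" and Y: "0 \<le> sobolev_norm 1 \<Omega> u"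
      using L2_norm_nonneg[of \<Omega> f] by (simp_all only: S_def sobolev_norm_1_nonneg le_add_same_cancel2)
    then have S: "0 \<le> S" by linarith
    have "energy_bound \<Omega> k u f \<le> z * S + S\<^sup>2"
      unfolding energy_bound_def z_def S_def[symmetric] using power_mono[OF YS Y, of 2] by linarith
    with * have zz: "z\<^sup>2 \<le> L * (z * S + S\<^sup>2)" unfolding z_def[symmetric] using L by (meson mult_left_mono order_trans)
    \<comment> \<open>If z exceeded \<open>(1 + L) * S\<close>, then \<open>L * S \<le> z\<close> as
      well, so the right-hand side of \<open>zz\<close> would be at most
      \<open>(1 + L) * z * S\<close>, which is below \<open>z\<^sup>2\<close>.\<close>
    have "z \<le> (1 + L) * S"
    proof (rule ccontr)
      assume "\<not> z \<le> (1 + L) * S"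
      then have lt: "(1 + L) * S < z" by simp
      have "0 \<le> (1 + L) * S" using L S by simp
      then have z: "0 < z" using lt by linarith
      have "z * ((1 + L) * S) < z * z" by (rule mult_strict_left_mono[OF lt z])
      moreover have "L * (S * S) \<le> z * S"
      proof -
        have "L * S \<le> z" using lt S by (simp add: distrib_right)
        then show ?thesis using mult_right_mono[OF _ S] by (metis mult.assoc)
      qed
      ultimately show False using zz by (simp add: power2_eq_square algebra_simps)
    qed
    then show "k * L2_norm \<Omega> u \<le> (1 + L) * (L2_norm \<Omega> f + sobolev_norm 1 \<Omega> u)" by (simp only: z_def S_def)
  qed
qed

theorem theorem1p2:
  fixes \<Omega> \<omega> :: "(real^'n::finite) set"
    and a2 :: "'n \<Rightarrow> 'n \<Rightarrow> real^'n \<Rightarrow> real"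
    and a1 :: "'n \<Rightarrow> real^'n \<Rightarrow> complex"
    and a a0 :: "real^'n \<Rightarrow> complex"
    and \<epsilon>0 E0 :: real
  assumes domain: "open \<Omega>" "connected \<Omega>" "\<Omega> \<noteq> {}" "bounded \<Omega>"
    and boundary: "C2_boundary \<Omega>"
    and subdomain: "open \<omega>" "\<omega> \<noteq> {}" "\<omega> \<subseteq> \<Omega>"
    and symmetric: "\<forall>x\<in>\<Omega>. \<forall>j m. a2 j m x = a2 m j x"
    and ellipticity_constants: "\<epsilon>0 > 0" "E0 > 0"
    and elliptic: "\<forall>x\<in>\<Omega>. \<forall>\<xi> :: real^'n.
        \<epsilon>0 * (norm \<xi>)\<^sup>2 \<le> (\<Sum>j\<in>UNIV. \<Sum>l\<in>UNIV. a2 j l x * \<xi> $ j * \<xi> $ l) \<and>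
        (\<Sum>j\<in>UNIV. \<Sum>l\<in>UNIV. a2 j l x * \<xi> $ j * \<xi> $ l) \<le> E0\<^sup>2 * (norm \<xi>)\<^sup>2"
    and a2_bounded: "\<forall>j m. a2 j m \<in> Linfty \<Omega>"
    and deriv_a2_bounded: "\<forall>p j m. \<exists>g \<in> Linfty \<Omega>. has_weak_partial \<Omega> p (a2 j m) g"
    and lower_order_bounded: "\<forall>j. a1 j \<in> Linfty \<Omega>" "a \<in> Linfty \<Omega>" "a0 \<in> Linfty \<Omega>"
  shows
    "(\<exists>C>0. \<forall>k\<ge>1. \<forall>u f. solves_helmholtz \<Omega> a2 a1 a a0 k u f \<longrightarrow>
        sobolev_norm 0 \<Omega> u
          \<le> C * inverse k * (sobolev_norm 0 \<Omega> f + sobolev_norm 1 \<omega> u + sobolev_norm 1 \<Omega> u))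
     \<and>
     (C2_diffeomorphic \<Omega> (ball 0 1) \<and>
      (\<exists>\<Gamma>. \<Gamma> \<noteq> {} \<and> openin (top_of_set (frontier \<Omega>)) \<Gamma> \<and> \<Gamma> \<subseteq> closure \<omega>) \<longrightarrow>
      (\<exists>(V :: real \<Rightarrow> (real^'n \<Rightarrow> complex) set) (p :: real \<Rightarrow> (real^'n \<Rightarrow> complex) \<Rightarrow> real).
         (\<forall>k\<ge>1. closed_sobolev_subspace 1 \<Omega> (V k)) \<and>
         (\<forall>k1\<ge>1. \<forall>k2\<ge>k1. V k1 \<subseteq> V k2) \<and>
         sobolev_closure 1 \<Omega> (\<Union>k\<in>{1..}. V k) = sobolev 1 \<Omega> \<and>
         (\<forall>k\<ge>1. sobolev_seminorm 1 \<Omega> (p k)) \<and>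
         (\<forall>k\<ge>1. \<forall>u \<in> V k. p k u = 0) \<and>
         (\<forall>k1\<ge>1. \<forall>k2\<ge>k1. \<forall>u \<in> sobolev 1 \<Omega>. p k2 u \<le> p k1 u) \<and>
         (\<exists>C>0. \<forall>k\<ge>1. \<forall>u f. solves_helmholtz \<Omega> a2 a1 a a0 k u f \<longrightarrow>
            sobolev_norm 0 \<Omega> u
              \<le> C * inverse k * (sobolev_norm 0 \<Omega> f + sobolev_norm 1 \<omega> u + p k u))))"
proof -
  obtain C where C: "0 < C" and bound: "\<And>k u f. 1 \<le> k \<Longrightarrow> solves_helmholtz \<Omega> a2 a1 a a0 k u f \<Longrightarrow>
      k * L2_norm \<Omega> u \<le> C * (L2_norm \<Omega> f + sobolev_norm 1 \<Omega> u)"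
    using helmholtz_bound[OF domain(1,4,3) boundary a2_bounded deriv_a2_bounded lower_order_bounded] by blast
  \<comment> \<open>Being nonnegative, this norm may be added on the right of both
    estimates.\<close>
  have \<omega>0: "0 \<le> sobolev_norm 1 \<omega> u" for u by (rule sobolev_norm_1_nonneg)
  have divide_k: "x \<le> c * inverse k * y" if "k * x \<le> c * y" "1 \<le> k" for x y c k :: real
    using that by (simp add: field_simps)
  \<comment> \<open>With this value C times the term
    \<open>\<delta> * k * L2_norm \<Omega> u\<close> from the filtration is half of
    \<open>k * L2_norm \<Omega> u\<close>; absorbing it on the left turns C into
    \<open>2 * C\<close>.\<close>
  define \<delta> where "\<delta> = inverse (2 * C)"
  have \<delta>: "0 < \<delta>" "C * \<delta> = 1 / 2" using C by (simp_all add: \<delta>_def)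
  obtain V :: "real \<Rightarrow> (real^'n \<Rightarrow> complex) set" and p :: "real \<Rightarrow> (real^'n \<Rightarrow> complex) \<Rightarrow> real" where Vp:
    "\<forall>k\<ge>1. closed_sobolev_subspace 1 \<Omega> (V k)"
    "\<forall>k1\<ge>1. \<forall>k2\<ge>k1. V k1 \<subseteq> V k2"
    "sobolev_closure 1 \<Omega> (\<Union>k\<in>{1..}. V k) = sobolev 1 \<Omega>"
    "\<forall>k\<ge>1. sobolev_seminorm 1 \<Omega> (p k)"
    "\<forall>k\<ge>1. \<forall>u \<in> V k. p k u = 0"
    "\<forall>k1\<ge>1. \<forall>k2\<ge>k1. \<forall>u \<in> sobolev 1 \<Omega>. p k2 u \<le> p k1 u"
    and split: "\<forall>k\<ge>1. \<forall>u \<in> sobolev 1 \<Omega>. sobolev_norm 1 \<Omega> u \<le> \<delta> * k * L2_norm \<Omega> u + p k u"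
    using frequency_filtration[OF domain(1,4) \<delta>(1)] by blast
  show ?thesis
  proof (intro conjI impI)
    show "\<exists>C>0. \<forall>k\<ge>1. \<forall>u f. solves_helmholtz \<Omega> a2 a1 a a0 k u f \<longrightarrow>
        sobolev_norm 0 \<Omega> u
          \<le> C * inverse k * (sobolev_norm 0 \<Omega> f + sobolev_norm 1 \<omega> u + sobolev_norm 1 \<Omega> u)"
      unfolding sobolev_norm.simps(1)
    proof (intro exI[of _ C] conjI C allI impI divide_k)
      fix k u f assume k: "1 \<le> k" and sol: "solves_helmholtz \<Omega> a2 a1 a a0 k u f"
      have "C * (L2_norm \<Omega> f + sobolev_norm 1 \<Omega> u) \<le> C * (L2_norm \<Omega> f + sobolev_norm 1 \<omega> u + sobolev_norm 1 \<Omega> u)"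
        using \<omega>0[of u] C by (intro mult_left_mono) linarith+
      with bound[OF k sol] show "k * L2_norm \<Omega> u \<le> C * (L2_norm \<Omega> f + sobolev_norm 1 \<omega> u + sobolev_norm 1 \<Omega> u)" by linarith
    qed
    have "\<exists>C>0. \<forall>k\<ge>1. \<forall>u f. solves_helmholtz \<Omega> a2 a1 a a0 k u f \<longrightarrow>
        sobolev_norm 0 \<Omega> u \<le> C * inverse k * (sobolev_norm 0 \<Omega> f + sobolev_norm 1 \<omega> u + p k u)"
      unfolding sobolev_norm.simps(1)
    proof (intro exI[of _ "2 * C"] conjI allI impI divide_k)
      show "0 < 2 * C" using C by simp
      fix k u f assume k: "1 \<le> k" and sol: "solves_helmholtz \<Omega> a2 a1 a a0 k u f"
      have "u \<in> sobolev 1 \<Omega>"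
        using sol sobolev_2D(1)[OF _ domain(1)] by (auto simp only: solves_helmholtz_def)
      then have "sobolev_norm 1 \<Omega> u \<le> \<delta> * k * L2_norm \<Omega> u + p k u" using split k by blast
      then have "C * (L2_norm \<Omega> f + sobolev_norm 1 \<Omega> u)
          \<le> C * (L2_norm \<Omega> f + sobolev_norm 1 \<omega> u + (\<delta> * k * L2_norm \<Omega> u + p k u))"
        using \<omega>0[of u] C by (intro mult_left_mono) linarith+
      also have "\<dots> = C * (L2_norm \<Omega> f + sobolev_norm 1 \<omega> u + p k u) + (C * \<delta>) * (k * L2_norm \<Omega> u)"
        by (simp only: distrib_left mult_ac add_ac)
      finally have "k * L2_norm \<Omega> u \<le> C * (L2_norm \<Omega> f + sobolev_norm 1 \<omega> u + p k u) + 1 / 2 * (k * L2_norm \<Omega> u)"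
        using bound[OF k sol] unfolding \<delta>(2) by linarith
      then show "k * L2_norm \<Omega> u \<le> 2 * C * (L2_norm \<Omega> f + sobolev_norm 1 \<omega> u + p k u)"
        unfolding mult.assoc by linarith
    qed
    with Vp show "\<exists>(V :: real \<Rightarrow> (real^'n \<Rightarrow> complex) set) (p :: real \<Rightarrow> (real^'n \<Rightarrow> complex) \<Rightarrow> real).
         (\<forall>k\<ge>1. closed_sobolev_subspace 1 \<Omega> (V k)) \<and>
         (\<forall>k1\<ge>1. \<forall>k2\<ge>k1. V k1 \<subseteq> V k2) \<and>
         sobolev_closure 1 \<Omega> (\<Union>k\<in>{1..}. V k) = sobolev 1 \<Omega> \<and>
         (\<forall>k\<ge>1. sobolev_seminorm 1 \<Omega> (p k)) \<and>
         (\<forall>k\<ge>1. \<forall>u \<in> V k. p k u = 0) \<and>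
         (\<forall>k1\<ge>1. \<forall>k2\<ge>k1. \<forall>u \<in> sobolev 1 \<Omega>. p k2 u \<le> p k1 u) \<and>
         (\<exists>C>0. \<forall>k\<ge>1. \<forall>u f. solves_helmholtz \<Omega> a2 a1 a a0 k u f \<longrightarrow>
            sobolev_norm 0 \<Omega> u
              \<le> C * inverse k * (sobolev_norm 0 \<Omega> f + sobolev_norm 1 \<omega> u + p k u))"
      by (intro exI[of _ V] exI[of _ p] conjI)
  qed
qed

end
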